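(* Let $X$ be a Lévy process in $\mathbb{R}^d$ satisfying assumptions (A) described in the context. Let $D\subset\mathbb{R}^d$ be an open, nonempty set and let $f:\mathbb{R}^d\to[0,\infty)$ be harmonic with respect to $X$ in $D$. Then $\nabla f(x)$ exists for every $x\in D$, and $$|\nabla f(x)|\le c\,\frac{f(x)}{\delta_D(x)\wedge 1},\qquad x\in D,$$ where $\delta_D(x)=\operatorname{dist}(x,\partial D)$ and $c$ is a constant depending only on the process $X$.
   Context: Assumptions (A) on $X=(X_t)_{t\ge0}$: (H0) $X$ is a pure-jump isotropic Lévy process in $\mathbb{R}^d$ with characteristic exponent $\psi$, i.e. $E^0e^{i\xi\cdot X_t}=e^{-t\psi(\xi)}$. Its Lévy measure is infinite and has a density $\nu(x)=\nu(|x|)$. (H1) $\nu(r)$ is nonincreasing and absolutely continuous on $(0,\infty)$, $-\nu'(r)/r$ is nonincreasing (here $\nu'$ is the function with $\nu(r)=-\int_r^\infty\nu'(\rho)\,d\rho$ for $r>0$), and there is a constant $a_1$ with $\nu(r)\le a_1\nu(r+1)$ for $r\ge1$ and $\nu(r)\le a_1\nu(2r)$ for $0<r\le1$. (H2) The scale invariant Harnack inequality holds: there is a constant $a_2$ such that for every $x_0\in\mathbb{R}^d$, $r\in(0,1]$ and every function $h$ that is nonnegative on $\mathbb{R}^d$ and harmonic with respect to $X$ in $B(x_0,r)$, $\sup_{B(x_0,r/2)}h\le a_2\inf_{B(x_0,r/2)}h$. A Borel function $f:\mathbb{R}^d\to\mathbb{R}$ is harmonic with respect to $X$ in an open set $D$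 if for every bounded open nonempty $B$ with $\overline B\subset D$ we have $f(x)=E^x f(X_{\tau_B})$ for $x\in B$, with the expectation absolutely convergent; here $\tau_B=\inf\{t>0:X_t\notin B\}$ and $P^x,E^x$ refer to the process started at $x$. *)

theory Defs
  imports "HOL-Probability.Probability"
begin

definition cadlag :: "(real \<Rightarrow> 'a::euclidean_space) \<Rightarrow> bool" where
  "cadlag p \<longleftrightarrow> (\<forall>t\<ge>0. continuous (at_right t) p \<and> (t > 0 \<longrightarrow> (\<exists>l. (p \<longlongrightarrow> l) (at_left t))))"

text \<open>A Levy process started at 0 on the probability space M (X under P^x is x + Y).\<close>
definition levy_process :: "'w measure \<Rightarrow> ('w \<Rightarrow> real \<Rightarrow> 'a::euclidean_space) \<Rightarrow> bool" where
  "levy_process M Y \<longleftrightarrow>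
     prob_space M \<and>
     (\<forall>t. (\<lambda>\<omega>. Y \<omega> t) \<in> borel_measurable M) \<and>
     (\<forall>\<omega>\<in>space M. Y \<omega> 0 = 0 \<and> cadlag (Y \<omega>)) \<and>
     (\<forall>(n::nat) (t::nat \<Rightarrow> real). t 0 \<ge> 0 \<and> (\<forall>i. t i \<le> t (Suc i)) \<longrightarrow>
        prob_space.indep_vars M (\<lambda>_. borel) (\<lambda>i \<omega>. Y \<omega> (t (Suc i)) - Y \<omega> (t i)) {..<n}) \<and>
     (\<forall>s t. 0 \<le> s \<and> s \<le> t \<longrightarrow>
        distr M borel (\<lambda>\<omega>. Y \<omega> t - Y \<omega> s) = distr M borel (\<lambda>\<omega>. Y \<omega> (t - s)))"

definition exit_time :: "('w \<Rightarrow> real \<Rightarrow> 'a::euclidean_space) \<Rightarrow> 'a \<Rightarrow> 'a set \<Rightarrow> 'w \<Rightarrow> real" where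
  "exit_time Y x B \<omega> = Inf {t. t > 0 \<and> x + Y \<omega> t \<notin> B}"

definition harmonic_wrt :: "'w measure \<Rightarrow> ('w \<Rightarrow> real \<Rightarrow> 'a::euclidean_space) \<Rightarrow> ('a \<Rightarrow> real) \<Rightarrow> 'a set \<Rightarrow> bool" where
  "harmonic_wrt M Y f D \<longleftrightarrow>
     f \<in> borel_measurable borel \<and>
     (\<forall>B. open B \<and> bounded B \<and> B \<noteq> {} \<and> closure B \<subseteq> D \<longrightarrow>
        (\<forall>x\<in>B. integrable M (\<lambda>\<omega>. f (x + Y \<omega> (exit_time Y x B \<omega>))) \<and>
                f x = (\<integral>\<omega>. f (x + Y \<omega> (exit_time Y x B \<omega>)) \<partial>M)))"

definition has_gradient_at :: "('a::euclidean_space \<Rightarrow> real) \<Rightarrow> 'a \<Rightarrow> 'a \<Rightarrow> bool" where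
  "has_gradient_at f g x \<longleftrightarrow>
     (\<forall>b\<in>Basis. ((\<lambda>t. f (x + t *\<^sub>R b)) has_real_derivative (g \<bullet> b)) (at 0))"

text \<open>min(dist(x, boundary D), 1); if the boundary is empty the distance is +infinity.\<close>
definition delta_min1 :: "'a::euclidean_space set \<Rightarrow> 'a \<Rightarrow> real" where
  "delta_min1 D x = (if frontier D = {} then 1 else min (infdist x (frontier D)) 1)"

end

theory Submission
  imports Defs
begin

text \<open>
  The law of the position at the exit from a small ball is controlled by testing Dynkin's formula
  against bump functions: it has a density off a neighbourhood of the ball, and the jumps leave that
  neighbourhood with a probability whose sum over dyadic scales diverges. The mean value property
  therefore makes a harmonic function \<open>f\<close> continuous, and it turns into the equation \<open>L f = 0\<close> for the
  mollifications of \<open>f\<close>, where \<open>L\<close> is the nonlocal generator.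

  The difference of such a solution and its mirror image in a hyperplane is antisymmetric. Since
  \<open>- \<nu>'(r) / r\<close> is nonincreasing, a barrier and the maximum principle for antisymmetric functions bound
  it by a multiple of the distance to the hyperplane, in terms of the supremum of \<open>f\<close> on a ball and of
  the tail integral of \<open>f\<close> against \<open>\<nu>\<close>. The Harnack inequality bounds the supremum by \<open>f x\<close>, and the
  mean value property bounds the tail. Applied to differences of translates of \<open>f\<close>, whose supremum and
  tail tend to zero, the same estimate shows that the difference quotients converge.
\<close>

section \<open>Symmetries of Lebesgue measure\<close>

text \<open>No scaling of \<open>\<nu>\<close> at the origin is available, so the chance of a long
  jump out of a small ball may tend to 0 with the radius; continuity cannot come from a fixed
  contraction per scale, and only the divergence of a sum is left. The hypothesis on
  \<open>- \<nu>' r / r\<close> says that \<open>\<nu>\<close> is convex as a function of r^2. It is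
  used as a Lipschitz bound of \<open>\<nu>\<close> relative to itself, which makes the kernels seen
  from a point and from its mirror image differ in proportion to the distance s to the hyperplane.
  Both errors of the barrier argument, from the lateral boundary and from the far values, inherit
  this factor s, and so does the gain from the concave barrier; hence a bound linear in s. A
  harmonic function is only Borel at first, so all equations are for mollifications, and the
  estimates may involve no norm that blows up when the mollification is removed. The exit law is
  reached without a Levy system formula: cosines diagonalise the semigroup, Gaussians are averages
  of cosines, and Gaussian averages of bumps lead to Dynkin's formula for bumps.\<close>

lemma lborel_invariant:
  fixes T :: "'a::euclidean_space \<Rightarrow> 'a" and f :: "'a \<Rightarrow> 'b::{banach, second_countable_topology}"
  assumes T: "T \<in> borel_measurable borel" and eq: "distr lborel borel T = lborel"
    and f: "f \<in> borel_measurable borel"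
  shows "(LBINT x. f (T x)) = (LBINT x. f x)"
    and "integrable lborel (\<lambda>x. f (T x)) \<longleftrightarrow> integrable lborel f"
proof -
  have T': "T \<in> measurable lborel borel" using T by simp
  show "(LBINT x. f (T x)) = (LBINT x. f x)"
    using integral_distr[OF T' f] eq by simp
  show "integrable lborel (\<lambda>x. f (T x)) \<longleftrightarrow> integrable lborel f"
    using integrable_distr_eq[OF T' f] eq by simp
qed

lemma lborel_invariant_nn:
  fixes T :: "'a::euclidean_space \<Rightarrow> 'a"
  assumes T: "T \<in> borel_measurable borel" and eq: "distr lborel borel T = lborel"
    and f: "f \<in> borel_measurable borel"
  shows "(\<integral>\<^sup>+x. f (T x) \<partial>lborel) = (\<integral>\<^sup>+x. f x \<partial>lborel)"
proof -
  have T': "T \<in> measurable lborel borel" using T by simp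
  show ?thesis using nn_integral_distr[OF T', of f] eq f by simp
qed

lemma distr_lborel_signs:
  fixes c :: "'a::euclidean_space \<Rightarrow> real" and t :: 'a
  assumes "\<And>j. j \<in> Basis \<Longrightarrow> \<bar>c j\<bar> = 1"
  shows "distr lborel borel (\<lambda>x. t + (\<Sum>j\<in>Basis. (c j * (x \<bullet> j)) *\<^sub>R j)) = lborel"
proof -
  have "\<And>j. j \<in> Basis \<Longrightarrow> c j \<noteq> 0" using assms by force
  from lborel_affine_euclidean[OF this, where t = t] show ?thesis
    using assms by (simp add: density_1)
qed

lemma distr_lborel_plus: "distr lborel borel (\<lambda>x::'a::euclidean_space. x + c) = lborel"
proof -
  have "((+) c) = (\<lambda>x. x + c)" by (auto simp: add.commute)
  then show ?thesis using lborel_distr_plus[of c] by simp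
qed

lemma distr_lborel_diff: "distr lborel borel (\<lambda>x::'a::euclidean_space. c - x) = lborel"
proof -
  have "(\<Sum>j\<in>Basis. (-1 * (x \<bullet> j)) *\<^sub>R j) = - x" for x :: 'a
    by (subst (2) euclidean_representation[of x, symmetric]) (simp add: sum_negf)
  then show ?thesis using distr_lborel_signs[of "\<lambda>_. -1" c] by simp
qed

lemma distr_lborel_uminus: "distr lborel borel (\<lambda>x::'a::euclidean_space. - x) = lborel"
  using distr_lborel_diff[of 0] by simp

definition refl_dir :: "'a::euclidean_space \<Rightarrow> 'a \<Rightarrow> 'a" where
  "refl_dir b x = x - (2 * (x \<bullet> b)) *\<^sub>R b"

lemma refl_dir_measurable[measurable]: "refl_dir b \<in> borel_measurable borel"
  unfolding refl_dir_def by measurable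

lemma distr_lborel_refl_dir:
  assumes b: "b \<in> Basis"
  shows "distr lborel borel (\<lambda>x. t + refl_dir b x) = lborel"
proof -
  have "(\<Sum>j\<in>Basis. ((if j = b then -1 else 1) * (x \<bullet> j)) *\<^sub>R j) = refl_dir b x" for x
  proof (rule euclidean_eqI)
    fix i :: 'a assume i: "i \<in> Basis"
    then show "(\<Sum>j\<in>Basis. ((if j = b then -1 else 1) * (x \<bullet> j)) *\<^sub>R j) \<bullet> i = refl_dir b x \<bullet> i"
      using b by (auto simp: refl_dir_def inner_diff_left inner_not_same_Basis)
  qed
  then show ?thesis using distr_lborel_signs[of "\<lambda>j. if j = b then -1 else 1" t] by simp
qed

lemma refl_dir_simps:
  assumes b: "b \<in> Basis"
  shows "refl_dir b (x + y) = refl_dir b x + refl_dir b y"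
    and "refl_dir b (x - y) = refl_dir b x - refl_dir b y"
    and "refl_dir b (- x) = - refl_dir b x"
    and "refl_dir b (refl_dir b x) = x"
    and "refl_dir b x \<bullet> b = - (x \<bullet> b)"
    and "norm (refl_dir b x) = norm x"
    and "refl_dir b (c *\<^sub>R b) = - (c *\<^sub>R b)"
proof -
  have bb: "b \<bullet> b = 1" using b by simp
  show "refl_dir b (x + y) = refl_dir b x + refl_dir b y"
    "refl_dir b (x - y) = refl_dir b x - refl_dir b y"
    "refl_dir b (- x) = - refl_dir b x"
    by (simp_all add: refl_dir_def inner_add_left inner_diff_left algebra_simps)
  show d: "refl_dir b x \<bullet> b = - (x \<bullet> b)"
    by (simp add: refl_dir_def inner_diff_left bb)
  have "refl_dir b (refl_dir b x) = refl_dir b x - (2 * (refl_dir b x \<bullet> b)) *\<^sub>R b"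
    by (rule refl_dir_def)
  also have "\<dots> = x" unfolding d by (simp add: refl_dir_def)
  finally show "refl_dir b (refl_dir b x) = x" .
  have "refl_dir b x \<bullet> refl_dir b x = x \<bullet> x"
    by (simp add: refl_dir_def inner_diff_left inner_diff_right bb inner_commute[of b x])
  then show "norm (refl_dir b x) = norm x" by (simp add: norm_eq_sqrt_inner)
  show "refl_dir b (c *\<^sub>R b) = - (c *\<^sub>R b)"
    unfolding refl_dir_def inner_scaleR_left bb scaleR_left_diff_distrib[symmetric] by simp
qed

text \<open>An isometry carrying one coordinate axis to another; it makes the integrals of a radial
  kernel along different axes equal, in \<open>jump_int_dir\<close>.\<close>

definition swap_dir :: "'a::euclidean_space \<Rightarrow> 'a \<Rightarrow> 'a \<Rightarrow> 'a" where
  "swap_dir b c x = (\<Sum>j\<in>Basis. (x \<bullet> Transposition.transpose b c j) *\<^sub>R j)"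

lemma swap_dir_measurable[measurable]: "swap_dir b c \<in> borel_measurable borel"
  unfolding swap_dir_def by measurable

lemma swap_dir_inner: "i \<in> Basis \<Longrightarrow> swap_dir b c x \<bullet> i = x \<bullet> Transposition.transpose b c i"
  unfolding swap_dir_def by simp

lemma transpose_Basis:
  assumes "b \<in> Basis" "c \<in> Basis"
  shows "bij_betw (Transposition.transpose b c) Basis Basis"
  by (rule bij_betw_byWitness[where f' = "Transposition.transpose b c"])
    (use assms in \<open>auto simp: Transposition.transpose_def\<close>)

lemma norm_swap_dir:
  assumes "b \<in> Basis" "c \<in> Basis"
  shows "norm (swap_dir b c x) = norm x"
proof -
  have "(\<Sum>i\<in>Basis. (x \<bullet> Transposition.transpose b c i)\<^sup>2) = (\<Sum>i\<in>Basis. (x \<bullet> i)\<^sup>2)"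
    by (rule sum.reindex_bij_betw[OF transpose_Basis[OF assms]])
  then show ?thesis
    unfolding norm_eq_sqrt_inner
    by (subst (1 2) euclidean_inner) (simp add: swap_dir_inner power2_eq_square)
qed

lemma distr_lborel_swap_dir:
  assumes bc: "b \<in> Basis" "c \<in> Basis"
  shows "distr lborel borel (swap_dir b c) = lborel"
proof (rule lborel_eqI[symmetric])
  let ?t = "Transposition.transpose b c"
  have tB: "?t i \<in> Basis" if "i \<in> Basis" for i using transpose_Basis[OF bc] that by (auto simp: bij_betw_def)
  fix l u :: 'a assume le: "\<And>b. b \<in> Basis \<Longrightarrow> l \<bullet> b \<le> u \<bullet> b"
  have tt: "?t (?t i) = i" for i by simp
  have "swap_dir b c -` box l u = box (swap_dir b c l) (swap_dir b c u)"
  proof (intro set_eqI iffI)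
    fix x assume "x \<in> swap_dir b c -` box l u"
    then have "l \<bullet> i < x \<bullet> ?t i \<and> x \<bullet> ?t i < u \<bullet> i" if "i \<in> Basis" for i
      using that by (auto simp: box_def swap_dir_inner)
    from this[OF tB] show "x \<in> box (swap_dir b c l) (swap_dir b c u)"
      by (auto simp: box_def swap_dir_inner)
  next
    fix x assume "x \<in> box (swap_dir b c l) (swap_dir b c u)"
    then have "l \<bullet> ?t i < x \<bullet> i \<and> x \<bullet> i < u \<bullet> ?t i" if "i \<in> Basis" for i
      using that by (auto simp: box_def swap_dir_inner)
    from this[OF tB] show "x \<in> swap_dir b c -` box l u"
      by (auto simp: box_def swap_dir_inner)
  qed
  then have "emeasure (distr lborel borel (swap_dir b c)) (box l u)
      = emeasure lborel (box (swap_dir b c l) (swap_dir b c u))"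
    by (simp add: emeasure_distr)
  also have "\<dots> = (\<Prod>i\<in>Basis. (swap_dir b c u - swap_dir b c l) \<bullet> i)"
    by (rule emeasure_lborel_box) (use le tB in \<open>auto simp: swap_dir_inner\<close>)
  also have "(\<Prod>i\<in>Basis. (swap_dir b c u - swap_dir b c l) \<bullet> i) = (\<Prod>i\<in>Basis. (u - l) \<bullet> ?t i)"
    by (intro prod.cong) (auto simp: inner_diff_left swap_dir_inner)
  also have "\<dots> = (\<Prod>i\<in>Basis. (u - l) \<bullet> i)"
    by (rule prod.reindex_bij_betw[OF transpose_Basis[OF bc]])
  finally show "emeasure (distr lborel borel (swap_dir b c)) (box l u) = (\<Prod>i\<in>Basis. (u - l) \<bullet> i)" .
qed simp

section \<open>Kernels\<close>

text \<open>For a bounded function with bounded second derivatives this is absolutely integrable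
  against a Levy kernel, so neither a compensating gradient term nor a principal value
  appears.\<close>

definition sdiff :: "('a::real_vector \<Rightarrow> real) \<Rightarrow> 'a \<Rightarrow> 'a \<Rightarrow> real" where
  "sdiff u x z = u (x + z) + u (x - z) - 2 * u x"

text \<open>\<open>nu_convex\<close> is the derivative-free form of the monotonicity of
  \<open>- \<nu>' r / r\<close>: the rate of decrease of \<open>\<nu>\<close> with respect to r^2
  decreases, that is, \<open>\<nu>\<close> is convex in r^2. \<open>N\<close> fixes the value 0 at
  the origin, where nothing is known about \<open>\<nu>\<close>.\<close>

locale levy_kernel =
  fixes \<nu> :: "real \<Rightarrow> real" and N :: "'a::euclidean_space \<Rightarrow> real" and a :: real
  assumes N_eq: "\<And>z. z \<noteq> 0 \<Longrightarrow> N z = \<nu> (norm z)" and N_0: "N 0 = 0"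
    and nu_nonneg: "\<And>r. 0 < r \<Longrightarrow> 0 \<le> \<nu> r"
    and nu_mono: "\<And>r s. 0 < r \<Longrightarrow> r \<le> s \<Longrightarrow> \<nu> s \<le> \<nu> r"
    and nu_convex: "\<And>p q t. 0 < p \<Longrightarrow> p < q \<Longrightarrow> q < t \<Longrightarrow>
          (\<nu> q - \<nu> t) * (q\<^sup>2 - p\<^sup>2) \<le> (\<nu> p - \<nu> q) * (t\<^sup>2 - q\<^sup>2)"
    and doubling_far: "\<And>r. 1 \<le> r \<Longrightarrow> \<nu> r \<le> a * \<nu> (r + 1)"
    and doubling_near: "\<And>r. 0 < r \<Longrightarrow> r \<le> 1 \<Longrightarrow> \<nu> r \<le> a * \<nu> (2 * r)"
    and N_integrable: "integrable lborel (\<lambda>z. min 1 ((norm z)\<^sup>2) * N z)"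
    and N_infinite: "(\<integral>\<^sup>+ z. ennreal (N z) \<partial>lborel) = \<infinity>"
begin

lemma N_nonneg: "0 \<le> N z"
  by (cases "z = 0") (auto simp: N_eq N_0 nu_nonneg)

lemma N_measurable[measurable]: "N \<in> borel_measurable borel"
proof -
  have "(\<lambda>z. (min 1 ((norm z)\<^sup>2) * N z) / min 1 ((norm z)\<^sup>2)) \<in> borel_measurable lborel"
    using borel_measurable_integrable[OF N_integrable] by measurable
  moreover have "(\<lambda>z. (min 1 ((norm z)\<^sup>2) * N z) / min 1 ((norm z)\<^sup>2)) = N"
    by (rule ext) (auto simp: N_0 min_def)
  ultimately show ?thesis by simp
qed

lemma N_minus[simp]: "N (- z) = N z"
  by (cases "z = 0") (auto simp: N_eq)

text \<open>A zero of \<open>\<nu>\<close> spreads: monotonicity carries it to the right, the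
  doubling at infinity back to radius 1, and the doubling near 0 on to all positive radii. A
  vanishing kernel contradicts \<open>N_infinite\<close>.\<close>

lemma nu_pos: assumes "0 < r" shows "0 < \<nu> r"
proof (rule ccontr)
  assume "\<not> 0 < \<nu> r"
  with nu_nonneg[OF assms] have z: "\<nu> r = 0" by simp
  have up: "\<nu> (r + real n) = 0" for n
    using nu_mono[OF assms, of "r + real n"] nu_nonneg[of "r + real n"] z assms by simp
  have down: "\<nu> t = 0" if "0 < t" "t \<ge> 1" for t
  proof -
    obtain n :: nat where n: "r \<le> real n" using real_arch_simple by blast
    have "\<nu> t \<le> \<bar>a\<bar>^k * \<nu> (t + real k)" for k :: nat
    proof (induction k)
      case (Suc k)
      have "\<nu> (t + real k) \<le> a * \<nu> (t + real k + 1)" using doubling_far[of "t + real k"] that by simp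
      also have "\<dots> \<le> \<bar>a\<bar> * \<nu> (t + real k + 1)" using nu_nonneg[of "t + real k + 1"] that
        by (intro mult_right_mono) auto
      finally have "\<bar>a\<bar>^k * \<nu> (t + real k) \<le> \<bar>a\<bar>^k * (\<bar>a\<bar> * \<nu> (t + real k + 1))"
        by (intro mult_left_mono) auto
      with Suc show ?case by (simp add: algebra_simps)
    qed simp
    from this[of n] have "\<nu> t \<le> \<bar>a\<bar>^n * \<nu> (t + real n)" .
    moreover have "\<nu> (t + real n) = 0"
      using nu_mono[OF assms, of "t + real n"] nu_nonneg[of "t + real n"] z that n by simp
    ultimately show ?thesis using nu_nonneg[of t] that by simp
  qed
  have z2: "\<nu> (1 / 2^k) = 0" for k :: nat
  proof (induction k)
    case 0 show ?case using down[of 1] by simp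
  next
    case (Suc k)
    have "\<nu> (1 / 2^Suc k) \<le> a * \<nu> (2 * (1 / 2^Suc k))"
      by (rule doubling_near) (auto simp del: power_Suc intro!: divide_le_eq_1_pos[THEN iffD2] one_le_power)
    then show ?case using Suc nu_nonneg[of "1 / 2^Suc k"] by simp
  qed
  have "\<nu> t = 0" if "0 < t" for t
  proof -
    obtain k :: nat where "1 / 2^k < t"
      using real_arch_pow_inv[OF \<open>0 < t\<close>, of "1/2"] by (auto simp: power_one_over)
    then show ?thesis using nu_mono[of "1/2^k" t] z2[of k] nu_nonneg[OF that] by simp
  qed
  then have "N z = 0" for z by (cases "z = 0") (auto simp: N_eq N_0)
  then show False using N_infinite by simp
qed

lemma a_ge_1: "1 \<le> a"
proof -
  have "\<nu> 1 \<le> a * \<nu> 2" using doubling_near[of 1] by simp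
  moreover have "\<nu> 2 \<le> \<nu> 1" "0 < \<nu> 2" using nu_mono[of 1 2] nu_pos[of 2] by auto
  ultimately have "\<nu> 2 * 1 \<le> \<nu> 2 * a" by (metis mult.commute mult.right_neutral order_trans)
  then show ?thesis using \<open>0 < \<nu> 2\<close> by (simp only: mult_le_cancel_left_pos)
qed

lemma nu_shift:
  assumes "0 < r" "0 \<le> t" "t \<le> r" "t \<le> 1"
  shows "\<nu> r \<le> a * \<nu> (r + t)"
proof (cases "r \<le> 1")
  case True
  have "\<nu> r \<le> a * \<nu> (2 * r)" using doubling_near True assms by simp
  also have "\<dots> \<le> a * \<nu> (r + t)"
    using a_ge_1 assms by (intro mult_left_mono nu_mono) auto
  finally show ?thesis .
next
  case False
  then have "\<nu> r \<le> a * \<nu> (r + 1)" using doubling_far by simp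
  also have "\<dots> \<le> a * \<nu> (r + t)"
    using a_ge_1 assms by (intro mult_left_mono nu_mono) auto
  finally show ?thesis .
qed

text \<open>This is how convexity in r^2 is used. For q \<le> 2p the slope on [p, q] is at most the
  slope on an interval of length \<open>min p 1 / 2\<close> to the left of p, where
  \<open>\<nu>\<close> is at most \<open>a * \<nu> p\<close> by doubling. For q > 2p the gap q - p
  exceeds \<open>min p 1\<close> and the bound is trivial.\<close>

lemma nu_diff:
  assumes p: "0 < p" and pq: "p \<le> q"
  shows "\<nu> p - \<nu> q \<le> 6 * a * \<nu> p * (q - p) / min p 1"
proof -
  define m where "m = min p 1"
  have m: "0 < m" "m \<le> p" "m \<le> 1" using p by (auto simp: m_def)
  have a: "1 \<le> a" by (rule a_ge_1)
  have np: "0 < \<nu> p" using nu_pos p by simp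
  show ?thesis
  proof (cases "q = p")
    case False
    with pq have lt: "p < q" by simp
    show ?thesis
    proof (cases "q \<le> 2 * p")
      case True
      define p0 where "p0 = p - m / 2"
      have p0: "0 < p0" "p0 < p" using m p by (auto simp: p0_def)
      have nup0: "\<nu> p0 \<le> a * \<nu> p"
        using nu_shift[of p0 "m/2"] m p by (simp add: p0_def)
      have "p\<^sup>2 - p0\<^sup>2 = (p - p0) * (p + p0)" by (simp add: power2_eq_square algebra_simps)
      also have "\<dots> \<ge> (m / 2) * p" using p0 m p by (intro mult_mono) (auto simp: p0_def)
      finally have d: "(m / 2) * p \<le> p\<^sup>2 - p0\<^sup>2" .
      have "q\<^sup>2 - p\<^sup>2 = (q - p) * (q + p)" by (simp add: power2_eq_square algebra_simps)
      also have "\<dots> \<le> (q - p) * (3 * p)" using lt True by (intro mult_left_mono) auto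
      finally have e: "q\<^sup>2 - p\<^sup>2 \<le> (q - p) * (3 * p)" .
      have e0: "0 \<le> q\<^sup>2 - p\<^sup>2" using lt p by (simp add: power_mono)
      have nn: "0 \<le> \<nu> p - \<nu> q" using nu_mono[OF p pq] by simp
      have "(\<nu> p - \<nu> q) * ((m / 2) * p) \<le> (\<nu> p - \<nu> q) * (p\<^sup>2 - p0\<^sup>2)"
        using d nn by (rule mult_left_mono)
      also have "\<dots> \<le> (\<nu> p0 - \<nu> p) * (q\<^sup>2 - p\<^sup>2)" using nu_convex[OF p0 lt] .
      also have "\<dots> \<le> (a * \<nu> p) * ((q - p) * (3 * p))"
        using nup0 np e e0 a by (intro mult_mono) auto
      \<comment> \<open>The 6 is the quotient of the 3 in \<open>e\<close> by the 1/2 in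
        \<open>d\<close>.\<close>
      also have "\<dots> = (6 * a * \<nu> p * (q - p)) * (p / 2)" by simp
      also have "(\<nu> p - \<nu> q) * ((m / 2) * p) = ((\<nu> p - \<nu> q) * m) * (p / 2)" by simp
      finally have "((\<nu> p - \<nu> q) * m) * (p / 2) \<le> (6 * a * \<nu> p * (q - p)) * (p / 2)" .
      then have "(\<nu> p - \<nu> q) * m \<le> 6 * a * \<nu> p * (q - p)"
        using p by (simp only: mult_le_cancel_right_pos half_gt_zero)
      then show ?thesis using m by (simp only: m_def[symmetric] pos_le_divide_eq)
    next
      case False
      have "m \<le> q - p" using False m by simp
      then have "1 \<le> (q - p) / m" using m by simp
      moreover have "1 \<le> 6 * a" using a by simp
      ultimately have "1 * 1 \<le> (6 * a) * ((q - p) / m)" by (intro mult_mono) auto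
      then have "\<nu> p * 1 \<le> \<nu> p * ((6 * a) * ((q - p) / m))"
        using np by (intro mult_left_mono) auto
      then have "\<nu> p \<le> 6 * a * \<nu> p * (q - p) / m" by (simp add: ac_simps)
      then show ?thesis unfolding m_def[symmetric] using nu_nonneg[of q] p pq by linarith
    qed
  qed simp
qed

text \<open>The truncated second moment of the kernel at radius r, the unit in which all estimates
  at scale r are measured. It bounds the reciprocal of the mean exit time from a ball of radius r up
  to a constant, see \<open>mean_exit_ge\<close>.\<close>

definition H :: "real \<Rightarrow> real" where
  "H r = (LBINT z. min 1 ((norm z)\<^sup>2 / r\<^sup>2) * N z)"

text \<open>Twice the generator of the process, because \<open>sdiff\<close> counts every jump with
  both signs; hence the factors 1/2 in the Dynkin formulas.\<close>

definition L :: "('a \<Rightarrow> real) \<Rightarrow> 'a \<Rightarrow> real" where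
  "L u x = (LBINT z. sdiff u x z * N z)"

lemma integrable_N_bound:
  assumes g[measurable]: "g \<in> borel_measurable borel" and b: "\<And>z. \<bar>g z\<bar> \<le> C * min 1 ((norm z)\<^sup>2)"
  shows "integrable lborel (\<lambda>z. g z * N z)"
proof (rule Bochner_Integration.integrable_bound)
  show "integrable lborel (\<lambda>z. C * (min 1 ((norm z)\<^sup>2) * N z))" using N_integrable by simp
  have "\<bar>g z\<bar> * N z \<le> \<bar>C\<bar> * (min 1 ((norm z)\<^sup>2) * N z)" for z
  proof -
    have "\<bar>g z\<bar> \<le> \<bar>C\<bar> * min 1 ((norm z)\<^sup>2)"
      using b[of z] by (rule order_trans) (auto intro!: mult_right_mono)
    from mult_right_mono[OF this N_nonneg[of z]] show ?thesis by (simp add: mult.assoc)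
  qed
  then show "AE z in lborel. norm (g z * N z) \<le> norm (C * (min 1 ((norm z)\<^sup>2) * N z))"
    by (intro AE_I2) (simp add: abs_mult N_nonneg)
qed simp

lemma min_scaled_bound:
  fixes z :: 'a
  assumes "0 < r"
  shows "min 1 ((norm z)\<^sup>2 / r\<^sup>2) \<le> max 1 (1 / r\<^sup>2) * min 1 ((norm z)\<^sup>2)"
proof (cases "norm z \<le> 1")
  case True
  then have "(norm z)\<^sup>2 \<le> 1" by (simp add: abs_square_le_1)
  then have "min 1 ((norm z)\<^sup>2) = (norm z)\<^sup>2" by simp
  moreover have "(norm z)\<^sup>2 / r\<^sup>2 \<le> max 1 (1 / r\<^sup>2) * (norm z)\<^sup>2"
    using mult_right_mono[of "1/r\<^sup>2" "max 1 (1 / r\<^sup>2)" "(norm z)\<^sup>2"] by simp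
  ultimately show ?thesis by simp
next
  case False
  then have "min 1 ((norm z)\<^sup>2) = 1" by simp
  then show ?thesis by simp
qed

lemma integrable_N_bound':
  assumes g[measurable]: "g \<in> borel_measurable borel" and r: "0 < r"
    and b: "\<And>z. \<bar>g z\<bar> \<le> C * min 1 ((norm z)\<^sup>2 / r\<^sup>2)"
  shows "integrable lborel (\<lambda>z. g z * N z)"
proof (rule integrable_N_bound[OF g])
  fix z
  have "\<bar>g z\<bar> \<le> \<bar>C\<bar> * min 1 ((norm z)\<^sup>2 / r\<^sup>2)"
    using b[of z] by (rule order_trans) (auto intro!: mult_right_mono)
  also have "\<dots> \<le> \<bar>C\<bar> * (max 1 (1 / r\<^sup>2) * min 1 ((norm z)\<^sup>2))"
    by (intro mult_left_mono min_scaled_bound r) auto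
  finally show "\<bar>g z\<bar> \<le> (\<bar>C\<bar> * max 1 (1 / r\<^sup>2)) * min 1 ((norm z)\<^sup>2)" by (simp add: mult.assoc)
qed

lemma H_integrable: "0 < r \<Longrightarrow> integrable lborel (\<lambda>z. min 1 ((norm z)\<^sup>2 / r\<^sup>2) * N z)"
  by (rule integrable_N_bound'[where r = r and C = 1]) auto

lemma integral_N_bound:
  assumes g[measurable]: "g \<in> borel_measurable borel" and r: "0 < r"
    and b: "\<And>z. g z \<le> C * min 1 ((norm z)\<^sup>2 / r\<^sup>2)" and C: "0 \<le> C"
  shows "(LBINT z. g z * N z) \<le> C * H r"
proof (cases "integrable lborel (\<lambda>z. g z * N z)")
  case True
  have "(LBINT z. g z * N z) \<le> (LBINT z. C * (min 1 ((norm z)\<^sup>2 / r\<^sup>2) * N z))"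
  proof (rule integral_mono[OF True])
    show "integrable lborel (\<lambda>z. C * (min 1 ((norm z)\<^sup>2 / r\<^sup>2) * N z))"
      using H_integrable[OF r] by simp
    show "g z * N z \<le> C * (min 1 ((norm z)\<^sup>2 / r\<^sup>2) * N z)" for z
      using mult_right_mono[OF b N_nonneg, of z z] by (simp add: mult.assoc)
  qed
  then show ?thesis by (simp add: H_def)
next
  case False
  have "0 \<le> H r" unfolding H_def by (intro integral_nonneg_AE AE_I2) (simp add: N_nonneg)
  with False C show ?thesis by (simp add: not_integrable_integral_eq)
qed

lemma H_pos: assumes "0 < r" shows "0 < H r"
proof (rule ccontr)
  let ?g = "\<lambda>z. min 1 ((norm z)\<^sup>2 / r\<^sup>2) * N z"
  assume "\<not> 0 < H r"
  moreover have nn: "AE z in lborel. 0 \<le> ?g z" by (simp add: N_nonneg)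
  ultimately have "H r = 0" unfolding H_def using integral_nonneg_AE[OF nn] by linarith
  then have "AE z in lborel. ?g z = 0"
    unfolding H_def using integral_nonneg_eq_0_iff_AE[OF H_integrable[OF assms] nn] by simp
  then have "AE z in lborel. N z = 0"
  proof (rule AE_mp, intro AE_I2 impI)
    fix z :: 'a assume "?g z = 0"
    then show "N z = 0" using assms by (cases "z = 0") (auto simp: N_0 min_def split: if_splits)
  qed
  then have "(\<integral>\<^sup>+ z. ennreal (N z) \<partial>lborel) = (\<integral>\<^sup>+ z. 0 \<partial>(lborel::'a measure))"
    by (intro nn_integral_cong_AE) auto
  then show False using N_infinite by simp
qed

lemma H_scale:
  assumes r: "0 < r" and l: "1 \<le> l"
  shows "H r \<le> l\<^sup>2 * H (l * r)"
proof -
  have "H r = (LBINT z. min 1 ((norm z)\<^sup>2 / r\<^sup>2) * N z)" by (simp add: H_def)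
  also have "\<dots> \<le> l\<^sup>2 * H (l * r)"
  proof (rule integral_N_bound)
    fix z :: 'a
    have "1 \<le> l\<^sup>2" using l by (simp add: one_le_power)
    moreover have "(norm z)\<^sup>2 / r\<^sup>2 = l\<^sup>2 * ((norm z)\<^sup>2 / (l * r)\<^sup>2)"
      using l r by (simp add: power_mult_distrib)
    ultimately show "min 1 ((norm z)\<^sup>2 / r\<^sup>2) \<le> l\<^sup>2 * min 1 ((norm z)\<^sup>2 / (l * r)\<^sup>2)"
      by (auto simp: min_def)
  qed (use assms in auto)
  finally show ?thesis .
qed

end

section \<open>The maximum principle for antisymmetric functions\<close>

lemma integral_nonpos:
  fixes f :: "'b \<Rightarrow> real"
  assumes "\<And>x. f x \<le> 0"
  shows "integral\<^sup>L M f \<le> 0"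
  using integral_nonneg_AE[where f = "\<lambda>x. - f x" and M = M] assms by simp

text \<open>An odd profile with continuous derivative, concave on the positive half line, of slope 2
  at 0 and constant beyond 1. Along the normal to the hyperplane it serves as the barrier: it
  vanishes linearly there, and its concavity makes \<open>L\<close> strictly negative on it at small
  positive heights.\<close>

definition odd_cap :: "real \<Rightarrow> real" where
  "odd_cap t = (if 1 \<le> t then 1 else if t \<le> -1 then -1 else if 0 \<le> t then 2 * t - t\<^sup>2 else 2 * t + t\<^sup>2)"

lemma odd_cap_minus: "odd_cap (- t) = - odd_cap t"
  by (auto simp: odd_cap_def)

lemma odd_cap_bounds: "\<bar>odd_cap t\<bar> \<le> 1"
proof -
  have "0 \<le> t \<Longrightarrow> t \<le> 1 \<Longrightarrow> \<bar>2 * t - t\<^sup>2\<bar> \<le> 1" for t :: real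
    using mult_left_le[of t t] zero_le_power2[of "t - 1"] by (auto simp: power2_eq_square algebra_simps)
  from this[of t] this[of "-t"] show ?thesis
    by (auto simp: odd_cap_def)
qed

lemma odd_cap_nonneg: "0 \<le> t \<Longrightarrow> 0 \<le> odd_cap t"
  using mult_left_le[of t t] by (auto simp: odd_cap_def power2_eq_square)

lemma odd_cap_le: "0 \<le> t \<Longrightarrow> odd_cap t \<le> 2 * t"
  by (auto simp: odd_cap_def)

lemma odd_cap_ge: assumes "1/4 \<le> t" shows "7/16 \<le> odd_cap t"
proof (cases "t < 1")
  case True
  have "0 \<le> (t - 1/4) * (7/4 - t)" using assms True by (intro mult_nonneg_nonneg) auto
  also have "\<dots> = 2 * t - t\<^sup>2 - 7/16" by (simp add: power2_eq_square field_simps)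
  finally show ?thesis using True assms by (auto simp: odd_cap_def)
qed (auto simp: odd_cap_def)

lemma odd_cap_continuous: "continuous_on {0..1/2} odd_cap"
proof -
  have "continuous_on {0..1/2} (\<lambda>t::real. 2 * t - t\<^sup>2)" by (intro continuous_intros)
  then show ?thesis by (rule continuous_on_eq) (auto simp: odd_cap_def)
qed

lemma odd_cap_measurable[measurable]: "odd_cap \<in> borel_measurable borel"
  unfolding odd_cap_def by measurable

text \<open>For t \<le> s both points lie on the concave branch and the gain is quadratic in t.
  Afterwards s - t has crossed to the negative side, where the profile is convex, and the gain is
  only of order s t; once s + t is on the plateau it is of order s. The minimum records all three
  orders.\<close>

lemma odd_cap_sdiff_pos:
  assumes s: "0 < s" "s \<le> 1/2" and t: "0 \<le> t"
  shows "odd_cap (s + t) + odd_cap (s - t) - 2 * odd_cap s \<le> - min (min (t\<^sup>2) (s * t)) s"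
proof -
  have cs: "odd_cap s = 2 * s - s\<^sup>2" using s by (simp add: odd_cap_def)
  have ss: "s\<^sup>2 \<le> s / 2" using s mult_left_mono[of s "1/2" s] by (simp add: power2_eq_square)
  consider "t \<le> s" | "s < t" "s + t \<le> 1" | "s < t" "1 < s + t" "t - s \<le> 1" | "1 < t - s" by linarith
  then show ?thesis
  proof cases
    case 1
    have "odd_cap (s + t) = 2 * (s + t) - (s + t)\<^sup>2"
    proof (cases "s + t < 1")
      case True then show ?thesis using s t by (auto simp: odd_cap_def)
    next
      case False
      then have "s + t = 1" using 1 s by simp
      then show ?thesis by (simp add: odd_cap_def)
    qed
    moreover have "odd_cap (s - t) = 2 * (s - t) - (s - t)\<^sup>2" using s t 1 by (auto simp: odd_cap_def)
    ultimately have "odd_cap (s + t) + odd_cap (s - t) - 2 * odd_cap s = - 2 * t\<^sup>2"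
      by (simp add: cs power2_eq_square algebra_simps)
    moreover have "min (min (t\<^sup>2) (s * t)) s \<le> 2 * t\<^sup>2" by (rule order_trans[of _ "t\<^sup>2"]) auto
    ultimately show ?thesis by simp
  next
    case 2
    have "odd_cap (s + t) = 2 * (s + t) - (s + t)\<^sup>2"
    proof (cases "s + t < 1")
      case True then show ?thesis using s t by (auto simp: odd_cap_def)
    next
      case False
      then have "s + t = 1" using 2 by simp
      then show ?thesis by (simp add: odd_cap_def)
    qed
    moreover have "odd_cap (s - t) = 2 * (s - t) + (s - t)\<^sup>2" using s t 2 by (auto simp: odd_cap_def)
    ultimately have "odd_cap (s + t) + odd_cap (s - t) - 2 * odd_cap s = 2 * s\<^sup>2 - 4 * (s * t)"
      by (simp add: cs power2_eq_square algebra_simps)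
    moreover have "s\<^sup>2 \<le> s * t" using s 2 by (simp add: power2_eq_square)
    moreover have "0 \<le> s * t" using s t by simp
    ultimately show ?thesis by (simp add: min_def)
  next
    case 3
    have "odd_cap (s + t) = 1" using 3 by (simp add: odd_cap_def)
    moreover have "odd_cap (s - t) = 2 * (s - t) + (s - t)\<^sup>2"
    proof (cases "s - t = -1")
      case False then show ?thesis using s t 3 by (auto simp: odd_cap_def)
    qed (simp add: odd_cap_def)
    ultimately have e: "odd_cap (s + t) + odd_cap (s - t) - 2 * odd_cap s = (1 - (t - s))\<^sup>2 - 4 * s + 2 * s\<^sup>2"
      by (simp add: cs power2_eq_square algebra_simps)
    have "(1 - (t - s))\<^sup>2 \<le> (2 * s)\<^sup>2" using 3 by (intro power_mono) auto
    then have "(1 - (t - s))\<^sup>2 - 4 * s + 2 * s\<^sup>2 \<le> - s" using ss by (simp add: power_mult_distrib)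
    then show ?thesis unfolding e by (simp add: min_def)
  next
    case 4
    have "odd_cap (s + t) = 1" "odd_cap (s - t) = -1" using 4 s by (auto simp: odd_cap_def)
    then have "odd_cap (s + t) + odd_cap (s - t) - 2 * odd_cap s \<le> - s" using ss cs s by simp
    then show ?thesis by (simp add: min_def)
  qed
qed

lemma odd_cap_sdiff:
  assumes s: "0 < s" "s \<le> 1/2"
  shows "odd_cap (s + t) + odd_cap (s - t) - 2 * odd_cap s \<le> - min (min (t\<^sup>2) (s * \<bar>t\<bar>)) s"
  using odd_cap_sdiff_pos[OF s, of "\<bar>t\<bar>"] by (cases "0 \<le> t") (auto simp: algebra_simps)

lemma odd_cap_sdiff_abs:
  assumes s: "0 < s" "s \<le> 1/2"
  shows "\<bar>odd_cap (s + t) + odd_cap (s - t) - 2 * odd_cap s\<bar> \<le> 4 * min 1 (t\<^sup>2 / s\<^sup>2)"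
proof (cases "\<bar>t\<bar> \<le> s")
  case True
  have q: "odd_cap y = 2 * y - y\<^sup>2" if "0 \<le> y" "y \<le> 1" for y
  proof (cases "y = 1")
    case False then show ?thesis using that by (auto simp: odd_cap_def)
  qed (simp add: odd_cap_def)
  have "odd_cap (s + t) + odd_cap (s - t) - 2 * odd_cap s = - 2 * t\<^sup>2"
    using True s by (simp add: q power2_eq_square algebra_simps)
  moreover have "t\<^sup>2 \<le> s\<^sup>2" using True s by (simp add: abs_le_square_iff[symmetric])
  moreover have "s\<^sup>2 \<le> 1" using s by (simp add: abs_square_le_1)
  moreover have "t\<^sup>2 * s\<^sup>2 \<le> t\<^sup>2 * 1" using \<open>s\<^sup>2 \<le> 1\<close> by (intro mult_left_mono) auto
  then have "t\<^sup>2 \<le> t\<^sup>2 / s\<^sup>2" using s by (simp add: field_simps)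
  ultimately have "2 * t\<^sup>2 \<le> 4 * 1" "2 * t\<^sup>2 \<le> 4 * (t\<^sup>2 / s\<^sup>2)" by (smt (verit) zero_le_power2)+
  then have "2 * t\<^sup>2 \<le> 4 * min 1 (t\<^sup>2 / s\<^sup>2)" by (auto simp: min_def)
  with \<open>odd_cap (s + t) + odd_cap (s - t) - 2 * odd_cap s = - 2 * t\<^sup>2\<close> show ?thesis by simp
next
  case False
  then have "s\<^sup>2 \<le> t\<^sup>2" using s by (simp add: abs_le_square_iff[symmetric])
  then have "1 \<le> t\<^sup>2 / s\<^sup>2" using s by simp
  then have "4 * min 1 (t\<^sup>2 / s\<^sup>2) = 4" by simp
  moreover have "\<bar>odd_cap (s + t) + odd_cap (s - t) - 2 * odd_cap s\<bar> \<le> 4"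
    using odd_cap_bounds[of "s + t"] odd_cap_bounds[of "s - t"] odd_cap_bounds[of s] by linarith
  ultimately show ?thesis by simp
qed

section \<open>Antisymmetric functions and the kernel reflected in a hyperplane\<close>

context levy_kernel begin

lemma nu_comp:
  assumes "0 < p" "0 < q" "q - p \<le> p" "q - p \<le> 1"
  shows "\<nu> p \<le> a * \<nu> q"
proof (cases "p \<le> q")
  case True
  then show ?thesis using nu_shift[of p "q - p"] assms by simp
next
  case False
  then have "\<nu> p \<le> 1 * \<nu> q" using nu_mono[of q p] assms by simp
  also have "\<dots> \<le> a * \<nu> q" using a_ge_1 nu_nonneg assms by (intro mult_right_mono) auto
  finally show ?thesis .
qed

lemma nu_diff_abs:
  assumes "0 < m" "m \<le> p" "m \<le> q" "m \<le> 1"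
  shows "\<bar>\<nu> p - \<nu> q\<bar> \<le> 6 * a * \<nu> (min p q) * \<bar>p - q\<bar> / m"
proof -
  have *: "\<bar>\<nu> p - \<nu> q\<bar> \<le> 6 * a * \<nu> p * (q - p) / m" if "p \<le> q" "m \<le> p" for p q
  proof -
    have p: "0 < p" using assms that by simp
    have "\<bar>\<nu> p - \<nu> q\<bar> \<le> 6 * a * \<nu> p * (q - p) / min p 1"
      using nu_diff[OF p that(1)] nu_mono[OF p that(1)] by simp
    also have "\<dots> \<le> 6 * a * \<nu> p * (q - p) / m"
      using assms that a_ge_1 nu_nonneg[OF p] by (intro divide_left_mono mult_nonneg_nonneg) auto
    finally show ?thesis .
  qed
  show ?thesis
  proof (cases "p \<le> q")
    case True with *[of p q] assms show ?thesis by (simp add: min_def)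
  next
    case False with *[of q p] assms show ?thesis by (simp add: min_def abs_minus_commute)
  qed
qed

lemma N_refl_dir: "b \<in> Basis \<Longrightarrow> N (refl_dir b z) = N z"
  by (metis N_0 N_eq norm_eq_zero refl_dir_simps(6))

text \<open>For x at height s, the vector \<open>z + (2 * s) *\<^sub>R b\<close> has the length of
  the jump from x to the mirror image of x + z. The hypothesis on z says that x + z lies on the same
  side as x, so its mirror image is farther away.\<close>

lemma norm_shift_dir:
  assumes b: "b \<in> Basis" and s: "0 < s" and z: "- s < z \<bullet> b"
  shows "norm z < norm (z + (2 * s) *\<^sub>R b)" and "s < norm (z + (2 * s) *\<^sub>R b)"
proof -
  have bb: "b \<bullet> b = 1" using b by simp
  have "(norm (z + (2 * s) *\<^sub>R b))\<^sup>2 = (norm z)\<^sup>2 + 4 * s * (z \<bullet> b) + 4 * s\<^sup>2"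
    unfolding power2_norm_eq_inner
    by (simp add: inner_add_left inner_add_right bb inner_commute[of b z] power2_eq_square algebra_simps)
  moreover have "0 < 4 * s * (z \<bullet> b + s)" using s z by (intro mult_pos_pos) auto
  ultimately have "(norm z)\<^sup>2 < (norm (z + (2 * s) *\<^sub>R b))\<^sup>2"
    by (simp add: power2_eq_square algebra_simps)
  then show "norm z < norm (z + (2 * s) *\<^sub>R b)" by (rule power_less_imp_less_base) simp
  have "s < (z + (2 * s) *\<^sub>R b) \<bullet> b" using z by (simp add: inner_add_left bb)
  also have "\<dots> \<le> norm (z + (2 * s) *\<^sub>R b)" using b Basis_le_norm[OF b, of "z + (2 * s) *\<^sub>R b"] by simp
  finally show "s < norm (z + (2 * s) *\<^sub>R b)" .
qed

lemma N_shift_le: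
  assumes b: "b \<in> Basis" and s: "0 < s" and z: "- s < z \<bullet> b" "z \<noteq> 0"
  shows "N (z + (2 * s) *\<^sub>R b) \<le> N z"
proof -
  have "z + (2 * s) *\<^sub>R b \<noteq> 0" using norm_shift_dir(2)[OF b s z(1)] s by auto
  then show ?thesis using norm_shift_dir(1)[OF b s z(1)] z by (simp add: N_eq nu_mono)
qed

definition asym_part :: "'a \<Rightarrow> real \<Rightarrow> ('a \<Rightarrow> real) \<Rightarrow> 'a \<Rightarrow> 'a \<Rightarrow> real" where
  "asym_part b s v x z =
     (if - s < z \<bullet> b then (v (x + z) - v x) * (N z - N (z + (2 * s) *\<^sub>R b)) else 0)"

text \<open>Pairing each jump with its mirror image rewrites the operator on an antisymmetric function
  with the nonnegative kernel \<^term>\<open>N z - N (z + (2 * s) *\<^sub>R b)\<close> on a half space, up to a killing term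
  of the right sign.\<close>

lemma L_antisym_le:
  assumes b: "b \<in> Basis" and v[measurable]: "v \<in> borel_measurable borel"
    and C: "\<And>x. \<bar>v x\<bar> \<le> C" and anti: "\<And>x. v (refl_dir b x) = - v x"
    and s: "s = x \<bullet> b" "0 < s" and vx: "0 \<le> v x"
    and int: "integrable lborel (\<lambda>z. sdiff v x z * N z)"
  shows "integrable lborel (\<lambda>z. asym_part b s v x z + asym_part b s v x (- z))"
    and "L v x \<le> (LBINT z. asym_part b s v x z + asym_part b s v x (- z))"
proof -
  define E where "E = asym_part b s v x"
  \<comment> \<open>\<open>J1\<close> carries the jumps staying on the side of x with the weight of
    the mirrored jump, \<open>J2\<close> the jumps to the other side. The change of variables
    \<open>T\<close> below gives both the same weight; antisymmetry then cancels the values of v and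
    leaves a nonpositive multiple of v x.\<close>
  define J1 where "J1 z = (if - s < z \<bullet> b then v (x + z) - v x else 0) * N (z + (2 * s) *\<^sub>R b)" for z
  define J2 where "J2 z = (if - s < z \<bullet> b then 0 else v (x + z) - v x) * N z" for z
  have bb: "b \<bullet> b = 1" using b by simp
  have C0: "0 \<le> C" using C[of x] by linarith
  have C2: "\<bar>v y - v x\<bar> \<le> 2 * C" for y using C[of y] C[of x] by linarith
  have E_eq: "(v (x + z) - v x) * N z = E z + (J1 z + J2 z)" for z
    by (simp add: E_def J1_def J2_def asym_part_def algebra_simps)
  define g1 where "g1 y = (if s < y \<bullet> b then v (x + (y - (2 * s) *\<^sub>R b)) - v x else 0)" for y
  have m1: "g1 \<in> borel_measurable borel" unfolding g1_def by measurable
  have far: "min 1 ((norm y)\<^sup>2 / s\<^sup>2) = 1" if "s \<le> norm y" for y :: 'a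
    using that s(2) by (simp add: power_mono)
  have i1': "integrable lborel (\<lambda>y. g1 y * N y)"
  proof (rule integrable_N_bound'[OF m1 s(2)])
    fix y :: 'a
    show "\<bar>g1 y\<bar> \<le> (2 * C) * min 1 ((norm y)\<^sup>2 / s\<^sup>2)"
    proof (cases "s < y \<bullet> b")
      case True
      then have "s \<le> norm y" using Basis_le_norm[OF b, of y] by linarith
      then show ?thesis using C2[of "x + (y - (2 * s) *\<^sub>R b)"] far True by (simp add: g1_def)
    next
      case False then show ?thesis using C0 by (simp add: g1_def)
    qed
  qed
  have J1_eq: "J1 = (\<lambda>z. g1 (z + (2 * s) *\<^sub>R b) * N (z + (2 * s) *\<^sub>R b))"
    by (rule ext) (auto simp: J1_def g1_def inner_add_left bb)
  have i1: "integrable lborel J1"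
    unfolding J1_eq using i1' lborel_invariant(2)[OF _ distr_lborel_plus[of "(2 * s) *\<^sub>R b"], of "\<lambda>y. g1 y * N y"] m1
    by simp
  have i2: "integrable lborel J2"
    unfolding J2_def
  proof (rule integrable_N_bound'[OF _ s(2)])
    fix z :: 'a
    show "\<bar>if - s < z \<bullet> b then 0 else v (x + z) - v x\<bar> \<le> (2 * C) * min 1 ((norm z)\<^sup>2 / s\<^sup>2)"
    proof (cases "- s < z \<bullet> b")
      case False
      then have "s \<le> norm z" using Basis_le_norm[OF b, of z] by linarith
      then show ?thesis using C2[of "x + z"] far False by simp
    qed (use C0 in simp)
  qed measurable
  have m2: "J2 \<in> borel_measurable borel" using borel_measurable_integrable[OF i2] by simp
  define T where "T z = - ((2 * s) *\<^sub>R b) + refl_dir b z" for z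
  have mT: "T \<in> borel_measurable borel" unfolding T_def by measurable
  have dT: "distr lborel borel T = lborel"
    unfolding T_def using distr_lborel_refl_dir[OF b] by blast
  have xT: "x + T z = refl_dir b (x + z)" for z
    unfolding T_def refl_dir_simps(1)[OF b] by (simp add: refl_dir_def s(1))
  have NT: "N (T z) = N (z + (2 * s) *\<^sub>R b)" for z
  proof -
    have "T z = refl_dir b (z + (2 * s) *\<^sub>R b)"
      unfolding T_def refl_dir_simps(1)[OF b] refl_dir_simps(7)[OF b] by simp
    then show ?thesis by (simp add: N_refl_dir[OF b])
  qed
  have Tb: "T z \<bullet> b = - (z \<bullet> b) - 2 * s" for z
    unfolding T_def by (simp add: inner_diff_left refl_dir_simps(5)[OF b] bb)
  have i2T: "integrable lborel (\<lambda>z. J2 (T z))" using lborel_invariant(2)[OF mT dT m2] i2 by simp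
  have neg: "J1 z + J2 (T z) \<le> 0" for z
  proof -
    have "J2 (T z) = (if z \<bullet> b < - s then 0 else - v (x + z) - v x) * N (z + (2 * s) *\<^sub>R b)"
      unfolding J2_def NT xT anti Tb by auto
    moreover have "v (x + z) = 0" if "z \<bullet> b = - s"
    proof -
      have "refl_dir b (x + z) = x + z" using that s by (simp add: refl_dir_def inner_add_left)
      then show ?thesis using anti[of "x + z"] by simp
    qed
    ultimately have "J1 z + J2 (T z) = (if z \<bullet> b < - s then 0 else if z \<bullet> b = - s then - v x else - 2 * v x) * N (z + (2 * s) *\<^sub>R b)"
      by (auto simp: J1_def algebra_simps)
    also have "\<dots> \<le> 0" using vx N_nonneg[of "z + (2 * s) *\<^sub>R b"] by (intro mult_nonpos_nonneg) auto
    finally show ?thesis .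
  qed
  have "(LBINT z. J1 z + J2 z) = (LBINT z. J1 z + J2 (T z))"
    using i1 i2 i2T lborel_invariant(1)[OF mT dT m2] by simp
  also have "\<dots> \<le> 0" using neg by (intro integral_nonpos) auto
  finally have R0: "(LBINT z. J1 z + J2 z) \<le> 0" .
  have iR: "integrable lborel (\<lambda>z. J1 z + J2 z)" using i1 i2 by simp
  have mR: "(\<lambda>z. J1 z + J2 z) \<in> borel_measurable borel" using borel_measurable_integrable[OF iR] by simp
  \<comment> \<open>\<open>E\<close> alone may fail to be integrable near 0, so the whole
    decomposition is symmetrised under z and -z before it is integrated.\<close>
  have iRm: "integrable lborel (\<lambda>z. J1 (- z) + J2 (- z))"
    using lborel_invariant(2)[OF _ distr_lborel_uminus mR] iR by simp
  have Rm: "(LBINT z. J1 (- z) + J2 (- z)) = (LBINT z. J1 z + J2 z)"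
    using lborel_invariant(1)[OF _ distr_lborel_uminus mR] by simp
  have sd: "sdiff v x z * N z = (E z + E (- z)) + ((J1 z + J2 z) + (J1 (- z) + J2 (- z)))" for z
    using E_eq[of z] E_eq[of "- z"] by (simp add: sdiff_def algebra_simps)
  have iRR: "integrable lborel (\<lambda>z. (J1 z + J2 z) + (J1 (- z) + J2 (- z)))"
    using iR iRm by (rule Bochner_Integration.integrable_add)
  have Eeq: "(\<lambda>z. E z + E (- z)) = (\<lambda>z. sdiff v x z * N z - ((J1 z + J2 z) + (J1 (- z) + J2 (- z))))"
    using sd by auto
  show iE: "integrable lborel (\<lambda>z. asym_part b s v x z + asym_part b s v x (- z))"
    unfolding E_def[symmetric] Eeq using int iRR by (rule Bochner_Integration.integrable_diff)
  have "L v x = (LBINT z. E z + E (- z)) + (LBINT z. (J1 z + J2 z) + (J1 (- z) + J2 (- z)))"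
    unfolding L_def sd using iE iRR by (intro Bochner_Integration.integral_add) (auto simp: E_def)
  also have "(LBINT z. (J1 z + J2 z) + (J1 (- z) + J2 (- z))) = 2 * (LBINT z. J1 z + J2 z)"
    using Bochner_Integration.integral_add[OF iR iRm] Rm by simp
  finally show "L v x \<le> (LBINT z. asym_part b s v x z + asym_part b s v x (- z))"
    using R0 by (simp add: E_def)
qed

text \<open>The integrand of \<open>L_antisym_le\<close> is an increment of v within the half space
  times a nonnegative kernel. Therefore a maximum over the half space suffices; antisymmetry has
  already accounted for the other side.\<close>

lemma antisym_maximum_principle:
  assumes b: "b \<in> Basis" and v: "v \<in> borel_measurable borel"
    and C: "\<And>x. \<bar>v x\<bar> \<le> C" and anti: "\<And>x. v (refl_dir b x) = - v x"
    and s: "0 < x \<bullet> b" and vx: "0 \<le> v x"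
    and int: "integrable lborel (\<lambda>z. sdiff v x z * N z)"
    and max: "\<And>y. 0 < y \<bullet> b \<Longrightarrow> v y \<le> v x"
  shows "L v x \<le> 0"
proof -
  have E: "asym_part b (x \<bullet> b) v x z \<le> 0" for z
  proof (cases "z = 0 \<or> z \<bullet> b \<le> - (x \<bullet> b)")
    case True then show ?thesis by (auto simp: asym_part_def)
  next
    case False
    then have "0 < (x + z) \<bullet> b" by (simp add: inner_add_left)
    then have "v (x + z) - v x \<le> 0" using max by simp
    moreover have "0 \<le> N z - N (z + (2 * (x \<bullet> b)) *\<^sub>R b)" using N_shift_le[OF b s, of z] False by auto
    ultimately show ?thesis using False by (auto simp: asym_part_def mult_nonpos_nonneg)
  qed
  have "L v x \<le> (LBINT z. asym_part b (x \<bullet> b) v x z + asym_part b (x \<bullet> b) v x (- z))"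
    by (rule L_antisym_le(2)[OF b v C anti refl s vx int])
  also have "\<dots> \<le> 0" using E add_nonpos_nonpos[OF E E] by (intro integral_nonpos) auto
  finally show ?thesis .
qed


text \<open>The concavity gain of \<open>odd_cap\<close> at height s / r against a jump of size q /
  r, in the form of \<open>odd_cap_sdiff\<close>. The same function bounds the loss caused by the
  lateral barrier from above, which is why gain and loss can be compared without further knowledge
  of \<open>\<nu>\<close>.\<close>

definition jump_min :: "real \<Rightarrow> real \<Rightarrow> real \<Rightarrow> real" where
  "jump_min r s q = min (min (q\<^sup>2 / r\<^sup>2) (s * \<bar>q\<bar> / r\<^sup>2)) (s / r)"

lemma jump_min_measurable[measurable]: "jump_min r s \<in> borel_measurable borel"
  unfolding jump_min_def by measurable

lemma jump_min_nonneg: "0 < r \<Longrightarrow> 0 < s \<Longrightarrow> 0 \<le> jump_min r s q"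
  by (simp add: jump_min_def)

lemma jump_min_mono:
  assumes "0 < r" "0 < s" "\<bar>q\<bar> \<le> \<bar>p\<bar>"
  shows "jump_min r s q \<le> jump_min r s p"
proof -
  have "q\<^sup>2 / r\<^sup>2 \<le> p\<^sup>2 / r\<^sup>2" using assms by (intro divide_right_mono) (auto simp: abs_le_square_iff)
  moreover have "s * \<bar>q\<bar> / r\<^sup>2 \<le> s * \<bar>p\<bar> / r\<^sup>2" using assms by (intro divide_right_mono mult_left_mono) auto
  ultimately show ?thesis unfolding jump_min_def by (intro min.mono) auto
qed

lemma jump_min_le:
  assumes "0 < s" "s \<le> r"
  shows "jump_min r s q \<le> min 1 (q\<^sup>2 / r\<^sup>2)"
proof -
  have "s / r \<le> 1" using assms by simp
  then show ?thesis by (auto simp: jump_min_def)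
qed

lemma jump_min_ge:
  assumes "0 < s" "s \<le> r"
  shows "(s / r) * min 1 (q\<^sup>2 / r\<^sup>2) \<le> jump_min r s q"
proof -
  have r: "0 < r" using assms by simp
  define t where "t = \<bar>q\<bar> / r"
  define y where "y = s / r"
  have t: "0 \<le> t" "q\<^sup>2 / r\<^sup>2 = t\<^sup>2" "s * \<bar>q\<bar> / r\<^sup>2 = y * t"
    using r by (auto simp: t_def y_def power_divide power2_eq_square)
  have y: "0 \<le> y" "y \<le> 1" using assms by (auto simp: y_def)
  have m: "min 1 (t\<^sup>2) \<le> t"
  proof (cases "t \<le> 1")
    case True then show ?thesis using t mult_left_le[of t t] by (simp add: power2_eq_square min_def)
  qed simp
  have "y * min 1 (t\<^sup>2) \<le> 1 * t\<^sup>2" using y by (intro mult_mono) auto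
  moreover have "y * min 1 (t\<^sup>2) \<le> y * t" using y m by (intro mult_left_mono) auto
  moreover have "y * min 1 (t\<^sup>2) \<le> y * 1" using y by (intro mult_left_mono) auto
  ultimately show ?thesis unfolding jump_min_def t(2,3) y_def[symmetric] by simp
qed

lemma jump_min_scale:
  assumes "0 < r" "0 < s" "1 \<le> d"
  shows "jump_min r s q / d \<le> jump_min r s (q / sqrt d)"
proof -
  have d: "1 \<le> sqrt d" "sqrt d \<le> d" using assms
    by (auto simp: real_le_lsqrt power2_eq_square)
  have "jump_min r s q / d \<le> (q\<^sup>2 / r\<^sup>2) / d"
    using assms by (intro divide_right_mono) (auto simp: jump_min_def)
  also have "\<dots> = (q / sqrt d)\<^sup>2 / r\<^sup>2" using assms by (simp add: power_divide)
  finally have 1: "jump_min r s q / d \<le> (q / sqrt d)\<^sup>2 / r\<^sup>2" .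
  have "jump_min r s q / d \<le> (s * \<bar>q\<bar> / r\<^sup>2) / d"
    using assms by (intro divide_right_mono) (auto simp: jump_min_def)
  also have "\<dots> \<le> (s * \<bar>q\<bar> / r\<^sup>2) / sqrt d" using assms d by (intro divide_left_mono) auto
  also have "\<dots> = s * \<bar>q / sqrt d\<bar> / r\<^sup>2" using assms by simp
  finally have 2: "jump_min r s q / d \<le> s * \<bar>q / sqrt d\<bar> / r\<^sup>2" .
  have "jump_min r s q / d \<le> (s / r) / d"
    using assms by (intro divide_right_mono) (auto simp: jump_min_def)
  also have "\<dots> \<le> (s / r) / 1" using assms by (intro divide_left_mono) auto
  finally have 3: "jump_min r s q / d \<le> s / r" by simp
  show ?thesis using 1 2 3 by (subst (2) jump_min_def) simp
qed

definition jump_int :: "real \<Rightarrow> real \<Rightarrow> real" where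
  "jump_int r s = (LBINT z. jump_min r s (norm z) * N z)"

lemma jump_min_integrable:
  assumes "0 < s" "s \<le> r" and g[measurable]: "g \<in> borel_measurable borel" and "\<And>z. \<bar>g z\<bar> \<le> norm (z::'a)"
  shows "integrable lborel (\<lambda>z. jump_min r s (g z) * N z)"
proof (rule integrable_N_bound'[where r = r and C = 1])
  fix z :: 'a
  have "jump_min r s (g z) \<le> jump_min r s (norm z)" using assms by (intro jump_min_mono) auto
  also have "\<dots> \<le> min 1 ((norm z)\<^sup>2 / r\<^sup>2)" using assms by (intro jump_min_le) auto
  finally show "\<bar>jump_min r s (g z)\<bar> \<le> 1 * min 1 ((norm z)\<^sup>2 / r\<^sup>2)"
    using jump_min_nonneg[of r s "g z"] assms by simp
qed (use assms in auto)

lemma jump_int_ge: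
  assumes "0 < s" "s \<le> r"
  shows "(s / r) * H r \<le> jump_int r s"
proof -
  have r: "0 < r" using assms by simp
  have "(s / r) * H r = (LBINT z. (s / r) * (min 1 ((norm z)\<^sup>2 / r\<^sup>2) * N z))" by (simp add: H_def)
  also have "\<dots> \<le> jump_int r s" unfolding jump_int_def
  proof (rule integral_mono)
    show "integrable lborel (\<lambda>z. (s / r) * (min 1 ((norm z)\<^sup>2 / r\<^sup>2) * N z))" using H_integrable[OF r] by simp
    show "integrable lborel (\<lambda>z. jump_min r s (norm z) * N z)" using assms by (intro jump_min_integrable) auto
    show "(s / r) * (min 1 ((norm z)\<^sup>2 / r\<^sup>2) * N z) \<le> jump_min r s (norm z) * N z" for z
      using mult_right_mono[OF jump_min_ge[OF assms] N_nonneg, of "norm z" z] by (simp add: mult.assoc)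
  qed
  finally show ?thesis .
qed

text \<open>With d the dimension, some coordinate of z has modulus at least
  \<open>norm z / sqrt d\<close>, for which \<open>jump_min_scale\<close> pays a factor d. Summing
  over the coordinates costs another d, since all directional integrals agree under
  \<open>swap_dir\<close>.\<close>

lemma jump_int_dir:
  assumes b: "b \<in> Basis" and s: "0 < s" "s \<le> r"
  shows "jump_int r s / (real DIM('a))\<^sup>2 \<le> (LBINT z. jump_min r s (z \<bullet> b) * N z)"
proof -
  let ?d = "real DIM('a)"
  have r: "0 < r" using s by simp
  have d: "1 \<le> ?d" by (simp add: DIM_ge_Suc0[simplified])
  have ic: "integrable lborel (\<lambda>z. jump_min r s (z \<bullet> c) * N z)" if "c \<in> Basis" for c
    using s Basis_le_norm[OF that] by (intro jump_min_integrable) auto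
  have eq: "(LBINT z. jump_min r s (z \<bullet> c) * N z) = (LBINT z. jump_min r s (z \<bullet> b) * N z)" if c: "c \<in> Basis" for c
  proof -
    have Ns: "N (swap_dir b c z) = N z" for z
      by (metis N_0 N_eq norm_eq_zero norm_swap_dir[OF b c])
    have "(LBINT z. jump_min r s (swap_dir b c z \<bullet> c) * N (swap_dir b c z)) = (LBINT z. jump_min r s (z \<bullet> c) * N z)"
      by (rule lborel_invariant(1)[OF _ distr_lborel_swap_dir[OF b c]]) measurable
    then show ?thesis by (simp add: Ns swap_dir_inner[OF c])
  qed
  have pt: "jump_min r s (norm z) / ?d \<le> (\<Sum>c\<in>Basis. jump_min r s (z \<bullet> c))" for z :: 'a
  proof -
    have "\<exists>c\<in>Basis. norm z / sqrt ?d \<le> \<bar>z \<bullet> c\<bar>"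
    proof (rule ccontr)
      assume "\<not> ?thesis"
      then have "\<bar>z \<bullet> c\<bar> < norm z / sqrt ?d" if "c \<in> Basis" for c using that by force
      then have lt: "(z \<bullet> c)\<^sup>2 < (norm z / sqrt ?d)\<^sup>2" if "c \<in> Basis" for c
        using power_strict_mono[of "\<bar>z \<bullet> c\<bar>" "norm z / sqrt ?d" 2] that by simp
      have "(norm z)\<^sup>2 = (\<Sum>c\<in>Basis. (z \<bullet> c)\<^sup>2)"
        unfolding power2_norm_eq_inner by (subst euclidean_inner) (simp add: power2_eq_square)
      also have "\<dots> < (\<Sum>c\<in>(Basis::'a set). (norm z / sqrt ?d)\<^sup>2)"
        by (rule sum_strict_mono) (use lt in auto)
      also have "\<dots> = (norm z)\<^sup>2" using d by (simp add: power_divide)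
      finally show False by simp
    qed
    then obtain c where c: "c \<in> Basis" "norm z / sqrt ?d \<le> \<bar>z \<bullet> c\<bar>" by blast
    have "jump_min r s (norm z) / ?d \<le> jump_min r s (norm z / sqrt ?d)" by (rule jump_min_scale[OF r s(1) d])
    also have "\<dots> \<le> jump_min r s (z \<bullet> c)" using r s c by (intro jump_min_mono) auto
    also have "\<dots> \<le> (\<Sum>c\<in>Basis. jump_min r s (z \<bullet> c))"
      using c jump_min_nonneg[OF r s(1)] by (intro member_le_sum) auto
    finally show ?thesis .
  qed
  have "jump_int r s / ?d = (LBINT z. (jump_min r s (norm z) * N z) / ?d)" by (simp add: jump_int_def)
  also have "\<dots> \<le> (LBINT z. (\<Sum>c\<in>Basis. jump_min r s (z \<bullet> c) * N z))"
  proof (rule integral_mono)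
    show "integrable lborel (\<lambda>z. (jump_min r s (norm z) * N z) / ?d)"
      using s jump_min_integrable[of s r norm] by simp
    show "integrable lborel (\<lambda>z. \<Sum>c\<in>Basis. jump_min r s (z \<bullet> c) * N z)" using ic by simp
    show "jump_min r s (norm z) * N z / ?d \<le> (\<Sum>c\<in>Basis. jump_min r s (z \<bullet> c) * N z)" for z
      using mult_right_mono[OF pt N_nonneg, of z z] by (simp add: sum_distrib_right)
  qed
  also have "\<dots> = (\<Sum>c\<in>(Basis::'a set). (LBINT z. jump_min r s (z \<bullet> c) * N z))"
    using ic by (intro Bochner_Integration.integral_sum) auto
  also have "\<dots> = ?d * (LBINT z. jump_min r s (z \<bullet> b) * N z)" using eq by simp
  finally show ?thesis using d by (simp add: field_simps power2_eq_square)
qed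

lemma L_odd_cap:
  assumes b: "b \<in> Basis" and r: "0 < r" and s: "0 < x \<bullet> b" "x \<bullet> b \<le> r / 2"
  defines "S \<equiv> \<lambda>y::'a. odd_cap (y \<bullet> b / r)"
  shows "integrable lborel (\<lambda>z. sdiff S x z * N z)"
    and "L S x \<le> - jump_int r (x \<bullet> b) / (real DIM('a))\<^sup>2"
proof -
  let ?s = "x \<bullet> b"
  have \<sigma>: "0 < ?s / r" "?s / r \<le> 1/2" using s r by (auto simp: field_simps)
  have sd: "sdiff S x z = odd_cap (?s / r + (z \<bullet> b) / r) + odd_cap (?s / r - (z \<bullet> b) / r) - 2 * odd_cap (?s / r)" for z
    by (simp add: sdiff_def S_def inner_add_left inner_diff_left add_divide_distrib diff_divide_distrib)
  have m[measurable]: "sdiff S x \<in> borel_measurable borel" unfolding sd by measurable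
  show i: "integrable lborel (\<lambda>z. sdiff S x z * N z)"
  proof (rule integrable_N_bound'[where r = ?s and C = 4])
    fix z :: 'a
    have "\<bar>sdiff S x z\<bar> \<le> 4 * min 1 (((z \<bullet> b) / r)\<^sup>2 / (?s / r)\<^sup>2)"
      unfolding sd by (rule odd_cap_sdiff_abs[OF \<sigma>])
    also have "((z \<bullet> b) / r)\<^sup>2 / (?s / r)\<^sup>2 = (z \<bullet> b)\<^sup>2 / ?s\<^sup>2" using r by (simp add: power_divide)
    also have "4 * min 1 ((z \<bullet> b)\<^sup>2 / ?s\<^sup>2) \<le> 4 * min 1 ((norm z)\<^sup>2 / ?s\<^sup>2)"
      using Basis_le_norm[OF b, of z]
      by (intro mult_left_mono min.mono divide_right_mono) (auto simp: abs_le_square_iff[symmetric])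
    finally show "\<bar>sdiff S x z\<bar> \<le> 4 * min 1 ((norm z)\<^sup>2 / ?s\<^sup>2)" .
  qed (use s in auto)
  have ic: "integrable lborel (\<lambda>z. jump_min r ?s (z \<bullet> b) * N z)"
    using s r Basis_le_norm[OF b] by (intro jump_min_integrable) auto
  have "L S x \<le> (LBINT z. - (jump_min r ?s (z \<bullet> b) * N z))"
    unfolding L_def
  proof (rule integral_mono[OF i])
    show "integrable lborel (\<lambda>z. - (jump_min r ?s (z \<bullet> b) * N z))" using ic by simp
    fix z :: 'a
    have "sdiff S x z \<le> - min (min (((z \<bullet> b) / r)\<^sup>2) (?s / r * \<bar>(z \<bullet> b) / r\<bar>)) (?s / r)"
      unfolding sd by (rule odd_cap_sdiff[OF \<sigma>])
    also have "\<dots> = - jump_min r ?s (z \<bullet> b)"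
      using r by (simp add: jump_min_def power_divide power2_eq_square)
    finally show "sdiff S x z * N z \<le> - (jump_min r ?s (z \<bullet> b) * N z)"
      using mult_right_mono[OF _ N_nonneg, of "sdiff S x z" _ z] by fastforce
  qed
  also have "\<dots> = - (LBINT z. jump_min r ?s (z \<bullet> b) * N z)" by simp
  also have "\<dots> \<le> - (jump_int r ?s / (real DIM('a))\<^sup>2)"
    using jump_int_dir[OF b s(1), of r] s r by simp
  finally show "L S x \<le> - jump_int r ?s / (real DIM('a))\<^sup>2" by simp
qed


section \<open>The lateral barrier\<close>

definition perp :: "'a \<Rightarrow> 'a \<Rightarrow> 'a" where "perp b x = x - (x \<bullet> b) *\<^sub>R b"

lemma perp_measurable[measurable]: "perp b \<in> borel_measurable borel"
  unfolding perp_def by measurable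

lemma perp_props:
  assumes b: "b \<in> Basis"
  shows "perp b (x + y) = perp b x + perp b y" "perp b (x - y) = perp b x - perp b y"
    "perp b (- x) = - perp b x" "perp b (refl_dir b x) = perp b x" "norm (perp b x) \<le> norm x"
    "(norm x)\<^sup>2 = (x \<bullet> b)\<^sup>2 + (norm (perp b x))\<^sup>2"
proof -
  have bb: "b \<bullet> b = 1" using b by simp
  show "perp b (x + y) = perp b x + perp b y" "perp b (x - y) = perp b x - perp b y"
    "perp b (- x) = - perp b x"
    by (simp_all add: perp_def inner_add_left inner_diff_left algebra_simps)
  show "perp b (refl_dir b x) = perp b x"
  proof -
    have "(2 * (x \<bullet> b)) *\<^sub>R b = (x \<bullet> b) *\<^sub>R b + (x \<bullet> b) *\<^sub>R b"
      unfolding scaleR_left_distrib[symmetric] by simp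
    then show ?thesis unfolding perp_def refl_dir_simps(5)[OF b] by (simp add: refl_dir_def)
  qed
  show *: "(norm x)\<^sup>2 = (x \<bullet> b)\<^sup>2 + (norm (perp b x))\<^sup>2"
    unfolding power2_norm_eq_inner perp_def
    by (simp add: inner_diff_left inner_diff_right bb inner_commute[of b x] power2_eq_square)
  have "(norm (perp b x))\<^sup>2 \<le> (norm x)\<^sup>2" using * by simp
  then show "norm (perp b x) \<le> norm x" by (rule power2_le_imp_le) simp
qed

text \<open>Zero on the axis in direction b and equal to 1 from distance r/4 on: it closes the side
  of the cylinder on which the maximum principle is applied, and it costs nothing on the axis, where
  the estimate is read off.\<close>

definition wall :: "'a \<Rightarrow> real \<Rightarrow> 'a \<Rightarrow> real" where
  "wall b r x = min (16 * (norm (perp b x))\<^sup>2 / r\<^sup>2) 1"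

definition odd_wall :: "'a \<Rightarrow> real \<Rightarrow> 'a \<Rightarrow> real" where
  "odd_wall b r x = sgn (x \<bullet> b) * wall b r x"

lemma wall_measurable[measurable]: "wall b r \<in> borel_measurable borel"
  unfolding wall_def by measurable

lemma odd_wall_measurable[measurable]: "odd_wall b r \<in> borel_measurable borel"
  unfolding odd_wall_def by measurable

lemma wall_bounds: "0 \<le> wall b r x" "wall b r x \<le> 1"
  by (auto simp: wall_def)

lemma odd_wall_abs: "\<bar>odd_wall b r x\<bar> \<le> 1"
  using wall_bounds[of b r x] by (auto simp: odd_wall_def abs_mult sgn_real_def)

lemma odd_wall_anti: "b \<in> Basis \<Longrightarrow> odd_wall b r (refl_dir b x) = - odd_wall b r x"
  by (simp add: odd_wall_def wall_def refl_dir_simps perp_props(1-5))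

lemma parallelogram: "(norm (x + z))\<^sup>2 + (norm (x - z))\<^sup>2 = 2 * (norm x)\<^sup>2 + 2 * (norm (z::'a))\<^sup>2"
  unfolding power2_norm_eq_inner by (simp add: inner_add_left inner_add_right inner_diff_left inner_diff_right)

lemma wall_small: "0 < r \<Longrightarrow> norm (perp b x) \<le> r / 4 \<Longrightarrow> wall b r x = 16 * (norm (perp b x))\<^sup>2 / r\<^sup>2"
proof -
  assume r: "0 < r" and "norm (perp b x) \<le> r / 4"
  then have "(norm (perp b x))\<^sup>2 \<le> (r / 4)\<^sup>2" by (intro power_mono) auto
  then have "16 * (norm (perp b x))\<^sup>2 / r\<^sup>2 \<le> 1" using r by (simp add: power_divide field_simps)
  then show ?thesis by (simp add: wall_def)
qed

lemma wall_large: "0 < r \<Longrightarrow> r / 4 \<le> norm (perp b x) \<Longrightarrow> wall b r x = 1"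
proof -
  assume r: "0 < r" and "r / 4 \<le> norm (perp b x)"
  then have "(r / 4)\<^sup>2 \<le> (norm (perp b x))\<^sup>2" by (intro power_mono) auto
  then have "1 \<le> 16 * (norm (perp b x))\<^sup>2 / r\<^sup>2" using r by (simp add: power_divide field_simps)
  then show ?thesis by (simp add: wall_def)
qed

text \<open>The wall does not vanish near the hyperplane, so its second differences alone would give
  an error without the factor s. The difference of the kernel and its mirror image supplies that
  factor through \<open>nu_diff_abs\<close>. Pairing z with \<open>- refl_dir b z\<close>, which has
  the same normal and the opposite tangential component, turns the increments into second
  differences of the wall.\<close>

lemma L_odd_wall:
  assumes b: "b \<in> Basis" and r: "0 < r" "r \<le> 1" and s: "0 < x \<bullet> b" "x \<bullet> b \<le> r"
    and x: "norm (perp b x) < r / 4"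
  shows "integrable lborel (\<lambda>z. sdiff (odd_wall b r) x z * N z)"
    and "L (odd_wall b r) x \<le> 384 * a * jump_int r (x \<bullet> b)"
proof -
  let ?S = "odd_wall b r"
  let ?s = "x \<bullet> b"
  \<comment> \<open>Within this radius of x a point stays on the positive side and in the region
    where the wall is a quadratic polynomial.\<close>
  define \<tau> where "\<tau> = min ?s (r / 4 - norm (perp b x))"
  have \<tau>: "0 < \<tau>" "\<tau> \<le> ?s" "\<tau> \<le> r / 4" "norm (perp b x) + \<tau> \<le> r / 4" using s x norm_ge_zero[of "perp b x"] unfolding \<tau>_def by (auto simp: min_def simp del: norm_ge_zero)
  have m: "sdiff ?S x \<in> borel_measurable borel" unfolding sdiff_def by measurable
  have SW: "?S y = wall b r y" if "0 < y \<bullet> b" for y using that by (simp add: odd_wall_def)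
  show i: "integrable lborel (\<lambda>z. sdiff ?S x z * N z)"
  proof (rule integrable_N_bound'[OF m \<tau>(1)])
    fix z :: 'a
    show "\<bar>sdiff ?S x z\<bar> \<le> 4 * min 1 ((norm z)\<^sup>2 / \<tau>\<^sup>2)"
    proof (cases "norm z < \<tau>")
      case True
      have "\<bar>z \<bullet> b\<bar> < ?s" using Basis_le_norm[OF b, of z] True \<tau> by linarith
      then have pos: "0 < (x + z) \<bullet> b" "0 < (x - z) \<bullet> b" by (auto simp: inner_add_left inner_diff_left)
      have pz: "norm (perp b z) \<le> \<tau>" using perp_props(5)[OF b, of z] True by simp
      have sm: "norm (perp b (x + z)) \<le> r / 4" "norm (perp b (x - z)) \<le> r / 4"
        unfolding perp_props(1-5)[OF b]
        using norm_triangle_ineq[of "perp b x" "perp b z"] norm_triangle_ineq4[of "perp b x" "perp b z"] pz \<tau> by auto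
      have "sdiff ?S x z = 16 / r\<^sup>2 * ((norm (perp b x + perp b z))\<^sup>2 + (norm (perp b x - perp b z))\<^sup>2 - 2 * (norm (perp b x))\<^sup>2)"
        using x by (simp add: sdiff_def SW[OF pos(1)] SW[OF pos(2)] SW[OF s(1)] wall_small[OF r(1) sm(1)] wall_small[OF r(1) sm(2)]
            wall_small[OF r(1)] perp_props(1-5)[OF b] algebra_simps)
      also have "\<dots> = 32 / r\<^sup>2 * (norm (perp b z))\<^sup>2" unfolding parallelogram by simp
      finally have eq: "sdiff ?S x z = 32 / r\<^sup>2 * (norm (perp b z))\<^sup>2" .
      have "32 / r\<^sup>2 * (norm (perp b z))\<^sup>2 \<le> 32 / r\<^sup>2 * (norm z)\<^sup>2"
        using perp_props(5)[OF b, of z] by (intro mult_left_mono power_mono) auto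
      also have "\<dots> = 2 * ((norm z)\<^sup>2 / (r / 4)\<^sup>2)" using r by (simp add: power_divide)
      also have "\<dots> \<le> 2 * ((norm z)\<^sup>2 / \<tau>\<^sup>2)"
        using \<tau> by (intro mult_left_mono divide_left_mono power_mono) auto
      finally have "\<bar>sdiff ?S x z\<bar> \<le> 2 * ((norm z)\<^sup>2 / \<tau>\<^sup>2)" unfolding eq by simp
      moreover have "(norm z)\<^sup>2 / \<tau>\<^sup>2 \<le> 1" using True \<tau> by (simp add: power_mono)
      moreover have "0 \<le> (norm z)\<^sup>2 / \<tau>\<^sup>2" by simp
      ultimately show ?thesis by (subst min_absorb2) linarith+
    next
      case False
      then have "1 \<le> (norm z)\<^sup>2 / \<tau>\<^sup>2" using \<tau> by (simp add: power_mono)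
      moreover have "\<bar>sdiff ?S x z\<bar> \<le> 4" unfolding sdiff_def
        using odd_wall_abs[of b r "x + z"] odd_wall_abs[of b r "x - z"] odd_wall_abs[of b r x] by linarith
      ultimately show ?thesis by simp
    qed
  qed
  define E where "E = asym_part b ?s ?S x"
  have Sx: "0 \<le> ?S x" using SW[OF s(1)] wall_bounds by simp
  note E1 = L_antisym_le[OF b odd_wall_measurable odd_wall_abs odd_wall_anti[OF b] refl s(1) Sx i, folded E_def]
  \<comment> \<open>384 = 32 * 12, with 32 from the second difference of the wall
    (\<open>W1\<close>) and 12 from the kernel difference (\<open>k2\<close>).\<close>
  let ?B = "\<lambda>z. 384 * a * (jump_min r ?s (norm z) * N z)"
  have EE: "E z + E (- refl_dir b z) \<le> ?B z" for z
  proof (cases "- ?s < z \<bullet> b \<and> z \<noteq> 0")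
    case False
    then have "E z + E (- refl_dir b z) = 0"
      by (auto simp: E_def asym_part_def refl_dir_simps[OF b], simp_all add: refl_dir_def)
    then show ?thesis using jump_min_nonneg[OF r(1) s(1), of "norm z"] N_nonneg[of z] a_ge_1 by simp
  next
    case True
    then have z: "- ?s < z \<bullet> b" "z \<noteq> 0" by auto
    let ?k = "N z - N (z + (2 * ?s) *\<^sub>R b)"
    have k0: "0 \<le> ?k" using N_shift_le[OF b s(1) z] by simp
    have k1: "?k \<le> N z" using N_nonneg by simp
    have nz: "0 < norm z" using z by simp
    have zne: "z + (2 * ?s) *\<^sub>R b \<noteq> 0" using norm_shift_dir(2)[OF b s(1) z(1)] s by auto
    have k2: "?k \<le> 12 * a * ?s / min (norm z) r * N z"
    proof -
      have le: "norm z \<le> norm (z + (2 * ?s) *\<^sub>R b)" using norm_shift_dir(1)[OF b s(1) z(1)] by simp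
      have "norm (z + (2 * ?s) *\<^sub>R b) \<le> norm z + norm ((2 * ?s) *\<^sub>R b)" by (rule norm_triangle_ineq)
      then have d: "norm (z + (2 * ?s) *\<^sub>R b) - norm z \<le> 2 * ?s" using b s by simp
      have "?k \<le> 6 * a * \<nu> (min (norm z) (norm (z + (2 * ?s) *\<^sub>R b))) * \<bar>norm z - norm (z + (2 * ?s) *\<^sub>R b)\<bar> / min (norm z) r"
        unfolding N_eq[OF z(2)] N_eq[OF zne]
        using nu_diff_abs[of "min (norm z) r" "norm z" "norm (z + (2 * ?s) *\<^sub>R b)"] nz r le by (auto simp: min_def)
      also have "\<dots> = 6 * a * N z * (norm (z + (2 * ?s) *\<^sub>R b) - norm z) / min (norm z) r"
        using le by (simp add: N_eq[OF z(2)] min_def)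
      also have "\<dots> \<le> 6 * a * N z * (2 * ?s) / min (norm z) r"
        using d a_ge_1 N_nonneg[of z] nz r by (intro divide_right_mono mult_left_mono) auto
      finally show ?thesis by (simp add: ac_simps)
    qed
    have perpS: "perp b (- refl_dir b z) = - perp b z" by (simp add: perp_props(1-5)[OF b])
    have pos: "0 < (x + z) \<bullet> b" "0 < (x + - refl_dir b z) \<bullet> b"
      using z by (auto simp: inner_add_left inner_diff_left refl_dir_simps[OF b])
    let ?W = "wall b r (x + z) + wall b r (x + - refl_dir b z) - 2 * wall b r x"
    have W1: "?W \<le> 32 * (norm z)\<^sup>2 / r\<^sup>2"
    proof -
      have "?W \<le> 16 * (norm (perp b (x + z)))\<^sup>2 / r\<^sup>2 + 16 * (norm (perp b (x + - refl_dir b z)))\<^sup>2 / r\<^sup>2 - 2 * (16 * (norm (perp b x))\<^sup>2 / r\<^sup>2)"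
        using wall_small[OF r(1), of b x] x by (intro diff_mono add_mono) (auto simp: wall_def)
      also have "\<dots> = 16 / r\<^sup>2 * ((norm (perp b x + perp b z))\<^sup>2 + (norm (perp b x - perp b z))\<^sup>2 - 2 * (norm (perp b x))\<^sup>2)"
        unfolding perp_props(1)[OF b] perpS by (simp add: algebra_simps)
      also have "\<dots> = 32 * (norm (perp b z))\<^sup>2 / r\<^sup>2" unfolding parallelogram by simp
      also have "\<dots> \<le> 32 * (norm z)\<^sup>2 / r\<^sup>2"
        using perp_props(5)[OF b, of z] by (intro divide_right_mono mult_left_mono power_mono) auto
      finally show ?thesis .
    qed
    have W2: "?W \<le> 2" using wall_bounds[of b r "x + z"] wall_bounds[of b r "x + - refl_dir b z"] wall_bounds[of b r x] by linarith
    have kr: "N (- refl_dir b z) - N (- refl_dir b z + (2 * ?s) *\<^sub>R b) = ?k"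
    proof -
      have "- refl_dir b z + (2 * ?s) *\<^sub>R b = - refl_dir b (z + (2 * ?s) *\<^sub>R b)"
        by (simp add: refl_dir_simps[OF b])
      then show ?thesis by (simp add: N_refl_dir[OF b])
    qed
    have "- ?s < (- refl_dir b z) \<bullet> b" using z by (simp add: refl_dir_simps[OF b])
    then have "E z + E (- refl_dir b z) = ?W * ?k"
      using z unfolding E_def asym_part_def kr SW[OF pos(1)] SW[OF pos(2)] SW[OF s(1)] by (simp add: algebra_simps)
    also have "\<dots> \<le> ?B z"
    proof (cases "?W \<le> 0")
      case True
      then have "?W * ?k \<le> 0" using k0 by (simp add: mult_nonpos_nonneg)
      also have "\<dots> \<le> ?B z" using jump_min_nonneg[OF r(1) s(1), of "norm z"] N_nonneg[of z] a_ge_1 by simp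
      finally show ?thesis .
    next
      case W0: False
      show ?thesis
      proof (cases "norm z \<le> r")
        case True
        have "?W * ?k \<le> (32 * (norm z)\<^sup>2 / r\<^sup>2) * N z" using W1 k1 k0 N_nonneg[of z] by (intro mult_mono) auto
        also have "\<dots> \<le> 384 * a * ((norm z)\<^sup>2 / r\<^sup>2 * N z)"
        proof -
          have "32 * ((norm z)\<^sup>2 / r\<^sup>2 * N z) \<le> (384 * a) * ((norm z)\<^sup>2 / r\<^sup>2 * N z)"
            using a_ge_1 N_nonneg[of z] by (intro mult_right_mono) auto
          then show ?thesis by simp
        qed
        finally have q1: "?W * ?k \<le> 384 * a * ((norm z)\<^sup>2 / r\<^sup>2 * N z)" .
        have "?W * ?k \<le> (32 * (norm z)\<^sup>2 / r\<^sup>2) * (12 * a * ?s / min (norm z) r * N z)"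
          using W1 k2 k0 by (intro mult_mono) auto
        also have "\<dots> = 384 * a * (?s * norm z / r\<^sup>2 * N z)"
          using True nz by (simp add: min_def power2_eq_square)
        finally have q2: "?W * ?k \<le> 384 * a * (?s * norm z / r\<^sup>2 * N z)" .
        have "?s * norm z / r\<^sup>2 \<le> ?s * r / r\<^sup>2" using True s by (intro divide_right_mono mult_left_mono) auto
        also have "\<dots> = ?s / r" using r by (simp add: power2_eq_square)
        finally have le: "?s * norm z / r\<^sup>2 \<le> ?s / r" .
        have "jump_min r ?s (norm z) = min ((norm z)\<^sup>2 / r\<^sup>2) (?s * norm z / r\<^sup>2)"
          unfolding jump_min_def using le by (simp add: min_def)
        then show ?thesis using q1 q2 by (simp add: min_def)
      next
        case False
        then have mz: "min (norm z) r = r" by simp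
        have "?W * ?k \<le> 2 * (12 * a * ?s / r * N z)" using W2 k2 k0 unfolding mz by (intro mult_mono) auto
        also have "\<dots> = 24 * (a * (?s / r * N z))" by simp
        also have "\<dots> \<le> 384 * (a * (?s / r * N z))" using a_ge_1 s r N_nonneg[of z] by (intro mult_right_mono) auto
        also have "?s / r = jump_min r ?s (norm z)"
        proof -
          have "?s / r \<le> 1" using s r by simp
          moreover have "1 \<le> (norm z)\<^sup>2 / r\<^sup>2" using False r by (simp add: power_mono)
          moreover have "?s * r / r\<^sup>2 \<le> ?s * norm z / r\<^sup>2" using False s by (intro divide_right_mono mult_left_mono) auto
          then have "?s / r \<le> ?s * norm z / r\<^sup>2" using r by (simp add: power2_eq_square)
          ultimately show ?thesis by (simp add: jump_min_def min_def)
        qed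
        finally show ?thesis by (simp add: ac_simps)
      qed
    qed
    finally show ?thesis .
  qed
  define g where "g z = E z + E (- z)" for z
  have ig: "integrable lborel g" using E1(1) by (simp add: g_def[abs_def])
  have mg: "g \<in> borel_measurable borel" using borel_measurable_integrable[OF ig] by simp
  have dr: "distr lborel borel (refl_dir b) = lborel" using distr_lborel_refl_dir[OF b, of 0] by simp
  have igr: "integrable lborel (\<lambda>z. g (refl_dir b z))"
    using lborel_invariant(2)[OF refl_dir_measurable dr mg] ig by simp
  have iB: "integrable lborel ?B" using s jump_min_integrable[of ?s r norm] by simp
  have Bm: "?B (- z) = ?B z" for z by simp
  \<comment> \<open>\<open>EE\<close> pairs z with its tangential reflection, whereas
    \<open>g\<close> pairs z with -z. Adding the copy of \<open>g\<close> under
    \<open>refl_dir b\<close> contains each pairing once, so that \<open>EE\<close> applies at z and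
    at -z.\<close>
  have "2 * (LBINT z. g z) = (LBINT z. g z + g (refl_dir b z))"
    using ig igr lborel_invariant(1)[OF refl_dir_measurable dr mg] by simp
  also have "\<dots> \<le> (LBINT z. 2 * ?B z)"
  proof (rule integral_mono)
    fix z
    show "g z + g (refl_dir b z) \<le> 2 * ?B z"
      using EE[of z] EE[of "- z"] unfolding Bm g_def by (simp add: refl_dir_simps[OF b])
  qed (use ig igr iB in auto)
  also have "\<dots> = 2 * (384 * a * jump_int r ?s)" by (simp add: jump_int_def)
  finally show "L ?S x \<le> 384 * a * jump_int r ?s" using E1(2) by (simp add: g_def[abs_def])
qed


section \<open>The contribution of far values and the barrier argument\<close>

lemma N_far_comp:
  assumes "0 < r" "r \<le> 1" "r \<le> norm y" "norm (x::'a) \<le> r / 2"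
  shows "y - x \<noteq> 0" "r / 2 \<le> norm (y - x)" "N (y - x) \<le> a * N y"
proof -
  have "norm y - norm x \<le> norm (y - x)" by (rule norm_triangle_ineq2)
  then have 1: "norm y - r / 2 \<le> norm (y - x)" using assms by linarith
  then show 2: "r / 2 \<le> norm (y - x)" using assms by linarith
  then show 3: "y - x \<noteq> 0" using assms by auto
  have "y \<noteq> 0" using assms by auto
  moreover have "\<nu> (norm (y - x)) \<le> a * \<nu> (norm y)" using 1 2 assms by (intro nu_comp) auto
  ultimately show "N (y - x) \<le> a * N y" using 3 by (simp add: N_eq)
qed

text \<open>The distances of x to y and to the mirror image of y differ by at most the distance of x
  to its own mirror image, which is twice the height of x.\<close>

lemma N_far_diff:
  assumes b: "b \<in> Basis" and r: "0 < r" "r \<le> 1" and y: "r \<le> norm y" and x: "norm x \<le> r / 2" and s: "0 < x \<bullet> b"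
  shows "\<bar>N (y - x) - N (refl_dir b y - x)\<bar> \<le> 24 * a\<^sup>2 * ((x \<bullet> b) / r) * N y"
proof -
  let ?p = "norm (y - x)" and ?q = "norm (refl_dir b y - x)"
  have ny: "norm (refl_dir b y) = norm y" by (rule refl_dir_simps(6)[OF b])
  note f1 = N_far_comp[OF r y x] and f2 = N_far_comp[OF r _ x, of "refl_dir b y", unfolded ny, OF y]
  have "\<bar>N (y - x) - N (refl_dir b y - x)\<bar> \<le> 6 * a * \<nu> (min ?p ?q) * \<bar>?p - ?q\<bar> / (r / 2)"
    unfolding N_eq[OF f1(1)] N_eq[OF f2(1)] using f1(2) f2(2) r by (intro nu_diff_abs) auto
  also have "\<dots> \<le> 6 * a * (a * N y) * (2 * (x \<bullet> b)) / (r / 2)"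
  proof (intro divide_right_mono mult_mono mult_left_mono)
    show "\<nu> (min ?p ?q) \<le> a * N y"
      using f1(3) f2(3) unfolding N_eq[OF f1(1)] N_eq[OF f2(1)] N_refl_dir[OF b] by (simp add: min_def)
    have "?q = norm (refl_dir b (refl_dir b y - x))" by (rule refl_dir_simps(6)[OF b, symmetric])
    also have "refl_dir b (refl_dir b y - x) = y - refl_dir b x" by (simp add: refl_dir_simps[OF b])
    finally have "\<bar>?p - ?q\<bar> \<le> norm ((y - x) - (y - refl_dir b x))" by (simp only: norm_triangle_ineq3)
    also have "(y - x) - (y - refl_dir b x) = - ((2 * (x \<bullet> b)) *\<^sub>R b)" by (simp add: refl_dir_def)
    also have "norm \<dots> = 2 * (x \<bullet> b)" using b s by simp
    finally show "\<bar>?p - ?q\<bar> \<le> 2 * (x \<bullet> b)" .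
    show "0 \<le> 6 * a * (a * N y)" using a_ge_1 N_nonneg[of y] by simp
  qed (use a_ge_1 r f1(1) f2(1) in \<open>auto intro!: nu_nonneg\<close>)
  also have "\<dots> = 24 * a\<^sup>2 * ((x \<bullet> b) / r) * N y" using r by (simp add: power2_eq_square)
  finally show ?thesis .
qed

text \<open>The product of c / M and A from \<open>refl_difference_upper\<close>; the leading 2 is
  the slope of \<open>odd_cap\<close> at 0.\<close>

definition grad_const :: real where
  "grad_const = 2 * ((48 * a\<^sup>2 + 2) * ((real DIM('a))\<^sup>2 * (384 * a + 1)))"

lemma grad_const_pos: "0 < grad_const"
  using a_ge_1 by (auto simp: grad_const_def intro!: mult_pos_pos add_nonneg_pos)

text \<open>Cutting the antisymmetric difference off outside the ball makes it bounded, but spoils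
  the equation by the contribution of the far values. That error is of order s / r times M * H r and
  is absorbed by the barrier. No derivative of u enters the bound, so it survives the removal of a
  mollification.\<close>

lemma refl_difference_upper:
  assumes b: "b \<in> Basis" and r: "0 < r" "r \<le> 1" and M: "0 < M"
    and u[measurable]: "u \<in> borel_measurable borel" and cont: "continuous_on (ball 0 r) u"
    and bd: "\<And>x. x \<in> ball 0 r \<Longrightarrow> \<bar>u x\<bar> \<le> M"
    and int: "\<And>x. x \<in> ball 0 (r/2) \<Longrightarrow> integrable lborel (\<lambda>z. sdiff u x z * N z)"
    and harm: "\<And>x. x \<in> ball 0 (r/2) \<Longrightarrow> L u x = 0"
    and tail_int: "integrable lborel (\<lambda>y. indicator {y. r \<le> norm y} y * u y * N y)"
    and tail: "(LBINT y. \<bar>indicator {y. r \<le> norm y} y * u y * N y\<bar>) \<le> M * H r"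
    and s: "0 < s" "s < r / 4"
  shows "u (s *\<^sub>R b) - u (- (s *\<^sub>R b)) \<le> grad_const * M * s / r"
proof -
  let ?R = "refl_dir b"
  \<comment> \<open>A times the gain of the normal barrier exceeds the loss from the wall by one
    full \<open>jump_int\<close>. Moreover A \<ge> 5 makes the barrier at least 1 at height r/4,
    where \<open>odd_cap\<close> is at least 7/16.\<close>
  define A where "A = (real DIM('a))\<^sup>2 * (384 * a + 1)"
  \<comment> \<open>The part \<open>48 * a\<^sup>2 * M\<close> matches the far contribution; the
    extra 2M makes the final inequality strict and lets the barrier dominate the values of F, which
    are at most 2M.\<close>
  define c where "c = (48 * a\<^sup>2 + 2) * M"
  have bb: "b \<bullet> b = 1" using b by simp
  have d1: "1 \<le> (real DIM('a))\<^sup>2" by (simp add: DIM_ge_Suc0[simplified] one_le_power)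
  have A5: "5 \<le> A"
  proof -
    have "1 * 5 \<le> (real DIM('a))\<^sup>2 * (384 * a + 1)" using d1 a_ge_1 by (intro mult_mono) auto
    then show ?thesis by (simp add: A_def)
  qed
  have c2: "2 * M \<le> c" "0 < c"
  proof -
    have "2 * M \<le> (48 * a\<^sup>2 + 2) * M" using M by (intro mult_right_mono) auto
    then show "2 * M \<le> c" by (simp add: c_def)
    then show "0 < c" using M by linarith
  qed
  define F where "F x = u x - u (?R x)" for x
  define I where "I x = indicator (ball 0 r) x * F x" for x
  define O1 where "O1 x = indicator {y. r \<le> norm y} x * F x" for x
  define S1 where "S1 x = odd_cap (x \<bullet> b / r)" for x
  define v where "v x = I x - c * (A * S1 x + odd_wall b r x)" for x
  have mF[measurable]: "F \<in> borel_measurable borel" unfolding F_def by measurable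
  have mI[measurable]: "I \<in> borel_measurable borel" unfolding I_def by (intro borel_measurable_times borel_measurable_indicator mF) auto
  have mO[measurable]: "O1 \<in> borel_measurable borel" unfolding O1_def by measurable
  have mS[measurable]: "S1 \<in> borel_measurable borel" unfolding S1_def by measurable
  have mv[measurable]: "v \<in> borel_measurable borel" unfolding v_def by measurable
  have nR: "norm (?R x) = norm x" for x by (rule refl_dir_simps(6)[OF b])
  have FR: "F (?R x) = - F x" for x by (simp add: F_def refl_dir_simps[OF b])
  have F_bd: "\<bar>F x\<bar> \<le> 2 * M" if "norm x < r" for x
    using bd[of x] bd[of "?R x"] that by (simp add: F_def nR)
  have I_bd: "\<bar>I x\<bar> \<le> 2 * M" for x
    using F_bd[of x] M by (auto simp: I_def indicator_def)
  have IO: "F x = I x + O1 x" for x by (auto simp: I_def O1_def indicator_def)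
  have v_anti: "v (?R x) = - v x" for x
    by (simp add: v_def I_def FR S1_def odd_wall_anti[OF b] nR indicator_def refl_dir_simps(5)[OF b]
        odd_cap_minus[of "x \<bullet> b / r", simplified] algebra_simps)
  have v_bd: "\<bar>v x\<bar> \<le> 2 * M + c * (A + 1)" for x
  proof -
    have "\<bar>A * S1 x + odd_wall b r x\<bar> \<le> A * 1 + 1"
      using odd_cap_bounds[of "x \<bullet> b / r"] odd_wall_abs[of b r x] A5
      by (intro order_trans[OF abs_triangle_ineq] add_mono) (auto simp: abs_mult S1_def)
    then have "\<bar>c * (A * S1 x + odd_wall b r x)\<bar> \<le> c * (A + 1)" using c2 by (simp add: abs_mult)
    then show ?thesis using I_bd[of x] unfolding v_def by linarith
  qed
  have region: "norm x < r / 2" if "\<bar>x \<bullet> b\<bar> \<le> r / 4" "norm (perp b x) \<le> r / 4" for x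
  proof -
    have "(x \<bullet> b)\<^sup>2 \<le> (r / 4)\<^sup>2" using that(1) r by (simp add: abs_le_square_iff[symmetric])
    moreover have "(norm (perp b x))\<^sup>2 \<le> (r / 4)\<^sup>2" using that(2) by (intro power_mono) auto
    ultimately have "(norm x)\<^sup>2 \<le> 2 * (r / 4)\<^sup>2" using perp_props(6)[OF b, of x] by linarith
    also have "\<dots> < (r / 2)\<^sup>2" using r by (simp add: power_divide)
    finally show ?thesis by (rule power_less_imp_less_base) (use r in auto)
  qed
  \<comment> \<open>A cylinder based on the hyperplane. F vanishes on the base, and the barrier is
    at least 2M on the top and on the side, so a positive maximum has to lie in the
    interior.\<close>
  let ?K = "{x. 0 \<le> x \<bullet> b \<and> x \<bullet> b \<le> r / 4 \<and> norm (perp b x) \<le> r / 4}"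
  have K_sub: "?K \<subseteq> cball 0 (r / 2)"
  proof
    fix x assume "x \<in> ?K"
    then have "norm x < r / 2" by (intro region) auto
    then show "x \<in> cball 0 (r / 2)" by simp
  qed
  have "closed ?K"
  proof -
    have "?K = {x. 0 \<le> x \<bullet> b} \<inter> {x. x \<bullet> b \<le> r / 4} \<inter> {x. norm (perp b x) \<le> r / 4}" by auto
    moreover have "closed {x. norm (perp b x) \<le> r / 4}"
      unfolding perp_def by (intro closed_Collect_le continuous_intros)
    moreover have "closed {x. 0 \<le> x \<bullet> b}" "closed {x. x \<bullet> b \<le> r / 4}"
      by (intro closed_Collect_le continuous_intros)+
    ultimately show ?thesis by (metis closed_Int)
  qed
  then have K: "compact ?K" using K_sub compact_eq_bounded_closed bounded_subset[OF bounded_cball] by blast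
  have K_ne: "?K \<noteq> {}"
  proof -
    have "(0::'a) \<in> ?K" using r by (simp add: perp_def)
    then show ?thesis by blast
  qed
  define w where "w x = F x - c * (A * S1 x + wall b r x)" for x
  have K_ball: "?K \<subseteq> ball 0 r"
  proof
    fix x assume "x \<in> ?K"
    then have "norm x \<le> r / 2" using K_sub by auto
    then show "x \<in> ball 0 r" using r by simp
  qed
  have cF: "continuous_on ?K F"
    unfolding F_def
  proof (intro continuous_on_diff)
    show "continuous_on ?K u" using continuous_on_subset[OF cont K_ball] .
    show "continuous_on ?K (\<lambda>x. u (?R x))"
    proof (rule continuous_on_compose2[OF cont])
      show "continuous_on ?K ?R" unfolding refl_dir_def by (intro continuous_intros)
      show "?R ` ?K \<subseteq> ball 0 r" using K_ball nR by (auto simp: dist_norm subset_iff)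
    qed
  qed
  have cS: "continuous_on ?K S1"
    unfolding S1_def
  proof (rule continuous_on_compose2[OF odd_cap_continuous])
    show "continuous_on ?K (\<lambda>x. x \<bullet> b / r)" using r by (intro continuous_intros) auto
    show "(\<lambda>x. x \<bullet> b / r) ` ?K \<subseteq> {0..1/2}" using r by (auto simp: field_simps)
  qed
  have cW: "continuous_on ?K (wall b r)"
    unfolding wall_def perp_def using r by (intro continuous_intros) auto
  have "continuous_on ?K w"
    unfolding w_def by (intro continuous_intros cF cS cW)
  then obtain x0 where x0: "x0 \<in> ?K" and sup: "\<And>x. x \<in> ?K \<Longrightarrow> w x \<le> w x0"
    using continuous_attains_sup[OF K K_ne] by blast
  have w0: "w x0 \<le> 0"
  proof (rule ccontr)
    assume "\<not> w x0 \<le> 0"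
    then have wpos: "0 < w x0" by simp
    have nx0: "norm x0 < r / 2" using region[of x0] x0 by auto
    have Fx0: "F x0 \<le> 2 * M" using F_bd[of x0] nx0 r by auto
    have S1nn: "0 \<le> S1 x" if "0 \<le> x \<bullet> b" for x using odd_cap_nonneg[of "x \<bullet> b / r"] that r by (simp add: S1_def)
    have big: "2 * M \<le> c * (A * S1 x + wall b r x)" if "r / 4 \<le> x \<bullet> b \<or> (0 \<le> x \<bullet> b \<and> r / 4 \<le> norm (perp b x))" for x
    proof -
      have "1 \<le> A * S1 x + wall b r x"
      proof (cases "r / 4 \<le> x \<bullet> b")
        case True
        then have "7 / 16 \<le> S1 x" unfolding S1_def using r by (intro odd_cap_ge) (simp add: field_simps)
        then have "5 * (7/16) \<le> A * S1 x" using A5 by (intro mult_mono) auto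
        then show ?thesis using wall_bounds[of b r x] by simp
      next
        case False
        then have "wall b r x = 1" "0 \<le> S1 x" using that wall_large[OF r(1)] S1nn by auto
        then show ?thesis using A5 by simp
      qed
      then have "c * 1 \<le> c * (A * S1 x + wall b r x)" using c2 by (intro mult_left_mono) auto
      then show ?thesis using c2 by linarith
    qed
    have x0b: "0 < x0 \<bullet> b"
    proof (rule ccontr)
      assume "\<not> 0 < x0 \<bullet> b"
      then have z: "x0 \<bullet> b = 0" using x0 by auto
      then have "?R x0 = x0" by (simp add: refl_dir_def)
      then have "F x0 = 0" by (simp add: F_def)
      moreover have "0 \<le> c * (A * S1 x0 + wall b r x0)" using S1nn[of x0] z wall_bounds[of b r x0] c2 A5 by simp
      ultimately show False using wpos by (simp add: w_def)
    qed
    have x0b': "x0 \<bullet> b < r / 4" and x0p: "norm (perp b x0) < r / 4"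
      using big[of x0] Fx0 wpos x0 x0b by (auto simp: w_def not_le[symmetric])
    let ?s = "x0 \<bullet> b"
    have vw: "v x = w x" if "norm x < r" "0 < x \<bullet> b" for x
      using that by (simp add: v_def w_def I_def odd_wall_def)
    have vx0: "v x0 = w x0" using vw nx0 x0b r by simp
    \<comment> \<open>The maximum over the cylinder is one over the half space: in the rest of the
      ball the barrier is at least 2M, and off the ball v is minus a nonnegative barrier.\<close>
    have vmax: "v y \<le> v x0" if "0 < y \<bullet> b" for y
    proof (cases "norm y < r")
      case True
      show ?thesis
      proof (cases "y \<in> ?K")
        case True then show ?thesis using sup vw vx0 that \<open>norm y < r\<close> by auto
      next
        case False
        then have "2 * M \<le> c * (A * S1 y + wall b r y)" using that by (intro big) auto
        then have "w y \<le> 0" using F_bd[OF True] by (simp add: w_def)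
        then show ?thesis using vw[OF True that] vx0 wpos by simp
      qed
    next
      case False
      then have "v y = - (c * (A * S1 y + wall b r y))" using that by (simp add: v_def I_def odd_wall_def)
      moreover have "0 \<le> c * (A * S1 y + wall b r y)" using S1nn[of y] that wall_bounds[of b r y] c2 A5 by simp
      ultimately show ?thesis using vx0 wpos by simp
    qed
    have xr: "x0 \<in> ball 0 (r/2)" "?R x0 \<in> ball 0 (r/2)" using nx0 nR by auto
    define h where "h z = sdiff u (?R x0) z * N z" for z
    have ih: "integrable lborel h" unfolding h_def using int[OF xr(2)] by simp
    have mh: "h \<in> borel_measurable borel" using borel_measurable_integrable[OF ih] by simp
    have dr: "distr lborel borel ?R = lborel" using distr_lborel_refl_dir[OF b, of 0] by simp
    have sF: "sdiff F x0 z * N z = sdiff u x0 z * N z - h (?R z)" for z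
      by (simp add: sdiff_def F_def h_def refl_dir_simps[OF b] N_refl_dir[OF b] algebra_simps)
    have ihR: "integrable lborel (\<lambda>z. h (?R z))" using lborel_invariant(2)[OF refl_dir_measurable dr mh] ih by simp
    have iF: "integrable lborel (\<lambda>z. sdiff F x0 z * N z)"
      unfolding sF using int[OF xr(1)] ihR by simp
    have LF: "L F x0 = 0"
    proof -
      have "L F x0 = L u x0 - (LBINT z. h (?R z))"
        unfolding L_def sF using int[OF xr(1)] ihR by simp
      also have "(LBINT z. h (?R z)) = L u (?R x0)"
        using lborel_invariant(1)[OF refl_dir_measurable dr mh] by (simp add: L_def h_def)
      finally show ?thesis using harm[OF xr(1)] harm[OF xr(2)] by simp
    qed
    define ou where "ou y = indicator {y. r \<le> norm y} y * u y" for y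
    have mo[measurable]: "ou \<in> borel_measurable borel" unfolding ou_def by measurable
    have Oo: "O1 y = ou y - ou (?R y)" for y by (auto simp: O1_def F_def ou_def nR indicator_def)
    have nx0': "norm x0 \<le> r / 2" using nx0 by simp
    have o_far: "\<bar>ou y\<bar> * N (y - x0) \<le> a * \<bar>ou y * N y\<bar>" "\<bar>ou y\<bar> * N (?R y - x0) \<le> a * \<bar>ou y * N y\<bar>"
      "\<bar>ou y * (N (y - x0) - N (?R y - x0))\<bar> \<le> 24 * a\<^sup>2 * (?s / r) * \<bar>ou y * N y\<bar>" for y
    proof -
      have "\<bar>ou y\<bar> * N (y - x0) \<le> a * \<bar>ou y * N y\<bar> \<and> \<bar>ou y\<bar> * N (?R y - x0) \<le> a * \<bar>ou y * N y\<bar> \<and>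
        \<bar>ou y * (N (y - x0) - N (?R y - x0))\<bar> \<le> 24 * a\<^sup>2 * (?s / r) * \<bar>ou y * N y\<bar>"
      proof (cases "r \<le> norm y")
        case True
        note q1 = N_far_comp(3)[OF r True nx0'] and q2 = N_far_comp(3)[OF r _ nx0', of "?R y", unfolded nR N_refl_dir[OF b], OF True]
          and q3 = N_far_diff[OF b r True nx0' x0b]
        show ?thesis using mult_left_mono[OF q1, of "\<bar>ou y\<bar>"] mult_left_mono[OF q2, of "\<bar>ou y\<bar>"] mult_left_mono[OF q3, of "\<bar>ou y\<bar>"] N_nonneg[of y]
          by (simp add: abs_mult mult.left_commute mult.assoc)
      qed (simp add: ou_def)
      then show "\<bar>ou y\<bar> * N (y - x0) \<le> a * \<bar>ou y * N y\<bar>" "\<bar>ou y\<bar> * N (?R y - x0) \<le> a * \<bar>ou y * N y\<bar>"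
        "\<bar>ou y * (N (y - x0) - N (?R y - x0))\<bar> \<le> 24 * a\<^sup>2 * (?s / r) * \<bar>ou y * N y\<bar>" by auto
    qed
    have io: "integrable lborel (\<lambda>y. \<bar>ou y * N y\<bar>)" using tail_int by (simp add: ou_def)
    have io1: "integrable lborel (\<lambda>y. ou y * N (y - x0))"
      by (rule Bochner_Integration.integrable_bound[OF integrable_mult_right[OF io, of a]])
        (use o_far(1) N_nonneg a_ge_1 in \<open>auto simp: abs_mult\<close>)
    have io2: "integrable lborel (\<lambda>y. ou y * N (?R y - x0))"
      by (rule Bochner_Integration.integrable_bound[OF integrable_mult_right[OF io, of a]])
        (use o_far(2) N_nonneg a_ge_1 in \<open>auto simp: abs_mult\<close>)
    define k where "k y = ou y * N (?R y - x0)" for y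
    have mk: "k \<in> borel_measurable borel" unfolding k_def by measurable
    have kR: "k (?R y) = ou (?R y) * N (y - x0)" for y by (simp add: k_def refl_dir_simps[OF b])
    have ikR: "integrable lborel (\<lambda>y. ou (?R y) * N (y - x0))"
      using lborel_invariant(2)[OF refl_dir_measurable dr mk] io2 unfolding kR by (simp add: k_def[abs_def])
    define Q where "Q y = O1 y * N (y - x0)" for y
    have Qe: "Q y = ou y * N (y - x0) - ou (?R y) * N (y - x0)" for y by (simp add: Q_def Oo algebra_simps)
    have iQ: "integrable lborel Q" unfolding Qe using io1 ikR by simp
    have mQ: "Q \<in> borel_measurable borel" using borel_measurable_integrable[OF iQ] by simp
    \<comment> \<open>Reflecting the second half of the integral moves the antisymmetry from the
      function to the kernel, and \<open>N_far_diff\<close> then yields the factor ?s / r.\<close>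
    have "(LBINT y. Q y) = (LBINT y. ou y * (N (y - x0) - N (?R y - x0)))"
      unfolding Qe using io1 io2 ikR lborel_invariant(1)[OF refl_dir_measurable dr mk]
      by (simp add: kR) (simp add: k_def algebra_simps)
    also have "\<bar>\<dots>\<bar> \<le> (LBINT y. 24 * a\<^sup>2 * (?s / r) * \<bar>ou y * N y\<bar>)"
      by (rule integral_abs_bound_integral)
        (use io io1 io2 o_far(3) in \<open>auto simp: right_diff_distrib\<close>)
    also have "\<dots> = 24 * a\<^sup>2 * (?s / r) * (LBINT y. \<bar>ou y * N y\<bar>)"
      by (rule integral_mult_right_zero)
    also have "\<dots> \<le> 24 * a\<^sup>2 * (?s / r) * (M * H r)"
      using tail x0b r unfolding ou_def by (intro mult_left_mono) auto
    finally have Qb: "\<bar>\<integral>y. Q y \<partial>lborel\<bar> \<le> 24 * a\<^sup>2 * (?s / r) * (M * H r)" .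
    have O0: "O1 x0 = 0" using nx0 r by (simp add: O1_def)
    have sO: "sdiff O1 x0 z * N z = Q (z + x0) + Q (x0 - z)" for z
      by (simp add: sdiff_def O0 Q_def algebra_simps)
    have iQ1: "integrable lborel (\<lambda>z. Q (z + x0))" using lborel_invariant(2)[OF _ distr_lborel_plus mQ] iQ by simp
    have iQ2: "integrable lborel (\<lambda>z. Q (x0 - z))" using lborel_invariant(2)[OF _ distr_lborel_diff mQ] iQ by simp
    have iO: "integrable lborel (\<lambda>z. sdiff O1 x0 z * N z)" unfolding sO using iQ1 iQ2 by simp
    have LO: "L O1 x0 = 2 * (LBINT y. Q y)"
      unfolding L_def sO using iQ1 iQ2 lborel_invariant(1)[OF _ distr_lborel_plus mQ, of x0] lborel_invariant(1)[OF _ distr_lborel_diff mQ, of x0] by simp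
    have sI: "sdiff I x0 z * N z = sdiff F x0 z * N z - sdiff O1 x0 z * N z" for z
      by (simp add: sdiff_def IO algebra_simps)
    have iI: "integrable lborel (\<lambda>z. sdiff I x0 z * N z)" unfolding sI using iF iO by simp
    \<comment> \<open>F solves the equation, so the truncation costs exactly the far contribution:
      \<open>L I\<close> is minus \<open>L O1\<close>.\<close>
    have LI: "L I x0 = - 2 * (LBINT y. Q y)"
      using iF iO LF LO unfolding L_def sI by simp
    have "?s \<le> r / 2" using x0b' r by simp
    note S1p = L_odd_cap[OF b r(1) x0b this, folded S1_def]
    have "?s \<le> r" using x0b' r by simp
    note SWp = L_odd_wall[OF b r x0b this x0p]
    have sv: "sdiff v x0 z * N z = sdiff I x0 z * N z - (c * (A * (sdiff S1 x0 z * N z)) + c * (sdiff (odd_wall b r) x0 z * N z))" for z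
      by (simp add: sdiff_def v_def algebra_simps)
    have S1p1: "integrable lborel (\<lambda>z. sdiff S1 x0 z * N z)" and S1p2: "L S1 x0 \<le> - jump_int r ?s / (real DIM('a))\<^sup>2"
      using S1p unfolding S1_def[abs_def] by auto
    have iv: "integrable lborel (\<lambda>z. sdiff v x0 z * N z)" unfolding sv using iI S1p1 SWp(1) by simp
    have "L v x0 = L I x0 - (c * (A * L S1 x0) + c * L (odd_wall b r) x0)"
      unfolding L_def sv using iI S1p1 SWp(1) by simp
    also have "\<dots> \<ge> - (48 * a\<^sup>2 * (?s / r) * (M * H r)) + c * jump_int r ?s"
    proof -
      let ?J = "jump_int r ?s"
      have "A * L S1 x0 \<le> A * (- ?J / (real DIM('a))\<^sup>2)" using S1p2 A5 by (intro mult_left_mono) auto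
      also have "\<dots> = - ((384 * a + 1) * ?J)" using d1 by (simp add: A_def)
      finally have "A * L S1 x0 + L (odd_wall b r) x0 \<le> - ?J" using SWp(2) by (simp add: algebra_simps)
      then have "c * (A * L S1 x0 + L (odd_wall b r) x0) \<le> c * (- ?J)" using c2 by (intro mult_left_mono) auto
      moreover have "- (48 * a\<^sup>2 * (?s / r) * (M * H r)) \<le> L I x0" using Qb unfolding LI by linarith
      ultimately show ?thesis by (simp add: algebra_simps)
    qed
    finally have low: "- (48 * a\<^sup>2 * (?s / r) * (M * H r)) + c * jump_int r ?s \<le> L v x0" .
    have "L v x0 \<le> 0"
      by (rule antisym_maximum_principle[OF b mv v_bd v_anti x0b _ iv vmax]) (use vx0 wpos in auto)
    with low have "c * jump_int r ?s \<le> 48 * a\<^sup>2 * (?s / r) * (M * H r)" by linarith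
    moreover have "c * ((?s / r) * H r) \<le> c * jump_int r ?s"
      using jump_int_ge[OF x0b \<open>?s \<le> r\<close>] c2 by (intro mult_left_mono) auto
    ultimately have "c * ((?s / r) * H r) \<le> 48 * a\<^sup>2 * (?s / r) * (M * H r)" by linarith
    then have "(48 * a\<^sup>2 + 2) * (M * ((?s / r) * H r)) \<le> 48 * a\<^sup>2 * (M * ((?s / r) * H r))"
      by (simp add: c_def ac_simps)
    moreover have "0 < M * ((?s / r) * H r)" using M x0b r H_pos[OF r(1)] by simp
    moreover have "False" if "(48 * a\<^sup>2 + 2) * q \<le> 48 * a\<^sup>2 * q" "0 < q" for q
      using that by (simp add: distrib_right)
    ultimately show False by blast
  qed
  have pb: "perp b (s *\<^sub>R b) = 0" by (simp add: perp_def bb)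
  have "s *\<^sub>R b \<in> ?K" using s r by (simp add: bb pb)
  then have "w (s *\<^sub>R b) \<le> 0" using sup w0 by fastforce
  then have "F (s *\<^sub>R b) \<le> c * (A * odd_cap (s / r))" by (simp add: w_def S1_def bb wall_def pb)
  also have "\<dots> \<le> c * (A * (2 * (s / r)))"
    using odd_cap_le[of "s / r"] s r c2 A5 by (intro mult_left_mono) auto
  also have "\<dots> = grad_const * M * s / r" by (simp add: grad_const_def c_def A_def)
  finally show ?thesis by (simp add: F_def refl_dir_simps(7)[OF b])
qed

lemma refl_difference_bound:
  assumes b: "b \<in> Basis" and r: "0 < r" "r \<le> 1" and M: "0 < M"
    and u: "u \<in> borel_measurable borel" and cont: "continuous_on (ball 0 r) u"
    and bd: "\<And>x. x \<in> ball 0 r \<Longrightarrow> \<bar>u x\<bar> \<le> M"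
    and int: "\<And>x. x \<in> ball 0 (r/2) \<Longrightarrow> integrable lborel (\<lambda>z. sdiff u x z * N z)"
    and harm: "\<And>x. x \<in> ball 0 (r/2) \<Longrightarrow> L u x = 0"
    and tail_int: "integrable lborel (\<lambda>y. indicator {y. r \<le> norm y} y * u y * N y)"
    and tail: "(LBINT y. \<bar>indicator {y. r \<le> norm y} y * u y * N y\<bar>) \<le> M * H r"
    and s: "0 < s" "s < r / 4"
  shows "\<bar>u (s *\<^sub>R b) - u (- (s *\<^sub>R b))\<bar> \<le> grad_const * M * s / r"
proof -
  have sn: "sdiff (\<lambda>x. - u x) x z = - sdiff u x z" for x z by (simp add: sdiff_def)
  have "(\<lambda>x. - u x) (s *\<^sub>R b) - (\<lambda>x. - u x) (- (s *\<^sub>R b)) \<le> grad_const * M * s / r"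
    by (rule refl_difference_upper[OF b r M _ _ _ _ _ _ _ s])
      (use u cont bd int harm tail_int tail in \<open>auto simp: L_def sn intro!: continuous_on_minus\<close>)
  moreover have "u (s *\<^sub>R b) - u (- (s *\<^sub>R b)) \<le> grad_const * M * s / r"
    by (rule refl_difference_upper[OF b r M u cont bd int harm tail_int tail s])
  ultimately show ?thesis by simp
qed

end

section \<open>Gaussian functions and the generator\<close>

lemma fubini_dominated:
  fixes f :: "'b \<Rightarrow> 'c \<Rightarrow> real"
  assumes M1: "sigma_finite_measure M1" and M2: "sigma_finite_measure M2"
    and f[measurable]: "(\<lambda>(x, y). f x y) \<in> borel_measurable (M1 \<Otimes>\<^sub>M M2)"
    and p: "integrable M1 p" and q: "integrable M2 q"
    and bd: "\<And>x y. \<bar>f x y\<bar> \<le> p x * q y"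
  shows "(\<integral>x. (\<integral>y. f x y \<partial>M2) \<partial>M1) = (\<integral>y. (\<integral>x. f x y \<partial>M1) \<partial>M2)"
    and "integrable M1 (\<lambda>x. \<integral>y. f x y \<partial>M2)"
    and "integrable M2 (\<lambda>y. \<integral>x. f x y \<partial>M1)"
proof -
  interpret M1: sigma_finite_measure M1 by (rule M1)
  interpret M2: sigma_finite_measure M2 by (rule M2)
  interpret P: pair_sigma_finite M1 M2 ..
  have i: "integrable (M1 \<Otimes>\<^sub>M M2) (\<lambda>(x, y). f x y)"
  proof (rule P.Fubini_integrable[OF f])
    have ic: "integrable M2 (\<lambda>y. f x y)" if "x \<in> space M1" for x
      by (rule Bochner_Integration.integrable_bound[OF integrable_mult_right[OF q, of "p x"]])
        (use that bd abs_ge_self[THEN order_trans[OF bd]] in auto)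
    then show "AE x in M1. integrable M2 (\<lambda>y. (case (x, y) of (x, y) \<Rightarrow> f x y))" by auto
    show "integrable M1 (\<lambda>x. \<integral>y. norm (case (x, y) of (x, y) \<Rightarrow> f x y) \<partial>M2)"
    proof (rule Bochner_Integration.integrable_bound[OF integrable_mult_left[OF p, of "\<integral>y. q y \<partial>M2"]])
      show "AE x in M1. norm (\<integral>y. norm (case (x, y) of (x, y) \<Rightarrow> f x y) \<partial>M2) \<le> norm (p x * (\<integral>y. q y \<partial>M2))"
      proof (intro AE_I2)
        fix x assume x: "x \<in> space M1"
        have "(\<integral>y. \<bar>f x y\<bar> \<partial>M2) \<le> (\<integral>y. p x * q y \<partial>M2)"
          using ic[OF x] q bd by (intro integral_mono) auto
        also have "\<dots> = p x * (\<integral>y. q y \<partial>M2)" by simp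
        finally show "norm (\<integral>y. norm (case (x, y) of (x, y) \<Rightarrow> f x y) \<partial>M2) \<le> norm (p x * (\<integral>y. q y \<partial>M2))"
          by simp
      qed
    qed measurable
  qed
  show "(\<integral>x. (\<integral>y. f x y \<partial>M2) \<partial>M1) = (\<integral>y. (\<integral>x. f x y \<partial>M1) \<partial>M2)"
    using P.Fubini_integral[OF i] by simp
  show "integrable M1 (\<lambda>x. \<integral>y. f x y \<partial>M2)" using P.integrable_fst'[OF i] by simp
  show "integrable M2 (\<lambda>y. \<integral>x. f x y \<partial>M1)" using P.integrable_snd[OF i] by simp
qed

lemma lborel_product_integral:
  fixes f :: "'a::euclidean_space \<Rightarrow> real \<Rightarrow> 'b::{real_normed_field, banach, second_countable_topology}"
  assumes i: "\<And>b. b \<in> Basis \<Longrightarrow> integrable lborel (f b)"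
  shows "integrable lborel (\<lambda>x. \<Prod>b\<in>Basis. f b (x \<bullet> b))"
    and "(LBINT x. (\<Prod>b\<in>Basis. f b (x \<bullet> b))) = (\<Prod>b\<in>Basis. (LBINT t. f b t))"
proof -
  interpret product_sigma_finite "\<lambda>b::'a. lborel :: real measure" ..
  let ?T = "\<lambda>g. \<Sum>b\<in>Basis. g b *\<^sub>R (b::'a)"
  have mf: "(\<lambda>x::'a. \<Prod>b\<in>Basis. f b (x \<bullet> b)) \<in> borel_measurable borel"
  proof (intro borel_measurable_prod)
    fix b :: 'a assume "b \<in> Basis"
    then have "f b \<in> borel_measurable borel" using borel_measurable_integrable[OF i] by simp
    then show "(\<lambda>x. f b (x \<bullet> b)) \<in> borel_measurable borel" by measurable
  qed
  have mT: "?T \<in> measurable (\<Pi>\<^sub>M b\<in>Basis. lborel) borel" by measurable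
  have T: "?T g \<bullet> b = g b" if "b \<in> Basis" for g b using that by simp
  have e: "(\<lambda>g. \<Prod>b\<in>Basis. f b (?T g \<bullet> b)) = (\<lambda>g. \<Prod>b\<in>Basis. f b (g b))"
    by (intro ext prod.cong) (auto simp: T)
  show "integrable lborel (\<lambda>x. \<Prod>b\<in>Basis. f b (x \<bullet> b))"
    unfolding lborel_eq[where 'a='a] integrable_distr_eq[OF mT mf] e
    by (rule product_integrable_prod) (use i in auto)
  show "(LBINT x. (\<Prod>b\<in>Basis. f b (x \<bullet> b))) = (\<Prod>b\<in>Basis. (LBINT t. f b t))"
    unfolding lborel_eq[where 'a='a] integral_distr[OF mT mf] e
    by (rule product_integral_prod) (use i in auto)
qed

definition gauss :: "'a::euclidean_space \<Rightarrow> real" where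
  "gauss x = (\<Prod>b\<in>Basis. std_normal_density (x \<bullet> b))"

lemma gauss_measurable[measurable]: "gauss \<in> borel_measurable borel"
  unfolding gauss_def by measurable

lemma gauss_nonneg: "0 \<le> gauss x"
  unfolding gauss_def by (intro prod_nonneg) (auto simp: normal_density_nonneg)

lemma gauss_integrable: "integrable lborel (gauss :: 'a::euclidean_space \<Rightarrow> real)"
  unfolding gauss_def by (rule lborel_product_integral) auto

lemma gauss_moment: "integrable lborel (\<lambda>x::'a::euclidean_space. (norm x)\<^sup>2 * gauss x)"
proof -
  have i2: "integrable lborel (\<lambda>t::real. t\<^sup>2 * std_normal_density t)"
    using integrable_std_normal_moment[of 2] by (simp add: mult.commute)
  have "integrable lborel (\<lambda>x::'a. (x \<bullet> c)\<^sup>2 * gauss x)" if c: "c \<in> Basis" for c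
  proof -
    let ?f = "\<lambda>b t. (if b = c then t\<^sup>2 else 1) * std_normal_density t"
    have "integrable lborel (\<lambda>x::'a. \<Prod>b\<in>Basis. ?f b (x \<bullet> b))"
    proof (rule lborel_product_integral(1))
      show "integrable lborel (?f b)" for b by (cases "b = c") (use i2 in auto)
    qed
    moreover have "(\<Prod>b\<in>Basis. ?f b (x \<bullet> b)) = (x \<bullet> c)\<^sup>2 * gauss x" for x :: 'a
    proof -
      have "(\<Prod>b\<in>Basis. if b = c then (x \<bullet> b)\<^sup>2 else 1) = (x \<bullet> c)\<^sup>2"
        by (subst prod.delta) (use c in auto)
      then show ?thesis unfolding prod.distrib gauss_def by simp
    qed
    ultimately show ?thesis by simp
  qed
  then have "integrable lborel (\<lambda>x::'a. \<Sum>c\<in>Basis. (x \<bullet> c)\<^sup>2 * gauss x)" by (intro Bochner_Integration.integrable_sum)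
  moreover have "(\<Sum>c\<in>Basis. (x \<bullet> c)\<^sup>2 * gauss x) = (norm x)\<^sup>2 * gauss x" for x :: 'a
    unfolding power2_norm_eq_inner by (subst euclidean_inner) (simp add: sum_distrib_right power2_eq_square)
  ultimately show ?thesis by simp
qed

lemma gauss_quad: "integrable lborel (\<lambda>\<xi>::'a::euclidean_space. (c + d * (norm \<xi>)\<^sup>2) * gauss \<xi>)"
proof -
  have "integrable lborel (\<lambda>\<xi>::'a. c * gauss \<xi> + d * ((norm \<xi>)\<^sup>2 * gauss \<xi>))"
    by (intro Bochner_Integration.integrable_add integrable_mult_right gauss_integrable gauss_moment)
  then show ?thesis by (simp add: algebra_simps)
qed

text \<open>The integral factorises over the coordinates into characteristic functions of the
  standard normal law; the real part is taken only at the end.\<close>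

lemma gauss_char:
  fixes x :: "'a::euclidean_space"
  shows "(LBINT \<xi>. cos (\<xi> \<bullet> x) * gauss \<xi>) = exp (- (norm x)\<^sup>2 / 2)"
proof -
  let ?f = "\<lambda>b t. cis (t * (x \<bullet> b)) * complex_of_real (std_normal_density t)"
  have if1: "integrable lborel (?f b)" for b
  proof (rule Bochner_Integration.integrable_bound[of _ "\<lambda>t. std_normal_density t"])
    have "(\<lambda>t. cis (t * (x \<bullet> b))) \<in> borel_measurable borel"
      unfolding cis_conv_exp by (intro borel_measurable_continuous_onI continuous_intros)
    then show "?f b \<in> borel_measurable lborel" by measurable
  qed (auto simp: norm_mult)
  have I1: "(LBINT t. ?f b t) = complex_of_real (exp (- (x \<bullet> b)\<^sup>2 / 2))" for b
  proof -
    have "char std_normal_distribution (x \<bullet> b) = (LBINT t. std_normal_density t *\<^sub>R iexp ((x \<bullet> b) * t))"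
      unfolding char_def by (subst integral_density) (auto simp: normal_density_nonneg)
    also have "\<dots> = (LBINT t. ?f b t)"
      by (intro Bochner_Integration.integral_cong) (auto simp: scaleR_conv_of_real cis_conv_exp ac_simps)
    finally show ?thesis by (simp add: char_std_normal_distribution)
  qed
  have e: "(\<Prod>b\<in>Basis. ?f b (\<xi> \<bullet> b)) = cis (\<xi> \<bullet> x) * complex_of_real (gauss \<xi>)" for \<xi> :: 'a
  proof -
    have "(\<Prod>b\<in>Basis. cis ((\<xi> \<bullet> b) * (x \<bullet> b))) = cis (\<Sum>b\<in>Basis. (\<xi> \<bullet> b) * (x \<bullet> b))"
      unfolding cis_conv_exp by (simp add: exp_sum sum_distrib_left)
    also have "(\<Sum>b\<in>Basis. (\<xi> \<bullet> b) * (x \<bullet> b)) = \<xi> \<bullet> x" by (rule euclidean_inner[symmetric])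
    finally show ?thesis by (simp add: prod.distrib gauss_def)
  qed
  have i: "integrable lborel (\<lambda>\<xi>::'a. cis (\<xi> \<bullet> x) * complex_of_real (gauss \<xi>))"
    using lborel_product_integral(1)[of ?f, OF if1] unfolding e .
  have "(LBINT \<xi>. cis (\<xi> \<bullet> x) * complex_of_real (gauss \<xi>)) = (\<Prod>b\<in>Basis. complex_of_real (exp (- (x \<bullet> b)\<^sup>2 / 2)))"
    using lborel_product_integral(2)[of ?f, OF if1] unfolding e I1 .
  also have "\<dots> = complex_of_real (exp (\<Sum>b\<in>Basis. - (x \<bullet> b)\<^sup>2 / 2))"
    by (simp add: exp_sum)
  also have "(\<Sum>b\<in>Basis. - (x \<bullet> b)\<^sup>2 / 2) = - (norm x)\<^sup>2 / 2"
    unfolding power2_norm_eq_inner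
    by (subst euclidean_inner) (simp add: sum_negf sum_divide_distrib power2_eq_square)
  finally have c: "(LBINT \<xi>. cis (\<xi> \<bullet> x) * complex_of_real (gauss \<xi>)) = complex_of_real (exp (- (norm x)\<^sup>2 / 2))" .
  have "Re (LBINT \<xi>. cis (\<xi> \<bullet> x) * complex_of_real (gauss \<xi>)) = (LBINT \<xi>. Re (cis (\<xi> \<bullet> x) * complex_of_real (gauss \<xi>)))"
    by (rule integral_Re[OF i, symmetric])
  then show ?thesis using c by simp
qed

lemma gauss_eq: "gauss (x::'a::euclidean_space) = (1 / sqrt (2 * pi)) ^ DIM('a) * exp (- (norm x)\<^sup>2 / 2)"
proof -
  have "gauss x = (\<Prod>b\<in>Basis. (1 / sqrt (2 * pi)) * exp (- (x \<bullet> b)\<^sup>2 / 2))"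
    unfolding gauss_def by (simp add: std_normal_density_def)
  also have "\<dots> = (1 / sqrt (2 * pi)) ^ DIM('a) * exp (\<Sum>b\<in>Basis. - (x \<bullet> b)\<^sup>2 / 2)"
    unfolding prod.distrib by (simp only: exp_sum finite_Basis prod_constant)
  also have "(\<Sum>b\<in>Basis. - (x \<bullet> b)\<^sup>2 / 2) = - (norm x)\<^sup>2 / 2"
    unfolding power2_norm_eq_inner
    by (subst euclidean_inner) (simp add: sum_negf sum_divide_distrib power2_eq_square)
  finally show ?thesis .
qed

lemma gauss_integral: "(LBINT x. gauss (x::'a::euclidean_space)) = 1"
  using gauss_char[of "0::'a"] by simp

text \<open>A Gaussian of width 1/k with value 1 at 0 instead of mass 1. In this normalisation
  \<open>gs_char\<close> exhibits it as the average of cosines of frequency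
  \<open>k *\<^sub>R \<xi>\<close> under the probability density \<open>gauss\<close>.\<close>

definition gs :: "real \<Rightarrow> 'a::euclidean_space \<Rightarrow> real" where
  "gs k x = exp (- (norm (k *\<^sub>R x))\<^sup>2 / 2)"

lemma gs_char: "gs k x = (LBINT \<xi>. cos (k * (\<xi> \<bullet> x)) * gauss \<xi>)"
  unfolding gs_def gauss_char[symmetric] by simp

lemma gs_bounds: "0 < gs k x" "gs k x \<le> 1"
  by (auto simp: gs_def)

lemma gs_continuous: "continuous_on UNIV (gs k)"
  unfolding gs_def by (intro continuous_intros) auto

lemma gs_measurable[measurable]: "gs k \<in> borel_measurable borel"
  using gs_continuous by (rule borel_measurable_continuous_onI)

lemma gs_minus[simp]: "gs k (- x) = gs k x"
  by (simp add: gs_def)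

lemma gs_gauss: "gs k x = (sqrt (2 * pi)) ^ DIM('a) * gauss (k *\<^sub>R (x::'a::euclidean_space))"
  by (simp add: gs_def gauss_eq power_divide)

lemma lborel_scale_integral:
  fixes f :: "'a::euclidean_space \<Rightarrow> real"
  assumes k: "0 < k" and f[measurable]: "f \<in> borel_measurable borel"
  shows "(LBINT x. f (k *\<^sub>R x)) = (LBINT x. f x) / k ^ DIM('a)"
    and "integrable lborel (\<lambda>x. f (k *\<^sub>R x)) \<longleftrightarrow> integrable lborel f"
proof -
  have l: "lborel = density (distr lborel borel (\<lambda>x::'a. k *\<^sub>R x)) (\<lambda>_. ennreal (k ^ DIM('a)))"
    using lborel_affine[of k "0::'a"] k by simp
  have m: "(\<lambda>x::'a. k *\<^sub>R x) \<in> measurable lborel borel" by measurable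
  have fd: "f \<in> borel_measurable (distr lborel borel (\<lambda>x::'a. k *\<^sub>R x))" by simp
  have "(LBINT x. f x) = (\<integral>x. k ^ DIM('a) *\<^sub>R f x \<partial>distr lborel borel (\<lambda>x::'a. k *\<^sub>R x))"
    by (subst l, subst integral_density[OF fd]) (use k in auto)
  also have "\<dots> = k ^ DIM('a) * (LBINT x. f (k *\<^sub>R x))"
    by (subst integral_distr[OF m]) auto
  finally show "(LBINT x. f (k *\<^sub>R x)) = (LBINT x. f x) / k ^ DIM('a)" using k by simp
  have "integrable lborel f \<longleftrightarrow> integrable (distr lborel borel (\<lambda>x::'a. k *\<^sub>R x)) (\<lambda>x. k ^ DIM('a) *\<^sub>R f x)"
    by (subst l, subst integrable_density[OF fd]) (use k in auto)
  also have "\<dots> \<longleftrightarrow> integrable lborel (\<lambda>x. k ^ DIM('a) *\<^sub>R f (k *\<^sub>R x))"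
    by (rule integrable_distr_eq[OF m]) auto
  finally show "integrable lborel (\<lambda>x. f (k *\<^sub>R x)) \<longleftrightarrow> integrable lborel f" using k by simp
qed

lemma gs_integrable: "0 < k \<Longrightarrow> integrable lborel (gs k :: 'a::euclidean_space \<Rightarrow> real)"
  unfolding gs_gauss[abs_def] using lborel_scale_integral(2)[of k "gauss :: 'a \<Rightarrow> real"] gauss_integrable by simp

lemma gs_integral_pos: assumes "0 < k" shows "0 < (LBINT x. gs k (x::'a::euclidean_space))"
  unfolding gs_gauss using lborel_scale_integral(1)[OF assms gauss_measurable[where 'a = 'a]] gauss_integral[where 'a = 'a] assms by simp

section \<open>The characteristic exponent and the nonlocal operator on Gaussians\<close>

context levy_kernel begin

text \<open>The characteristic exponent of the process; it is real because the kernel is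
  symmetric.\<close>

definition Psi :: "'a \<Rightarrow> real" where
  "Psi \<xi> = (LBINT y. (1 - cos (\<xi> \<bullet> y)) * N y)"

lemma one_minus_cos_bound: "\<bar>1 - cos (\<xi> \<bullet> y)\<bar> \<le> (2 + (norm \<xi>)\<^sup>2 / 2) * min 1 ((norm (y::'a))\<^sup>2)"
proof -
  have 1: "\<bar>1 - cos (\<xi> \<bullet> y)\<bar> \<le> 2" using cos_ge_minus_one[of "\<xi> \<bullet> y"] cos_le_one[of "\<xi> \<bullet> y"] by simp
  have "1 - cos (\<xi> \<bullet> y) \<le> (\<xi> \<bullet> y)\<^sup>2 / 2" using cos_double_sin[of "(\<xi> \<bullet> y) / 2"] abs_sin_x_le_abs_x[of "(\<xi> \<bullet> y) / 2"]
      abs_le_square_iff[of "sin ((\<xi> \<bullet> y) / 2)" "(\<xi> \<bullet> y) / 2"] by (simp add: power_divide)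
  also have "(\<xi> \<bullet> y)\<^sup>2 \<le> (norm \<xi> * norm y)\<^sup>2"
    using Cauchy_Schwarz_ineq2[of \<xi> y] by (intro abs_le_square_iff[THEN iffD1]) auto
  finally have 2: "\<bar>1 - cos (\<xi> \<bullet> y)\<bar> \<le> (norm \<xi>)\<^sup>2 / 2 * (norm y)\<^sup>2"
    using cos_le_one[of "\<xi> \<bullet> y"] by (simp add: power_mult_distrib)
  show ?thesis
  proof (cases "(norm y)\<^sup>2 \<le> 1")
    case True
    then have "min 1 ((norm y)\<^sup>2) = (norm y)\<^sup>2" by simp
    moreover have "0 \<le> 2 * (norm y)\<^sup>2" by simp
    ultimately show ?thesis using 2 by (simp only: distrib_right)
  next
    case False
    then have m: "min 1 ((norm y)\<^sup>2) = 1" by simp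
    have "0 \<le> (norm \<xi>)\<^sup>2 / 2" by simp
    then show ?thesis unfolding m mult_1_right using 1 by linarith
  qed
qed

lemma Psi_integrable: "integrable lborel (\<lambda>y. (1 - cos (\<xi> \<bullet> y)) * N y)"
  by (rule integrable_N_bound[OF _ one_minus_cos_bound]) measurable

lemma Psi_nonneg: "0 \<le> Psi \<xi>"
  unfolding Psi_def by (intro integral_nonneg_AE AE_I2) (simp add: N_nonneg)

lemma Psi_bound: "Psi \<xi> \<le> (2 + (norm \<xi>)\<^sup>2 / 2) * (LBINT y. min 1 ((norm y)\<^sup>2) * N y)"
proof -
  have "Psi \<xi> \<le> (LBINT y. (2 + (norm \<xi>)\<^sup>2 / 2) * (min 1 ((norm y)\<^sup>2) * N y))"
    unfolding Psi_def
  proof (rule integral_mono[OF Psi_integrable])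
    show "integrable lborel (\<lambda>y. (2 + (norm \<xi>)\<^sup>2 / 2) * (min 1 ((norm y)\<^sup>2) * N y))" using N_integrable by simp
    show "(1 - cos (\<xi> \<bullet> y)) * N y \<le> (2 + (norm \<xi>)\<^sup>2 / 2) * (min 1 ((norm y)\<^sup>2) * N y)" for y
      using mult_right_mono[OF order_trans[OF abs_ge_self one_minus_cos_bound[of \<xi> y]] N_nonneg[of y]] by (simp add: mult.assoc)
  qed
  then show ?thesis by simp
qed

lemma Psi_measurable[measurable]: "Psi \<in> borel_measurable borel"
proof -
  have "(\<lambda>(\<xi>::'a, y). (1 - cos (\<xi> \<bullet> y)) * N y) \<in> borel_measurable (borel \<Otimes>\<^sub>M lborel)" by measurable
  then have "(\<lambda>\<xi>. \<integral>y. (1 - cos (\<xi> \<bullet> y)) * N y \<partial>lborel) \<in> borel_measurable borel"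
    by (rule lborel.borel_measurable_lebesgue_integral)
  then show ?thesis unfolding Psi_def .
qed

lemma Psi_gauss_integrable: "integrable lborel (\<lambda>\<xi>. Psi (k *\<^sub>R \<xi>) * gauss \<xi>)"
proof (rule Bochner_Integration.integrable_bound)
  let ?c = "\<integral>y. min 1 ((norm y)\<^sup>2) * N y \<partial>lborel"
  show "integrable lborel (\<lambda>\<xi>::'a. (2 * ?c) * gauss \<xi> + (k\<^sup>2 / 2 * ?c) * ((norm \<xi>)\<^sup>2 * gauss \<xi>))"
    by (intro Bochner_Integration.integrable_add integrable_mult_right gauss_integrable gauss_moment)
  show "AE \<xi> in lborel. norm (Psi (k *\<^sub>R \<xi>) * gauss \<xi>) \<le> norm ((2 * ?c) * gauss \<xi> + (k\<^sup>2 / 2 * ?c) * ((norm \<xi>)\<^sup>2 * gauss \<xi>))"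
  proof (intro AE_I2)
    fix \<xi> :: 'a
    have "Psi (k *\<^sub>R \<xi>) * gauss \<xi> \<le> (2 + (norm (k *\<^sub>R \<xi>))\<^sup>2 / 2) * ?c * gauss \<xi>"
      by (intro mult_right_mono Psi_bound gauss_nonneg)
    also have "\<dots> = (2 * ?c) * gauss \<xi> + (k\<^sup>2 / 2 * ?c) * ((norm \<xi>)\<^sup>2 * gauss \<xi>)"
      by (simp add: power_mult_distrib algebra_simps)
    finally show "norm (Psi (k *\<^sub>R \<xi>) * gauss \<xi>) \<le> norm ((2 * ?c) * gauss \<xi> + (k\<^sup>2 / 2 * ?c) * ((norm \<xi>)\<^sup>2 * gauss \<xi>))"
      using Psi_nonneg[of "k *\<^sub>R \<xi>"] gauss_nonneg[of \<xi>] by simp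
  qed
qed measurable

lemma sdiff_gs:
  "sdiff (gs k) x z = - 2 * (\<integral>\<xi>. cos (k * (\<xi> \<bullet> x)) * (1 - cos (k * (\<xi> \<bullet> z))) * gauss \<xi> \<partial>(lborel::'a measure))"
proof -
  have i: "integrable lborel (\<lambda>\<xi>::'a. g \<xi> * gauss \<xi>)"
    if "g \<in> borel_measurable borel" "\<And>\<xi>. \<bar>g \<xi>\<bar> \<le> 1" for g
    by (rule Bochner_Integration.integrable_bound[OF gauss_integrable])
      (use that gauss_nonneg in \<open>auto simp: abs_mult mult_left_le_one_le\<close>)
  have "sdiff (gs k) x z = (LBINT \<xi>. cos (k * (\<xi> \<bullet> (x + z))) * gauss \<xi> + cos (k * (\<xi> \<bullet> (x - z))) * gauss \<xi> - 2 * (cos (k * (\<xi> \<bullet> x)) * gauss \<xi>))"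
    unfolding sdiff_def gs_char by (simp add: i)
  also have "\<dots> = (LBINT \<xi>. - 2 * (cos (k * (\<xi> \<bullet> x)) * (1 - cos (k * (\<xi> \<bullet> z))) * gauss \<xi>))"
    by (intro Bochner_Integration.integral_cong)
      (auto simp: inner_add_right inner_diff_right distrib_left right_diff_distrib cos_add cos_diff algebra_simps)
  finally show ?thesis by simp
qed

lemma sdiff_gs_bound:
  obtains C where "\<And>x z. \<bar>sdiff (gs k :: 'a \<Rightarrow> real) x z\<bar> \<le> C * min 1 ((norm z)\<^sup>2)"
proof
  fix x z :: 'a
  define q where "q \<xi> = (2 + k\<^sup>2 * (norm \<xi>)\<^sup>2 / 2) * gauss \<xi>" for \<xi> :: 'a
  have iq: "integrable lborel q"
    using gauss_quad[of 2 "k\<^sup>2 / 2"] by (simp add: q_def[abs_def])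
  have "\<bar>\<integral>\<xi>. cos (k * (\<xi> \<bullet> x)) * (1 - cos (k * (\<xi> \<bullet> z))) * gauss \<xi> \<partial>lborel\<bar> \<le> (LBINT \<xi>. min 1 ((norm z)\<^sup>2) * q \<xi>)"
  proof (rule integral_abs_bound_integral)
    fix \<xi> :: 'a
    have "\<bar>1 - cos ((k *\<^sub>R \<xi>) \<bullet> z)\<bar> \<le> (2 + (norm (k *\<^sub>R \<xi>))\<^sup>2 / 2) * min 1 ((norm z)\<^sup>2)" by (rule one_minus_cos_bound)
    then have 1: "\<bar>1 - cos (k * (\<xi> \<bullet> z))\<bar> \<le> (2 + k\<^sup>2 * (norm \<xi>)\<^sup>2 / 2) * min 1 ((norm z)\<^sup>2)" by (simp add: power_mult_distrib)
    have "\<bar>cos (k * (\<xi> \<bullet> x))\<bar> * \<bar>1 - cos (k * (\<xi> \<bullet> z))\<bar> \<le> 1 * ((2 + k\<^sup>2 * (norm \<xi>)\<^sup>2 / 2) * min 1 ((norm z)\<^sup>2))"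
      by (intro mult_mono 1) auto
    then have "\<bar>cos (k * (\<xi> \<bullet> x))\<bar> * \<bar>1 - cos (k * (\<xi> \<bullet> z))\<bar> * gauss \<xi> \<le> ((2 + k\<^sup>2 * (norm \<xi>)\<^sup>2 / 2) * min 1 ((norm z)\<^sup>2)) * gauss \<xi>"
      using gauss_nonneg[of \<xi>] by (intro mult_right_mono) auto
    then show "\<bar>cos (k * (\<xi> \<bullet> x)) * (1 - cos (k * (\<xi> \<bullet> z))) * gauss \<xi>\<bar> \<le> min 1 ((norm z)\<^sup>2) * q \<xi>"
      using gauss_nonneg[of \<xi>] by (simp add: abs_mult q_def ac_simps)
  next
    show "integrable lborel (\<lambda>\<xi>. cos (k * (\<xi> \<bullet> x)) * (1 - cos (k * (\<xi> \<bullet> z))) * gauss \<xi>)"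
    proof (rule Bochner_Integration.integrable_bound[OF integrable_mult_right[OF gauss_integrable, of 2]])
      have "\<bar>cos (k * (\<xi> \<bullet> x)) * (1 - cos (k * (\<xi> \<bullet> z)))\<bar> \<le> 1 * 2" for \<xi> :: 'a
        unfolding abs_mult using cos_ge_minus_one[of "k * (\<xi> \<bullet> z)"] cos_le_one[of "k * (\<xi> \<bullet> z)"] by (intro mult_mono) auto
      from mult_right_mono[OF this gauss_nonneg]
      show "AE \<xi> in lborel. norm (cos (k * (\<xi> \<bullet> x)) * (1 - cos (k * (\<xi> \<bullet> z))) * gauss \<xi>) \<le> norm (2 * gauss \<xi>)"
        by (intro AE_I2) (simp add: abs_mult[of _ "gauss _"] gauss_nonneg)
    qed measurable
  qed (use iq in simp)
  also have "\<dots> = (LBINT \<xi>. q \<xi>) * min 1 ((norm z)\<^sup>2)" by simp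
  finally show "\<bar>sdiff (gs k) x z\<bar> \<le> (2 * (LBINT \<xi>. (2 + k\<^sup>2 * (norm \<xi>)\<^sup>2 / 2) * gauss (\<xi>::'a))) * min 1 ((norm z)\<^sup>2)"
    unfolding sdiff_gs q_def by simp
qed

text \<open>On a cosine of frequency \<open>k *\<^sub>R \<xi>\<close> the operator acts as
  multiplication by \<open>- 2 * Psi (k *\<^sub>R \<xi>)\<close>, and the Gaussian averages such
  cosines. The exchange of integrals rests on the finite second moment of
  \<open>gauss\<close>.\<close>

lemma L_gs: "L (gs k) x = - 2 * (LBINT \<xi>. cos (k * (\<xi> \<bullet> x)) * Psi (k *\<^sub>R \<xi>) * gauss \<xi>)"
proof -
  define f where "f z \<xi> = cos (k * (\<xi> \<bullet> x)) * (1 - cos (k * (\<xi> \<bullet> z))) * gauss \<xi> * N z" for z \<xi> :: 'a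
  define q where "q \<xi> = (2 + k\<^sup>2 * (norm \<xi>)\<^sup>2 / 2) * gauss \<xi>" for \<xi> :: 'a
  have iq: "integrable lborel q"
    using gauss_quad[of 2 "k\<^sup>2 / 2"] by (simp add: q_def[abs_def])
  have fb: "\<bar>f z \<xi>\<bar> \<le> (min 1 ((norm z)\<^sup>2) * N z) * q \<xi>" for z \<xi>
  proof -
    have "\<bar>1 - cos ((k *\<^sub>R \<xi>) \<bullet> z)\<bar> \<le> (2 + (norm (k *\<^sub>R \<xi>))\<^sup>2 / 2) * min 1 ((norm z)\<^sup>2)" by (rule one_minus_cos_bound)
    then have 1: "\<bar>1 - cos (k * (\<xi> \<bullet> z))\<bar> \<le> (2 + k\<^sup>2 * (norm \<xi>)\<^sup>2 / 2) * min 1 ((norm z)\<^sup>2)" by (simp add: power_mult_distrib)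
    have "\<bar>cos (k * (\<xi> \<bullet> x))\<bar> * \<bar>1 - cos (k * (\<xi> \<bullet> z))\<bar> \<le> 1 * ((2 + k\<^sup>2 * (norm \<xi>)\<^sup>2 / 2) * min 1 ((norm z)\<^sup>2))"
      by (intro mult_mono 1) auto
    then have "\<bar>cos (k * (\<xi> \<bullet> x))\<bar> * \<bar>1 - cos (k * (\<xi> \<bullet> z))\<bar> * (gauss \<xi> * N z) \<le> ((2 + k\<^sup>2 * (norm \<xi>)\<^sup>2 / 2) * min 1 ((norm z)\<^sup>2)) * (gauss \<xi> * N z)"
      using gauss_nonneg[of \<xi>] N_nonneg[of z] by (intro mult_right_mono) auto
    then show ?thesis using gauss_nonneg[of \<xi>] N_nonneg[of z] by (simp add: f_def q_def abs_mult ac_simps)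
  qed
  have mf: "(\<lambda>(z, \<xi>). f z \<xi>) \<in> borel_measurable (lborel \<Otimes>\<^sub>M lborel)" unfolding f_def by measurable
  have sf: "sigma_finite_measure (lborel :: 'a measure)" ..
  have "L (gs k) x = (LBINT z. - 2 * (LBINT \<xi>. f z \<xi>))"
    unfolding L_def sdiff_gs f_def by (intro Bochner_Integration.integral_cong) (auto simp flip: integral_mult_left_zero)
  also have "\<dots> = - 2 * (LBINT z. (LBINT \<xi>. f z \<xi>))" by simp
  also have "(LBINT z. (LBINT \<xi>. f z \<xi>)) = (LBINT \<xi>. (LBINT z. f z \<xi>))"
    by (rule fubini_dominated(1)[OF sf sf mf N_integrable iq fb])
  also have "\<dots> = (LBINT \<xi>. cos (k * (\<xi> \<bullet> x)) * Psi (k *\<^sub>R \<xi>) * gauss \<xi>)"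
  proof (intro Bochner_Integration.integral_cong refl)
    fix \<xi> :: 'a
    have "(LBINT z. f z \<xi>) = (LBINT z. (cos (k * (\<xi> \<bullet> x)) * gauss \<xi>) * ((1 - cos ((k *\<^sub>R \<xi>) \<bullet> z)) * N z))"
      unfolding f_def by (intro Bochner_Integration.integral_cong) auto
    also have "\<dots> = cos (k * (\<xi> \<bullet> x)) * gauss \<xi> * Psi (k *\<^sub>R \<xi>)" by (simp add: Psi_def)
    finally show "(LBINT z. f z \<xi>) = cos (k * (\<xi> \<bullet> x)) * Psi (k *\<^sub>R \<xi>) * gauss \<xi>" by simp
  qed
  finally show ?thesis .
qed

end

section \<open>Exit times and Dynkin's formula\<close>

lemma (in prob_space) indep_var_integral:
  fixes F :: "'c \<Rightarrow> 'c \<Rightarrow> real"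
  assumes ind: "indep_var S X T Z" and F[measurable]: "(\<lambda>(x, z). F x z) \<in> borel_measurable (S \<Otimes>\<^sub>M T)"
    and bd: "\<And>x z. \<bar>F x z\<bar> \<le> B"
  shows "(\<integral>\<omega>. F (X \<omega>) (Z \<omega>) \<partial>M) = (\<integral>\<omega>. (\<integral>\<omega>'. F (X \<omega>) (Z \<omega>') \<partial>M) \<partial>M)"
proof -
  have X[measurable]: "X \<in> measurable M S" and Z[measurable]: "Z \<in> measurable M T"
    using indep_var_rv1[OF ind] indep_var_rv2[OF ind] by auto
  have deq: "distr M S X \<Otimes>\<^sub>M distr M T Z = distr M (S \<Otimes>\<^sub>M T) (\<lambda>\<omega>. (X \<omega>, Z \<omega>))"
    using ind unfolding indep_var_distribution_eq by auto
  interpret X: prob_space "distr M S X" by (rule prob_space_distr) fact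
  interpret Z: prob_space "distr M T Z" by (rule prob_space_distr) fact
  interpret P: pair_sigma_finite "distr M S X" "distr M T Z" ..
  interpret PP: pair_prob_space "distr M S X" "distr M T Z" ..
  have mF: "(\<lambda>(x, z). F x z) \<in> borel_measurable (distr M S X \<Otimes>\<^sub>M distr M T Z)" by simp
  have i: "integrable (distr M S X \<Otimes>\<^sub>M distr M T Z) (\<lambda>(x, z). F x z)"
    by (rule PP.integrable_const_bound[where B = B]) (use bd mF in auto)
  have "(\<integral>\<omega>. F (X \<omega>) (Z \<omega>) \<partial>M) = (\<integral>p. (case p of (x, z) \<Rightarrow> F x z) \<partial>distr M (S \<Otimes>\<^sub>M T) (\<lambda>\<omega>. (X \<omega>, Z \<omega>)))"
    by (subst integral_distr) auto
  also have "\<dots> = (\<integral>x. (\<integral>z. F x z \<partial>distr M T Z) \<partial>distr M S X)"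
    unfolding deq[symmetric] using P.integral_fst'[OF i] by simp
  also have "\<dots> = (\<integral>x. (\<integral>\<omega>'. F x (Z \<omega>') \<partial>M) \<partial>distr M S X)"
  proof (intro Bochner_Integration.integral_cong refl)
    fix x assume "x \<in> space (distr M S X)"
    then have "(\<lambda>z. F x z) \<in> borel_measurable T" by simp
    then show "(\<integral>z. F x z \<partial>distr M T Z) = (\<integral>\<omega>'. F x (Z \<omega>') \<partial>M)" by (rule integral_distr[OF Z])
  qed
  also have "\<dots> = (\<integral>\<omega>. (\<integral>\<omega>'. F (X \<omega>) (Z \<omega>') \<partial>M) \<partial>M)"
    by (rule integral_distr[OF X]) measurable
  finally show ?thesis .
qed

locale levy_setting = levy_kernel \<nu> N a for \<nu> and N :: "'a::euclidean_space \<Rightarrow> real" and a +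
  fixes M :: "'w measure" and Y :: "'w \<Rightarrow> real \<Rightarrow> 'a"
  assumes levy: "levy_process M Y"
    and char_exp: "\<And>t \<xi>. 0 \<le> t \<Longrightarrow>
          (\<integral>\<omega>. cis (\<xi> \<bullet> Y \<omega> t) \<partial>M) = complex_of_real (exp (- t * Psi \<xi>))"
begin

sublocale prob_space M
  using levy by (simp add: levy_process_def)

lemma Y_measurable[measurable]: "(\<lambda>\<omega>. Y \<omega> t) \<in> borel_measurable M"
  using levy by (simp add: levy_process_def)

lemma Y_0: "\<omega> \<in> space M \<Longrightarrow> Y \<omega> 0 = 0"
  using levy by (simp add: levy_process_def)

lemma Y_right_cont: "\<omega> \<in> space M \<Longrightarrow> 0 \<le> t \<Longrightarrow> continuous (at_right t) (Y \<omega>)"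
  using levy by (simp add: levy_process_def cadlag_def)

definition P :: "real \<Rightarrow> ('a \<Rightarrow> real) \<Rightarrow> 'a \<Rightarrow> real" where
  "P h \<phi> x = (\<integral>\<omega>. \<phi> (x + Y \<omega> h) \<partial>M)"

lemma integrable_bounded:
  fixes g :: "'w \<Rightarrow> real"
  shows "g \<in> borel_measurable M \<Longrightarrow> (\<And>\<omega>. \<bar>g \<omega>\<bar> \<le> B) \<Longrightarrow> integrable M g"
  by (rule integrable_const_bound[where B = B]) auto

text \<open>The exponent is real, so the expected sine vanishes, and cosines are eigenfunctions of
  the semigroup.\<close>

lemma P_cos: assumes t: "0 \<le> t" shows "P t (\<lambda>y. cos (\<xi> \<bullet> y)) x = cos (\<xi> \<bullet> x) * exp (- t * Psi \<xi>)"
proof -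
  have ic: "integrable M (\<lambda>\<omega>. cos (\<xi> \<bullet> Y \<omega> t))" and isn: "integrable M (\<lambda>\<omega>. sin (\<xi> \<bullet> Y \<omega> t))"
    by (rule integrable_bounded[where B = 1]; simp)+
  have mc: "(\<lambda>\<omega>. cis (\<xi> \<bullet> Y \<omega> t)) \<in> borel_measurable M"
  proof -
    have "cis \<in> borel_measurable borel"
      unfolding cis_conv_exp[abs_def] by (intro borel_measurable_continuous_onI continuous_intros)
    then show ?thesis by measurable
  qed
  have i: "integrable M (\<lambda>\<omega>. cis (\<xi> \<bullet> Y \<omega> t))"
    by (rule integrable_const_bound[where B = 1]) (use mc in auto)
  have re: "(\<integral>\<omega>. cos (\<xi> \<bullet> Y \<omega> t) \<partial>M) = exp (- t * Psi \<xi>)"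
    using integral_Re[OF i] char_exp[OF t, of \<xi>] by simp
  have im: "(\<integral>\<omega>. sin (\<xi> \<bullet> Y \<omega> t) \<partial>M) = 0"
    using integral_Im[OF i] char_exp[OF t, of \<xi>] by simp
  have "P t (\<lambda>y. cos (\<xi> \<bullet> y)) x = (\<integral>\<omega>. cos (\<xi> \<bullet> x) * cos (\<xi> \<bullet> Y \<omega> t) - sin (\<xi> \<bullet> x) * sin (\<xi> \<bullet> Y \<omega> t) \<partial>M)"
    unfolding P_def by (simp add: inner_add_right cos_add)
  also have "\<dots> = cos (\<xi> \<bullet> x) * exp (- t * Psi \<xi>)" using ic isn re im by simp
  finally show ?thesis .
qed

lemma P_gs:
  assumes h: "0 \<le> h"
  shows "P h (gs k) x = (LBINT \<xi>. cos (k * (\<xi> \<bullet> x)) * exp (- h * Psi (k *\<^sub>R \<xi>)) * gauss \<xi>)"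
proof -
  have mf: "(\<lambda>(\<omega>, \<xi>). cos (k * (\<xi> \<bullet> (x + Y \<omega> h))) * gauss \<xi>) \<in> borel_measurable (M \<Otimes>\<^sub>M lborel)" by measurable
  have "P h (gs k) x = (\<integral>\<omega>. (LBINT \<xi>. cos (k * (\<xi> \<bullet> (x + Y \<omega> h))) * gauss \<xi>) \<partial>M)"
    unfolding P_def gs_char ..
  also have "\<dots> = (LBINT \<xi>. (\<integral>\<omega>. cos (k * (\<xi> \<bullet> (x + Y \<omega> h))) * gauss \<xi> \<partial>M))"
    by (rule fubini_dominated(1)[OF sigma_finite_measure_axioms lborel.sigma_finite_measure_axioms mf, where p = "\<lambda>_. 1", OF _ gauss_integrable])
      (auto simp: abs_mult gauss_nonneg intro: mult_left_le_one_le)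
  also have "\<dots> = (LBINT \<xi>. cos (k * (\<xi> \<bullet> x)) * exp (- h * Psi (k *\<^sub>R \<xi>)) * gauss \<xi>)"
    using P_cos[OF h, of "k *\<^sub>R _" x] by (intro Bochner_Integration.integral_cong) (auto simp: P_def)
  finally show ?thesis .
qed

text \<open>An error bound for the difference quotient of the semigroup on a Gaussian that does not
  depend on the point: the factor in front of the cosine is nonnegative, so the cosine may be
  bounded by 1.\<close>

definition gs_err :: "real \<Rightarrow> real \<Rightarrow> real" where
  "gs_err k h = (LBINT \<xi>. (Psi (k *\<^sub>R \<xi>) - (1 - exp (- h * Psi (k *\<^sub>R \<xi>))) / h) * gauss \<xi>)"

lemma exp_quotient_bounds:
  assumes h: "0 < (h::real)" and p: "0 \<le> p"
  shows "0 \<le> (1 - exp (- h * p)) / h" "(1 - exp (- h * p)) / h \<le> p"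
proof -
  show "0 \<le> (1 - exp (- h * p)) / h" using h p by simp
  have "1 - h * p \<le> exp (- h * p)" using exp_ge_add_one_self[of "- h * p"] by simp
  then show "(1 - exp (- h * p)) / h \<le> p" using h by (simp add: field_simps)
qed

lemma gs_err_integrable:
  assumes h: "0 < h"
  shows "integrable lborel (\<lambda>\<xi>. (Psi (k *\<^sub>R \<xi>) - (1 - exp (- h * Psi (k *\<^sub>R \<xi>))) / h) * gauss \<xi>)"
proof (rule Bochner_Integration.integrable_bound[OF Psi_gauss_integrable[of k]])
  show "AE \<xi> in lborel. norm ((Psi (k *\<^sub>R \<xi>) - (1 - exp (- h * Psi (k *\<^sub>R \<xi>))) / h) * gauss \<xi>) \<le> norm (Psi (k *\<^sub>R \<xi>) * gauss \<xi>)"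
  proof (intro AE_I2)
    fix \<xi> :: 'a
    have "\<bar>Psi (k *\<^sub>R \<xi>) - (1 - exp (- h * Psi (k *\<^sub>R \<xi>))) / h\<bar> \<le> \<bar>Psi (k *\<^sub>R \<xi>)\<bar>"
      using exp_quotient_bounds[OF h Psi_nonneg[of "k *\<^sub>R \<xi>"]] by linarith
    then show "norm ((Psi (k *\<^sub>R \<xi>) - (1 - exp (- h * Psi (k *\<^sub>R \<xi>))) / h) * gauss \<xi>) \<le> norm (Psi (k *\<^sub>R \<xi>) * gauss \<xi>)"
      by (simp add: abs_mult mult_right_mono)
  qed
qed measurable

lemma abs_cos_mult_le: "\<bar>cos t * q\<bar> \<le> \<bar>q::real\<bar>"
  using mult_right_mono[OF abs_cos_le_one[of t], of "\<bar>q\<bar>"] by (simp add: abs_mult)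

lemma cos_mult_le: "0 \<le> q \<Longrightarrow> \<bar>cos t * q\<bar> \<le> (q::real)"
  using mult_right_mono[OF abs_cos_le_one[of t], of q] by (simp add: abs_mult)

lemma gs_generator:
  assumes h: "0 < h"
  shows "\<bar>(P h (gs k) x - gs k x) / h - L (gs k) x / 2\<bar> \<le> gs_err k h"
proof -
  let ?D = "\<lambda>\<xi>. Psi (k *\<^sub>R \<xi>) - (1 - exp (- h * Psi (k *\<^sub>R \<xi>))) / h"
  have i1: "integrable lborel (\<lambda>\<xi>::'a. cos (k * (\<xi> \<bullet> x)) * gauss \<xi>)"
    by (rule Bochner_Integration.integrable_bound[OF gauss_integrable])
      (auto simp: gauss_nonneg intro!: AE_I2 cos_mult_le)
  have i2: "integrable lborel (\<lambda>\<xi>::'a. cos (k * (\<xi> \<bullet> x)) * exp (- h * Psi (k *\<^sub>R \<xi>)) * gauss \<xi>)"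
  proof (rule Bochner_Integration.integrable_bound[OF gauss_integrable])
    have "\<bar>cos (k * (\<xi> \<bullet> x))\<bar> * exp (- h * Psi (k *\<^sub>R \<xi>)) \<le> 1 * 1" for \<xi> :: 'a
      using h Psi_nonneg[of "k *\<^sub>R \<xi>"] by (intro mult_mono) auto
    from mult_right_mono[OF this gauss_nonneg]
    show "AE \<xi> in lborel. norm (cos (k * (\<xi> \<bullet> x)) * exp (- h * Psi (k *\<^sub>R \<xi>)) * gauss \<xi>) \<le> norm (gauss \<xi>)"
      by (intro AE_I2) (simp add: abs_mult gauss_nonneg)
  qed measurable
  have i3: "integrable lborel (\<lambda>\<xi>::'a. cos (k * (\<xi> \<bullet> x)) * Psi (k *\<^sub>R \<xi>) * gauss \<xi>)"
  proof (rule Bochner_Integration.integrable_bound[OF Psi_gauss_integrable[of k]])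
    have "\<bar>cos (k * (\<xi> \<bullet> x))\<bar> * (Psi (k *\<^sub>R \<xi>) * gauss \<xi>) \<le> 1 * (Psi (k *\<^sub>R \<xi>) * gauss \<xi>)" for \<xi> :: 'a
      using Psi_nonneg[of "k *\<^sub>R \<xi>"] gauss_nonneg[of \<xi>] by (intro mult_right_mono) auto
    then show "AE \<xi> in lborel. norm (cos (k * (\<xi> \<bullet> x)) * Psi (k *\<^sub>R \<xi>) * gauss \<xi>) \<le> norm (Psi (k *\<^sub>R \<xi>) * gauss \<xi>)"
      by (intro AE_I2) (simp add: abs_mult gauss_nonneg Psi_nonneg mult.assoc)
  qed measurable
  have "(P h (gs k) x - gs k x) / h - L (gs k) x / 2 =
     (LBINT \<xi>. (cos (k * (\<xi> \<bullet> x)) * exp (- h * Psi (k *\<^sub>R \<xi>)) * gauss \<xi> - cos (k * (\<xi> \<bullet> x)) * gauss \<xi>) / h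
        + cos (k * (\<xi> \<bullet> x)) * Psi (k *\<^sub>R \<xi>) * gauss \<xi>)"
    unfolding L_gs P_gs[OF less_imp_le[OF h]] gs_char[of k x] using i1 i2 i3 by simp
  also have "\<dots> = (LBINT \<xi>. cos (k * (\<xi> \<bullet> x)) * (?D \<xi> * gauss \<xi>))"
  proof (intro Bochner_Integration.integral_cong refl)
    have "(c * e * g - c * g) / h + c * p * g = c * ((p - (1 - e) / h) * g)" for c e g p :: real
      using h by (simp add: field_simps)
    then show "(cos (k * (\<xi> \<bullet> x)) * exp (- h * Psi (k *\<^sub>R \<xi>)) * gauss \<xi> - cos (k * (\<xi> \<bullet> x)) * gauss \<xi>) / h
        + cos (k * (\<xi> \<bullet> x)) * Psi (k *\<^sub>R \<xi>) * gauss \<xi> = cos (k * (\<xi> \<bullet> x)) * (?D \<xi> * gauss \<xi>)" for \<xi> .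
  qed
  finally have e: "(P h (gs k) x - gs k x) / h - L (gs k) x / 2 = (LBINT \<xi>. cos (k * (\<xi> \<bullet> x)) * (?D \<xi> * gauss \<xi>))" .
  show ?thesis unfolding e gs_err_def
  proof (rule integral_abs_bound_integral)
    show "integrable lborel (\<lambda>\<xi>. ?D \<xi> * gauss \<xi>)" by (rule gs_err_integrable[OF h])
    fix \<xi> :: 'a
    have "0 \<le> ?D \<xi> * gauss \<xi>" using exp_quotient_bounds(2)[OF h Psi_nonneg[of "k *\<^sub>R \<xi>"]] gauss_nonneg[of \<xi>] by simp
    then show le: "\<bar>cos (k * (\<xi> \<bullet> x)) * (?D \<xi> * gauss \<xi>)\<bar> \<le> ?D \<xi> * gauss \<xi>"
      by (rule cos_mult_le)
  next
    show "integrable lborel (\<lambda>\<xi>. cos (k * (\<xi> \<bullet> x)) * (?D \<xi> * gauss \<xi>))"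
    proof (rule Bochner_Integration.integrable_bound[OF gs_err_integrable[OF h, of k]])
      show "AE \<xi> in lborel. norm (cos (k * (\<xi> \<bullet> x)) * (?D \<xi> * gauss \<xi>)) \<le> norm (?D \<xi> * gauss \<xi>)"
        by (intro AE_I2) (simp only: real_norm_def abs_cos_mult_le)
    qed measurable
  qed
qed

lemma gs_err_lim: "(\<lambda>n. gs_err k (1 / 2 ^ n)) \<longlonglongrightarrow> 0"
proof -
  have "(\<lambda>n. gs_err k (1 / 2 ^ n)) \<longlonglongrightarrow> (\<integral>\<xi>. 0 \<partial>(lborel :: 'a measure))"
    unfolding gs_err_def
  proof (rule integral_dominated_convergence[where w = "\<lambda>\<xi>. Psi (k *\<^sub>R \<xi>) * gauss \<xi>"])
    show "integrable lborel (\<lambda>\<xi>. Psi (k *\<^sub>R \<xi>) * gauss \<xi>)" by (rule Psi_gauss_integrable)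
    show "AE \<xi> in lborel. (\<lambda>n. (Psi (k *\<^sub>R \<xi>) - (1 - exp (- (1 / 2 ^ n) * Psi (k *\<^sub>R \<xi>))) / (1 / 2 ^ n)) * gauss \<xi>) \<longlonglongrightarrow> 0"
    proof (intro AE_I2)
      fix \<xi> :: 'a
      define p where "p = Psi (k *\<^sub>R \<xi>)"
      have h0: "(\<lambda>n. 1 / 2 ^ n :: real) \<longlonglongrightarrow> 0"
        using LIMSEQ_realpow_zero[of "1/2::real"] by (simp add: power_one_over)
      have "((\<lambda>h. exp (- h * p)) has_real_derivative (- p)) (at 0)"
        by (auto intro!: derivative_eq_intros)
      then have "((\<lambda>h. (exp (- (0 + h) * p) - exp (- 0 * p)) / h) \<longlongrightarrow> - p) (at 0)" unfolding DERIV_def .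
      then have d: "((\<lambda>h. (exp (- h * p) - 1) / h) \<longlongrightarrow> - p) (at 0)" by simp
      have "filterlim (\<lambda>n. 1 / 2 ^ n :: real) (at 0) sequentially"
        using h0 by (simp add: filterlim_at)
      from filterlim_compose[OF d this] have "(\<lambda>n. (exp (- (1 / 2 ^ n) * p) - 1) / (1 / 2 ^ n)) \<longlonglongrightarrow> - p" .
      then have "(\<lambda>n. (p + (exp (- (1 / 2 ^ n) * p) - 1) / (1 / 2 ^ n)) * gauss \<xi>) \<longlonglongrightarrow> (p + - p) * gauss \<xi>"
        by (intro tendsto_intros)
      moreover have "(p + (exp (- (1 / 2 ^ n) * p) - 1) / (1 / 2 ^ n)) = p - (1 - exp (- (1 / 2 ^ n) * p)) / (1 / 2 ^ n)" for n
        by (simp add: algebra_simps)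
      ultimately show "(\<lambda>n. (Psi (k *\<^sub>R \<xi>) - (1 - exp (- (1 / 2 ^ n) * Psi (k *\<^sub>R \<xi>))) / (1 / 2 ^ n)) * gauss \<xi>) \<longlonglongrightarrow> 0"
        by (simp add: p_def)
    qed
    show "AE \<xi> in lborel. norm ((Psi (k *\<^sub>R \<xi>) - (1 - exp (- (1 / 2 ^ n) * Psi (k *\<^sub>R \<xi>))) / (1 / 2 ^ n)) * gauss \<xi>) \<le> Psi (k *\<^sub>R \<xi>) * gauss \<xi>" for n
    proof (intro AE_I2)
      fix \<xi> :: 'a
      have h: "0 < 1 / (2::real) ^ n" by simp
      have "\<bar>Psi (k *\<^sub>R \<xi>) - (1 - exp (- (1 / 2 ^ n) * Psi (k *\<^sub>R \<xi>))) / (1 / 2 ^ n)\<bar> \<le> Psi (k *\<^sub>R \<xi>)"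
        using exp_quotient_bounds[OF h Psi_nonneg[of "k *\<^sub>R \<xi>"]] by linarith
      from mult_right_mono[OF this gauss_nonneg[of \<xi>]]
      show "norm ((Psi (k *\<^sub>R \<xi>) - (1 - exp (- (1 / 2 ^ n) * Psi (k *\<^sub>R \<xi>))) / (1 / 2 ^ n)) * gauss \<xi>) \<le> Psi (k *\<^sub>R \<xi>) * gauss \<xi>"
        by (simp add: abs_mult gauss_nonneg)
    qed
  qed measurable
  then show ?thesis by simp
qed

section \<open>Dynkin's formula on a time grid\<close>

definition stays :: "real \<Rightarrow> real \<Rightarrow> nat \<Rightarrow> 'w \<Rightarrow> bool" where
  "stays h s n \<omega> \<longleftrightarrow> (\<forall>j\<le>n. norm (Y \<omega> (real j * h)) \<le> s)"

lemma stays_measurable[measurable]: "Measurable.pred M (stays h s n)"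
  unfolding stays_def by measurable

text \<open>The Markov property at a grid time: the event and the current position are functions of
  the first n increments, and the next increment is independent of these and distributed like the
  position at time h.\<close>

lemma markov_step:
  assumes h: "0 \<le> h" and \<phi>[measurable]: "\<phi> \<in> borel_measurable borel" and bd: "\<And>y. \<bar>\<phi> y\<bar> \<le> B"
  shows "(\<integral>\<omega>. of_bool (stays h s n \<omega>) * \<phi> (x + Y \<omega> (real (Suc n) * h)) \<partial>M)
       = (\<integral>\<omega>. of_bool (stays h s n \<omega>) * P h \<phi> (x + Y \<omega> (real n * h)) \<partial>M)"
proof -
  define t where "t i = real i * h" for i :: nat
  define D where "D i \<omega> = Y \<omega> (t (Suc i)) - Y \<omega> (t i)" for i \<omega>
  have D_m[measurable]: "D i \<in> borel_measurable M" for i unfolding D_def by measurable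
  have tm: "t 0 \<ge> 0 \<and> (\<forall>i. t i \<le> t (Suc i))" using h by (auto simp: t_def mult_right_mono)
  have ind: "indep_vars (\<lambda>_. borel) D {..<Suc n}"
    using levy tm unfolding levy_process_def D_def by blast
  have st: "distr M borel (D n) = distr M borel (\<lambda>\<omega>. Y \<omega> h)"
  proof -
    have "distr M borel (\<lambda>\<omega>. Y \<omega> (t (Suc n)) - Y \<omega> (t n)) = distr M borel (\<lambda>\<omega>. Y \<omega> (t (Suc n) - t n))"
      using levy tm h unfolding levy_process_def by (auto simp: t_def)
    moreover have "t (Suc n) - t n = h" by (simp add: t_def algebra_simps)
    ultimately show ?thesis by (simp add: D_def[abs_def])
  qed
  have tel: "(\<Sum>i<j. D i \<omega>) = Y \<omega> (t j)" if "\<omega> \<in> space M" for j \<omega>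
  proof -
    have "(\<Sum>i<j. D i \<omega>) = Y \<omega> (t j) - Y \<omega> (t 0)" unfolding D_def by (rule sum_lessThan_telescope)
    then show ?thesis using Y_0[OF that] by (simp add: t_def)
  qed
  define X where "X \<omega> = restrict (\<lambda>i. D i \<omega>) {..<n}" for \<omega>
  define Z where "Z \<omega> = restrict (\<lambda>i. D i \<omega>) {n}" for \<omega>
  have iv: "indep_var (PiM {..<n} (\<lambda>_. borel)) X (PiM {n} (\<lambda>_. borel)) Z"
    unfolding X_def Z_def by (rule indep_var_restrict[OF ind]) auto
  \<comment> \<open>The event of having stayed is written through partial sums of increments, as a
    product of indicators, so that it becomes a measurable function on the product space carrying
    the law of the increments.\<close>
  define F where "F d e = (\<Prod>j\<le>n. of_bool (norm (\<Sum>i<j. d i) \<le> s)) * \<phi> (x + (\<Sum>i<n. d i) + e n)" for d e :: "nat \<Rightarrow> 'a"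
  let ?PP = "PiM {..<n} (\<lambda>_. borel) \<Otimes>\<^sub>M PiM {n} (\<lambda>_. borel) :: ((nat \<Rightarrow> 'a) \<times> (nat \<Rightarrow> 'a)) measure"
  have mS[measurable]: "(\<lambda>p. \<Sum>i<j. fst p i) \<in> borel_measurable ?PP" if "j \<le> n" for j
  proof (intro borel_measurable_sum)
    fix i assume "i \<in> {..<j}"
    with that have i: "i \<in> {..<n}" by simp
    show "(\<lambda>p. fst p i) \<in> borel_measurable ?PP"
      by (rule measurable_compose[OF measurable_fst measurable_component_singleton[OF i, of "\<lambda>_. borel"]])
  qed
  have mZ[measurable]: "(\<lambda>p. snd p n) \<in> borel_measurable ?PP"
    by (rule measurable_compose[OF measurable_snd measurable_component_singleton[of n "{n}" "\<lambda>_. borel"]]) simp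
  have mF: "(\<lambda>(d, e). F d e) \<in> borel_measurable ?PP"
    unfolding F_def case_prod_beta
  proof (intro borel_measurable_times borel_measurable_prod)
    fix j assume "j \<in> {..n}"
    then have m: "(\<lambda>p. \<Sum>i<j. fst p i) \<in> borel_measurable ?PP" by (intro mS) auto
    show "(\<lambda>p. of_bool (norm (\<Sum>i<j. fst p i) \<le> s) :: real) \<in> borel_measurable ?PP"
      using m by measurable
  next
    have m: "(\<lambda>p. \<Sum>i<n. fst p i) \<in> borel_measurable ?PP" by (intro mS) auto
    show "(\<lambda>p. \<phi> (x + (\<Sum>i<n. fst p i) + snd p n)) \<in> borel_measurable ?PP"
      using m by measurable
  qed
  have pr01: "0 \<le> (\<Prod>j\<le>n. of_bool (Q j) :: real)" "(\<Prod>j\<le>n. of_bool (Q j) :: real) \<le> 1" for Q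
    by (auto intro!: prod_nonneg prod_le_1)
  have Fb: "\<bar>F d e\<bar> \<le> B" for d e
    unfolding F_def abs_mult using pr01[of "\<lambda>j. norm (\<Sum>i<j. d i) \<le> s"] bd[of "x + (\<Sum>i<n. d i) + e n"]
    by (smt (verit) mult_left_le_one_le abs_ge_zero)
  have XZ: "X \<omega> i = D i \<omega>" if "i < n" for i \<omega> using that by (simp add: X_def)
  have sX: "(\<Sum>i<j. X \<omega> i) = Y \<omega> (t j)" if "\<omega> \<in> space M" "j \<le> n" for j \<omega>
  proof -
    have "(\<Sum>i<j. X \<omega> i) = (\<Sum>i<j. D i \<omega>)" using that XZ by (intro sum.cong) auto
    then show ?thesis using tel that by simp
  qed
  have FX: "F (X \<omega>) e = of_bool (stays h s n \<omega>) * \<phi> (x + Y \<omega> (t n) + e n)" if "\<omega> \<in> space M" for \<omega> e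
  proof -
    have "(\<Prod>j\<le>n. of_bool (norm (\<Sum>i<j. X \<omega> i) \<le> s) :: real) = (\<Prod>j\<le>n. of_bool (norm (Y \<omega> (t j)) \<le> s))"
      using sX[OF that] by (intro prod.cong) auto
    also have "\<dots> = of_bool (stays h s n \<omega>)"
      by (auto simp: stays_def t_def prod_zero_iff)
    finally show ?thesis using sX[OF that, of n] by (simp add: F_def)
  qed
  have "(\<integral>\<omega>. F (X \<omega>) (Z \<omega>) \<partial>M) = (\<integral>\<omega>. (\<integral>\<omega>'. F (X \<omega>) (Z \<omega>') \<partial>M) \<partial>M)"
    by (rule indep_var_integral[OF iv mF Fb])
  also have "(\<integral>\<omega>. F (X \<omega>) (Z \<omega>) \<partial>M) = (\<integral>\<omega>. of_bool (stays h s n \<omega>) * \<phi> (x + Y \<omega> (real (Suc n) * h)) \<partial>M)"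
    by (intro Bochner_Integration.integral_cong refl) (simp add: FX Z_def D_def t_def)
  also have "(\<integral>\<omega>. (\<integral>\<omega>'. F (X \<omega>) (Z \<omega>') \<partial>M) \<partial>M) = (\<integral>\<omega>. of_bool (stays h s n \<omega>) * P h \<phi> (x + Y \<omega> (real n * h)) \<partial>M)"
  proof (intro Bochner_Integration.integral_cong refl)
    fix \<omega> assume \<omega>: "\<omega> \<in> space M"
    have "(\<integral>\<omega>'. F (X \<omega>) (Z \<omega>') \<partial>M) = of_bool (stays h s n \<omega>) * (\<integral>\<omega>'. \<phi> (x + Y \<omega> (t n) + D n \<omega>') \<partial>M)"
      by (simp add: FX[OF \<omega>] Z_def)
    also have "(\<integral>\<omega>'. \<phi> (x + Y \<omega> (t n) + D n \<omega>') \<partial>M) = (\<integral>w. \<phi> (x + Y \<omega> (t n) + w) \<partial>distr M borel (D n))"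
      by (rule integral_distr[symmetric]) measurable
    also have "\<dots> = P h \<phi> (x + Y \<omega> (t n))" unfolding st P_def by (rule integral_distr) measurable
    finally show "(\<integral>\<omega>'. F (X \<omega>) (Z \<omega>') \<partial>M) = of_bool (stays h s n \<omega>) * P h \<phi> (x + Y \<omega> (real n * h))"
      by (simp add: t_def)
  qed
  finally show ?thesis .
qed

text \<open>The disjunct \<open>j = n\<close> caps the index, which makes it bounded and defined
  also on paths that never leave.\<close>

definition stop_index :: "real \<Rightarrow> real \<Rightarrow> nat \<Rightarrow> 'w \<Rightarrow> nat" where
  "stop_index h s n \<omega> = (LEAST j. j = n \<or> s < norm (Y \<omega> (real j * h)))"

lemma stop_index_measurable[measurable]: "stop_index h s n \<in> measurable M (count_space UNIV)"
  unfolding stop_index_def by measurable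

lemma stop_index_stays: "stays h s n \<omega> \<Longrightarrow> stop_index h s n \<omega> = n"
  unfolding stop_index_def stays_def
proof (rule Least_equality)
  fix j assume a: "\<forall>j\<le>n. norm (Y \<omega> (real j * h)) \<le> s" and j: "j = n \<or> s < norm (Y \<omega> (real j * h))"
  show "n \<le> j" using a[rule_format, of j] j by (cases "n \<le> j") auto
qed simp

lemma stop_index_le: "stop_index h s n \<omega> \<le> n"
  unfolding stop_index_def by (rule Least_le) simp

lemma stop_index_Suc:
  "stop_index h s (Suc n) \<omega> = (if stays h s n \<omega> then Suc n else stop_index h s n \<omega>)"
proof (cases "stays h s n \<omega>")
  case True
  have "stop_index h s (Suc n) \<omega> = Suc n"
    unfolding stop_index_def
  proof (rule Least_equality)
    fix j assume j: "j = Suc n \<or> s < norm (Y \<omega> (real j * h))"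
    show "Suc n \<le> j"
    proof (rule ccontr)
      assume "\<not> Suc n \<le> j"
      then have "j \<le> n" by simp
      then have "norm (Y \<omega> (real j * h)) \<le> s" using True by (simp add: stays_def)
      then show False using j \<open>\<not> Suc n \<le> j\<close> by simp
    qed
  qed simp
  then show ?thesis using True by simp
next
  case False
  then obtain i where i: "i \<le> n" "s < norm (Y \<omega> (real i * h))" by (auto simp: stays_def not_le)
  let ?q = "LEAST j. s < norm (Y \<omega> (real j * h))"
  have q: "s < norm (Y \<omega> (real ?q * h))" "?q \<le> n"
    using LeastI[of "\<lambda>j. s < norm (Y \<omega> (real j * h))" i] Least_le[of "\<lambda>j. s < norm (Y \<omega> (real j * h))" i] i by simp_all
  have *: "stop_index h s m \<omega> = ?q" if "n \<le> m" for m
    unfolding stop_index_def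
  proof (rule Least_equality)
    show "?q = m \<or> s < norm (Y \<omega> (real ?q * h))" using q by simp
    show "?q \<le> j" if "j = m \<or> s < norm (Y \<omega> (real j * h))" for j
      using that q \<open>n \<le> m\<close> by (auto intro: Least_le)
  qed
  show ?thesis using *[of n] *[of "Suc n"] False by simp
qed

lemma stop_position_measurable[measurable]:
  "(\<lambda>\<omega>. Y \<omega> (real (stop_index h s n \<omega>) * h)) \<in> borel_measurable M"
  by (rule measurable_compose_countable[where f = "\<lambda>i \<omega>. Y \<omega> (real i * h)"]) measurable

lemma stop_index_integrable: "integrable M (\<lambda>\<omega>. real (stop_index h s n \<omega>))"
  by (rule integrable_bounded[where B = "real n"]) (auto simp: stop_index_le)

text \<open>Induction on the cap: raising it by one changes the stopped path only on the event
  \<open>stays\<close>, where one more step is made, and by \<open>markov_step\<close> the mean gain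
  of that step is at most c.\<close>

lemma discrete_dynkin:
  assumes h: "0 \<le> h" and \<phi>[measurable]: "\<phi> \<in> borel_measurable borel" and bd: "\<And>y. \<bar>\<phi> y\<bar> \<le> B"
    and c: "\<And>y. norm y \<le> s \<Longrightarrow> P h \<phi> (x + y) - \<phi> (x + y) \<le> c"
  shows "(\<integral>\<omega>. \<phi> (x + Y \<omega> (real (stop_index h s n \<omega>) * h)) \<partial>M) - \<phi> x \<le> c * (\<integral>\<omega>. real (stop_index h s n \<omega>) \<partial>M)"
proof (induction n)
  case 0
  have "stop_index h s 0 \<omega> = 0" for \<omega> using stop_index_le[of h s 0 \<omega>] by simp
  moreover have "(\<integral>\<omega>. \<phi> (x + Y \<omega> 0) \<partial>M) = (\<integral>\<omega>. \<phi> x \<partial>M)"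
    by (intro Bochner_Integration.integral_cong) (auto simp: Y_0)
  ultimately show ?case by (simp add: prob_space)
next
  case (Suc n)
  have Pm: "P h \<phi> \<in> borel_measurable borel"
  proof -
    have "(\<lambda>(y, \<omega>). \<phi> (y + Y \<omega> h)) \<in> borel_measurable (borel \<Otimes>\<^sub>M M)" by measurable
    from borel_measurable_lebesgue_integral[OF this] show ?thesis by (simp add: P_def[abs_def])
  qed
  have Pb: "\<bar>P h \<phi> y\<bar> \<le> B" for y
  proof -
    have i: "integrable M (\<lambda>\<omega>. \<phi> (y + Y \<omega> h))" by (rule integrable_bounded[where B = B]) (auto simp: bd)
    have "P h \<phi> y \<le> B" unfolding P_def
      by (rule integral_le_const[OF i]) (use bd abs_le_D1 in blast)
    moreover have "- B \<le> P h \<phi> y" unfolding P_def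
      by (rule integral_ge_const[OF i]) (use bd in \<open>auto simp: abs_le_iff minus_le_iff\<close>)
    ultimately show ?thesis by simp
  qed
  have B0: "0 \<le> B" using bd[of 0] by linarith
  have bo: "\<bar>of_bool Q * r\<bar> \<le> C" if "\<bar>r\<bar> \<le> C" for Q and r C :: real
    using that by (cases Q) auto
  let ?I = "\<lambda>\<omega>. of_bool (stays h s n \<omega>) :: real"
  have i0: "integrable M (\<lambda>\<omega>. \<phi> (x + Y \<omega> (real (stop_index h s n \<omega>) * h)))"
    by (rule integrable_bounded[where B = B]) (auto simp: bd)
  have i1: "integrable M (\<lambda>\<omega>. ?I \<omega> * \<phi> (x + Y \<omega> (real (Suc n) * h)))"
    by (rule integrable_bounded[where B = B]) (auto intro!: bo bd B0 simp del: of_nat_Suc)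
  have i2: "integrable M (\<lambda>\<omega>. ?I \<omega> * \<phi> (x + Y \<omega> (real n * h)))"
    by (rule integrable_bounded[where B = B]) (auto intro!: bo bd B0)
  have i3: "integrable M (\<lambda>\<omega>. ?I \<omega> * P h \<phi> (x + Y \<omega> (real n * h)))"
    by (rule integrable_bounded[where B = B]) (use Pm in \<open>auto intro!: bo Pb B0\<close>)
  have i4: "integrable M ?I" by (rule integrable_bounded[where B = 1]) auto
  have "(\<integral>\<omega>. \<phi> (x + Y \<omega> (real (stop_index h s (Suc n) \<omega>) * h)) \<partial>M)
    = (\<integral>\<omega>. \<phi> (x + Y \<omega> (real (stop_index h s n \<omega>) * h)) + (?I \<omega> * \<phi> (x + Y \<omega> (real (Suc n) * h)) - ?I \<omega> * \<phi> (x + Y \<omega> (real n * h))) \<partial>M)"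
    by (intro Bochner_Integration.integral_cong) (auto simp: stop_index_Suc stop_index_stays)
  also have "\<dots> = (\<integral>\<omega>. \<phi> (x + Y \<omega> (real (stop_index h s n \<omega>) * h)) \<partial>M)
      + ((\<integral>\<omega>. ?I \<omega> * P h \<phi> (x + Y \<omega> (real n * h)) \<partial>M) - (\<integral>\<omega>. ?I \<omega> * \<phi> (x + Y \<omega> (real n * h)) \<partial>M))"
    using i0 i1 i2 unfolding markov_step[OF h \<phi> bd, symmetric] by simp
  also have "(\<integral>\<omega>. ?I \<omega> * P h \<phi> (x + Y \<omega> (real n * h)) \<partial>M) - (\<integral>\<omega>. ?I \<omega> * \<phi> (x + Y \<omega> (real n * h)) \<partial>M)
      = (\<integral>\<omega>. ?I \<omega> * P h \<phi> (x + Y \<omega> (real n * h)) - ?I \<omega> * \<phi> (x + Y \<omega> (real n * h)) \<partial>M)"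
    using i3 i2 by simp
  also have "\<dots> \<le> (\<integral>\<omega>. c * ?I \<omega> \<partial>M)"
  proof (rule integral_mono)
    fix \<omega>
    show "?I \<omega> * P h \<phi> (x + Y \<omega> (real n * h)) - ?I \<omega> * \<phi> (x + Y \<omega> (real n * h)) \<le> c * ?I \<omega>"
      using c[of "Y \<omega> (real n * h)"] by (cases "stays h s n \<omega>") (auto simp: stays_def)
  qed (use i2 i3 i4 in auto)
  finally have "(\<integral>\<omega>. \<phi> (x + Y \<omega> (real (stop_index h s (Suc n) \<omega>) * h)) \<partial>M) - \<phi> x
     \<le> c * (\<integral>\<omega>. real (stop_index h s n \<omega>) \<partial>M) + c * (\<integral>\<omega>. ?I \<omega> \<partial>M)" using Suc by simp
  also have "\<dots> = c * (\<integral>\<omega>. real (stop_index h s n \<omega>) + ?I \<omega> \<partial>M)"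
    using stop_index_integrable i4 by (simp add: distrib_left)
  also have "(\<integral>\<omega>. real (stop_index h s n \<omega>) + ?I \<omega> \<partial>M) = (\<integral>\<omega>. real (stop_index h s (Suc n) \<omega>) \<partial>M)"
    by (intro Bochner_Integration.integral_cong) (auto simp: stop_index_Suc stop_index_stays)
  finally show ?case .
qed

text \<open>If the exponent vanished, the closed set where the cosine is 1 would have full measure,
  since \<open>N\<close> is positive off 0. It would then be the whole space, but it misses
  \<open>(pi / (\<xi> \<bullet> \<xi>)) *\<^sub>R \<xi>\<close>.\<close>

lemma Psi_pos: assumes "\<xi> \<noteq> 0" shows "0 < Psi \<xi>"
proof (rule ccontr)
  assume "\<not> 0 < Psi \<xi>"
  then have "Psi \<xi> = 0" using Psi_nonneg[of \<xi>] by simp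
  moreover have nn: "AE y in lborel. 0 \<le> (1 - cos (\<xi> \<bullet> y)) * N y" by (simp add: N_nonneg)
  ultimately have "AE y in lborel. (1 - cos (\<xi> \<bullet> y)) * N y = 0"
    unfolding Psi_def using integral_nonneg_eq_0_iff_AE[OF Psi_integrable nn] by simp
  then have "AE y in lborel. y \<in> {y. cos (\<xi> \<bullet> y) = 1}"
  proof (rule AE_mp, intro AE_I2 impI)
    fix y :: 'a assume "(1 - cos (\<xi> \<bullet> y)) * N y = 0"
    then show "y \<in> {y. cos (\<xi> \<bullet> y) = 1}" using nu_pos[of "norm y"] by (cases "y = 0") (auto simp: N_eq)
  qed
  then have "AE y in lebesgue. y \<in> {y. cos (\<xi> \<bullet> y) = 1}" by (rule AE_completion)
  moreover have "closed {y. cos (\<xi> \<bullet> y) = 1}" by (intro closed_Collect_eq continuous_intros)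
  ultimately have "(pi / (\<xi> \<bullet> \<xi>)) *\<^sub>R \<xi> \<in> {y. cos (\<xi> \<bullet> y) = 1}"
    by (rule mem_closed_if_AE_lebesgue[rotated])
  then show False using assms by simp
qed

text \<open>The test function is a cosine with frequency 1/s along one axis. On the ball of radius s
  it stays above cos 1 > 0, so each step lowers its mean by a definite multiple of the step length,
  while its mean can change by at most 2 in total.\<close>

lemma stop_index_bound:
  assumes s: "0 < s"
  obtains B where "\<And>n j. (\<integral>\<omega>. real (stop_index (1 / 2 ^ j) s n \<omega>) / 2 ^ j \<partial>M) \<le> B"
proof -
  obtain b :: 'a where b: "b \<in> Basis" using nonempty_Basis by blast
  define \<xi> where "\<xi> = (1 / s) *\<^sub>R b"
  define p where "p = 1 - exp (- Psi \<xi>)"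
  have "\<xi> \<noteq> 0" using b s by (auto simp: \<xi>_def nonzero_Basis)
  then have p: "0 < p" using Psi_pos by (simp add: p_def)
  have c1: "0 < cos (1::real)" using cos_gt_zero[of 1] pi_half_gt_zero pi_gt3 by simp
  show ?thesis
  proof (rule that[of "2 / (p * cos 1)"])
    fix n j :: nat
    let ?h = "1 / 2 ^ j :: real"
    let ?K = "\<integral>\<omega>. real (stop_index ?h s n \<omega>) \<partial>M"
    let ?q = "1 - exp (- ?h * Psi \<xi>)"
    have h: "0 < ?h" "?h \<le> 1" by (auto simp: field_simps one_le_power)
    \<comment> \<open>By convexity of exp the decay over a step of length hh is at least hh times
      the decay over a unit step; this makes the bound uniform in the mesh.\<close>
    have "hh * p \<le> 1 - exp (- hh * Psi \<xi>)" if "0 \<le> hh" "hh \<le> 1" for hh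
    proof -
      have cv: "convex_on UNIV (exp :: real \<Rightarrow> real)" by (rule exp_convex)
      have "exp ((1 - hh) *\<^sub>R 0 + hh *\<^sub>R (- Psi \<xi>)) \<le> (1 - hh) * exp 0 + hh * exp (- Psi \<xi>)"
        by (rule convex_onD[OF cv]) (use that in auto)
      then show ?thesis by (simp add: p_def algebra_simps)
    qed
    from this[of ?h] have q: "?h * p \<le> ?q" using h by simp
    have q0: "0 \<le> ?q" using Psi_nonneg[of \<xi>] by simp
    have "(\<integral>\<omega>. cos (\<xi> \<bullet> (0 + Y \<omega> (real (stop_index ?h s n \<omega>) * ?h))) \<partial>M) - cos (\<xi> \<bullet> 0) \<le> (- (?q * cos 1)) * ?K"
    proof (rule discrete_dynkin[where B = 1])
      fix y :: 'a assume y: "norm y \<le> s"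
      have "\<bar>y \<bullet> b\<bar> \<le> s" using Basis_le_norm[OF b, of y] y by linarith
      then have "\<bar>\<xi> \<bullet> y\<bar> \<le> 1" using s by (simp add: \<xi>_def inner_commute[of b y] abs_mult)
      then have "cos 1 \<le> cos (\<xi> \<bullet> y)" using cos_monotone_0_pi_le[of "\<bar>\<xi> \<bullet> y\<bar>" 1] pi_gt3 by simp
      then have "?q * cos 1 \<le> ?q * cos (\<xi> \<bullet> y)" using q0 by (intro mult_left_mono)
      then show "P ?h (\<lambda>y. cos (\<xi> \<bullet> y)) (0 + y) - cos (\<xi> \<bullet> (0 + y)) \<le> - (?q * cos 1)"
        using P_cos[OF less_imp_le[OF h(1)], of \<xi> y] by (simp add: algebra_simps)
    qed (use h in auto)
    moreover have "-1 \<le> (\<integral>\<omega>. cos (\<xi> \<bullet> (0 + Y \<omega> (real (stop_index ?h s n \<omega>) * ?h))) \<partial>M)"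
    proof -
      have "(\<integral>\<omega>. -1 \<partial>M) \<le> (\<integral>\<omega>. cos (\<xi> \<bullet> (0 + Y \<omega> (real (stop_index ?h s n \<omega>) * ?h))) \<partial>M)"
        by (rule integral_mono) (auto intro!: integrable_bounded[where B = 1])
      then show ?thesis by (simp add: prob_space)
    qed
    ultimately have "?q * cos 1 * ?K \<le> 2" by simp
    moreover have "?h * p * cos 1 * ?K \<le> ?q * cos 1 * ?K"
      using q c1 by (intro mult_right_mono) auto
    ultimately have "(p * cos 1) * (?h * ?K) \<le> 2" by (simp add: ac_simps)
    then have "?h * ?K \<le> 2 / (p * cos 1)" using p c1 by (simp add: pos_le_divide_eq mult.commute)
    then show "(\<integral>\<omega>. real (stop_index ?h s n \<omega>) / 2 ^ j \<partial>M) \<le> 2 / (p * cos 1)" by simp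
  qed
qed

end

section \<open>The exit time as a limit along dyadic grids\<close>

context levy_setting begin

definition dyadic_exit :: "real \<Rightarrow> nat \<Rightarrow> 'w \<Rightarrow> real" where
  "dyadic_exit s j \<omega> = real (LEAST i. s < norm (Y \<omega> (real i * (1 / 2 ^ j)))) * (1 / 2 ^ j)"

definition leaves :: "real \<Rightarrow> 'w \<Rightarrow> bool" where
  "leaves s \<omega> \<longleftrightarrow> \<omega> \<in> space M \<and> (\<forall>j::nat. \<exists>i::nat. s < norm (Y \<omega> (real i * (1 / 2 ^ j))))"

text \<open>A measurable version of the first time at which the norm exceeds s, see
  \<open>sig_eq_Inf\<close>; only countably many times enter. For s > 0 the default 0 concerns a
  null set by \<open>AE_leaves\<close>.\<close>

definition sig :: "real \<Rightarrow> 'w \<Rightarrow> real" where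
  "sig s \<omega> = (if leaves s \<omega> then INF j. dyadic_exit s j \<omega> else 0)"

lemma dyadic_exit_measurable[measurable]: "dyadic_exit s j \<in> borel_measurable M"
proof -
  have "(\<lambda>\<omega>. LEAST i. s < norm (Y \<omega> (real i * (1 / 2 ^ j)))) \<in> measurable M (count_space UNIV)" by measurable
  then show ?thesis unfolding dyadic_exit_def by measurable
qed

lemma dyadic_position_measurable[measurable]: "(\<lambda>\<omega>. Y \<omega> (dyadic_exit s j \<omega>)) \<in> borel_measurable M"
proof -
  have "(\<lambda>\<omega>. LEAST i. s < norm (Y \<omega> (real i * (1 / 2 ^ j)))) \<in> measurable M (count_space UNIV)" by measurable
  then show ?thesis unfolding dyadic_exit_def
    by (rule measurable_compose_countable[where f = "\<lambda>i \<omega>. Y \<omega> (real i * (1 / 2 ^ j))", rotated]) measurable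
qed

lemma leaves_measurable[measurable]: "Measurable.pred M (leaves s)"
  unfolding leaves_def by measurable

lemma dyadic_exit_nonneg: "0 \<le> dyadic_exit s j \<omega>"
  by (simp add: dyadic_exit_def)

lemma dyadic_exit_out: "leaves s \<omega> \<Longrightarrow> s < norm (Y \<omega> (dyadic_exit s j \<omega>))"
  unfolding dyadic_exit_def leaves_def
  using LeastI_ex[of "\<lambda>i::nat. s < norm (Y \<omega> (real i * (1 / 2 ^ j)))"] by blast

lemma dyadic_exit_le: "s < norm (Y \<omega> (real i * (1 / 2 ^ j))) \<Longrightarrow> dyadic_exit s j \<omega> \<le> real i * (1 / 2 ^ j)"
  unfolding dyadic_exit_def using Least_le[of "\<lambda>i::nat. s < norm (Y \<omega> (real i * (1 / 2 ^ j)))" i]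
  by (intro mult_right_mono) auto

lemma dyadic_exit_decseq: assumes "leaves s \<omega>" shows "decseq (\<lambda>j. dyadic_exit s j \<omega>)"
proof (rule decseq_SucI)
  fix j
  define q where "q = (LEAST i. s < norm (Y \<omega> (real i * (1 / 2 ^ j))))"
  have T: "dyadic_exit s j \<omega> = real (2 * q) * (1 / 2 ^ Suc j)" by (simp add: dyadic_exit_def q_def)
  show "dyadic_exit s (Suc j) \<omega> \<le> dyadic_exit s j \<omega>"
    using dyadic_exit_out[OF assms, of j] dyadic_exit_le[of s \<omega> "2 * q" "Suc j"] unfolding T by blast
qed

lemma dyadic_exit_lim: assumes "leaves s \<omega>" shows "(\<lambda>j. dyadic_exit s j \<omega>) \<longlonglongrightarrow> sig s \<omega>"
proof -
  have "bdd_below (range (\<lambda>j. dyadic_exit s j \<omega>))"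
    by (rule bdd_belowI2[where m = 0]) (rule dyadic_exit_nonneg)
  from LIMSEQ_decseq_INF[OF this dyadic_exit_decseq[OF assms]] show ?thesis using assms by (simp add: sig_def)
qed

lemma sig_le_dyadic: "leaves s \<omega> \<Longrightarrow> sig s \<omega> \<le> dyadic_exit s j \<omega>"
  unfolding sig_def by (auto intro!: cINF_lower bdd_belowI2[where m = 0] simp: dyadic_exit_nonneg)

lemma sig_nonneg: "0 \<le> sig s \<omega>"
  unfolding sig_def by (auto intro!: cINF_greatest simp: dyadic_exit_nonneg)

lemma sig_measurable[measurable]: "sig s \<in> borel_measurable M"
proof (rule borel_measurable_LIMSEQ_real)
  show "(\<lambda>\<omega>. if leaves s \<omega> then dyadic_exit s j \<omega> else 0) \<in> borel_measurable M" for j by measurable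
  show "(\<lambda>j. if leaves s \<omega> then dyadic_exit s j \<omega> else 0) \<longlonglongrightarrow> sig s \<omega>" for \<omega>
    using dyadic_exit_lim[of s \<omega>] by (cases "leaves s \<omega>") (auto simp: sig_def)
qed

text \<open>The dyadic exit times approach \<open>sig s \<omega>\<close> from the right, so right
  continuity of the path gives the limit.\<close>

lemma position_lim: assumes l: "leaves s \<omega>" shows "(\<lambda>j. Y \<omega> (dyadic_exit s j \<omega>)) \<longlonglongrightarrow> Y \<omega> (sig s \<omega>)"
proof -
  have \<omega>: "\<omega> \<in> space M" using l by (simp add: leaves_def)
  have "continuous (at (sig s \<omega>) within {sig s \<omega>..}) (Y \<omega>)"
  proof -
    have "at (sig s \<omega>) within {sig s \<omega>..} = at_right (sig s \<omega>)"
      unfolding at_within_def by (rule arg_cong[where f = "\<lambda>S. inf _ (principal S)"]) auto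
    then show ?thesis using Y_right_cont[OF \<omega> sig_nonneg[of s \<omega>]] by simp
  qed
  then show ?thesis
    by (rule continuous_within_tendsto_compose') (use sig_le_dyadic[OF l] dyadic_exit_lim[OF l] in auto)
qed

lemma exit_position_measurable[measurable]: "(\<lambda>\<omega>. Y \<omega> (sig s \<omega>)) \<in> borel_measurable M"
proof (rule borel_measurable_LIMSEQ_metric)
  show "(\<lambda>\<omega>. if leaves s \<omega> then Y \<omega> (dyadic_exit s j \<omega>) else 0) \<in> borel_measurable M" for j by measurable
  show "(\<lambda>j. if leaves s \<omega> then Y \<omega> (dyadic_exit s j \<omega>) else 0) \<longlonglongrightarrow> Y \<omega> (sig s \<omega>)" if "\<omega> \<in> space M" for \<omega>
    using position_lim[of s \<omega>] Y_0[OF that] by (cases "leaves s \<omega>") (auto simp: sig_def)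
qed

lemma exit_position_far: assumes l: "leaves s \<omega>" shows "s \<le> norm (Y \<omega> (sig s \<omega>))"
  by (rule LIMSEQ_le_const[OF tendsto_norm[OF position_lim[OF l]]])
    (use dyadic_exit_out[OF l] less_imp_le in blast)

text \<open>On the event of never leaving along a grid the capped index equals its cap n, so n times
  the probability of this event stays bounded by \<open>stop_index_bound\<close>.\<close>

lemma AE_leaves: assumes s: "0 < s" shows "AE \<omega> in M. leaves s \<omega>"
proof -
  obtain B where B: "\<And>n j. (\<integral>\<omega>. real (stop_index (1 / 2 ^ j) s n \<omega>) / 2 ^ j \<partial>M) \<le> B"
    using stop_index_bound[OF s] by blast
  have "AE \<omega> in M. \<exists>i::nat. s < norm (Y \<omega> (real i * (1 / 2 ^ j)))" for j :: nat
  proof -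
    let ?Q = "{\<omega>\<in>space M. \<forall>i::nat. norm (Y \<omega> (real i * (1 / 2 ^ j))) \<le> s}"
    have Q: "?Q \<in> events" by measurable
    have le: "real n * prob ?Q \<le> B * 2 ^ j" for n
    proof -
      have "real n * prob ?Q = (\<integral>\<omega>. real n * indicator ?Q \<omega> \<partial>M)" using Q by simp
      also have "\<dots> \<le> (\<integral>\<omega>. real (stop_index (1 / 2 ^ j) s n \<omega>) \<partial>M)"
      proof (rule integral_mono)
        show "integrable M (\<lambda>\<omega>. real n * indicator ?Q \<omega>)"
          using Q by (intro integrable_mult_right) (simp add: integrable_indicator_iff emeasure_eq_measure)
        fix \<omega>
        show "real n * indicator ?Q \<omega> \<le> real (stop_index (1 / 2 ^ j) s n \<omega>)"
        proof (cases "\<omega> \<in> ?Q")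
          case True
          then have "stays (1 / 2 ^ j) s n \<omega>" by (auto simp: stays_def)
          then show ?thesis using True by (simp add: stop_index_stays)
        qed simp
      qed (rule stop_index_integrable)
      also have "\<dots> \<le> B * 2 ^ j" using B[of j n] by (simp add: field_simps)
      finally show ?thesis .
    qed
    have "prob ?Q = 0"
    proof (rule ccontr)
      assume "prob ?Q \<noteq> 0"
      then have p: "0 < prob ?Q" using measure_nonneg[of M ?Q] by linarith
      obtain n :: nat where "B * 2 ^ j / prob ?Q < real n" using reals_Archimedean2 by blast
      then show False using le[of n] p by (simp add: pos_divide_less_eq)
    qed
    then have "AE \<omega> in M. \<omega> \<notin> ?Q" using Q by (simp add: prob_eq_0)
    then show ?thesis by (rule AE_mp) (auto simp: not_le)
  qed
  then have "AE \<omega> in M. \<forall>j::nat. \<exists>i::nat. s < norm (Y \<omega> (real i * (1 / 2 ^ j)))"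
    unfolding AE_all_countable by blast
  then show ?thesis using AE_space by eventually_elim (simp add: leaves_def)
qed

lemma stop_index_lim:
  assumes l: "leaves s \<omega>"
  shows "eventually (\<lambda>n. real (stop_index (1 / 2 ^ j) s n \<omega>) * (1 / 2 ^ j) = dyadic_exit s j \<omega>) sequentially"
proof -
  let ?P = "\<lambda>i::nat. s < norm (Y \<omega> (real i * (1 / 2 ^ j)))"
  have q: "?P (LEAST i. ?P i)" by (rule LeastI_ex) (use l in \<open>auto simp only: leaves_def\<close>)
  have "stop_index (1 / 2 ^ j) s n \<omega> = (LEAST i. ?P i)" if "(LEAST i. ?P i) \<le> n" for n
    unfolding stop_index_def
  proof (rule Least_equality)
    show "(LEAST i. ?P i) = n \<or> ?P (LEAST i. ?P i)" using q by simp
    show "(LEAST i. ?P i) \<le> i" if "i = n \<or> ?P i" for i using that \<open>(LEAST i. ?P i) \<le> n\<close> by (auto intro: Least_le)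
  qed
  then show ?thesis unfolding dyadic_exit_def eventually_sequentially by auto
qed

lemma dyadic_exit_expectation:
  assumes s: "0 < s"
  shows "integrable M (dyadic_exit s j)"
    and "(\<lambda>n. \<integral>\<omega>. real (stop_index (1 / 2 ^ j) s n \<omega>) * (1 / 2 ^ j) \<partial>M) \<longlonglongrightarrow> (\<integral>\<omega>. dyadic_exit s j \<omega> \<partial>M)"
proof -
  let ?f = "\<lambda>n \<omega>. real (stop_index (1 / 2 ^ j) s n \<omega>) * (1 / 2 ^ j)"
  obtain B where B: "\<And>n j. (\<integral>\<omega>. real (stop_index (1 / 2 ^ j) s n \<omega>) / 2 ^ j \<partial>M) \<le> B"
    using stop_index_bound[OF s] by blast
  have i: "integrable M (?f n)" for n using stop_index_integrable by simp
  have le: "?f n \<omega> \<le> ?f (Suc n) \<omega>" for n \<omega>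
    using stop_index_le[of "1 / 2 ^ j" s n \<omega>] by (intro mult_right_mono) (auto simp: stop_index_Suc)
  have inc: "incseq (\<lambda>n. ?f n \<omega>)" for \<omega> using le by (rule incseq_SucI)
  have incI: "incseq (\<lambda>n. \<integral>\<omega>. ?f n \<omega> \<partial>M)" using i le by (intro incseq_SucI integral_mono) auto
  have "(\<integral>\<omega>. ?f n \<omega> \<partial>M) \<le> B" for n using B[of j n] by simp
  then obtain x where x: "(\<lambda>n. \<integral>\<omega>. ?f n \<omega> \<partial>M) \<longlonglongrightarrow> x"
    using incseq_convergent[OF incI] by blast
  have lim: "AE \<omega> in M. (\<lambda>n. ?f n \<omega>) \<longlonglongrightarrow> dyadic_exit s j \<omega>"
    using AE_leaves[OF s] by eventually_elim (rule tendsto_eventually[OF stop_index_lim])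
  have mono: "AE \<omega> in M. mono (\<lambda>n. ?f n \<omega>)" using inc by simp
  show "integrable M (dyadic_exit s j)"
    by (rule integrable_monotone_convergence[OF i mono lim x]) measurable
  have "(\<integral>\<omega>. dyadic_exit s j \<omega> \<partial>M) = x"
    by (rule integral_monotone_convergence[OF i mono lim x]) measurable
  then show "(\<lambda>n. \<integral>\<omega>. ?f n \<omega> \<partial>M) \<longlonglongrightarrow> (\<integral>\<omega>. dyadic_exit s j \<omega> \<partial>M)" using x by simp
qed

lemma dyadic_dynkin:
  assumes s: "0 < s" and \<phi>[measurable]: "\<phi> \<in> borel_measurable borel" and bd: "\<And>y. \<bar>\<phi> y\<bar> \<le> B"
    and c: "\<And>y. norm y \<le> s \<Longrightarrow> P (1 / 2 ^ j) \<phi> (x + y) - \<phi> (x + y) \<le> c * (1 / 2 ^ j)"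
  shows "(\<integral>\<omega>. \<phi> (x + Y \<omega> (dyadic_exit s j \<omega>)) \<partial>M) - \<phi> x \<le> c * (\<integral>\<omega>. dyadic_exit s j \<omega> \<partial>M)"
proof (rule LIMSEQ_le)
  let ?h = "1 / 2 ^ j :: real"
  show "(\<lambda>n. c * (\<integral>\<omega>. real (stop_index ?h s n \<omega>) * ?h \<partial>M)) \<longlonglongrightarrow> c * (\<integral>\<omega>. dyadic_exit s j \<omega> \<partial>M)"
    by (intro tendsto_intros dyadic_exit_expectation s)
  have "(\<lambda>n. \<integral>\<omega>. \<phi> (x + Y \<omega> (real (stop_index ?h s n \<omega>) * ?h)) \<partial>M) \<longlonglongrightarrow> (\<integral>\<omega>. \<phi> (x + Y \<omega> (dyadic_exit s j \<omega>)) \<partial>M)"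
  proof (rule integral_dominated_convergence[where w = "\<lambda>_. B"])
    show "AE \<omega> in M. (\<lambda>n. \<phi> (x + Y \<omega> (real (stop_index ?h s n \<omega>) * ?h))) \<longlonglongrightarrow> \<phi> (x + Y \<omega> (dyadic_exit s j \<omega>))"
      using AE_leaves[OF s]
    proof eventually_elim
      case (elim \<omega>)
      show ?case by (rule tendsto_eventually, rule eventually_mono[OF stop_index_lim[OF elim, of j]]) simp
    qed
  qed (auto simp: bd)
  then show "(\<lambda>n. (\<integral>\<omega>. \<phi> (x + Y \<omega> (real (stop_index ?h s n \<omega>) * ?h)) \<partial>M) - \<phi> x) \<longlonglongrightarrow> (\<integral>\<omega>. \<phi> (x + Y \<omega> (dyadic_exit s j \<omega>)) \<partial>M) - \<phi> x"
    by (intro tendsto_intros)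
  have "(\<integral>\<omega>. \<phi> (x + Y \<omega> (real (stop_index ?h s n \<omega>) * ?h)) \<partial>M) - \<phi> x \<le> c * (\<integral>\<omega>. real (stop_index ?h s n \<omega>) * ?h \<partial>M)" for n
    using discrete_dynkin[OF _ \<phi> bd c, of s n] by simp
  then show "\<exists>N. \<forall>n\<ge>N. (\<integral>\<omega>. \<phi> (x + Y \<omega> (real (stop_index ?h s n \<omega>) * ?h)) \<partial>M) - \<phi> x \<le> c * (\<integral>\<omega>. real (stop_index ?h s n \<omega>) * ?h \<partial>M)"
    by blast
qed

definition mean_exit :: "real \<Rightarrow> real" where
  "mean_exit s = (\<integral>\<omega>. sig s \<omega> \<partial>M)"

lemma sig_integrable: assumes s: "0 < s" shows "integrable M (sig s)"
proof (rule Bochner_Integration.integrable_bound[OF dyadic_exit_expectation(1)[OF s, of 0]])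
  show "AE \<omega> in M. norm (sig s \<omega>) \<le> norm (dyadic_exit s 0 \<omega>)"
    using AE_leaves[OF s] by eventually_elim (simp add: sig_nonneg sig_le_dyadic dyadic_exit_nonneg)
qed measurable

lemma mean_exit_nonneg: "0 \<le> mean_exit s"
  unfolding mean_exit_def by (intro integral_nonneg_AE AE_I2 sig_nonneg)

text \<open>A one-sided form suffices because it applies to the negative of the test function as
  well. The generator limit is required along h = 2^-n and uniformly in space, since the mesh of the
  exit times and the step of the semigroup shrink together.\<close>

lemma dynkin_upper:
  assumes s: "0 < s" and \<phi>: "continuous_on UNIV \<phi>" and bd: "\<And>y. \<bar>\<phi> y\<bar> \<le> B"
    and gen: "\<And>n y. \<bar>(P (1 / 2 ^ n) \<phi> y - \<phi> y) / (1 / 2 ^ n) - \<psi> y\<bar> \<le> \<epsilon> n" and e: "\<epsilon> \<longlonglongrightarrow> 0"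
    and m: "\<And>y. norm y \<le> s \<Longrightarrow> \<psi> (x + y) \<le> m"
  shows "(\<integral>\<omega>. \<phi> (x + Y \<omega> (sig s \<omega>)) \<partial>M) - \<phi> x \<le> m * mean_exit s"
proof (rule LIMSEQ_le)
  have \<phi>m[measurable]: "\<phi> \<in> borel_measurable borel" using \<phi> by (rule borel_measurable_continuous_onI)
  have "(\<lambda>j. \<integral>\<omega>. \<phi> (x + Y \<omega> (dyadic_exit s j \<omega>)) \<partial>M) \<longlonglongrightarrow> (\<integral>\<omega>. \<phi> (x + Y \<omega> (sig s \<omega>)) \<partial>M)"
  proof (rule integral_dominated_convergence[where w = "\<lambda>_. B"])
    show "AE \<omega> in M. (\<lambda>j. \<phi> (x + Y \<omega> (dyadic_exit s j \<omega>))) \<longlonglongrightarrow> \<phi> (x + Y \<omega> (sig s \<omega>))"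
      using AE_leaves[OF s]
    proof eventually_elim
      case (elim \<omega>)
      have "isCont \<phi> (x + Y \<omega> (sig s \<omega>))" using \<phi> by (simp add: continuous_on_eq_continuous_at)
      then show ?case by (rule isCont_tendsto_compose) (intro tendsto_intros position_lim elim)
    qed
  qed (auto simp: bd)
  then show "(\<lambda>j. (\<integral>\<omega>. \<phi> (x + Y \<omega> (dyadic_exit s j \<omega>)) \<partial>M) - \<phi> x) \<longlonglongrightarrow> (\<integral>\<omega>. \<phi> (x + Y \<omega> (sig s \<omega>)) \<partial>M) - \<phi> x"
    by (intro tendsto_intros)
  have "(\<lambda>j. \<integral>\<omega>. dyadic_exit s j \<omega> \<partial>M) \<longlonglongrightarrow> mean_exit s"
    unfolding mean_exit_def
  proof (rule integral_dominated_convergence[where w = "dyadic_exit s 0"])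
    show "integrable M (dyadic_exit s 0)" by (rule dyadic_exit_expectation(1)[OF s])
    show "AE \<omega> in M. (\<lambda>j. dyadic_exit s j \<omega>) \<longlonglongrightarrow> sig s \<omega>"
      using AE_leaves[OF s] by eventually_elim (rule dyadic_exit_lim)
    show "AE \<omega> in M. norm (dyadic_exit s j \<omega>) \<le> dyadic_exit s 0 \<omega>" for j
      using AE_leaves[OF s] by eventually_elim (use decseqD[OF dyadic_exit_decseq, of _ _ 0 j] dyadic_exit_nonneg in auto)
  qed measurable
  then show "(\<lambda>j. (m + \<epsilon> j) * (\<integral>\<omega>. dyadic_exit s j \<omega> \<partial>M)) \<longlonglongrightarrow> m * mean_exit s"
    using tendsto_mult[OF tendsto_add[OF tendsto_const[of m] e]] by simp
  have "(\<integral>\<omega>. \<phi> (x + Y \<omega> (dyadic_exit s j \<omega>)) \<partial>M) - \<phi> x \<le> (m + \<epsilon> j) * (\<integral>\<omega>. dyadic_exit s j \<omega> \<partial>M)" for j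
  proof (rule dyadic_dynkin[OF s \<phi>m bd])
    fix y :: 'a assume y: "norm y \<le> s"
    have h: "0 < 1 / (2::real) ^ j" by simp
    have "(P (1 / 2 ^ j) \<phi> (x + y) - \<phi> (x + y)) / (1 / 2 ^ j) \<le> m + \<epsilon> j"
      using gen[of j "x + y"] m[OF y] by linarith
    then show "P (1 / 2 ^ j) \<phi> (x + y) - \<phi> (x + y) \<le> (m + \<epsilon> j) * (1 / 2 ^ j)"
      using h by (simp only: pos_divide_le_eq)
  qed
  then show "\<exists>N. \<forall>j\<ge>N. (\<integral>\<omega>. \<phi> (x + Y \<omega> (dyadic_exit s j \<omega>)) \<partial>M) - \<phi> x \<le> (m + \<epsilon> j) * (\<integral>\<omega>. dyadic_exit s j \<omega> \<partial>M)"
    by blast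
qed

text \<open>If the norm exceeds s at time t, then by right continuity it does so on an interval to
  the right of t, and such an interval contains points of every sufficiently fine grid close to
  t.\<close>

lemma sig_eq_Inf:
  assumes l: "leaves s \<omega>" and s: "0 < s"
  shows "sig s \<omega> = Inf {t. 0 < t \<and> s < norm (Y \<omega> t)}" and "{t. 0 < t \<and> s < norm (Y \<omega> t)} \<noteq> {}"
proof -
  let ?S = "{t. 0 < t \<and> s < norm (Y \<omega> t)}"
  have \<omega>: "\<omega> \<in> space M" using l by (simp add: leaves_def)
  have inS: "dyadic_exit s j \<omega> \<in> ?S" for j
  proof -
    have "dyadic_exit s j \<omega> \<noteq> 0" using dyadic_exit_out[OF l, of j] Y_0[OF \<omega>] s by auto
    then show ?thesis using dyadic_exit_nonneg[of s j \<omega>] dyadic_exit_out[OF l, of j] by simp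
  qed
  then show ne: "?S \<noteq> {}" by blast
  have bb: "bdd_below ?S" by (rule bdd_belowI[of _ 0]) auto
  have "Inf ?S \<le> sig s \<omega>"
    by (rule LIMSEQ_le_const[OF dyadic_exit_lim[OF l]]) (use cInf_lower[OF inS bb] in blast)
  moreover have "sig s \<omega> \<le> Inf ?S"
  proof (rule cInf_greatest[OF ne])
    fix t assume t: "t \<in> ?S"
    show "sig s \<omega> \<le> t"
    proof (rule field_le_epsilon)
      fix e :: real assume e: "0 < e"
      have "(Y \<omega> \<longlongrightarrow> Y \<omega> t) (at_right t)" using Y_right_cont[OF \<omega>, of t] t by (simp add: continuous_within)
      then have "eventually (\<lambda>u. s < norm (Y \<omega> u)) (at_right t)"
        using t by (intro order_tendstoD(1)[OF tendsto_norm]) auto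
      then obtain d where d: "t < d" "\<And>u. t < u \<Longrightarrow> u < d \<Longrightarrow> s < norm (Y \<omega> u)"
        unfolding eventually_at_right_field by blast
      define g where "g = min e (d - t) / 2"
      have g: "0 < g" using e d by (simp add: g_def)
      obtain j :: nat where j: "1 / 2 ^ j < g"
        using real_arch_pow_inv[OF g, of "1/2"] by (auto simp: power_one_over)
      define i where "i = nat \<lfloor>t * 2 ^ j\<rfloor> + 1"
      have "real i = of_int \<lfloor>t * 2 ^ j\<rfloor> + 1" using t by (simp add: i_def)
      then have i: "t * 2 ^ j < real i" "real i \<le> t * 2 ^ j + 1" by linarith+
      then have u: "t < real i * (1 / 2 ^ j)" "real i * (1 / 2 ^ j) \<le> t + 1 / 2 ^ j" by (auto simp: field_simps)
      have "g \<le> (d - t) / 2" "g \<le> e / 2" by (auto simp: g_def)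
      then have "v < d" "v \<le> t + e" if "v \<le> t + w" "w < g" for v w using that d(1) e by simp_all
      from this[OF u(2) j] have ud: "real i * (1 / 2 ^ j) < d" and le: "real i * (1 / 2 ^ j) \<le> t + e" .
      from ud have "s < norm (Y \<omega> (real i * (1 / 2 ^ j)))" using d(2) u by blast
      from dyadic_exit_le[OF this] sig_le_dyadic[OF l, of j] le show "sig s \<omega> \<le> t + e" by linarith
    qed
  qed
  ultimately show "sig s \<omega> = Inf ?S" by simp
qed

lemma leaves_mono: "leaves s \<omega> \<Longrightarrow> s' \<le> s \<Longrightarrow> leaves s' \<omega>"
  unfolding leaves_def by (meson le_less_trans)

lemma sig_mono:
  assumes "leaves s \<omega>" "0 < s'" "s' \<le> s"
  shows "sig s' \<omega> \<le> sig s \<omega>"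
  using assms sig_eq_Inf[OF leaves_mono[OF assms(1,3)] assms(2)] sig_eq_Inf[OF assms(1)]
  by (auto intro!: cInf_superset_mono bdd_belowI[of _ 0])

text \<open>For a fixed radius the exit time from the open ball need not be measurable, but it lies between
  \<^term>\<open>sig s'\<close> and \<^term>\<open>sig s\<close> for \<^term>\<open>s' < s\<close>, hence equals \<^term>\<open>sig s\<close> almost surely wherever the
  monotone function \<^term>\<open>mean_exit\<close> is continuous.\<close>

lemma exit_time_eq_sig:
  obtains C where "countable C"
    and "\<And>s x. 0 < s \<Longrightarrow> s \<notin> C \<Longrightarrow> AE \<omega> in M. exit_time Y x (ball x s) \<omega> = sig s \<omega>"
proof
  let ?C = "{s\<in>{0<..}. \<not> continuous (at s within {0<..}) mean_exit}"
  have mono: "mean_exit s' \<le> mean_exit s" if "0 < s'" "s' \<le> s" for s' s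
    unfolding mean_exit_def
  proof (rule integral_mono_AE)
    show "AE \<omega> in M. sig s' \<omega> \<le> sig s \<omega>"
      using AE_leaves[of s] that by (auto elim!: eventually_mono intro!: sig_mono)
  qed (use that in \<open>auto intro!: sig_integrable\<close>)
  then show "countable ?C" by (intro mono_on_ctble_discont mono_onI) auto
  fix s :: real and x :: 'a assume s: "0 < s" and "s \<notin> ?C"
  then have cont: "isCont mean_exit s" by (simp add: at_within_open[of _ "{0<..}"])
  define r where "r n = s - s / 2 / (real n + 1)" for n :: nat
  have r: "0 < r n" "r n < s" for n
  proof -
    have "s / 2 / (real n + 1) \<le> s / 2 / 1" using s by (intro divide_left_mono) auto
    then show "0 < r n" using s unfolding r_def by linarith
    show "r n < s" using s by (simp add: r_def)
  qed
  have "(\<lambda>n. s / 2 / real (Suc n)) \<longlonglongrightarrow> 0" by (rule LIMSEQ_Suc[OF lim_const_over_n])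
  then have "r \<longlonglongrightarrow> s - 0" unfolding r_def by (intro tendsto_diff tendsto_const) (simp add: add.commute)
  then have "r \<longlonglongrightarrow> s" by simp
  from isCont_tendsto_compose[OF cont this] have lim: "(\<lambda>n. mean_exit (r n)) \<longlonglongrightarrow> mean_exit s" .
  \<comment> \<open>Continuity of \<open>mean_exit\<close> at s forces this infimum of gaps to have
    integral 0, and the exit time from the open ball lies inside every one of the gaps.\<close>
  define g where "g \<omega> = (INF n. \<bar>sig s \<omega> - sig (r n) \<omega>\<bar>)" for \<omega>
  have bb: "bdd_below (range (\<lambda>n. \<bar>sig s \<omega> - sig (r n) \<omega>\<bar>))" for \<omega> by (rule bdd_belowI2[where m = 0]) auto
  have g0: "0 \<le> g \<omega>" for \<omega> unfolding g_def by (rule cINF_greatest) auto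
  have gle: "g \<omega> \<le> \<bar>sig s \<omega> - sig (r n) \<omega>\<bar>" for n \<omega> unfolding g_def by (rule cINF_lower[OF bb]) auto
  have gm[measurable]: "g \<in> borel_measurable M" unfolding g_def
    by (rule borel_measurable_cINF) (use bb in auto)
  have id: "integrable M (\<lambda>\<omega>. \<bar>sig s \<omega> - sig (r n) \<omega>\<bar>)" for n
    using sig_integrable[OF s] sig_integrable[OF r(1)[of n]] by simp
  have gi: "integrable M g"
    by (rule Bochner_Integration.integrable_bound[OF id[of 0]]) (use g0 gle[of _ 0] in auto)
  have "(\<integral>\<omega>. g \<omega> \<partial>M) \<le> mean_exit s - mean_exit (r n)" for n
  proof -
    have "(\<integral>\<omega>. g \<omega> \<partial>M) \<le> (\<integral>\<omega>. \<bar>sig s \<omega> - sig (r n) \<omega>\<bar> \<partial>M)" by (rule integral_mono[OF gi id gle])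
    also have "\<dots> = (\<integral>\<omega>. sig s \<omega> - sig (r n) \<omega> \<partial>M)"
    proof (rule integral_cong_AE)
      show "AE \<omega> in M. \<bar>sig s \<omega> - sig (r n) \<omega>\<bar> = sig s \<omega> - sig (r n) \<omega>"
        using AE_leaves[OF s] by eventually_elim (use sig_mono[OF _ r(1), of s _ n] r(2)[of n] in auto)
    qed measurable
    also have "\<dots> = mean_exit s - mean_exit (r n)"
      unfolding mean_exit_def using sig_integrable[OF s] sig_integrable[OF r(1)[of n]] by simp
    finally show ?thesis .
  qed
  moreover have "(\<lambda>n. mean_exit s - mean_exit (r n)) \<longlonglongrightarrow> mean_exit s - mean_exit s" by (intro tendsto_intros lim)
  ultimately have "(\<integral>\<omega>. g \<omega> \<partial>M) \<le> 0" using LIMSEQ_le_const[of _ 0 "\<integral>\<omega>. g \<omega> \<partial>M"] by auto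
  moreover have "0 \<le> (\<integral>\<omega>. g \<omega> \<partial>M)" using g0 by (intro integral_nonneg_AE AE_I2) auto
  ultimately have "(\<integral>\<omega>. g \<omega> \<partial>M) = 0" by simp
  then have "AE \<omega> in M. g \<omega> = 0" using integral_nonneg_eq_0_iff_AE[OF gi] g0 by auto
  then show "AE \<omega> in M. exit_time Y x (ball x s) \<omega> = sig s \<omega>"
    using AE_leaves[OF s]
  proof eventually_elim
    case (elim \<omega>)
    let ?E = "{t. 0 < t \<and> s \<le> norm (Y \<omega> t)}"
    have ex: "exit_time Y x (ball x s) \<omega> = Inf ?E"
      unfolding exit_time_def by (rule arg_cong[where f = Inf]) (auto simp: dist_norm)
    note S = sig_eq_Inf[OF elim(2) s]
    have up: "Inf ?E \<le> sig s \<omega>"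
      unfolding S(1) by (rule cInf_superset_mono[OF S(2)]) (auto intro!: bdd_belowI[of _ 0])
    have low: "sig (r n) \<omega> \<le> Inf ?E" for n
    proof -
      have ln: "leaves (r n) \<omega>" using leaves_mono[OF elim(2), of "r n"] r(2)[of n] by simp
      have "?E \<noteq> {}" using S(2) by force
      then show ?thesis unfolding sig_eq_Inf(1)[OF ln r(1)]
        by (rule cInf_superset_mono) (use r(2)[of n] in \<open>auto intro!: bdd_belowI[of _ 0]\<close>)
    qed
    have "sig s \<omega> - Inf ?E \<le> g \<omega>" unfolding g_def
    proof (rule cINF_greatest)
      show "sig s \<omega> - Inf ?E \<le> \<bar>sig s \<omega> - sig (r n) \<omega>\<bar>" for n using low[of n] by linarith
    qed simp
    then show ?case using up elim(1) ex by simp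
  qed
qed

end

section \<open>Bump functions and their second differences\<close>

definition bump :: "real \<Rightarrow> 'a::euclidean_space \<Rightarrow> real" where
  "bump d x = (max 0 (1 - (norm x)\<^sup>2 / d\<^sup>2))\<^sup>2"

lemma bump_continuous: "continuous_on S (bump d)"
proof (cases "d = 0")
  case False then show ?thesis unfolding bump_def by (intro continuous_intros) auto
qed (simp add: bump_def[abs_def])

lemma bump_measurable[measurable]: "bump d \<in> borel_measurable borel"
  by (rule borel_measurable_continuous_onI[OF bump_continuous])

lemma bump_nonneg: "0 \<le> bump d x"
  by (simp add: bump_def)

lemma bump_le_1: "bump d x \<le> 1"
  unfolding bump_def by (rule power_le_one) auto

lemma bump_abs: "\<bar>bump d x\<bar> \<le> 1"
  using bump_nonneg[of d x] bump_le_1[of d x] by simp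

lemma bump_mult_le: "0 \<le> q \<Longrightarrow> \<bar>bump d x * q\<bar> \<le> (q::real)"
  using mult_right_mono[OF bump_abs, of q d x] by (simp add: abs_mult)

lemma bump_isCont: "isCont (bump d) (x::'a::euclidean_space)"
  using bump_continuous[of "UNIV :: 'a set" d] by (simp add: continuous_on_eq_continuous_at)

lemma gs_abs: "\<bar>gs k x\<bar> \<le> 1"
  using gs_bounds[of k x] by simp

lemma bump_0: "bump d 0 = 1"
  by (simp add: bump_def)

lemma bump_minus[simp]: "bump d (- x) = bump d x"
  by (simp add: bump_def)

lemma bump_commute: "bump d (x - y) = bump d (y - x)"
  by (simp add: bump_def norm_minus_commute)

lemma bump_out: "0 < d \<Longrightarrow> d \<le> norm x \<Longrightarrow> bump d x = 0"
proof -
  assume "0 < d" "d \<le> norm x"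
  then have "1 \<le> (norm x)\<^sup>2 / d\<^sup>2" by (simp add: power_mono)
  then show ?thesis by (simp add: bump_def)
qed

lemma bump_integrable: assumes d: "0 < d" shows "integrable lborel (bump d :: 'a::euclidean_space \<Rightarrow> real)"
proof (rule Bochner_Integration.integrable_bound)
  show "integrable lborel (indicator (cball (0::'a) d) :: 'a \<Rightarrow> real)"
    using emeasure_lborel_cball_finite by (simp add: integrable_indicator_iff)
  show "AE x in lborel. norm (bump d x) \<le> norm (indicator (cball (0::'a) d) x :: real)"
  proof (intro AE_I2)
    fix x :: 'a
    show "norm (bump d x) \<le> norm (indicator (cball (0::'a) d) x :: real)"
      using bump_out[OF d, of x] bump_abs[of d x] by (cases "norm x \<le> d") auto
  qed
qed simp

lemma bump_integral_pos: assumes d: "0 < d" shows "0 < (LBINT x. bump d (x::'a::euclidean_space))"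
proof (rule ccontr)
  assume "\<not> ?thesis"
  moreover have "0 \<le> (LBINT x. bump d (x::'a))" by (intro integral_nonneg_AE AE_I2 bump_nonneg)
  ultimately have "(LBINT x. bump d (x::'a)) = 0" by simp
  then have "AE x in lborel. bump d (x::'a) = 0"
    using integral_nonneg_eq_0_iff_AE[OF bump_integrable[OF d]] bump_nonneg by auto
  then have "AE x in lborel. x \<in> {x. bump d (x::'a) = 0}" by simp
  then have "AE x in lebesgue. x \<in> {x. bump d (x::'a) = 0}" by (rule AE_completion)
  moreover have "closed {x. bump d (x::'a) = 0}"
    by (intro closed_Collect_eq bump_continuous continuous_on_const)
  ultimately have "(0::'a) \<in> {x. bump d x = 0}" by (rule mem_closed_if_AE_lebesgue[rotated])
  then show False by (simp add: bump_0)
qed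

text \<open>The function sending t to the square of max 0 (1 - t) is convex and its derivative has
  Lipschitz constant 2, so its first order Taylor remainder lies between 0 and (u - t)^2. This is
  the reason for the square in \<open>bump\<close>: without it there would be a corner at the
  boundary of the support.\<close>

lemma max_square_taylor:
  fixes t u :: real
  shows "0 \<le> (max 0 (1 - u))\<^sup>2 - (max 0 (1 - t))\<^sup>2 + 2 * max 0 (1 - t) * (u - t)"
    and "(max 0 (1 - u))\<^sup>2 - (max 0 (1 - t))\<^sup>2 + 2 * max 0 (1 - t) * (u - t) \<le> (u - t)\<^sup>2"
proof -
  consider "t \<le> 1" "u \<le> 1" | "t \<le> 1" "1 < u" | "1 < t" "u \<le> 1" | "1 < t" "1 < u" by linarith
  then have "0 \<le> (max 0 (1 - u))\<^sup>2 - (max 0 (1 - t))\<^sup>2 + 2 * max 0 (1 - t) * (u - t) \<and>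
    (max 0 (1 - u))\<^sup>2 - (max 0 (1 - t))\<^sup>2 + 2 * max 0 (1 - t) * (u - t) \<le> (u - t)\<^sup>2"
  proof cases
    case 1
    then have m: "max 0 (1 - u) = 1 - u" "max 0 (1 - t) = 1 - t" by auto
    have e: "(1 - u)\<^sup>2 - (1 - t)\<^sup>2 + 2 * (1 - t) * (u - t) = (u - t)\<^sup>2" by (simp add: power2_eq_square algebra_simps)
    show ?thesis unfolding m e by simp
  next
    case 2
    then have m: "max 0 (1 - u) = 0" "max 0 (1 - t) = 1 - t" by auto
    have "0 \<le> (1 - t) * ((u - 1) + (u - t))" using 2 by (intro mult_nonneg_nonneg) auto
    then have 1: "0 \<le> 0\<^sup>2 - (1 - t)\<^sup>2 + 2 * (1 - t) * (u - t)" by (simp add: power2_eq_square algebra_simps)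
    have "0 \<le> (u - 1)\<^sup>2" by simp
    then have 2: "0\<^sup>2 - (1 - t)\<^sup>2 + 2 * (1 - t) * (u - t) \<le> (u - t)\<^sup>2" by (simp add: power2_eq_square algebra_simps)
    show ?thesis unfolding m using 1 2 by blast
  next
    case 3
    then have m: "max 0 (1 - u) = 1 - u" "max 0 (1 - t) = 0" by auto
    have "(1 - u)\<^sup>2 \<le> (t - u)\<^sup>2" using 3 by (intro power_mono) auto
    then show ?thesis unfolding m by (simp add: power2_commute)
  next
    case 4
    then have m: "max 0 (1 - u) = 0" "max 0 (1 - t) = 0" by auto
    show ?thesis unfolding m by simp
  qed
  then show "0 \<le> (max 0 (1 - u))\<^sup>2 - (max 0 (1 - t))\<^sup>2 + 2 * max 0 (1 - t) * (u - t)"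
    "(max 0 (1 - u))\<^sup>2 - (max 0 (1 - t))\<^sup>2 + 2 * max 0 (1 - t) * (u - t) \<le> (u - t)\<^sup>2" by auto
qed

text \<open>Two Taylor remainders in the variable |x|^2, whose increments under z and -z cancel up
  to 2 |z|^2. For |x| < 2 the remainders add up to at most (8 * 4 + 2) |z|^2, whence 34; for |x|
  \<ge> 2 and |z| < 1 all three terms vanish.\<close>

lemma sdiff_bump_unit: "\<bar>sdiff (bump 1) x z\<bar> \<le> 34 * min 1 ((norm (z::'a::euclidean_space))\<^sup>2)"
proof (cases "norm z < 1")
  case False
  then have "min 1 ((norm z)\<^sup>2) = 1" by (simp add: one_le_power)
  moreover have "\<bar>sdiff (bump 1) x z\<bar> \<le> 2"
    unfolding sdiff_def using bump_nonneg[of 1 "x + z"] bump_le_1[of 1 "x + z"] bump_nonneg[of 1 "x - z"]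
      bump_le_1[of 1 "x - z"] bump_nonneg[of 1 x] bump_le_1[of 1 x] by linarith
  ultimately show ?thesis by simp
next
  case z: True
  have z2: "(norm z)\<^sup>2 \<le> 1" using z by (simp add: abs_square_le_1)
  then have mz: "min 1 ((norm z)\<^sup>2) = (norm z)\<^sup>2" by simp
  show ?thesis
  proof (cases "2 \<le> norm x")
    case True
    have "1 \<le> norm (x + z)" "1 \<le> norm (x - z)" "1 \<le> norm x"
      using True z norm_triangle_ineq2[of x "- z"] norm_triangle_ineq2[of x z] by auto
    then have "sdiff (bump 1) x z = 0" by (simp add: sdiff_def bump_out)
    then show ?thesis by simp
  next
    case False
    let ?t = "(norm x)\<^sup>2" and ?u = "(norm (x + z))\<^sup>2" and ?w = "(norm (x - z))\<^sup>2"
    let ?m = "max 0 (1 - ?t)" and ?p = "x \<bullet> z" and ?q = "(norm z)\<^sup>2"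
    have u: "?u - ?t = 2 * ?p + ?q" and w: "?w - ?t = - 2 * ?p + ?q"
      unfolding power2_norm_eq_inner by (auto simp: inner_add_left inner_add_right inner_diff_left inner_diff_right inner_commute[of z x])
    have sd: "sdiff (bump 1) x z = ((max 0 (1 - ?u))\<^sup>2 - ?m\<^sup>2 + 2 * ?m * (?u - ?t)) + ((max 0 (1 - ?w))\<^sup>2 - ?m\<^sup>2 + 2 * ?m * (?w - ?t)) - 4 * (?m * ?q)"
      unfolding u w by (simp add: sdiff_def bump_def algebra_simps)
    have m: "0 \<le> ?m * ?q" "?m * ?q \<le> 1 * ?q" by (simp, rule mult_right_mono, auto)
    have "- (4 * ?q) \<le> sdiff (bump 1) x z"
      unfolding sd using max_square_taylor(1)[of ?u ?t] max_square_taylor(1)[of ?w ?t] m by linarith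
    moreover have "sdiff (bump 1) x z \<le> 34 * ?q"
    proof -
      have "?p\<^sup>2 \<le> (norm x)\<^sup>2 * ?q" using Cauchy_Schwarz_ineq[of x z] by (simp add: power2_norm_eq_inner)
      also have "\<dots> \<le> 2\<^sup>2 * ?q" using False by (intro mult_right_mono power_mono) auto
      finally have p: "?p\<^sup>2 \<le> 4 * ?q" by simp
      have q: "?q\<^sup>2 \<le> ?q" using z2 mult_left_le[of ?q ?q] by (simp add: power2_eq_square[of ?q])
      have "sdiff (bump 1) x z \<le> (?u - ?t)\<^sup>2 + (?w - ?t)\<^sup>2"
        unfolding sd using max_square_taylor(2)[of ?u ?t] max_square_taylor(2)[of ?w ?t] m by linarith
      also have "\<dots> = 8 * ?p\<^sup>2 + 2 * ?q\<^sup>2" unfolding u w by (simp add: power2_eq_square algebra_simps)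
      also have "\<dots> \<le> 34 * ?q" using p q by linarith
      finally show ?thesis .
    qed
    moreover have "0 \<le> ?q" by simp
    ultimately show ?thesis unfolding mz by linarith
  qed
qed

lemma sdiff_bump:
  assumes d: "0 < d"
  shows "\<bar>sdiff (bump d) x z\<bar> \<le> 34 * min 1 ((norm (z::'a::euclidean_space))\<^sup>2 / d\<^sup>2)"
proof -
  have b: "bump d y = bump 1 ((1 / d) *\<^sub>R y)" for y :: 'a
    using d by (simp add: bump_def power_divide)
  have "sdiff (bump d) x z = sdiff (bump 1) ((1 / d) *\<^sub>R x) ((1 / d) *\<^sub>R z)"
    by (simp add: sdiff_def b scaleR_add_right scaleR_diff_right)
  also have "\<bar>\<dots>\<bar> \<le> 34 * min 1 ((norm ((1 / d) *\<^sub>R z))\<^sup>2)" by (rule sdiff_bump_unit)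
  also have "(norm ((1 / d) *\<^sub>R z))\<^sup>2 = (norm z)\<^sup>2 / d\<^sup>2" using d by (simp add: power_divide)
  finally show ?thesis .
qed

section \<open>Gaussian averages and Dynkin's formula for bumps\<close>

definition gconv :: "real \<Rightarrow> ('a::euclidean_space \<Rightarrow> real) \<Rightarrow> 'a \<Rightarrow> real" where
  "gconv k g x = (LBINT y. g (x - y) * gs k y) / (LBINT y. gs k (y::'a))"

lemma gconv_eq:
  fixes g :: "'a::euclidean_space \<Rightarrow> real"
  assumes k: "0 < k" and g[measurable]: "g \<in> borel_measurable borel"
  shows "gconv k g x = (LBINT v. g (x - (1 / k) *\<^sub>R v) * gauss v)"
proof -
  define C where "C = (sqrt (2 * pi)) ^ DIM('a)"
  have C: "0 < C" by (simp add: C_def)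
  have gs: "gs k y = C * gauss (k *\<^sub>R y)" for y :: 'a by (simp add: gs_gauss C_def)
  define F where "F v = g (x - (1 / k) *\<^sub>R v) * gauss v" for v
  have F: "F \<in> borel_measurable borel" unfolding F_def by measurable
  have "(LBINT y. g (x - y) * gs k y) = (LBINT y. C * F (k *\<^sub>R y))"
    using k by (intro Bochner_Integration.integral_cong) (auto simp: gs F_def)
  also have "\<dots> = C * ((LBINT v. F v) / k ^ DIM('a))" using lborel_scale_integral(1)[OF k F] by simp
  finally have n: "(LBINT y. g (x - y) * gs k y) = C * ((LBINT v. F v) / k ^ DIM('a))" .
  have "(LBINT y. gs k (y::'a)) = C * (LBINT y. gauss (k *\<^sub>R (y::'a)))" unfolding gs by simp
  also have "(LBINT y. gauss (k *\<^sub>R (y::'a))) = 1 / k ^ DIM('a)"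
    using lborel_scale_integral(1)[OF k gauss_measurable[where 'a = 'a]] gauss_integral[where 'a = 'a] by simp
  finally have z: "(LBINT y. gs k (y::'a)) = C * (1 / k ^ DIM('a))" .
  show ?thesis unfolding gconv_def n z using k C by (simp add: F_def[abs_def])
qed

text \<open>Uniformity on balls is what Dynkin's formula requires, since it evaluates the generator
  on a ball. The Gaussian mass outside a growing ball tends to 0, and inside it uniform continuity
  of g on a slightly larger compact ball applies.\<close>

lemma gconv_uniform:
  fixes g :: "'a::euclidean_space \<Rightarrow> real"
  assumes g: "continuous_on UNIV g" and B: "\<And>x. \<bar>g x\<bar> \<le> B" and e: "0 < e"
  shows "eventually (\<lambda>n. \<forall>x\<in>cball x0 s. \<bar>gconv (real n) g x - g x\<bar> \<le> e) sequentially"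
proof -
  have gm[measurable]: "g \<in> borel_measurable borel" using g by (rule borel_measurable_continuous_onI)
  have B0: "0 \<le> B" using B[of 0] by linarith
  have "uniformly_continuous_on (cball x0 (s + 1)) g"
    by (rule compact_uniformly_continuous[OF continuous_on_subset[OF g]]) auto
  then obtain t where t: "0 < t" "\<And>x y. x \<in> cball x0 (s + 1) \<Longrightarrow> y \<in> cball x0 (s + 1) \<Longrightarrow> dist y x < t \<Longrightarrow> dist (g y) (g x) < e / 2"
    unfolding uniformly_continuous_on_def using half_gt_zero[OF e] by metis
  define t' where "t' = min t 1"
  have t': "0 < t'" "t' \<le> t" "t' \<le> 1" using t by (auto simp: t'_def)
  have lim: "(\<lambda>n. \<integral>v. indicator {v. real n * t' \<le> norm v} v * gauss (v::'a) \<partial>lborel) \<longlonglongrightarrow> (\<integral>v. 0 \<partial>(lborel::'a measure))"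
  proof (rule integral_dominated_convergence[where w = gauss])
    show "AE v in lborel. (\<lambda>n. indicator {v. real n * t' \<le> norm v} v * gauss (v::'a)) \<longlonglongrightarrow> 0"
    proof (intro AE_I2)
      fix v :: 'a
      obtain m :: nat where m: "norm v / t' < real m" using reals_Archimedean2 by blast
      have "eventually (\<lambda>n. indicator {v. real n * t' \<le> norm v} v * gauss v = 0) sequentially"
      proof (rule eventually_sequentiallyI[of m])
        fix n assume "m \<le> n"
        then have "norm v < real n * t'" using m t' by (simp add: pos_divide_less_eq) (smt (verit) mult_right_mono of_nat_mono)
        then show "indicator {v. real n * t' \<le> norm v} v * gauss v = 0" by simp
      qed
      then show "(\<lambda>n. indicator {v. real n * t' \<le> norm v} v * gauss v) \<longlonglongrightarrow> 0" by (rule tendsto_eventually)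
    qed
    show "AE v in lborel. norm (indicator {v. real n * t' \<le> norm v} v * gauss (v::'a)) \<le> gauss v" for n
      by (intro AE_I2) (auto simp: indicator_def gauss_nonneg)
  qed (auto simp: gauss_integrable)
  have "0 < e / (4 * (B + 1))" using e B0 by simp
  with lim have "eventually (\<lambda>n. (LBINT v. indicator {v. real n * t' \<le> norm v} v * gauss (v::'a)) < e / (4 * (B + 1))) sequentially"
    by (intro order_tendstoD(2)) auto
  then show ?thesis using eventually_gt_at_top[of 0]
  proof eventually_elim
    case (elim n)
    show ?case
    proof
      fix x assume x: "x \<in> cball x0 s"
      have n: "0 < real n" using elim by simp
      let ?I = "\<lambda>v. indicator {v. real n * t' \<le> norm v} v * gauss (v::'a)"
      have iI: "integrable lborel ?I"
        by (rule Bochner_Integration.integrable_bound[OF gauss_integrable]) (auto simp: indicator_def)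
      have ig: "integrable lborel (\<lambda>v. g (x - (1 / real n) *\<^sub>R v) * gauss v)"
        by (rule Bochner_Integration.integrable_bound[OF integrable_mult_right[OF gauss_integrable, of B]])
          (use B B0 gauss_nonneg in \<open>auto simp: abs_mult intro!: mult_right_mono AE_I2\<close>)
      have "gconv (real n) g x - g x = (LBINT v. g (x - (1 / real n) *\<^sub>R v) * gauss v) - g x * (LBINT v. gauss (v::'a))"
        unfolding gconv_eq[OF n gm] gauss_integral by simp
      also have "\<dots> = (LBINT v. (g (x - (1 / real n) *\<^sub>R v) - g x) * gauss v)"
        using ig gauss_integrable[where 'a = 'a] by (simp add: left_diff_distrib)
      finally have e1: "gconv (real n) g x - g x = (LBINT v. (g (x - (1 / real n) *\<^sub>R v) - g x) * gauss v)" .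
      have "\<bar>\<integral>v. (g (x - (1 / real n) *\<^sub>R v) - g x) * gauss v \<partial>lborel\<bar> \<le> (LBINT v. e / 2 * gauss v + 2 * B * ?I v)"
      proof (rule integral_abs_bound_integral)
        show "integrable lborel (\<lambda>v. (g (x - (1 / real n) *\<^sub>R v) - g x) * gauss v)"
          using ig gauss_integrable[where 'a = 'a] by (simp add: left_diff_distrib)
        show "integrable lborel (\<lambda>v. e / 2 * gauss v + 2 * B * ?I v)"
          by (intro Bochner_Integration.integrable_add integrable_mult_right gauss_integrable iI)
        fix v :: 'a
        show "\<bar>(g (x - (1 / real n) *\<^sub>R v) - g x) * gauss v\<bar> \<le> e / 2 * gauss v + 2 * B * ?I v"
        proof (cases "real n * t' \<le> norm v")
          case True
          have "\<bar>g (x - (1 / real n) *\<^sub>R v) - g x\<bar> \<le> 2 * B" using B[of x] B[of "x - (1 / real n) *\<^sub>R v"] by linarith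
          from mult_right_mono[OF this gauss_nonneg[of v]] show ?thesis
            using True e gauss_nonneg[of v] by (simp add: abs_mult add_increasing)
        next
          case False
          then have d: "norm ((1 / real n) *\<^sub>R v) < t'" using n by (simp add: field_simps)
          have "dist (g (x - (1 / real n) *\<^sub>R v)) (g x) < e / 2"
          proof (rule t(2))
            show "x \<in> cball x0 (s + 1)" using x by simp
            have "dist x0 (x - (1 / real n) *\<^sub>R v) \<le> dist x0 x + norm ((1 / real n) *\<^sub>R v)"
              using norm_triangle_ineq[of "x0 - x" "(1 / real n) *\<^sub>R v"] by (simp add: dist_norm algebra_simps)
            then show "x - (1 / real n) *\<^sub>R v \<in> cball x0 (s + 1)" using x d t' by simp
            show "dist (x - (1 / real n) *\<^sub>R v) x < t" using d t' by (simp add: dist_norm)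
          qed
          then have "\<bar>g (x - (1 / real n) *\<^sub>R v) - g x\<bar> \<le> e / 2" by (simp add: dist_norm)
          from mult_right_mono[OF this gauss_nonneg[of v]] show ?thesis
            using False gauss_nonneg[of v] by (simp add: abs_mult)
        qed
      qed
      also have "\<dots> = e / 2 * (LBINT v. gauss (v::'a)) + 2 * B * (LBINT v. ?I v)"
        using Bochner_Integration.integral_add[OF integrable_mult_right[OF gauss_integrable, of "e/2"] integrable_mult_right[OF iI, of "2 * B"]] by simp
      also have "\<dots> \<le> e / 2 + 2 * B * (e / (4 * (B + 1)))"
        using elim(1) B0 unfolding gauss_integral by (intro add_mono mult_left_mono) auto
      also have "2 * B * (e / (4 * (B + 1))) \<le> e / 2" using B0 e by (simp add: field_simps)
      finally show "\<bar>gconv (real n) g x - g x\<bar> \<le> e" unfolding e1 by simp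
    qed
  qed
qed

context levy_kernel begin

lemma L_bump_integrable: "0 < d \<Longrightarrow> integrable lborel (\<lambda>z. sdiff (bump d) x z * N z)"
  by (rule integrable_N_bound'[OF _ _ sdiff_bump]) (auto simp: sdiff_def)

lemma L_bump_bound: assumes d: "0 < d" shows "\<bar>L (bump d) x\<bar> \<le> 34 * H d"
proof -
  have m: "(\<lambda>z. sdiff (bump d) x z) \<in> borel_measurable borel" unfolding sdiff_def by measurable
  have "L (bump d) x \<le> 34 * H d"
    unfolding L_def by (rule integral_N_bound[OF m d]) (use sdiff_bump[OF d, of x] abs_le_D1 in auto)
  moreover have "(LBINT z. (- sdiff (bump d) x z) * N z) \<le> 34 * H d"
    by (rule integral_N_bound[OF _ d]) (use sdiff_bump[OF d, of x] abs_le_D2 m in auto)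
  ultimately show ?thesis by (simp add: L_def)
qed

lemma L_bump_continuous: assumes d: "0 < d" shows "continuous_on UNIV (L (bump d))"
  unfolding continuous_on_sequentially
proof (intro allI ballI impI)
  fix w and x :: 'a assume "(\<forall>n. w n \<in> UNIV) \<and> w \<longlonglongrightarrow> x"
  then have w: "w \<longlonglongrightarrow> x" by simp
  have c: "isCont (bump d) y" for y :: 'a by (rule bump_isCont)
  have "(\<lambda>n. \<integral>z. sdiff (bump d) (w n) z * N z \<partial>lborel) \<longlonglongrightarrow> (LBINT z. sdiff (bump d) x z * N z)"
  proof (rule integral_dominated_convergence[where w = "\<lambda>z. 34 * (min 1 ((norm z)\<^sup>2 / d\<^sup>2) * N z)"])
    show "integrable lborel (\<lambda>z. 34 * (min 1 ((norm z)\<^sup>2 / d\<^sup>2) * N z))" using H_integrable[OF d] by simp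
    show "AE z in lborel. (\<lambda>n. sdiff (bump d) (w n) z * N z) \<longlonglongrightarrow> sdiff (bump d) x z * N z"
      unfolding sdiff_def by (intro AE_I2 tendsto_intros isCont_tendsto_compose[OF c] w)
    show "AE z in lborel. norm (sdiff (bump d) (w n) z * N z) \<le> 34 * (min 1 ((norm z)\<^sup>2 / d\<^sup>2) * N z)" for n
      using mult_right_mono[OF sdiff_bump[OF d] N_nonneg] by (intro AE_I2) (simp add: abs_mult N_nonneg mult.assoc)
  qed (auto simp: sdiff_def)
  then show "(L (bump d) \<circ> w) \<longlonglongrightarrow> L (bump d) x" by (simp add: L_def comp_def)
qed

lemma L_gs_measurable[measurable]: "L (gs k) \<in> borel_measurable borel"
proof -
  have "(\<lambda>(x, z). sdiff (gs k) x z * N z) \<in> borel_measurable (borel \<Otimes>\<^sub>M lborel)"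
    unfolding sdiff_def by measurable
  from lborel.borel_measurable_lebesgue_integral[OF this] show ?thesis by (simp add: L_def[abs_def])
qed

lemma L_bump_measurable[measurable]: "L (bump d) \<in> borel_measurable borel"
proof -
  have "(\<lambda>(x, z). sdiff (bump d) x z * N z) \<in> borel_measurable (borel \<Otimes>\<^sub>M lborel)"
    unfolding sdiff_def by measurable
  from lborel.borel_measurable_lebesgue_integral[OF this] show ?thesis by (simp add: L_def[abs_def])
qed

lemma conv_commute:
  fixes f g :: "'a \<Rightarrow> real"
  assumes [measurable]: "f \<in> borel_measurable borel" "g \<in> borel_measurable borel"
  shows "(LBINT y. f (x - y) * g y) = (LBINT y. f y * g (x - y))"
  using lborel_invariant(1)[OF _ distr_lborel_diff[of x], of "\<lambda>y. f (x - y) * g y"] by simp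

lemma bump_gs_integrable: assumes "0 < k" shows "integrable lborel (\<lambda>y. bump d (w - y) * gs k y)"
  by (rule Bochner_Integration.integrable_bound[OF gs_integrable[OF assms]])
    (auto simp: gs_bounds(1) less_imp_le intro!: bump_mult_le)

text \<open>The operator commutes with translations, so it may be moved from one factor of a
  convolution to the other.\<close>

lemma L_gconv_bump:
  assumes d: "0 < d" and k: "0 < k"
  shows "(LBINT y. bump d y * L (gs k) (x - y)) = (LBINT y. L (bump d) (x - y) * gs k y)"
proof -
  have sf: "sigma_finite_measure (lborel :: 'a measure)" ..
  obtain C where C: "\<And>x z. \<bar>sdiff (gs k :: 'a \<Rightarrow> real) x z\<bar> \<le> C * min 1 ((norm z)\<^sup>2)" using sdiff_gs_bound by blast
  define f where "f y z = bump d y * (sdiff (gs k) (x - y) z * N z)" for y z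
  define g where "g y z = gs k y * (sdiff (bump d) (x - y) z * N z)" for y z
  have mf: "(\<lambda>(y, z). f y z) \<in> borel_measurable (lborel \<Otimes>\<^sub>M lborel)" unfolding f_def sdiff_def by measurable
  have mg: "(\<lambda>(y, z). g y z) \<in> borel_measurable (lborel \<Otimes>\<^sub>M lborel)" unfolding g_def sdiff_def by measurable
  have fb: "\<bar>f y z\<bar> \<le> bump d y * (C * (min 1 ((norm z)\<^sup>2) * N z))" for y z
  proof -
    have "\<bar>sdiff (gs k) (x - y) z\<bar> * N z \<le> C * min 1 ((norm z)\<^sup>2) * N z" by (rule mult_right_mono[OF C N_nonneg])
    from mult_left_mono[OF this bump_nonneg[of d y]] show ?thesis
      by (simp add: f_def abs_mult bump_nonneg N_nonneg mult.assoc)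
  qed
  have gb: "\<bar>g y z\<bar> \<le> gs k y * (34 * (min 1 ((norm z)\<^sup>2 / d\<^sup>2) * N z))" for y z
  proof -
    have "\<bar>sdiff (bump d) (x - y) z\<bar> * N z \<le> 34 * min 1 ((norm z)\<^sup>2 / d\<^sup>2) * N z" by (rule mult_right_mono[OF sdiff_bump[OF d] N_nonneg])
    from mult_left_mono[OF this less_imp_le[OF gs_bounds(1)[of k y]]] show ?thesis
      by (simp add: g_def abs_mult gs_bounds(1) less_imp_le N_nonneg mult.assoc)
  qed
  have ig: "integrable lborel (\<lambda>y. bump d (w - y) * gs k y)" for w by (rule bump_gs_integrable[OF k])
  have inner: "(LBINT y. f y z) = (LBINT y. g y z)" for z
  proof -
    have ig': "integrable lborel (\<lambda>y. bump d y * gs k (w - y))" for w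
      using lborel_invariant(2)[OF _ distr_lborel_diff[of w], of "\<lambda>y. bump d (w - y) * gs k y"] ig[of w] by simp
    have "(LBINT y. f y z) = (LBINT y. (bump d y * gs k ((x + z) - y) + bump d y * gs k ((x - z) - y) - 2 * (bump d y * gs k (x - y))) * N z)"
      unfolding f_def sdiff_def by (intro Bochner_Integration.integral_cong) (auto simp: algebra_simps)
    also have "\<dots> = ((LBINT y. bump d y * gs k ((x + z) - y)) + (LBINT y. bump d y * gs k ((x - z) - y)) - 2 * (LBINT y. bump d y * gs k (x - y))) * N z"
      using ig'[of "x + z"] ig'[of "x - z"] ig'[of x] by simp
    also have "\<dots> = ((LBINT y. bump d ((x + z) - y) * gs k y) + (LBINT y. bump d ((x - z) - y) * gs k y) - 2 * (LBINT y. bump d (x - y) * gs k y)) * N z"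
      by (simp add: conv_commute)
    also have "\<dots> = (LBINT y. (bump d ((x + z) - y) * gs k y + bump d ((x - z) - y) * gs k y - 2 * (bump d (x - y) * gs k y)) * N z)"
      using ig[of "x + z"] ig[of "x - z"] ig[of x] by simp
    also have "\<dots> = (LBINT y. g y z)"
      unfolding g_def sdiff_def by (intro Bochner_Integration.integral_cong) (auto simp: algebra_simps)
    finally show ?thesis .
  qed
  have "(LBINT y. bump d y * L (gs k) (x - y)) = (LBINT y. (LBINT z. f y z))"
    by (simp add: L_def f_def)
  also have "\<dots> = (LBINT z. (LBINT y. f y z))"
    by (rule fubini_dominated(1)[OF sf sf mf bump_integrable[OF d] _ fb]) (use N_integrable in simp)
  also have "\<dots> = (LBINT z. (LBINT y. g y z))" by (simp add: inner)
  also have "\<dots> = (LBINT y. (LBINT z. g y z))"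
    by (rule fubini_dominated(1)[OF sf sf mg gs_integrable[OF k] _ gb, symmetric]) (use H_integrable[OF d] in simp)
  also have "\<dots> = (LBINT y. L (bump d) (x - y) * gs k y)" by (simp add: L_def g_def mult.commute)
  finally show ?thesis .
qed

end

context levy_setting begin

text \<open>A bump does not come as an average of cosines, but its Gaussian average is a
  superposition of translated Gaussians. The spatially uniform error \<open>gs_err\<close> passes
  through this superposition, multiplied by the ratio of the two masses.\<close>

lemma gconv_bump_generator:
  assumes d: "0 < d" and k: "0 < k" and h: "0 < h"
  defines "Zk \<equiv> (LBINT y. gs k (y::'a))"
  shows "\<bar>(P h (gconv k (bump d)) x - gconv k (bump d) x) / h - gconv k (\<lambda>y. L (bump d) y / 2) x\<bar>
     \<le> (LBINT y. bump d (y::'a)) / Zk * gs_err k h"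
proof -
  have Z: "0 < Zk" unfolding Zk_def by (rule gs_integral_pos[OF k])
  have gc: "gconv k (bump d) w = (LBINT y. bump d y * gs k (w - y)) / Zk" for w :: 'a
    unfolding gconv_def Zk_def by (simp add: conv_commute)
  have mf: "(\<lambda>(\<omega>, y). bump d y * gs k (x + Y \<omega> h - y)) \<in> borel_measurable (M \<Otimes>\<^sub>M lborel)" by measurable
  have fb: "\<bar>bump d y * gs k (x + Y \<omega> h - y)\<bar> \<le> 1 * bump d y" for \<omega> y
    using bump_nonneg[of d y] gs_bounds[of k "x + Y \<omega> h - y"] by (simp add: abs_mult mult_left_le)
  note fub = fubini_dominated[OF sigma_finite_measure_axioms lborel.sigma_finite_measure_axioms mf _ bump_integrable[OF d] fb]
  have eP: "P h (gs k) (x - y) = (\<integral>\<omega>. gs k (x + Y \<omega> h - y) \<partial>M)" for y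
    unfolding P_def by (intro Bochner_Integration.integral_cong) (auto simp: algebra_simps)
  have iP: "integrable lborel (\<lambda>y. bump d y * P h (gs k) (x - y))"
    using fub(3) by (simp add: eP)
  have PP: "P h (gconv k (bump d)) x = (LBINT y. bump d y * P h (gs k) (x - y)) / Zk"
  proof -
    have "P h (gconv k (bump d)) x = (\<integral>\<omega>. (LBINT y. bump d y * gs k (x + Y \<omega> h - y)) / Zk \<partial>M)"
      unfolding P_def gc ..
    also have "\<dots> = (\<integral>\<omega>. (LBINT y. bump d y * gs k (x + Y \<omega> h - y)) \<partial>M) / Zk" by simp
    also have "(\<integral>\<omega>. (LBINT y. bump d y * gs k (x + Y \<omega> h - y)) \<partial>M) = (LBINT y. (\<integral>\<omega>. bump d y * gs k (x + Y \<omega> h - y) \<partial>M))"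
      by (rule fub(1)) simp
    finally show ?thesis by (simp add: eP)
  qed
  have i1: "integrable lborel (\<lambda>y. bump d y * gs k (x - y))"
    using lborel_invariant(2)[OF _ distr_lborel_diff[of x], of "\<lambda>y. bump d (x - y) * gs k y"] bump_gs_integrable[OF k, of d x] by simp
  \<comment> \<open>A crude bound, read off from the generator estimate at the given h; it only
    serves integrability.\<close>
  have Lb: "\<bar>L (gs k) w\<bar> \<le> 2 * (gs_err k h + 1 / h)" for w
  proof -
    have "\<bar>P h (gs k) w\<bar> \<le> 1"
    proof -
      have i: "integrable M (\<lambda>\<omega>. gs k (w + Y \<omega> h))"
        by (rule integrable_bounded[where B = 1]) (auto simp: gs_abs)
      have "P h (gs k) w \<le> 1" unfolding P_def by (rule integral_le_const[OF i]) (auto simp: gs_bounds)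
      moreover have "0 \<le> P h (gs k) w" unfolding P_def by (rule integral_ge_const[OF i]) (use gs_bounds(1) less_imp_le in blast)
      ultimately show ?thesis by simp
    qed
    moreover have "0 \<le> P h (gs k) w" unfolding P_def using gs_bounds(1)[of k] less_imp_le by (intro integral_nonneg_AE AE_I2) blast
    ultimately have "\<bar>(P h (gs k) w - gs k w) / h\<bar> \<le> 1 / h"
      using gs_bounds[of k w] h by (simp add: abs_divide divide_right_mono)
    moreover have "\<bar>l\<bar> \<le> 2 * (e + t)" if "\<bar>q\<bar> \<le> t" "\<bar>q - l / 2\<bar> \<le> e" for q l e t :: real
      using that by (auto simp: abs_le_iff)
    ultimately show ?thesis using gs_generator[OF h, of k w] by blast
  qed
  have i2: "integrable lborel (\<lambda>y. bump d y * L (gs k) (x - y))"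
  proof (rule Bochner_Integration.integrable_bound[OF integrable_mult_left[OF bump_integrable[OF d], of "2 * (gs_err k h + 1 / h)"]])
    have "\<bar>bump d y * L (gs k) (x - y)\<bar> \<le> \<bar>bump d y * (2 * (gs_err k h + 1 / h))\<bar>" for y
      unfolding abs_mult[of "bump d y"] using order_trans[OF Lb abs_ge_self] by (intro mult_left_mono) auto
    then show "AE y in lborel. norm (bump d y * L (gs k) (x - y)) \<le> norm (bump d y * (2 * (gs_err k h + 1 / h)))"
      by (intro AE_I2) simp
  qed measurable
  have gL: "gconv k (\<lambda>y. L (bump d) y / 2) x = (LBINT y. bump d y * L (gs k) (x - y)) / 2 / Zk"
    unfolding gconv_def Zk_def L_gconv_bump[OF d k] by simp
  have "(P h (gconv k (bump d)) x - gconv k (bump d) x) / h - gconv k (\<lambda>y. L (bump d) y / 2) x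
    = ((LBINT y. bump d y * P h (gs k) (x - y)) / h - (LBINT y. bump d y * gs k (x - y)) / h - (LBINT y. bump d y * L (gs k) (x - y)) / 2) / Zk"
    unfolding PP gL gc using Z h by (simp add: field_simps)
  also have "\<dots> = (LBINT y. bump d y * P h (gs k) (x - y) / h - bump d y * gs k (x - y) / h - bump d y * L (gs k) (x - y) / 2) / Zk"
    using iP i1 i2 by simp
  also have "(LBINT y. bump d y * P h (gs k) (x - y) / h - bump d y * gs k (x - y) / h - bump d y * L (gs k) (x - y) / 2)
    = (LBINT y. bump d y * ((P h (gs k) (x - y) - gs k (x - y)) / h - L (gs k) (x - y) / 2))"
    using h by (intro Bochner_Integration.integral_cong) (auto simp: right_diff_distrib diff_divide_distrib)
  finally have e: "(P h (gconv k (bump d)) x - gconv k (bump d) x) / h - gconv k (\<lambda>y. L (bump d) y / 2) x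
    = (LBINT y. bump d y * ((P h (gs k) (x - y) - gs k (x - y)) / h - L (gs k) (x - y) / 2)) / Zk" .
  have "\<bar>\<integral>y. bump d y * ((P h (gs k) (x - y) - gs k (x - y)) / h - L (gs k) (x - y) / 2) \<partial>lborel\<bar> \<le> (LBINT y. bump d (y::'a) * gs_err k h)"
  proof (rule integral_abs_bound_integral)
    have "integrable lborel (\<lambda>y. bump d y * P h (gs k) (x - y) / h - bump d y * gs k (x - y) / h - bump d y * L (gs k) (x - y) / 2)"
      using iP i1 i2 by simp
    then show "integrable lborel (\<lambda>y. bump d y * ((P h (gs k) (x - y) - gs k (x - y)) / h - L (gs k) (x - y) / 2))"
      by (simp add: right_diff_distrib diff_divide_distrib)
    show "\<bar>bump d y * ((P h (gs k) (x - y) - gs k (x - y)) / h - L (gs k) (x - y) / 2)\<bar> \<le> bump d y * gs_err k h" for y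
      unfolding abs_mult using gs_generator[OF h, of k "x - y"] bump_nonneg[of d y] by (simp add: mult_left_mono)
  qed (rule integrable_mult_left[OF bump_integrable[OF d]])
  then show ?thesis unfolding e using Z by (simp add: abs_divide divide_right_mono)
qed

lemma gconv_bump_props:
  assumes d: "0 < d" and k: "0 < k"
  shows "continuous_on UNIV (gconv k (bump d :: 'a \<Rightarrow> real))" and "\<bar>gconv k (bump d) (x::'a)\<bar> \<le> 1"
proof -
  have i: "integrable lborel (\<lambda>v::'a. bump d (x - (1 / k) *\<^sub>R v) * gauss v)" for x
    by (rule Bochner_Integration.integrable_bound[OF gauss_integrable])
      (auto simp: gauss_nonneg intro!: bump_mult_le)
  have "gconv k (bump d) x \<le> (LBINT v. gauss (v::'a))" unfolding gconv_eq[OF k bump_measurable]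
    using abs_le_D1[OF bump_mult_le[OF gauss_nonneg]] by (intro integral_mono i gauss_integrable) auto
  moreover have "0 \<le> gconv k (bump d) x" unfolding gconv_eq[OF k bump_measurable]
    by (intro integral_nonneg_AE AE_I2) (simp add: bump_nonneg gauss_nonneg)
  ultimately show "\<bar>gconv k (bump d) x\<bar> \<le> 1" unfolding gauss_integral by simp
  have c: "isCont (bump d) y" for y :: 'a by (rule bump_isCont)
  show "continuous_on UNIV (gconv k (bump d :: 'a \<Rightarrow> real))"
    unfolding continuous_on_sequentially
  proof (intro allI ballI impI)
    fix w and x :: 'a assume "(\<forall>n. w n \<in> UNIV) \<and> w \<longlonglongrightarrow> x"
    then have w: "w \<longlonglongrightarrow> x" by simp
    have "(\<lambda>n. \<integral>v. bump d (w n - (1 / k) *\<^sub>R v) * gauss v \<partial>lborel) \<longlonglongrightarrow> (LBINT v. bump d (x - (1 / k) *\<^sub>R v) * gauss v)"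
    proof (rule integral_dominated_convergence[where w = gauss])
      show "AE v in lborel. (\<lambda>n. bump d (w n - (1 / k) *\<^sub>R v) * gauss v) \<longlonglongrightarrow> bump d (x - (1 / k) *\<^sub>R v) * gauss v"
        by (intro AE_I2 tendsto_intros isCont_tendsto_compose[OF c] w)
      show "AE v in lborel. norm (bump d (w n - (1 / k) *\<^sub>R v) * gauss v) \<le> gauss v" for n
        by (intro AE_I2) (simp only: real_norm_def bump_mult_le[OF gauss_nonneg])
    qed (auto simp: gauss_integrable)
    then show "(gconv k (bump d) \<circ> w) \<longlonglongrightarrow> gconv k (bump d) x"
      unfolding comp_def gconv_eq[OF k bump_measurable] .
  qed
qed

lemma bump_exit_limit:
  assumes d: "0 < d"
  shows "(\<lambda>n. \<integral>\<omega>. gconv (real (Suc n)) (bump d) (x + Y \<omega> (sig s \<omega>)) \<partial>M) \<longlonglongrightarrow> (\<integral>\<omega>. bump d (x + Y \<omega> (sig s \<omega>)) \<partial>M)"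
    and "(\<lambda>n. gconv (real (Suc n)) (bump d) x) \<longlonglongrightarrow> bump d x"
proof -
  have lim: "(\<lambda>n. gconv (real (Suc n)) (bump d) w) \<longlonglongrightarrow> bump d w" for w :: 'a
  proof (rule LIMSEQ_Suc[of "\<lambda>n. gconv (real n) (bump d) w"], rule LIMSEQ_I)
    fix e :: real assume e: "0 < e"
    have "eventually (\<lambda>n. \<forall>x\<in>cball w 0. \<bar>gconv (real n) (bump d) x - bump d x\<bar> \<le> e / 2) sequentially"
      by (rule gconv_uniform[where B = 1, OF bump_continuous]) (use e in \<open>auto simp: bump_abs\<close>)
    then show "\<exists>no. \<forall>n\<ge>no. norm (gconv (real n) (bump d) w - bump d w) < e"
      unfolding eventually_sequentially using e by (auto simp: field_simps) (smt (verit) field_sum_of_halves)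
  qed
  show "(\<lambda>n. gconv (real (Suc n)) (bump d) x) \<longlonglongrightarrow> bump d x" by (rule lim)
  show "(\<lambda>n. \<integral>\<omega>. gconv (real (Suc n)) (bump d) (x + Y \<omega> (sig s \<omega>)) \<partial>M) \<longlonglongrightarrow> (\<integral>\<omega>. bump d (x + Y \<omega> (sig s \<omega>)) \<partial>M)"
  proof (rule integral_dominated_convergence[where w = "\<lambda>_. 1"])
    have "gconv (real (Suc n)) (bump d) \<in> borel_measurable (borel :: 'a measure)" for n
      by (rule borel_measurable_continuous_onI[OF gconv_bump_props(1)[OF d]]) simp
    then show "(\<lambda>\<omega>. gconv (real (Suc n)) (bump d) (x + Y \<omega> (sig s \<omega>))) \<in> borel_measurable M" for n by measurable
    show "AE \<omega> in M. norm (gconv (real (Suc n)) (bump d) (x + Y \<omega> (sig s \<omega>))) \<le> 1" for n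
      using gconv_bump_props(2)[OF d, of "real (Suc n)"] by simp
  qed (auto intro: lim simp del: of_nat_Suc)
qed

text \<open>Two successive limits: the mesh tends to 0 for a fixed Gaussian width, where the error
  is uniform in space, and then the width tends to 0. The bound m is halved because \<open>L\<close>
  is twice the generator.\<close>

lemma bump_dynkin:
  assumes d: "0 < d" and s: "0 < s"
  shows "(\<And>y. norm y \<le> s \<Longrightarrow> L (bump d) (x + y) \<le> m) \<Longrightarrow>
      (\<integral>\<omega>. bump d (x + Y \<omega> (sig s \<omega>)) \<partial>M) - bump d x \<le> m / 2 * mean_exit s"
    and "(\<And>y. norm y \<le> s \<Longrightarrow> m \<le> L (bump d) (x + y)) \<Longrightarrow>
      m / 2 * mean_exit s \<le> (\<integral>\<omega>. bump d (x + Y \<omega> (sig s \<omega>)) \<partial>M) - bump d x"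
proof -
  let ?g = "\<lambda>n. gconv (real (Suc n)) (bump d :: 'a \<Rightarrow> real)"
  let ?E = "\<integral>\<omega>. bump d (x + Y \<omega> (sig s \<omega>)) \<partial>M"
  let ?c = "\<lambda>k. (LBINT y. bump d (y::'a)) / (LBINT y. gs k (y::'a))"
  have lim: "(\<lambda>n. (\<integral>\<omega>. ?g n (x + Y \<omega> (sig s \<omega>)) \<partial>M) - ?g n x) \<longlonglongrightarrow> ?E - bump d x"
    by (intro tendsto_diff bump_exit_limit d)
  have unif: "\<exists>n0. \<forall>n\<ge>n0. \<forall>y. norm y \<le> s \<longrightarrow> \<bar>gconv (real (Suc n)) (\<lambda>y. L (bump d) y / 2) (x + y) - L (bump d) (x + y) / 2\<bar> \<le> e"
    if e: "0 < e" for e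
  proof -
    have "eventually (\<lambda>n. \<forall>w\<in>cball x s. \<bar>gconv (real n) (\<lambda>y. L (bump d) y / 2) w - L (bump d) w / 2\<bar> \<le> e) sequentially"
    proof (rule gconv_uniform[where B = "34 * H d"])
      show "continuous_on UNIV (\<lambda>y. L (bump d) y / 2)" using L_bump_continuous[OF d] by (intro continuous_intros) auto
      show "\<bar>L (bump d) y / 2\<bar> \<le> 34 * H d" for y using L_bump_bound[OF d, of y] H_pos[OF d] by simp
    qed (rule e)
    then obtain n0 where "\<And>n. n0 \<le> n \<Longrightarrow> \<forall>w\<in>cball x s. \<bar>gconv (real n) (\<lambda>y. L (bump d) y / 2) w - L (bump d) w / 2\<bar> \<le> e"
      unfolding eventually_sequentially by blast
    then show ?thesis by (intro exI[of _ n0]) (auto simp: dist_norm simp del: of_nat_Suc)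
  qed
  have gen: "\<bar>(P (1 / 2 ^ j) (?g n) y - ?g n y) / (1 / 2 ^ j) - gconv (real (Suc n)) (\<lambda>y. L (bump d) y / 2) y\<bar> \<le> ?c (real (Suc n)) * gs_err (real (Suc n)) (1 / 2 ^ j)" for j n y
    by (rule gconv_bump_generator[OF d]) auto
  have err: "(\<lambda>j. ?c (real (Suc n)) * gs_err (real (Suc n)) (1 / 2 ^ j)) \<longlonglongrightarrow> 0" for n
    by (rule tendsto_mult_right_zero[OF gs_err_lim])
  note cn = gconv_bump_props(1)[OF d, of "real (Suc _)"] and bn = gconv_bump_props(2)[OF d, of "real (Suc _)"]
  show "?E - bump d x \<le> m / 2 * mean_exit s" if m: "\<And>y. norm y \<le> s \<Longrightarrow> L (bump d) (x + y) \<le> m"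
  proof (rule field_le_epsilon)
    fix e :: real assume e: "0 < e"
    define e' where "e' = e / (mean_exit s + 1)"
    have e': "0 < e'" "e' * mean_exit s \<le> e" using e mean_exit_nonneg[of s] by (auto simp: e'_def field_simps)
    obtain n0 where n0: "\<And>n y. n0 \<le> n \<Longrightarrow> norm y \<le> s \<Longrightarrow> \<bar>gconv (real (Suc n)) (\<lambda>y. L (bump d) y / 2) (x + y) - L (bump d) (x + y) / 2\<bar> \<le> e'"
      using unif[OF e'(1)] by blast
    have "(\<integral>\<omega>. ?g n (x + Y \<omega> (sig s \<omega>)) \<partial>M) - ?g n x \<le> (m / 2 + e') * mean_exit s" if n: "n0 \<le> n" for n
    proof (rule dynkin_upper[OF s cn bn gen err])
      fix y :: 'a assume y: "norm y \<le> s"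
      show "gconv (real (Suc n)) (\<lambda>y. L (bump d) y / 2) (x + y) \<le> m / 2 + e'" using n0[OF n y] m[OF y] by linarith
    qed auto
    then have "?E - bump d x \<le> (m / 2 + e') * mean_exit s" by (intro LIMSEQ_le_const2[OF lim]) blast
    then show "?E - bump d x \<le> m / 2 * mean_exit s + e" using e'(2) by (simp add: distrib_right)
  qed
  show "m / 2 * mean_exit s \<le> ?E - bump d x" if m: "\<And>y. norm y \<le> s \<Longrightarrow> m \<le> L (bump d) (x + y)"
  proof (rule field_le_epsilon)
    fix e :: real assume e: "0 < e"
    define e' where "e' = e / (mean_exit s + 1)"
    have e': "0 < e'" "e' * mean_exit s \<le> e" using e mean_exit_nonneg[of s] by (auto simp: e'_def field_simps)
    obtain n0 where n0: "\<And>n y. n0 \<le> n \<Longrightarrow> norm y \<le> s \<Longrightarrow> \<bar>gconv (real (Suc n)) (\<lambda>y. L (bump d) y / 2) (x + y) - L (bump d) (x + y) / 2\<bar> \<le> e'"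
      using unif[OF e'(1)] by blast
    have "(m / 2 - e') * mean_exit s \<le> (\<integral>\<omega>. ?g n (x + Y \<omega> (sig s \<omega>)) \<partial>M) - ?g n x" if n: "n0 \<le> n" for n
    proof -
      have "(\<integral>\<omega>. - ?g n (x + Y \<omega> (sig s \<omega>)) \<partial>M) - (- ?g n x) \<le> (- (m / 2) + e') * mean_exit s"
      proof (rule dynkin_upper[OF s _ _ _ err[of n], where \<phi> = "\<lambda>y. - ?g n y" and \<psi> = "\<lambda>y. - gconv (real (Suc n)) (\<lambda>y. L (bump d) y / 2) y"])
        show "continuous_on UNIV (\<lambda>y. - ?g n y)" using cn by (intro continuous_intros) simp
        show "\<bar>- ?g n y\<bar> \<le> 1" for y using bn by simp
        have Pm: "P h (\<lambda>y. - ?g n y) y = - P h (?g n) y" for h y by (simp add: P_def)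
        show "\<bar>(P (1 / 2 ^ j) (\<lambda>y. - ?g n y) y - - ?g n y) / (1 / 2 ^ j) - - gconv (real (Suc n)) (\<lambda>y. L (bump d) y / 2) y\<bar> \<le> ?c (real (Suc n)) * gs_err (real (Suc n)) (1 / 2 ^ j)" for j y
        proof -
          have "(P (1 / 2 ^ j) (\<lambda>y. - ?g n y) y - - ?g n y) / (1 / 2 ^ j) - - gconv (real (Suc n)) (\<lambda>y. L (bump d) y / 2) y
            = - ((P (1 / 2 ^ j) (?g n) y - ?g n y) / (1 / 2 ^ j) - gconv (real (Suc n)) (\<lambda>y. L (bump d) y / 2) y)"
            unfolding Pm by (simp add: algebra_simps)
          then show ?thesis using gen[of j n y] by (simp only: abs_minus_cancel)
        qed
        fix y :: 'a assume y: "norm y \<le> s"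
        show "- gconv (real (Suc n)) (\<lambda>y. L (bump d) y / 2) (x + y) \<le> - (m / 2) + e'" using n0[OF n y] m[OF y] by linarith
      qed
      then show ?thesis by (simp add: algebra_simps)
    qed
    then have "(m / 2 - e') * mean_exit s \<le> ?E - bump d x" by (intro LIMSEQ_le_const[OF lim]) blast
    then show "m / 2 * mean_exit s \<le> ?E - bump d x + e" using e'(2) by (simp add: left_diff_distrib)
  qed
qed

end

section \<open>Exit distributions\<close>

context levy_kernel begin

text \<open>Outside the support only jumps into the bump count, so \<open>L (bump d)\<close> is
  twice the convolution of the bump with \<open>N\<close>, and \<open>N\<close> lies between the
  values of \<open>\<nu>\<close> at the extreme distances.\<close>

lemma L_bump_far:
  assumes d: "0 < d" and w: "d < norm w"
  shows "(LBINT z. \<bar>sdiff (bump d) w z\<bar> * N z) = L (bump d) w"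
    and "2 * (LBINT y. bump d (y::'a)) * \<nu> (norm w + d) \<le> L (bump d) w"
    and "L (bump d) w \<le> 2 * (LBINT y. bump d (y::'a)) * \<nu> (norm w - d)"
proof -
  define g where "g y = bump d y * N (y - w)" for y :: 'a
  have mg: "g \<in> borel_measurable borel" unfolding g_def by measurable
  have b: "bump d y * \<nu> (norm w + d) \<le> g y \<and> g y \<le> bump d y * \<nu> (norm w - d)" for y
  proof (cases "norm y < d")
    case True
    have 1: "norm w - d \<le> norm (y - w)" "norm (y - w) \<le> norm w + d"
      using True norm_triangle_ineq2[of w y] norm_triangle_ineq4[of y w] by (auto simp: norm_minus_commute)
    have nz: "y - w \<noteq> 0" using True w by auto
    have "\<nu> (norm w + d) \<le> N (y - w)" "N (y - w) \<le> \<nu> (norm w - d)"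
      unfolding N_eq[OF nz] using 1 w nz by (auto intro!: nu_mono)
    then show ?thesis unfolding g_def by (auto intro!: mult_left_mono simp: bump_nonneg)
  next
    case False then show ?thesis using bump_out[OF d, of y] by (simp add: g_def)
  qed
  have g0: "0 \<le> g y" for y by (simp add: g_def bump_nonneg N_nonneg)
  have ig: "integrable lborel g"
    by (rule Bochner_Integration.integrable_bound[OF integrable_mult_left[OF bump_integrable[OF d], of "\<nu> (norm w - d)"]])
      (use b g0 mg in \<open>auto intro!: AE_I2 order_trans[OF _ abs_ge_self]\<close>)
  have w0: "bump d w = 0" using bump_out[OF d, of w] w by simp
  have sd: "sdiff (bump d) w z * N z = g (z + w) + g (w - z)" for z
    by (simp add: sdiff_def w0 g_def algebra_simps)
  have sdn: "0 \<le> sdiff (bump d) w z" for z by (simp add: sdiff_def w0 bump_nonneg)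
  then show "(LBINT z. \<bar>sdiff (bump d) w z\<bar> * N z) = L (bump d) w" by (simp add: L_def)
  have "integrable lborel (\<lambda>z. g (z + w))" using lborel_invariant(2)[OF _ distr_lborel_plus mg] ig by simp
  moreover have "integrable lborel (\<lambda>z. g (w - z))" using lborel_invariant(2)[OF _ distr_lborel_diff mg] ig by simp
  ultimately have Lw: "L (bump d) w = 2 * (LBINT y. g y)"
    unfolding L_def sd using lborel_invariant(1)[OF _ distr_lborel_plus mg, of w] lborel_invariant(1)[OF _ distr_lborel_diff mg, of w] by simp
  have "(LBINT y. bump d (y::'a) * \<nu> (norm w + d)) \<le> (LBINT y. g y)"
    using b by (intro integral_mono ig integrable_mult_left[OF bump_integrable[OF d]]) auto
  then show "2 * (LBINT y. bump d (y::'a)) * \<nu> (norm w + d) \<le> L (bump d) w" unfolding Lw by simp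
  have "(LBINT y. g y) \<le> (LBINT y. bump d (y::'a) * \<nu> (norm w - d))"
    using b by (intro integral_mono ig integrable_mult_left[OF bump_integrable[OF d]]) auto
  then show "L (bump d) w \<le> 2 * (LBINT y. bump d (y::'a)) * \<nu> (norm w - d)" unfolding Lw by simp
qed

text \<open>A weight comparable with \<open>N\<close> away from the origin but bounded near it.
  Integrability against it is the global condition on f that carries all interchanges of limits
  below; moving its centre by at most 1 costs a factor a.\<close>

definition W :: "'a \<Rightarrow> real" where "W y = \<nu> (norm y + 1)"

lemma W_pos: "0 < W y"
  unfolding W_def by (rule nu_pos) (simp add: add_nonneg_pos)

text \<open>Measurability is at hand for \<open>N\<close> on the space, so the radius is realised as
  a vector on a coordinate axis. Similar rewritings occur in \<open>tail_bound\<close> and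
  \<open>mv_ball_difference\<close>.\<close>

lemma W_measurable[measurable]: "W \<in> borel_measurable borel"
proof -
  obtain b :: 'a where b: "b \<in> Basis" using nonempty_Basis by blast
  have "W y = N ((norm y + 1) *\<^sub>R b)" for y
  proof -
    have "(norm y + 1) *\<^sub>R b \<noteq> 0" using b by (smt (verit) nonzero_Basis norm_ge_zero scaleR_eq_0_iff)
    then show ?thesis using b by (simp add: W_def N_eq)
  qed
  then show ?thesis by (simp add: W_def[abs_def])
qed

lemma W_comp: assumes "norm (y - y') \<le> 1" shows "W y \<le> a * W y'"
proof -
  have "norm y' \<le> norm y + 1" using norm_triangle_ineq2[of y' y] assms by (simp add: norm_minus_commute)
  then show ?thesis unfolding W_def using norm_ge_zero[of y] norm_ge_zero[of y'] by (intro nu_comp) linarith+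
qed

lemma W_integrable: "integrable lborel W"
proof (rule Bochner_Integration.integrable_bound)
  have "integrable lborel (\<lambda>y::'a. \<nu> 1 * indicator (cball 0 1) y)"
    by (intro integrable_mult_right) (use emeasure_lborel_cball_finite in \<open>simp add: integrable_indicator_iff\<close>)
  then show "integrable lborel (\<lambda>y::'a. \<nu> 1 * indicator (cball 0 1) y + min 1 ((norm y)\<^sup>2) * N y)"
    using N_integrable by (rule Bochner_Integration.integrable_add)
  show "AE y in lborel. norm (W y) \<le> norm (\<nu> 1 * indicator (cball 0 1) y + min 1 ((norm y)\<^sup>2) * N y)"
  proof (intro AE_I2)
    fix y :: 'a
    have "W y \<le> \<nu> 1 * indicator (cball 0 1) y + min 1 ((norm y)\<^sup>2) * N y"
    proof (cases "norm y \<le> 1")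
      case True
      have "W y \<le> \<nu> 1" unfolding W_def by (rule nu_mono) auto
      then show ?thesis using True N_nonneg[of y] by (simp add: add_increasing2)
    next
      case False
      then have "min 1 ((norm y)\<^sup>2) = 1" by (simp add: one_le_power)
      moreover have "W y \<le> N y" unfolding W_def using False by (subst N_eq) (auto intro!: nu_mono)
      ultimately show ?thesis using False by simp
    qed
    then show "norm (W y) \<le> norm (\<nu> 1 * indicator (cball 0 1) y + min 1 ((norm y)\<^sup>2) * N y)"
      using W_pos[of y] by simp
  qed
qed measurable

text \<open>Near the origin the integral is at most 34 * H d and \<open>W\<close> is bounded below.
  Far out the second difference is nonnegative, and two doublings compare
  \<open>\<nu> (norm w - d)\<close> with \<open>W w\<close>.\<close>

lemma sdiff_bump_W:
  assumes d: "0 < d" "d \<le> 1"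
  obtains C where "0 \<le> C" "\<And>w. (LBINT z. \<bar>sdiff (bump d) w z\<bar> * N z) \<le> C * W w"
proof -
  let ?K = "\<integral>y. bump d (y::'a) \<partial>lborel"
  have K: "0 < ?K" by (rule bump_integral_pos[OF d(1)])
  have n3: "0 < \<nu> 3" by (rule nu_pos) simp
  define C where "C = 34 * H d / \<nu> 3 + 2 * ?K * a\<^sup>2"
  have C0: "0 \<le> 34 * H d / \<nu> 3" "0 \<le> 2 * ?K * a\<^sup>2" using H_pos[OF d(1)] n3 K a_ge_1 by auto
  show ?thesis
  proof (rule that[of C])
    show "0 \<le> C" using C0 by (simp add: C_def)
    fix w :: 'a
    show "(LBINT z. \<bar>sdiff (bump d) w z\<bar> * N z) \<le> C * W w"
    proof (cases "norm w \<le> 2")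
      case True
      have "(LBINT z. \<bar>sdiff (bump d) w z\<bar> * N z) \<le> 34 * H d"
        by (rule integral_N_bound[OF _ d(1)]) (use sdiff_bump[OF d(1)] in \<open>auto simp: sdiff_def\<close>)
      also have "\<dots> = (34 * H d / \<nu> 3) * \<nu> 3" using n3 by simp
      also have "\<dots> \<le> (34 * H d / \<nu> 3) * W w"
        unfolding W_def using True C0 by (intro mult_left_mono nu_mono) (auto simp: add_nonneg_pos)
      also have "\<dots> \<le> C * W w" using C0 W_pos[of w] by (intro mult_right_mono) (auto simp: C_def)
      finally show ?thesis .
    next
      case False
      then have w: "d < norm w" using d by simp
      have "\<nu> (norm w - d) \<le> \<nu> (norm w - 1)" using False d by (intro nu_mono) auto
      also have "\<dots> \<le> a * \<nu> (norm w)" using False by (intro nu_comp) auto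
      also have "\<dots> \<le> a * (a * \<nu> (norm w + 1))" using False a_ge_1 by (intro mult_left_mono nu_comp) auto
      finally have n: "\<nu> (norm w - d) \<le> a\<^sup>2 * W w" by (simp add: W_def power2_eq_square)
      have "(LBINT z. \<bar>sdiff (bump d) w z\<bar> * N z) \<le> 2 * ?K * \<nu> (norm w - d)"
        using L_bump_far(1,3)[OF d(1) w] by simp
      also have "\<dots> \<le> 2 * ?K * (a\<^sup>2 * W w)" using n K by (intro mult_left_mono) auto
      also have "\<dots> \<le> C * W w"
      proof -
        have "0 \<le> (34 * H d / \<nu> 3) * W w" using C0(1) W_pos[of w] by (intro mult_nonneg_nonneg) auto
        then show ?thesis by (simp add: C_def distrib_right)
      qed
      finally show ?thesis .
    qed
  qed
qed

lemma L_bump_le_abs: assumes d: "0 < d" shows "\<bar>L (bump d) w\<bar> \<le> (LBINT z. \<bar>sdiff (bump d) w z\<bar> * N z)"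
proof -
  have i: "integrable lborel (\<lambda>z. sdiff (bump d) w z * N z)" by (rule L_bump_integrable[OF d])
  have "\<bar>sdiff (bump d) w z * N z\<bar> = \<bar>sdiff (bump d) w z\<bar> * N z" for z by (simp add: abs_mult N_nonneg)
  then show ?thesis unfolding L_def using integral_abs_bound[of lborel "\<lambda>z. sdiff (bump d) w z * N z"] by simp
qed

end

section \<open>The law of the exit position\<close>

context levy_setting begin

definition mu :: "real \<Rightarrow> 'a measure" where
  "mu s = distr M borel (\<lambda>\<omega>. Y \<omega> (sig s \<omega>))"

lemma mu_prob: "prob_space (mu s)"
  unfolding mu_def by (rule prob_space_distr) measurable

lemma sets_mu[simp, measurable_cong]: "sets (mu s) = sets borel"
  by (simp add: mu_def)

lemma space_mu[simp]: "space (mu s) = UNIV"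
  by (simp add: mu_def)

lemma mu_support: assumes "0 < s" shows "AE z in mu s. s \<le> norm z"
  unfolding mu_def
  by (subst AE_distr_iff) (use AE_leaves[OF assms] in \<open>auto elim!: eventually_mono intro: exit_position_far\<close>)

text \<open>The exit law tested against a bump centred at -x; all quantitative information on the
  law is extracted from these numbers.\<close>

definition bm :: "real \<Rightarrow> real \<Rightarrow> 'a \<Rightarrow> real" where
  "bm d s x = (\<integral>z. bump d (x + z) \<partial>mu s)"

lemma bm_eq: "bm d s x = (\<integral>\<omega>. bump d (x + Y \<omega> (sig s \<omega>)) \<partial>M)"
  unfolding bm_def mu_def by (rule integral_distr) measurable

lemma mu_bump_integrable: "integrable (mu s) (\<lambda>z. bump d (x + z))"
proof -
  interpret mu: prob_space "mu s" by (rule mu_prob)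
  show ?thesis by (rule mu.integrable_const_bound[where B = 1]) (auto simp: bump_abs)
qed

lemma bm_nonneg: "0 \<le> bm d s x"
  unfolding bm_def by (intro integral_nonneg_AE AE_I2 bump_nonneg)

lemma bm_nn: "(\<integral>\<^sup>+z. ennreal (bump d (x + z)) \<partial>mu s) = ennreal (bm d s x)"
  unfolding bm_def by (rule nn_integral_eq_integral[OF mu_bump_integrable]) (simp add: bump_nonneg)

lemma bm_measurable[measurable]: "bm d s \<in> borel_measurable borel"
proof -
  interpret mu: prob_space "mu s" by (rule mu_prob)
  have "(\<lambda>(x, z). bump d (x + z)) \<in> borel_measurable (borel \<Otimes>\<^sub>M mu s)" by measurable
  from mu.borel_measurable_lebesgue_integral[OF this] show ?thesis by (simp add: bm_def[abs_def])
qed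

lemma bm_dynkin:
  assumes "0 < d" "0 < s"
  shows "(\<And>y. norm y \<le> s \<Longrightarrow> L (bump d) (x + y) \<le> m) \<Longrightarrow> bm d s x - bump d x \<le> m / 2 * mean_exit s"
    and "(\<And>y. norm y \<le> s \<Longrightarrow> m \<le> L (bump d) (x + y)) \<Longrightarrow> m / 2 * mean_exit s \<le> bm d s x - bump d x"
  unfolding bm_eq by (rule bump_dynkin[OF assms]; assumption)+

text \<open>The bump of radius s is 1 at the start and 0 at the exit, while \<open>L\<close> of it
  is at least \<open>- (34 * H s)\<close>; halving gives 17.\<close>

lemma mean_exit_ge: assumes s: "0 < s" shows "1 \<le> 17 * H s * mean_exit s"
proof -
  have "(- (34 * H s)) / 2 * mean_exit s \<le> bm s s 0 - bump s (0::'a)"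
  proof (rule bm_dynkin(2)[OF s s])
    fix y :: 'a
    show "- (34 * H s) \<le> L (bump s) (0 + y)" using L_bump_bound[OF s, of "0 + y"] by linarith
  qed
  moreover have "bm s s 0 = (\<integral>z. 0 \<partial>mu s)" unfolding bm_def
  proof (rule integral_cong_AE)
    show "AE z in mu s. bump s (0 + z) = 0" using mu_support[OF s] by (rule eventually_mono) (simp add: bump_out[OF s])
  qed auto
  ultimately show ?thesis by (simp add: bump_0)
qed

lemma mean_exit_pos: assumes s: "0 < s" shows "0 < mean_exit s"
  using mean_exit_ge[OF s] H_pos[OF s] mean_exit_nonneg[of s] by (cases "mean_exit s = 0") auto

text \<open>Together with \<open>bm_far_upper\<close> this replaces a Levy system formula: the mass
  that the exit law puts near -w is the mean exit time times a jump density, taken at a distance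
  between \<open>norm w - s - d\<close> and \<open>norm w + s + d\<close>.\<close>

lemma bm_far_lower:
  assumes d: "0 < d" and s: "0 < s" and w: "d + s < norm w"
  shows "mean_exit s * (LBINT y. bump d (y::'a)) * \<nu> (norm w + s + d) \<le> bm d s w"
proof -
  let ?K = "\<integral>y. bump d (y::'a) \<partial>lborel"
  have "(2 * ?K * \<nu> (norm w + s + d)) / 2 * mean_exit s \<le> bm d s w - bump d w"
  proof (rule bm_dynkin(2)[OF d s])
    fix y :: 'a assume y: "norm y \<le> s"
    have 1: "norm w - s \<le> norm (w + y)" "norm (w + y) \<le> norm w + s"
      using y norm_triangle_ineq[of w y] norm_diff_ineq[of w y] by linarith+
    then have 2: "d < norm (w + y)" using w by linarith
    have "2 * ?K * \<nu> (norm w + s + d) \<le> 2 * ?K * \<nu> (norm (w + y) + d)"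
      using 1 2 d bump_integral_pos[OF d, where 'a = 'a] by (intro mult_left_mono nu_mono) auto
    also have "\<dots> \<le> L (bump d) (w + y)" by (rule L_bump_far(2)[OF d 2])
    finally show "2 * ?K * \<nu> (norm w + s + d) \<le> L (bump d) (w + y)" .
  qed
  then show ?thesis using bump_nonneg[of d w] by (simp add: ac_simps)
qed

lemma bm_far_upper:
  assumes d: "0 < d" and s: "0 < s" and w: "d + s < norm w"
  shows "bm d s w \<le> mean_exit s * (LBINT y. bump d (y::'a)) * \<nu> (norm w - s - d)"
proof -
  let ?K = "\<integral>y. bump d (y::'a) \<partial>lborel"
  have "bm d s w - bump d w \<le> (2 * ?K * \<nu> (norm w - s - d)) / 2 * mean_exit s"
  proof (rule bm_dynkin(1)[OF d s])
    fix y :: 'a assume y: "norm y \<le> s"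
    have 1: "norm w - s \<le> norm (w + y)"
      using y norm_diff_ineq[of w y] by linarith
    then have 2: "d < norm (w + y)" using w by linarith
    have "L (bump d) (w + y) \<le> 2 * ?K * \<nu> (norm (w + y) - d)" by (rule L_bump_far(3)[OF d 2])
    also have "\<dots> \<le> 2 * ?K * \<nu> (norm w - s - d)"
      using 1 2 w bump_integral_pos[OF d, where 'a = 'a] by (intro mult_left_mono nu_mono) auto
    finally show "L (bump d) (w + y) \<le> 2 * ?K * \<nu> (norm w - s - d)" .
  qed
  moreover have "bump d w = 0" using bump_out[OF d, of w] w s by simp
  ultimately show ?thesis by (simp add: ac_simps)
qed

lemma bm_W:
  assumes d: "0 < d" "d \<le> 1"
  obtains C where "0 \<le> C"
    "\<And>s w. 0 < s \<Longrightarrow> s \<le> 1 \<Longrightarrow> \<bar>bm d s w - bump d w\<bar> \<le> C * mean_exit s * W w"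
proof -
  obtain C where C: "0 \<le> C" "\<And>w. (LBINT z. \<bar>sdiff (bump d) w z\<bar> * N z) \<le> C * W w"
    using sdiff_bump_W[OF d] by blast
  have LC: "\<bar>L (bump d) (w + y)\<bar> \<le> C * (a * W w)" if "norm y \<le> 1" for w y
  proof -
    have "\<bar>L (bump d) (w + y)\<bar> \<le> C * W (w + y)" using L_bump_le_abs[OF d(1)] C(2) order_trans by blast
    also have "\<dots> \<le> C * (a * W w)" using that C(1) by (intro mult_left_mono W_comp) auto
    finally show ?thesis .
  qed
  show ?thesis
  proof (rule that[of "C * a"])
    show "0 \<le> C * a" using C a_ge_1 by simp
    fix s w assume s: "0 < s" "s \<le> (1::real)"
    define q where "q = C * (a * W w) / 2 * mean_exit s"
    have "bm d s w - bump d w \<le> C * (a * W w) / 2 * mean_exit s"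
    proof (rule bm_dynkin(1)[OF d(1) s(1)])
      fix y :: 'a assume "norm y \<le> s"
      then show "L (bump d) (w + y) \<le> C * (a * W w)" using LC[of y w] s by linarith
    qed
    then have up: "bm d s w - bump d w \<le> q" by (simp add: q_def)
    have "(- (C * (a * W w))) / 2 * mean_exit s \<le> bm d s w - bump d w"
    proof (rule bm_dynkin(2)[OF d(1) s(1)])
      fix y :: 'a assume "norm y \<le> s"
      then show "- (C * (a * W w)) \<le> L (bump d) (w + y)" using LC[of y w] s by linarith
    qed
    then have "- q \<le> bm d s w - bump d w" by (simp add: q_def)
    with up have "\<bar>bm d s w - bump d w\<bar> \<le> C * (a * W w) / 2 * mean_exit s" unfolding q_def[symmetric] by linarith
    also have "\<dots> \<le> C * a * mean_exit s * W w"
      using C a_ge_1 W_pos[of w] mean_exit_nonneg[of s] by (simp add: ac_simps mult_nonneg_nonneg less_imp_le)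
    finally show "\<bar>bm d s w - bump d w\<bar> \<le> C * a * mean_exit s * W w" .
  qed
qed

text \<open>Harmonicity is stated with the exit time from an open ball, the estimates with
  \<open>sig\<close>; at these radii the two agree almost surely, for every centre.\<close>

definition good_radius :: "real \<Rightarrow> bool" where
  "good_radius s \<longleftrightarrow> 0 < s \<and> (\<forall>x. AE \<omega> in M. exit_time Y x (ball x s) \<omega> = sig s \<omega>)"

lemma good_radius_exists: assumes "0 \<le> p" "p < q" obtains s where "p < s" "s < q" "good_radius s"
proof -
  obtain C where C: "countable C" "\<And>s x. 0 < s \<Longrightarrow> s \<notin> C \<Longrightarrow> AE \<omega> in M. exit_time Y x (ball x s) \<omega> = sig s \<omega>"
    using exit_time_eq_sig by blast
  have "uncountable {p<..<q}" using assms by (simp add: uncountable_open_interval)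
  then obtain s where "s \<in> {p<..<q}" "s \<notin> C" using C(1) by (meson countable_subset subsetI)
  then show ?thesis using that C(2) assms by (auto simp: good_radius_def)
qed

section \<open>The mean value property and the tail of a harmonic function\<close>

definition mean_value :: "('a \<Rightarrow> real) \<Rightarrow> real \<Rightarrow> 'a \<Rightarrow> bool" where
  "mean_value u s x \<longleftrightarrow> integrable (mu s) (\<lambda>z. u (x + z)) \<and> u x = (\<integral>z. u (x + z) \<partial>mu s)"

lemma harmonic_mean_value:
  assumes h: "harmonic_wrt M Y f D" and s: "good_radius s" and D: "cball x s \<subseteq> D"
  shows "mean_value f s x"
proof -
  have f[measurable]: "f \<in> borel_measurable borel" using h by (simp add: harmonic_wrt_def)
  have s0: "0 < s" using s by (simp add: good_radius_def)
  have "closure (ball x s) \<subseteq> D" using D s0 by simp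
  then have i: "integrable M (\<lambda>\<omega>. f (x + Y \<omega> (exit_time Y x (ball x s) \<omega>)))"
    and e: "f x = (\<integral>\<omega>. f (x + Y \<omega> (exit_time Y x (ball x s) \<omega>)) \<partial>M)"
    using h s0 unfolding harmonic_wrt_def by (auto dest!: spec[of _ "ball x s"])
  have ae: "AE \<omega> in M. f (x + Y \<omega> (exit_time Y x (ball x s) \<omega>)) = f (x + Y \<omega> (sig s \<omega>))"
  proof -
    have "AE \<omega> in M. exit_time Y x (ball x s) \<omega> = sig s \<omega>" using s by (simp add: good_radius_def)
    then show ?thesis by eventually_elim simp
  qed
  have m: "(\<lambda>\<omega>. f (x + Y \<omega> (sig s \<omega>))) \<in> borel_measurable M" by measurable
  have i': "integrable M (\<lambda>\<omega>. f (x + Y \<omega> (sig s \<omega>)))"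
    using integrable_cong_AE[OF borel_measurable_integrable[OF i] m ae] i by simp
  have e': "f x = (\<integral>\<omega>. f (x + Y \<omega> (sig s \<omega>)) \<partial>M)"
    using integral_cong_AE[OF borel_measurable_integrable[OF i] m ae] e by simp
  show ?thesis unfolding mean_value_def mu_def
    using i' e' by (subst integrable_distr_eq, measurable, subst integral_distr) auto
qed

text \<open>Fubini and a translation move the average over the exit position from f to the bump. The
  integrals are of nonnegative functions because integrability of f over the whole space is only
  derived from this identity.\<close>

lemma mean_value_mollify:
  assumes f[measurable]: "f \<in> borel_measurable borel" and f0: "\<And>x. 0 \<le> f x" and d: "0 < d"
    and mv: "\<And>x. x \<in> ball x0 d \<Longrightarrow> mean_value f s x"
  shows "(\<integral>\<^sup>+x. ennreal (bump d (x0 - x) * f x) \<partial>lborel) = (\<integral>\<^sup>+y. ennreal (f y * bm d s (x0 - y)) \<partial>lborel)"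
proof -
  interpret mu: prob_space "mu s" by (rule mu_prob)
  interpret P: pair_sigma_finite lborel "mu s" ..
  have 1: "ennreal (bump d (x0 - x) * f x) = (\<integral>\<^sup>+z. ennreal (bump d (x0 - x) * f (x + z)) \<partial>mu s)" for x
  proof (cases "x \<in> ball x0 d")
    case True
    have "ennreal (f x) = (\<integral>\<^sup>+z. ennreal (f (x + z)) \<partial>mu s)"
      using mv[OF True] f0 unfolding mean_value_def by (subst nn_integral_eq_integral) auto
    then show ?thesis using bump_nonneg[of d "x0 - x"] f0
      by (simp add: ennreal_mult nn_integral_cmult)
  next
    case False
    then have "bump d (x0 - x) = 0" by (intro bump_out[OF d]) (simp add: dist_norm)
    then show ?thesis by simp
  qed
  have "(\<integral>\<^sup>+x. ennreal (bump d (x0 - x) * f x) \<partial>lborel) = (\<integral>\<^sup>+x. (\<integral>\<^sup>+z. ennreal (bump d (x0 - x) * f (x + z)) \<partial>mu s) \<partial>lborel)"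
    by (simp add: 1)
  also have "\<dots> = (\<integral>\<^sup>+z. (\<integral>\<^sup>+x. ennreal (bump d (x0 - x) * f (x + z)) \<partial>lborel) \<partial>mu s)"
    by (rule P.Fubini'[symmetric]) measurable
  also have "\<dots> = (\<integral>\<^sup>+z. (\<integral>\<^sup>+y. ennreal (f y * bump d (x0 - y + z)) \<partial>lborel) \<partial>mu s)"
  proof (rule nn_integral_cong)
    fix z
    have "(\<integral>\<^sup>+x. ennreal (f (x + z) * bump d (x0 - (x + z) + z)) \<partial>lborel) = (\<integral>\<^sup>+y. ennreal (f y * bump d (x0 - y + z)) \<partial>lborel)"
      by (rule lborel_invariant_nn[OF _ distr_lborel_plus]) measurable
    then show "(\<integral>\<^sup>+x. ennreal (bump d (x0 - x) * f (x + z)) \<partial>lborel) = (\<integral>\<^sup>+y. ennreal (f y * bump d (x0 - y + z)) \<partial>lborel)"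
      by (simp add: mult.commute)
  qed
  also have "\<dots> = (\<integral>\<^sup>+y. (\<integral>\<^sup>+z. ennreal (f y * bump d (x0 - y + z)) \<partial>mu s) \<partial>lborel)"
    by (rule P.Fubini') measurable
  also have "\<dots> = (\<integral>\<^sup>+y. ennreal (f y * bm d s (x0 - y)) \<partial>lborel)"
    by (rule nn_integral_cong) (simp add: ennreal_mult'[OF f0] nn_integral_cmult bm_nn)
  finally show ?thesis .
qed

text \<open>By \<open>bm_far_lower\<close> the mean values near x0 contain the far part of f
  weighted by \<open>\<nu>\<close>, times the mean exit time. They are at most G, and dividing by
  the mean exit time leaves 17 * H s * G by \<open>mean_exit_ge\<close>; the mass of the bump
  cancels.\<close>

lemma tail_bound:
  assumes f[measurable]: "f \<in> borel_measurable borel" and f0: "\<And>x. 0 \<le> f x" and d: "0 < d" and s: "0 < s"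
    and mv: "\<And>x. x \<in> ball x0 d \<Longrightarrow> mean_value f s x" and G: "\<And>x. x \<in> ball x0 d \<Longrightarrow> f x \<le> G" "0 \<le> G"
  shows "(\<integral>\<^sup>+y. ennreal (indicator {y. d + s < norm (x0 - y)} y * f y * \<nu> (norm (x0 - y) + s + d)) \<partial>lborel) \<le> ennreal (17 * H s * G)"
proof -
  let ?K = "\<integral>y. bump d (y::'a) \<partial>lborel"
  have K: "0 < ?K" by (rule bump_integral_pos[OF d])
  have e: "0 < mean_exit s" by (rule mean_exit_pos[OF s])
  let ?g = "\<lambda>y. indicator {y. d + s < norm (x0 - y)} y * f y * \<nu> (norm (x0 - y) + s + d)"
  have g0: "0 \<le> ?g y" for y using f0[of y] nu_nonneg[of "norm (x0 - y) + s + d"] d s by (auto simp: indicator_def add_nonneg_pos)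
  have le: "(mean_exit s * ?K) * ?g y \<le> f y * bm d s (x0 - y)" for y
  proof (cases "d + s < norm (x0 - y)")
    case True
    from mult_left_mono[OF bm_far_lower[OF d s True] f0[of y]] show ?thesis using True by (simp add: ac_simps)
  qed (simp add: f0 bm_nonneg)
  have "ennreal (mean_exit s * ?K) * (\<integral>\<^sup>+y. ennreal (?g y) \<partial>lborel) = (\<integral>\<^sup>+y. ennreal ((mean_exit s * ?K) * ?g y) \<partial>lborel)"
  proof -
    have m: "(\<lambda>y. ennreal (?g y)) \<in> borel_measurable lborel"
    proof -
      have "(\<lambda>y. indicator {y. d + s < norm (x0 - y)} y * f y * (if y = x0 then \<nu> (s + d) else N ((1 + (s + d) / norm (x0 - y)) *\<^sub>R (x0 - y)))) \<in> borel_measurable borel"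
        by measurable
      moreover have "(if y = x0 then \<nu> (s + d) else N ((1 + (s + d) / norm (x0 - y)) *\<^sub>R (x0 - y))) = \<nu> (norm (x0 - y) + s + d)" for y
      proof (cases "y = x0")
        case False
        have p: "0 < 1 + (s + d) / norm (x0 - y)" using d s by (intro add_pos_nonneg divide_nonneg_nonneg) auto
        then have "(1 + (s + d) / norm (x0 - y)) *\<^sub>R (x0 - y) \<noteq> 0" using False by simp
        moreover have "norm ((1 + (s + d) / norm (x0 - y)) *\<^sub>R (x0 - y)) = norm (x0 - y) + s + d"
          using p False by (simp add: abs_of_pos) (simp add: field_simps)
        ultimately show ?thesis using False by (simp only: N_eq if_False simp_thms)
      qed (simp add: add.commute)
      ultimately show ?thesis by simp
    qed
    show ?thesis using e K g0 by (subst nn_integral_cmult[OF m, symmetric]) (simp add: ennreal_mult)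
  qed
  also have "\<dots> \<le> (\<integral>\<^sup>+y. ennreal (f y * bm d s (x0 - y)) \<partial>lborel)" using le by (intro nn_integral_mono ennreal_leI) auto
  also have "\<dots> = (\<integral>\<^sup>+x. ennreal (bump d (x0 - x) * f x) \<partial>lborel)" by (rule mean_value_mollify[OF f f0 d mv, symmetric])
  also have "\<dots> \<le> (\<integral>\<^sup>+x. ennreal (G * bump d (x0 - x)) \<partial>lborel)"
  proof (intro nn_integral_mono ennreal_leI)
    fix x
    show "bump d (x0 - x) * f x \<le> G * bump d (x0 - x)"
    proof (cases "x \<in> ball x0 d")
      case True then show ?thesis using mult_left_mono[OF G(1)[OF True] bump_nonneg[of d "x0 - x"]] by (simp add: mult.commute)
    next
      case False
      then have "bump d (x0 - x) = 0" by (intro bump_out[OF d]) (simp add: dist_norm)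
      then show ?thesis by simp
    qed
  qed
  also have "\<dots> = ennreal (G * ?K)"
  proof -
    have i: "integrable lborel (\<lambda>x. bump d (x0 - x))"
      using lborel_invariant(2)[OF _ distr_lborel_diff[of x0] bump_measurable] bump_integrable[OF d] by simp
    have "(LBINT x. bump d (x0 - x)) = ?K" by (rule lborel_invariant(1)[OF _ distr_lborel_diff bump_measurable]) simp
    then show ?thesis using i G(2) by (subst nn_integral_eq_integral) (auto intro!: AE_I2 mult_nonneg_nonneg bump_nonneg)
  qed
  finally have fin: "ennreal (mean_exit s * ?K) * (\<integral>\<^sup>+y. ennreal (?g y) \<partial>lborel) \<le> ennreal (G * ?K)" .
  have "(\<integral>\<^sup>+y. ennreal (?g y) \<partial>lborel) \<le> ennreal (G * ?K) / ennreal (mean_exit s * ?K)"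
  proof -
    have "(\<integral>\<^sup>+y. ennreal (?g y) \<partial>lborel) = (ennreal (mean_exit s * ?K) * (\<integral>\<^sup>+y. ennreal (?g y) \<partial>lborel)) / ennreal (mean_exit s * ?K)"
      using e K by (subst ennreal_mult_divide_eq[symmetric]) (auto simp: mult.commute)
    also have "\<dots> \<le> ennreal (G * ?K) / ennreal (mean_exit s * ?K)" by (rule divide_right_mono_ennreal[OF fin])
    finally show ?thesis .
  qed
  also have "\<dots> = ennreal (G * ?K / (mean_exit s * ?K))" using e K G(2) by (intro divide_ennreal) auto
  also have "\<dots> \<le> ennreal (17 * H s * G)"
  proof (rule ennreal_leI)
    have "G * ?K / (mean_exit s * ?K) = G / mean_exit s" using K by simp
    also have "\<dots> \<le> 17 * H s * G"
    proof -
      have "G * 1 \<le> G * (17 * H s * mean_exit s)" using mean_exit_ge[OF s] G(2) by (rule mult_left_mono)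
      then show ?thesis using e by (simp add: pos_divide_le_eq ac_simps)
    qed
    finally show "G * ?K / (mean_exit s * ?K) \<le> 17 * H s * G" .
  qed
  finally show ?thesis .
qed

end

section \<open>Continuity of harmonic functions\<close>

text \<open>Induction over integrable functions. For the indicator of A take a compact K inside and
  an open U outside with U - K small: a shift shorter than the distance from K to the complement of
  U changes the indicator only on U - K and on its translate.\<close>

lemma L1_translation:
  fixes F :: "'a::euclidean_space \<Rightarrow> real"
  assumes "integrable lborel F" "0 < (\<epsilon>::real)"
  shows "\<exists>e>0. \<forall>h. norm h < e \<longrightarrow> (LBINT y. \<bar>F (y + h) - F y\<bar>) \<le> \<epsilon>"
  using assms
proof (induction arbitrary: \<epsilon> rule: integrable_induct)
  case (base A c)
  have A[measurable]: "A \<in> sets borel" using base by simp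
  define \<delta> where "\<delta> = \<epsilon> / (4 * (\<bar>c\<bar> + 1))"
  have \<delta>: "0 < \<delta>" using base by (simp add: \<delta>_def)
  obtain U where U: "open U" "A \<subseteq> U" "emeasure lebesgue (U - A) < ennreal \<delta>"
    using sets_lebesgue_outer_open[of A \<delta>] A \<delta> by auto
  have "emeasure lborel (U - A) < ennreal \<delta>" using U A by simp
  obtain K where K: "compact K" "K \<subseteq> A" "emeasure lborel (A - K) < ennreal \<delta>"
  proof -
    \<comment> \<open>Restricting Lebesgue measure to A gives a finite measure, to which inner
      regularity is applied.\<close>
    define m where "m = density lborel (indicator A)"
    have em: "emeasure m B = emeasure lborel (A \<inter> B)" if "B \<in> sets borel" for B
      unfolding m_def using that by (simp add: emeasure_density indicator_inter_arith[symmetric] Int_commute)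
    have sp: "space m = UNIV" "sets m = sets borel" by (auto simp: m_def)
    have fin: "emeasure m (space m) \<noteq> \<infinity>" using base em[of UNIV] sp by simp
    have SUP: "emeasure m A = (SUP K \<in> {K. K \<subseteq> A \<and> compact K}. emeasure m K)"
      by (rule inner_regular[OF sp(2) fin A])
    have "\<exists>K. K \<subseteq> A \<and> compact K \<and> emeasure m A < emeasure m K + ennreal \<delta>"
    proof (cases "emeasure m A = 0")
      case True then show ?thesis using \<delta> by (intro exI[of _ "{}"]) auto
    next
      case False
      have pos: "0 < emeasure m A" using False by (simp add: zero_less_iff_neq_zero)
      have fA: "emeasure m A < top" using base(2) em[OF A] by simp
      have "emeasure m A - ennreal \<delta> < emeasure m A" by (rule ennreal_between[OF _ pos fA]) (use \<delta> in simp)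
      then have "emeasure m A - ennreal \<delta> < (SUP K \<in> {K. K \<subseteq> A \<and> compact K}. emeasure m K)" unfolding SUP[symmetric] .
      then obtain K where K: "K \<subseteq> A" "compact K" "emeasure m A - ennreal \<delta> < emeasure m K"
        unfolding less_SUP_iff by blast
      have "emeasure m A < emeasure m K + ennreal \<delta>"
      proof (cases "ennreal \<delta> \<le> emeasure m A")
        case True then show ?thesis using K(3) minus_less_iff_ennreal[OF ennreal_less_top True] by blast
      next
        case False then show ?thesis by (intro less_le_trans[OF _ add_increasing[OF zero_le order_refl]]) simp
      qed
      then show ?thesis using K by blast
    qed
    then obtain K where K: "K \<subseteq> A" "compact K" "emeasure m A < emeasure m K + ennreal \<delta>" by blast
    have Kb: "K \<in> sets borel" using K(2) by (simp add: borel_compact)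
    have "emeasure lborel A = emeasure lborel K + emeasure lborel (A - K)"
      using plus_emeasure[of K lborel "A - K"] K(1) Kb A by (simp add: Un_absorb1)
    moreover have "emeasure lborel K \<noteq> \<infinity>" using K(2) emeasure_compact_finite[of K] by simp
    moreover have "emeasure m A = emeasure lborel A" "emeasure m K = emeasure lborel K"
      using em[OF A] em[OF Kb] K(1) by (auto simp: Int_absorb1)
    ultimately have "emeasure lborel (A - K) < ennreal \<delta>" using K(3) by simp
    then show ?thesis using that K by blast
  qed
  let ?V = "U - K"
  have Kb: "K \<in> sets borel" using K(1) by (simp add: borel_compact)
  have Ub: "U \<in> sets borel" using U(1) by simp
  have Vm: "?V \<in> sets borel" using Kb Ub by simp
  have "emeasure lborel ?V \<le> emeasure lborel (U - A) + emeasure lborel (A - K)"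
    using Ub A Kb by (intro order_trans[OF emeasure_mono emeasure_subadditive]) auto
  also have "\<dots> \<le> ennreal \<delta> + ennreal \<delta>"
    using U(3) K(3) Ub A by (intro add_mono) auto
  also have "\<dots> = ennreal (2 * \<delta>)" using \<delta> by (simp add: ennreal_plus[symmetric] del: ennreal_plus)
  finally have V2: "emeasure lborel ?V \<le> ennreal (2 * \<delta>)" .
  then have Vfin: "emeasure lborel ?V < \<infinity>" using ennreal_less_top le_less_trans by (metis infinity_ennreal_def)
  have V3: "measure lborel ?V \<le> 2 * \<delta>" using V2 \<delta> by (simp add: measure_def enn2real_leI)
  obtain e where e: "0 < e" "(\<Union>x\<in>K. ball x e) \<subseteq> U"
    using compact_subset_open_imp_ball_epsilon_subset[OF K(1) U(1)] K(2) U(2) by blast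
  show ?case
  proof (intro exI[of _ e] conjI allI impI e)
    fix h :: 'a assume h: "norm h < e"
    have iV: "integrable lborel (indicator ?V :: 'a \<Rightarrow> real)" using Vm Vfin by (simp add: integrable_indicator_iff)
    have iVh: "integrable lborel (\<lambda>y. indicator ?V (y + h) :: real)"
      using lborel_invariant(2)[OF _ distr_lborel_plus[of h], of "indicator ?V :: 'a \<Rightarrow> real"] iV Vm by simp
    have pt: "\<bar>indicator A (y + h) *\<^sub>R c - indicator A y *\<^sub>R c\<bar> \<le> \<bar>c\<bar> * (indicator ?V y + indicator ?V (y + h))" for y
    proof -
      have 1: "y \<in> U" if "y + h \<in> K" using e(2) that h by (force simp: dist_norm)
      have 2: "y + h \<in> U" if "y \<in> K" using e(2) that h by (force simp: dist_norm)
      show ?thesis using 1 2 K(2) U(2) by (auto simp: indicator_def)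
    qed
    have "(LBINT y. \<bar>indicator A (y + h) *\<^sub>R c - indicator A y *\<^sub>R c\<bar>) \<le> (LBINT y. \<bar>c\<bar> * (indicator ?V y + indicator ?V (y + h)))"
    proof (rule integral_mono')
      show "integrable lborel (\<lambda>y. \<bar>c\<bar> * (indicator ?V y + indicator ?V (y + h)) :: real)" using iV iVh by simp
    qed (use pt in auto)
    also have "\<dots> = \<bar>c\<bar> * (2 * measure lborel ?V)"
    proof -
      have "(LBINT y. indicator ?V (y + h)) = (LBINT y. (indicator ?V y :: real))"
        using lborel_invariant(1)[OF _ distr_lborel_plus[of h], of "indicator ?V :: 'a \<Rightarrow> real"] Vm by simp
      then show ?thesis using iV iVh by simp
    qed
    also have "\<dots> \<le> \<bar>c\<bar> * (2 * (2 * \<delta>))" using V3 by (intro mult_left_mono) auto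
    also have "\<dots> \<le> \<epsilon>" using base by (simp add: \<delta>_def field_simps)
    finally show "(LBINT y. \<bar>indicator A (y + h) *\<^sub>R c - indicator A y *\<^sub>R c\<bar>) \<le> \<epsilon>" .
  qed
next
  case (add f g)
  obtain e1 where e1: "0 < e1" "\<And>h. norm h < e1 \<Longrightarrow> (LBINT y. \<bar>f (y + h) - f y\<bar>) \<le> \<epsilon> / 2"
    using add.IH(1)[of "\<epsilon> / 2"] add.prems by auto
  obtain e2 where e2: "0 < e2" "\<And>h. norm h < e2 \<Longrightarrow> (LBINT y. \<bar>g (y + h) - g y\<bar>) \<le> \<epsilon> / 2"
    using add.IH(2)[of "\<epsilon> / 2"] add.prems by auto
  have sh: "integrable lborel (\<lambda>y. q (y + h))" if "integrable lborel q" for q :: "'a \<Rightarrow> real" and h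
    using lborel_invariant(2)[OF _ distr_lborel_plus[of h], of q] borel_measurable_integrable[OF that] that by simp
  show ?case
  proof (intro exI[of _ "min e1 e2"] conjI allI impI)
    fix h :: 'a assume h: "norm h < min e1 e2"
    have i: "integrable lborel (\<lambda>y. \<bar>f (y + h) - f y\<bar>)" "integrable lborel (\<lambda>y. \<bar>g (y + h) - g y\<bar>)"
      using add.hyps sh[OF add.hyps(1)] sh[OF add.hyps(2)] by auto
    have "(LBINT y. \<bar>f (y + h) + g (y + h) - (f y + g y)\<bar>) \<le> (LBINT y. \<bar>f (y + h) - f y\<bar> + \<bar>g (y + h) - g y\<bar>)"
      by (rule integral_mono') (use i in auto)
    also have "\<dots> \<le> \<epsilon> / 2 + \<epsilon> / 2" using i e1(2)[of h] e2(2)[of h] h by simp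
    finally show "(LBINT y. \<bar>f (y + h) + g (y + h) - (f y + g y)\<bar>) \<le> \<epsilon>" by simp
  qed (use e1 e2 in auto)
next
  case (lim f s)
  have sh: "integrable lborel (\<lambda>y. q (y + h))" "(LBINT y. q (y + h)) = (LBINT y. q y)"
    if "integrable lborel q" for q :: "'a \<Rightarrow> real" and h
    using lborel_invariant[OF _ distr_lborel_plus[of h], of q] borel_measurable_integrable[OF that] that by auto
  have "(\<lambda>i. \<integral>y. \<bar>s i y - f y\<bar> \<partial>lborel) \<longlonglongrightarrow> (\<integral>y. 0 \<partial>(lborel::'a measure))"
  proof (rule integral_dominated_convergence[where w = "\<lambda>y. 3 * \<bar>f y\<bar>"])
    show "AE y in lborel. (\<lambda>i. \<bar>s i y - f y\<bar>) \<longlonglongrightarrow> 0"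
    proof (intro AE_I2)
      fix y :: 'a
      have "(\<lambda>i. s i y - f y) \<longlonglongrightarrow> f y - f y" using lim.hyps(2)[of y] by (intro tendsto_intros) auto
      then show "(\<lambda>i. \<bar>s i y - f y\<bar>) \<longlonglongrightarrow> 0" using tendsto_rabs_zero by fastforce
    qed
    show "AE y in lborel. norm \<bar>s i y - f y\<bar> \<le> 3 * \<bar>f y\<bar>" for i
      using lim.hyps(3)[of _ i] by (intro AE_I2) (smt (verit) real_norm_def space_lborel UNIV_I)
  qed (use lim.hyps(1,4) borel_measurable_integrable[OF lim.hyps(4)] borel_measurable_integrable[OF lim.hyps(1)] in auto)
  then have "eventually (\<lambda>i. (LBINT y. \<bar>s i y - f y\<bar>) < \<epsilon> / 3) sequentially"
    using lim.prems by (intro order_tendstoD(2)) auto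
  then obtain i where i: "(LBINT y. \<bar>s i y - f y\<bar>) < \<epsilon> / 3" by (auto simp: eventually_sequentially)
  obtain e where e: "0 < e" "\<And>h. norm h < e \<Longrightarrow> (LBINT y. \<bar>s i (y + h) - s i y\<bar>) \<le> \<epsilon> / 3"
    using lim.IH[of "\<epsilon> / 3" i] lim.prems by auto
  show ?case
  proof (intro exI[of _ e] conjI allI impI e)
    fix h :: 'a assume h: "norm h < e"
    have i1: "integrable lborel (\<lambda>y. \<bar>s i y - f y\<bar>)" using lim.hyps(1,4) by simp
    have i2: "integrable lborel (\<lambda>y. \<bar>s i (y + h) - f (y + h)\<bar>)" "(LBINT y. \<bar>s i (y + h) - f (y + h)\<bar>) = (LBINT y. \<bar>s i y - f y\<bar>)"
      using sh[OF i1, of h] by auto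
    have i3: "integrable lborel (\<lambda>y. \<bar>s i (y + h) - s i y\<bar>)" using sh(1)[OF lim.hyps(1)[of i], of h] lim.hyps(1)[of i] by simp
    have "(LBINT y. \<bar>f (y + h) - f y\<bar>) \<le> (LBINT y. \<bar>s i (y + h) - f (y + h)\<bar> + \<bar>s i (y + h) - s i y\<bar> + \<bar>s i y - f y\<bar>)"
      by (rule integral_mono') (use i1 i2 i3 in auto)
    also have "\<dots> \<le> \<epsilon> / 3 + \<epsilon> / 3 + \<epsilon> / 3" using i1 i2 i3 i e(2)[OF h] by simp
    finally show "(LBINT y. \<bar>f (y + h) - f y\<bar>) \<le> \<epsilon>" by simp
  qed
qed

section \<open>Weighted translation and the jump mass at dyadic scales\<close>

context levy_kernel begin

text \<open>\<open>W\<close> samples \<open>\<nu>\<close> at radii at least 1, so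
  \<open>nu_diff_abs\<close> applies with m = 1; the second factor a moves the reference value to
  the point y + h.\<close>

lemma W_diff: assumes h: "norm h \<le> 1" shows "\<bar>W (y + h) - W y\<bar> \<le> 6 * a\<^sup>2 * norm h * W (y + h)"
proof -
  let ?p = "norm (y + h) + 1" and ?q = "norm y + 1"
  have d: "\<bar>?p - ?q\<bar> \<le> norm h" using norm_triangle_ineq3[of "y + h" y] by simp
  have "\<bar>\<nu> ?p - \<nu> ?q\<bar> \<le> 6 * a * \<nu> (min ?p ?q) * \<bar>?p - ?q\<bar> / 1" by (rule nu_diff_abs) auto
  also have "\<dots> \<le> 6 * a * (a * \<nu> ?p) * norm h"
  proof -
    have "\<nu> (min ?p ?q) \<le> a * \<nu> ?p"
    proof (rule nu_comp)
      have "0 \<le> norm y" "0 \<le> norm (y + h)" by auto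
      then show "0 < min ?p ?q" "0 < ?p" "?p - min ?p ?q \<le> min ?p ?q" "?p - min ?p ?q \<le> 1" using d h by linarith+
    qed
    moreover have "0 \<le> \<nu> (min ?p ?q)" "0 \<le> \<nu> ?p" by (intro nu_nonneg; smt (verit) norm_ge_zero)+
    ultimately show ?thesis unfolding div_by_1 using d a_ge_1
      by (intro mult_mono mult_left_mono) auto
  qed
  finally show ?thesis by (simp add: W_def power2_eq_square ac_simps)
qed

text \<open>The weight stays fixed while f is shifted. The plain L1 statement shifts the product,
  and the error from shifting the weight is of relative size \<open>norm h\<close> by
  \<open>W_diff\<close>.\<close>

lemma weighted_translation:
  assumes f[measurable]: "f \<in> borel_measurable borel" and i: "integrable lborel (\<lambda>y. f y * W (y - x0))" and "0 < (\<epsilon>::real)"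
  shows "\<exists>e>0. \<forall>h. norm h < e \<longrightarrow> integrable lborel (\<lambda>y. \<bar>f (y + h) - f y\<bar> * W (y - x0)) \<and>
      (LBINT y. \<bar>f (y + h) - f y\<bar> * W (y - x0)) \<le> \<epsilon>"
proof -
  let ?F = "\<lambda>y. f y * W (y - x0)"
  let ?I = "\<integral>y. \<bar>?F y\<bar> \<partial>lborel"
  have I0: "0 \<le> ?I" by simp
  obtain e1 where e1: "0 < e1" "\<And>h. norm h < e1 \<Longrightarrow> (LBINT y. \<bar>?F (y + h) - ?F y\<bar>) \<le> \<epsilon> / 2"
    using L1_translation[OF i, of "\<epsilon> / 2"] assms(3) by auto
  define e where "e = min (min e1 1) (\<epsilon> / (12 * a\<^sup>2 * (?I + 1)))"
  have a2: "0 < a\<^sup>2" using a_ge_1 by simp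
  have e: "0 < e" using e1(1) assms(3) a2 add_nonneg_pos[OF I0 zero_less_one] unfolding e_def by (simp add: divide_pos_pos mult_pos_pos)
  show ?thesis
  proof (intro exI[of _ e] conjI allI impI e)
    fix h :: 'a assume "norm h < e"
    then have h: "norm h < e1" "norm h \<le> 1" "norm h \<le> \<epsilon> / (12 * a\<^sup>2 * (?I + 1))" by (auto simp: e_def)
    have mF: "?F \<in> borel_measurable borel" by measurable
    have iS: "integrable lborel (\<lambda>y. ?F (y + h))" using lborel_invariant(2)[OF _ distr_lborel_plus[of h] mF] i by simp
    have aS: "integrable lborel (\<lambda>y. \<bar>?F (y + h)\<bar>)" "(LBINT y. \<bar>?F (y + h)\<bar>) = ?I"
      using iS lborel_invariant(1)[OF _ distr_lborel_plus[of h], of "\<lambda>y. \<bar>?F y\<bar>"] by auto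
    have pt: "\<bar>f (y + h) - f y\<bar> * W (y - x0) \<le> \<bar>?F (y + h) - ?F y\<bar> + 6 * a\<^sup>2 * norm h * \<bar>?F (y + h)\<bar>" for y
    proof -
      have yh: "(y - x0) + h = (y + h) - x0" by simp
      have "\<bar>f (y + h) - f y\<bar> * W (y - x0) = \<bar>(?F (y + h) - ?F y) - f (y + h) * (W ((y + h) - x0) - W (y - x0))\<bar>"
      proof -
        have "(?F (y + h) - ?F y) - f (y + h) * (W ((y + h) - x0) - W (y - x0)) = (f (y + h) - f y) * W (y - x0)"
          by (simp add: algebra_simps)
        then show ?thesis using W_pos[of "y - x0"] by (simp add: abs_mult)
      qed
      also have "\<dots> \<le> \<bar>?F (y + h) - ?F y\<bar> + \<bar>f (y + h)\<bar> * \<bar>W ((y + h) - x0) - W (y - x0)\<bar>"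
        unfolding abs_mult[symmetric] by (rule abs_triangle_ineq4)
      also have "\<bar>f (y + h)\<bar> * \<bar>W ((y + h) - x0) - W (y - x0)\<bar> \<le> \<bar>f (y + h)\<bar> * (6 * a\<^sup>2 * norm h * W ((y + h) - x0))"
        using W_diff[OF h(2), of "y - x0"] unfolding yh by (intro mult_left_mono) auto
      also have "\<dots> = 6 * a\<^sup>2 * norm h * \<bar>?F (y + h)\<bar>" using W_pos[of "(y + h) - x0"] by (simp add: abs_mult)
      finally show ?thesis by simp
    qed
    have iR: "integrable lborel (\<lambda>y. \<bar>?F (y + h) - ?F y\<bar> + 6 * a\<^sup>2 * norm h * \<bar>?F (y + h)\<bar>)"
      by (intro Bochner_Integration.integrable_add integrable_abs Bochner_Integration.integrable_diff integrable_mult_right iS i)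
    have pos: "0 \<le> \<bar>f (y + h) - f y\<bar> * W (y - x0)" for y using W_pos[of "y - x0"] by simp
    show iL: "integrable lborel (\<lambda>y. \<bar>f (y + h) - f y\<bar> * W (y - x0))"
      by (rule Bochner_Integration.integrable_bound[OF iR]) (use pt pos in \<open>auto intro!: AE_I2 order_trans[OF _ abs_ge_self] simp: abs_mult W_pos less_imp_le\<close>)
    have "(LBINT y. \<bar>f (y + h) - f y\<bar> * W (y - x0)) \<le> (LBINT y. \<bar>?F (y + h) - ?F y\<bar> + 6 * a\<^sup>2 * norm h * \<bar>?F (y + h)\<bar>)"
      by (rule integral_mono[OF iL iR pt])
    also have "\<dots> = (LBINT y. \<bar>?F (y + h) - ?F y\<bar>) + 6 * a\<^sup>2 * norm h * ?I"
      using aS iS i by (subst Bochner_Integration.integral_add) auto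
    also have "\<dots> \<le> \<epsilon> / 2 + 6 * a\<^sup>2 * (\<epsilon> / (12 * a\<^sup>2 * (?I + 1))) * ?I"
      using e1(2)[OF h(1)] h(3) a2 I0 by (intro add_mono mult_right_mono mult_left_mono) auto
    also have "6 * a\<^sup>2 * (\<epsilon> / (12 * a\<^sup>2 * (?I + 1))) * ?I = (\<epsilon> / 2) * (?I / (?I + 1))"
    proof -
      have "6 * p * (\<epsilon> / (12 * p * (I + 1))) * I = (\<epsilon> / 2) * (I / (I + 1))" if "0 < p" "0 \<le> I" for p I :: real
        using that by (simp add: divide_simps add_nonneg_eq_0_iff)
      then show ?thesis using a2 I0 by blast
    qed
    also have "\<dots> \<le> (\<epsilon> / 2) * 1"
    proof -
      have q: "I / (I + 1) \<le> 1" if "0 \<le> I" for I :: real using that by (simp add: divide_simps)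
      show ?thesis by (rule mult_left_mono[OF q[OF I0]]) (use assms(3) in simp)
    qed
    finally show "(LBINT y. \<bar>f (y + h) - f y\<bar> * W (y - x0)) \<le> \<epsilon>" by simp
  qed
qed

definition tail_mass :: "real \<Rightarrow> real" where
  "tail_mass t = (LBINT z. indicator {z. t < norm z} z * N z)"

lemma tail_mass_integrable: assumes "0 < t" shows "integrable lborel (\<lambda>z. indicator {z. t < norm z} z * N z)"
  by (rule integrable_N_bound'[OF _ assms, of _ 1]) (use assms in \<open>auto simp: indicator_def power_mono\<close>)

lemma tail_mass_mono: assumes "0 < t" "t \<le> t'" shows "tail_mass t' \<le> tail_mass t"
  unfolding tail_mass_def using assms N_nonneg
  by (intro integral_mono tail_mass_integrable) (auto simp: indicator_def)

lemma tail_mass_nonneg: "0 \<le> tail_mass t"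
  unfolding tail_mass_def by (intro integral_nonneg_AE AE_I2) (simp add: N_nonneg)

text \<open>The truncated second moment at radius 2^-i without division by the squared radius; in
  this normalisation it decreases to 0, and its relative decrements are controlled by the jump mass
  beyond 2^-(i+1).\<close>

definition quad_int :: "nat \<Rightarrow> real" where
  "quad_int i = (LBINT z. min ((1/4)^i) ((norm z)\<^sup>2) * N z)"

lemma quad_int_eq: "quad_int i = (1/4)^i * H ((1/2)^i)"
proof -
  have "min ((1/4)^i) ((norm z)\<^sup>2) = (1/4)^i * min 1 ((norm z)\<^sup>2 / ((1/2)^i)\<^sup>2)" for z :: 'a
  proof -
    have "((1/2)^i)\<^sup>2 = (1/4 :: real)^i" by (simp add: power_mult_distrib[symmetric] power2_eq_square)
    then show ?thesis by (simp add: min_mult_distrib_left)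
  qed
  then show ?thesis by (simp add: quad_int_def H_def mult.assoc)
qed

lemma quad_int_integrable: "integrable lborel (\<lambda>z. min ((1/4)^i) ((norm z)\<^sup>2) * N z)"
  by (rule integrable_N_bound[where C = 1]) (auto simp: min_le_iff_disj power_le_one)

lemma quad_int_pos: "0 < quad_int i"
  unfolding quad_int_eq using H_pos[of "(1/2)^i"] by simp

lemma quad_int_lim: "quad_int \<longlonglongrightarrow> 0"
proof -
  have "(\<lambda>i. \<integral>z. min ((1/4)^i) ((norm z)\<^sup>2) * N z \<partial>lborel) \<longlonglongrightarrow> (\<integral>z. 0 \<partial>(lborel::'a measure))"
  proof (rule integral_dominated_convergence[OF _ _ N_integrable])
    show "AE z in lborel. (\<lambda>i. min ((1/4)^i) ((norm (z::'a))\<^sup>2) * N z) \<longlonglongrightarrow> 0"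
    proof (intro AE_I2)
      fix z :: 'a
      have "(\<lambda>i. min ((1/4)^i) ((norm z)\<^sup>2) * N z) \<longlonglongrightarrow> min 0 ((norm z)\<^sup>2) * N z"
        by (intro tendsto_intros LIMSEQ_realpow_zero) auto
      then show "(\<lambda>i. min ((1/4)^i) ((norm z)\<^sup>2) * N z) \<longlonglongrightarrow> 0" by simp
    qed
    show "AE z in lborel. norm (min ((1/4)^i) ((norm (z::'a))\<^sup>2) * N z) \<le> min 1 ((norm z)\<^sup>2) * N z" for i
      using N_nonneg by (intro AE_I2) (auto simp: abs_mult intro!: mult_right_mono min.mono power_le_one)
  qed auto
  then show ?thesis by (simp add: quad_int_def[abs_def])
qed

text \<open>The truncations at levels 4^-i and 4^-(i+1) differ only where |z| > 2^-(i+1), and there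
  by at most 4^-i.\<close>

lemma quad_int_step: "(quad_int i - quad_int (Suc i)) / quad_int i \<le> tail_mass ((1/2)^Suc i) / H ((1/2)^i)"
proof -
  let ?t = "(1/2)^Suc i :: real"
  have t: "0 < ?t" by simp
  have "quad_int i - quad_int (Suc i) = (LBINT z. min ((1/4)^i) ((norm z)\<^sup>2) * N z - min ((1/4)^Suc i) ((norm z)\<^sup>2) * N z)"
    unfolding quad_int_def using quad_int_integrable by (intro Bochner_Integration.integral_diff[symmetric]) blast+
  also have "\<dots> \<le> (LBINT z. (1/4)^i * (indicator {z. ?t < norm z} z * N z))"
  proof (rule integral_mono)
    fix z :: 'a
    have "min ((1/4)^i) ((norm z)\<^sup>2) - min ((1/4)^Suc i) ((norm z)\<^sup>2) \<le> (1/4)^i * indicator {z. ?t < norm z} z"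
    proof (cases "?t < norm z")
      case False
      have "(norm z)\<^sup>2 \<le> ?t\<^sup>2" using False by (intro power_mono) auto
      also have "?t\<^sup>2 = (1/4)^Suc i" by (simp only: power_mult[symmetric] mult.commute[of _ 2]) (simp only: power_mult, simp add: power2_eq_square)
      finally have "(norm z)\<^sup>2 \<le> (1/4)^Suc i" .
      moreover have "(1/4)^Suc i \<le> ((1/4)^i :: real)" by simp
      ultimately have "(norm z)\<^sup>2 \<le> (1/4)^Suc i" "(norm z)\<^sup>2 \<le> (1/4)^i" by linarith+
      then show ?thesis using False by (simp add: min_absorb2 del: power_Suc)
    next
      case True
      have "0 \<le> min ((1/4)^Suc i) ((norm z)\<^sup>2)" by simp
      then show ?thesis using True by (simp add: min_def)
    qed
    from mult_right_mono[OF this N_nonneg[of z]]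
    show "min ((1/4)^i) ((norm z)\<^sup>2) * N z - min ((1/4)^Suc i) ((norm z)\<^sup>2) * N z \<le> (1/4)^i * (indicator {z. ?t < norm z} z * N z)"
      by (simp only: left_diff_distrib mult.assoc)
  next
    show "integrable lborel (\<lambda>z. min ((1/4)^i) ((norm z)\<^sup>2) * N z - min ((1/4)^Suc i) ((norm z)\<^sup>2) * N z)"
      by (rule Bochner_Integration.integrable_diff[OF quad_int_integrable quad_int_integrable])
    show "integrable lborel (\<lambda>z. (1/4)^i * (indicator {z. ?t < norm z} z * N z))"
      by (rule integrable_mult_right[OF tail_mass_integrable[OF t]])
  qed
  also have "\<dots> = (1/4)^i * tail_mass ?t" unfolding tail_mass_def by (rule integral_mult_right_zero)
  finally have "(quad_int i - quad_int (Suc i)) / quad_int i \<le> ((1/4)^i * tail_mass ?t) / quad_int i"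
    using quad_int_pos[of i] by (intro divide_right_mono) auto
  also have "\<dots> = tail_mass ?t / H ((1/2)^i)" unfolding quad_int_eq by (rule mult_divide_mult_cancel_left) simp
  finally show ?thesis .
qed

text \<open>The sum diverges because \<^term>\<open>quad_int i\<close> decreases to zero; this is what makes the product of
  the probabilities of a short overshoot vanish.\<close>

lemma tail_sum_unbounded: "\<exists>n\<ge>m. c \<le> (\<Sum>i=m..<n. tail_mass ((1/2)^Suc i) / H ((1/2)^i))"
proof -
  let ?t = "\<lambda>i. tail_mass ((1/2)^Suc i) / H ((1/2)^i)"
  have dec: "quad_int (Suc i) \<le> quad_int i" for i
    unfolding quad_int_def using N_nonneg
    by (intro integral_mono quad_int_integrable mult_right_mono min.mono) (auto simp: power_decreasing)
  have t0: "0 \<le> ?t i" for i using tail_mass_nonneg H_pos[of "(1/2)^i"] by simp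
  \<comment> \<open>Starting from any index, \<open>quad_int\<close> eventually halves, so some
    block of relative decrements adds up to 1/2; joining k blocks gives k/2.\<close>
  have half: "\<exists>n\<ge>m. 1/2 \<le> (\<Sum>i=m..<n. ?t i)" for m
  proof -
    have "eventually (\<lambda>n. quad_int n < quad_int m / 2) sequentially"
      using quad_int_pos[of m] by (intro order_tendstoD(2)[OF quad_int_lim]) auto
    then obtain n where n: "m \<le> n" "quad_int n < quad_int m / 2"
      by (metis (no_types, lifting) eventually_sequentially linear)
    have "quad_int m - quad_int n = (\<Sum>i=m..<n. quad_int i - quad_int (Suc i))"
      using sum_Suc_diff'[OF n(1), of "\<lambda>i. - quad_int i"] by simp
    also have "\<dots> / quad_int m = (\<Sum>i=m..<n. (quad_int i - quad_int (Suc i)) / quad_int m)" by (rule sum_divide_distrib)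
    also have "\<dots> \<le> (\<Sum>i=m..<n. ?t i)"
    proof (rule sum_mono)
      fix i assume i: "i \<in> {m..<n}"
      have "quad_int i \<le> quad_int m" using i lift_Suc_antimono_le[of quad_int m i] dec by simp
      then have "(quad_int i - quad_int (Suc i)) / quad_int m \<le> (quad_int i - quad_int (Suc i)) / quad_int i"
        using dec[of i] quad_int_pos[of i] quad_int_pos[of m] by (intro divide_left_mono mult_pos_pos) auto
      also have "\<dots> \<le> ?t i" by (rule quad_int_step)
      finally show "(quad_int i - quad_int (Suc i)) / quad_int m \<le> ?t i" .
    qed
    finally have "(quad_int m - quad_int n) / quad_int m \<le> (\<Sum>i=m..<n. ?t i)" .
    moreover have "1/2 \<le> (quad_int m - quad_int n) / quad_int m" using n(2) quad_int_pos[of m] by (simp add: pos_le_divide_eq)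
    ultimately show ?thesis using n(1) by (intro exI[of _ n] conjI) linarith+
  qed
  have "\<exists>n\<ge>m. real k / 2 \<le> (\<Sum>i=m..<n. ?t i)" for k
  proof (induction k)
    case 0 show ?case by (intro exI[of _ m]) simp
  next
    case (Suc k)
    then obtain n where n: "m \<le> n" "real k / 2 \<le> (\<Sum>i=m..<n. ?t i)" by blast
    obtain n' where n': "n \<le> n'" "1/2 \<le> (\<Sum>i=n..<n'. ?t i)" using half by blast
    have "(\<Sum>i=m..<n'. ?t i) = (\<Sum>i=m..<n. ?t i) + (\<Sum>i=n..<n'. ?t i)" using sum.atLeastLessThan_concat[OF n(1) n'(1), of ?t] by simp
    moreover have "real (Suc k) / 2 = real k / 2 + 1 / 2" by (simp add: field_simps)
    ultimately show ?case using n n' by (intro exI[of _ n'] conjI) linarith+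
  qed
  moreover obtain k :: nat where "2 * c \<le> real k" using real_arch_simple by blast
  ultimately obtain n where "m \<le> n" "real k / 2 \<le> (\<Sum>i=m..<n. ?t i)" by blast
  then show ?thesis using \<open>2 * c \<le> real k\<close> by (intro exI[of _ n] conjI) linarith+
qed

end

text \<open>Testing with bumps compares measures on open sets only; outer regularity extends the
  comparison to Borel sets.\<close>

lemma nn_integral_mono_open:
  fixes m1 m2 :: "'a::euclidean_space measure"
  assumes s1: "sets m1 = sets borel" and s2: "sets m2 = sets borel" and fin: "emeasure m2 (space m2) \<noteq> \<infinity>"
    and le: "\<And>U. open U \<Longrightarrow> emeasure m1 U \<le> emeasure m2 U"
  shows "(\<integral>\<^sup>+x. g x \<partial>m1) \<le> (\<integral>\<^sup>+x. g x \<partial>m2)"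
proof -
  have "emeasure m1 B \<le> emeasure m2 B" if B: "B \<in> sets m1" for B
  proof -
    have "emeasure m2 B = (INF U \<in> {U. B \<subseteq> U \<and> open U}. emeasure m2 U)"
      by (rule outer_regular[OF s2 fin]) (use B s1 in simp)
    moreover have "emeasure m1 B \<le> emeasure m2 U" if "B \<subseteq> U" "open U" for U
      using emeasure_mono[OF that(1), of m1] le[OF that(2)] that(2) s1 by (auto intro: order_trans)
    ultimately show ?thesis by (auto intro!: INF_greatest)
  qed
  then have "m1 \<le> m2" using s1 s2 by (subst le_measure) auto
  then show ?thesis using s1 s2 by (intro nn_integral_mono_measure) auto
qed

section \<open>Density bound and overshoot of the exit law\<close>

context levy_setting begin

lemma mu_mollify:
  assumes d: "0 < d" and A[measurable]: "A \<in> sets borel"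
  shows "(\<integral>\<^sup>+z. (\<integral>\<^sup>+w. ennreal (indicator A w * bump d (w - z)) \<partial>lborel) \<partial>mu s) = (\<integral>\<^sup>+w. ennreal (indicator A w * bm d s (- w)) \<partial>lborel)"
proof -
  interpret mu: prob_space "mu s" by (rule mu_prob)
  interpret P: pair_sigma_finite lborel "mu s" ..
  have "(\<integral>\<^sup>+z. (\<integral>\<^sup>+w. ennreal (indicator A w * bump d (w - z)) \<partial>lborel) \<partial>mu s) = (\<integral>\<^sup>+w. (\<integral>\<^sup>+z. ennreal (indicator A w * bump d (w - z)) \<partial>mu s) \<partial>lborel)"
    by (rule P.Fubini') measurable
  also have "\<dots> = (\<integral>\<^sup>+w. ennreal (indicator A w * bm d s (- w)) \<partial>lborel)"
  proof (rule nn_integral_cong)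
    fix w :: 'a
    have "bump d (w - z) = bump d (- w + z)" for z by (subst bump_commute) (simp add: add.commute)
    then show "(\<integral>\<^sup>+z. ennreal (indicator A w * bump d (w - z)) \<partial>mu s) = ennreal (indicator A w * bm d s (- w))"
      using bm_nn[where d = d and x = "- w" and s = s] by (simp add: indicator_def)
  qed
  finally show ?thesis .
qed

lemma bump_shift_nn: assumes d: "0 < d" shows "(\<integral>\<^sup>+w. ennreal (bump d (w - (z::'a))) \<partial>lborel) = ennreal (LBINT y. bump d (y::'a))"
proof -
  have "(\<integral>\<^sup>+w. ennreal (bump d (w + (- z))) \<partial>lborel) = (\<integral>\<^sup>+w. ennreal (bump d (w::'a)) \<partial>lborel)"
    by (rule lborel_invariant_nn[OF _ distr_lborel_plus]) measurable
  also have "\<dots> = ennreal (LBINT y. bump d (y::'a))"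
    by (rule nn_integral_eq_integral[OF bump_integrable[OF d]]) (simp add: bump_nonneg)
  finally show ?thesis by simp
qed

text \<open>By \<open>bm_far_upper\<close> the averages of the exit law over bumps are bounded by a
  multiple of \<open>W\<close>, uniformly as the bumps shrink, and Fatou's lemma turns this into a
  bound on open sets. The restriction to norms above 2 * s keeps away from the sphere of radius s,
  where the bound \<open>\<nu> (norm w - s - d)\<close> degenerates.\<close>

lemma mu_le_W:
  assumes s: "0 < s" "s \<le> 1/2"
  obtains C where "0 \<le> C"
    "\<And>g. g \<in> borel_measurable borel \<Longrightarrow> (\<integral>\<^sup>+z. indicator {z. 2 * s < norm z} z * g z \<partial>mu s) \<le> ennreal C * (\<integral>\<^sup>+z. g z * ennreal (W z) \<partial>lborel)"
proof -
  interpret mu: prob_space "mu s" by (rule mu_prob)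
  have n4: "0 < \<nu> 4" and n3: "0 < \<nu> (3 * s / 4)" using s by (auto intro!: nu_pos)
  \<comment> \<open>The first summand serves large w by two doublings; the second serves norms below
    3, where \<open>W\<close> is at least \<open>\<nu> 4\<close>.\<close>
  define C1 where "C1 = a\<^sup>2 + \<nu> (3 * s / 4) / \<nu> 4"
  have C1: "0 < C1" using a_ge_1 n4 n3 by (simp add: C1_def add_pos_pos)
  have far: "\<nu> (norm w - s - d) \<le> C1 * W w" if d: "0 < d" "d \<le> s / 4" and w: "2 * s < norm w" for d w
  proof (cases "norm w < 3")
    case True
    have "\<nu> (norm w - s - d) \<le> \<nu> (3 * s / 4)" using d w s by (intro nu_mono) auto
    also have "\<dots> = (\<nu> (3 * s / 4) / \<nu> 4) * \<nu> 4" using n4 by simp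
    also have "\<dots> \<le> (\<nu> (3 * s / 4) / \<nu> 4) * W w"
      unfolding W_def using True n3 n4 by (intro mult_left_mono nu_mono) (auto simp: add_nonneg_pos)
    also have "\<dots> \<le> C1 * W w" using W_pos[of w] a_ge_1 by (intro mult_right_mono) (auto simp: C1_def)
    finally show ?thesis .
  next
    case False
    let ?p = "norm w - s - d"
    have p: "2 \<le> ?p" using False s d by linarith
    have "\<nu> ?p \<le> a * \<nu> (?p + 1)" using p by (intro nu_comp) auto
    also have "\<dots> \<le> a * (a * \<nu> (?p + 1 + 1))" using p a_ge_1 by (intro mult_left_mono nu_comp) auto
    also have "\<dots> \<le> a * (a * W w)" unfolding W_def using p a_ge_1 s d norm_ge_zero[of w]
      by (intro mult_left_mono nu_mono) linarith+
    also have "\<dots> \<le> C1 * W w" using W_pos[of w] n3 n4 by (simp add: C1_def distrib_right power2_eq_square)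
    finally show ?thesis .
  qed
  define C where "C = mean_exit s * C1"
  have C: "0 < C" using mean_exit_pos[OF s(1)] C1 by (simp add: C_def)
  let ?R = "{z::'a. 2 * s < norm z}"
  have Ro: "open ?R" by (intro open_Collect_less continuous_intros)
  have openU: "emeasure (mu s) U \<le> (\<integral>\<^sup>+w. ennreal (C * W w) * indicator U w \<partial>lborel)" if U: "open U" "U \<subseteq> ?R" for U
  proof -
    have [measurable]: "U \<in> sets borel" using U(1) by simp
    define d where "d n = s / 4 / real (Suc n)" for n
    have d: "0 < d n" "d n \<le> s / 4" for n using s by (auto simp: d_def divide_simps)
    have dl: "d \<longlonglongrightarrow> 0" unfolding d_def[abs_def] by real_asymp
    define K where "K n = (LBINT y. bump (d n) (y::'a))" for n
    have K: "0 < K n" for n unfolding K_def by (rule bump_integral_pos[OF d(1)])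
    define q where "q n z = ennreal (1 / K n) * (\<integral>\<^sup>+w. ennreal (indicator U w * bump (d n) (w - z)) \<partial>lborel)" for n and z :: 'a
    have qm: "q n \<in> borel_measurable borel" for n
    proof -
      have "(\<lambda>(z, w). ennreal (indicator U w * bump (d n) (w - z))) \<in> borel_measurable (borel \<Otimes>\<^sub>M lborel)" by measurable
      from lborel.borel_measurable_nn_integral[OF this] show ?thesis unfolding q_def[abs_def] by simp
    qed
    \<comment> \<open>For z in the open set U the bump around z eventually lies in U, and then
      \<open>q n z\<close> is its full normalised mass 1.\<close>
    have q1: "indicator U z \<le> liminf (\<lambda>n. q n z)" for z
    proof (cases "z \<in> U")
      case True
      then obtain e where e: "0 < e" "ball z e \<subseteq> U" using U(1) open_contains_ball by blast
      have "eventually (\<lambda>n. d n < e) sequentially" using order_tendstoD(2)[OF dl e(1)] .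
      then have "eventually (\<lambda>n. 1 \<le> q n z) sequentially"
      proof eventually_elim
        case (elim n)
        have "indicator U w * bump (d n) (w - z) = bump (d n) (w - z)" for w
        proof (cases "w \<in> U")
          case False
          then have "w \<notin> ball z e" using e by blast
          then have "e \<le> norm (w - z)" by (simp add: dist_norm norm_minus_commute)
          then show ?thesis using elim bump_out[OF d(1)[of n], of "w - z"] by simp
        qed simp
        then have "q n z = ennreal (1 / K n) * ennreal (K n)" unfolding q_def K_def by (simp only: bump_shift_nn[OF d(1)[of n], of z])
        also have "\<dots> = 1" using K[of n] by (simp add: ennreal_mult[symmetric])
        finally show ?case by simp
      qed
      then have "1 \<le> liminf (\<lambda>n. q n z)" by (rule Liminf_bounded)
      then show ?thesis using True by simp
    qed simp
    have "emeasure (mu s) U = (\<integral>\<^sup>+z. indicator U z \<partial>mu s)" by simp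
    also have "\<dots> \<le> (\<integral>\<^sup>+z. liminf (\<lambda>n. q n z) \<partial>mu s)" by (intro nn_integral_mono q1)
    also have "\<dots> \<le> liminf (\<lambda>n. \<integral>\<^sup>+z. q n z \<partial>mu s)" by (rule nn_integral_liminf) (use qm in simp)
    also have "\<dots> \<le> (\<integral>\<^sup>+w. ennreal (C * W w) * indicator U w \<partial>lborel)"
    proof -
      have "(\<integral>\<^sup>+z. q n z \<partial>mu s) \<le> (\<integral>\<^sup>+w. ennreal (C * W w) * indicator U w \<partial>lborel)" for n
      proof -
        have mm: "(\<lambda>z. \<integral>\<^sup>+w. ennreal (indicator U w * bump (d n) (w - z)) \<partial>lborel) \<in> borel_measurable (mu s)"
        proof -
          have "(\<lambda>(z, w). ennreal (indicator U w * bump (d n) (w - z))) \<in> borel_measurable (borel \<Otimes>\<^sub>M lborel)" by measurable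
          from lborel.borel_measurable_nn_integral[OF this] show ?thesis by simp
        qed
        have "(\<integral>\<^sup>+z. q n z \<partial>mu s) = ennreal (1 / K n) * (\<integral>\<^sup>+w. ennreal (indicator U w * bm (d n) s (- w)) \<partial>lborel)"
          unfolding q_def by (subst nn_integral_cmult[OF mm]) (simp add: mu_mollify[OF d(1)])
        also have "\<dots> = (\<integral>\<^sup>+w. ennreal (1 / K n) * ennreal (indicator U w * bm (d n) s (- w)) \<partial>lborel)"
          by (rule nn_integral_cmult[symmetric]) measurable
        also have "\<dots> \<le> (\<integral>\<^sup>+w. ennreal (C * W w) * indicator U w \<partial>lborel)"
        proof (rule nn_integral_mono)
          fix w :: 'a
          show "ennreal (1 / K n) * ennreal (indicator U w * bm (d n) s (- w)) \<le> ennreal (C * W w) * indicator U w"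
          proof (cases "w \<in> U")
            case True
            then have w: "2 * s < norm w" using U by auto
            have "bm (d n) s (- w) \<le> mean_exit s * K n * \<nu> (norm w - s - d n)"
              using bm_far_upper[OF d(1)[of n] s(1), of "- w"] w d[of n] s by (simp add: K_def)
            also have "\<dots> \<le> mean_exit s * K n * (C1 * W w)"
              using far[OF d(1)[of n] d(2)[of n] w] mean_exit_pos[OF s(1)] K[of n] by (intro mult_left_mono) auto
            finally have "1 / K n * bm (d n) s (- w) \<le> C * W w" using K[of n] by (simp add: C_def field_simps)
            then have "ennreal (1 / K n * bm (d n) s (- w)) \<le> ennreal (C * W w)" by (rule ennreal_leI)
            moreover have "ennreal (1 / K n) * ennreal (bm (d n) s (- w)) = ennreal (1 / K n * bm (d n) s (- w))"
              using K[of n] bm_nonneg[of "d n" s "- w"] by (intro ennreal_mult[symmetric]) auto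
            ultimately show ?thesis using True by simp
          qed simp
        qed
        finally show ?thesis .
      qed
      then have "liminf (\<lambda>n. \<integral>\<^sup>+z. q n z \<partial>mu s) \<le> limsup (\<lambda>n. \<integral>\<^sup>+z. q n z \<partial>mu s)" "limsup (\<lambda>n. \<integral>\<^sup>+z. q n z \<partial>mu s) \<le> (\<integral>\<^sup>+w. ennreal (C * W w) * indicator U w \<partial>lborel)"
        by (auto intro!: Liminf_le_Limsup Limsup_bounded always_eventually)
      then show ?thesis by (rule order_trans)
    qed
    finally show ?thesis .
  qed
  let ?m1 = "density (mu s) (indicator ?R)" and ?m2 = "density lborel (\<lambda>w. ennreal (C * W w))"
  have [measurable]: "?R \<in> sets borel" using Ro by simp
  have m12: "(\<integral>\<^sup>+z. g z \<partial>?m1) \<le> (\<integral>\<^sup>+z. g z \<partial>?m2)" for g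
  proof (rule nn_integral_mono_open)
    have "emeasure ?m2 (space ?m2) = (\<integral>\<^sup>+w. ennreal (C * W w) \<partial>lborel)" by (simp add: emeasure_density)
    also have "\<dots> = ennreal (LBINT w. C * W w)" using C W_pos
      by (intro nn_integral_eq_integral integrable_mult_right W_integrable) (auto simp: less_imp_le)
    finally show "emeasure ?m2 (space ?m2) \<noteq> \<infinity>" by simp
    fix U :: "'a set" assume U: "open U"
    then have [measurable]: "U \<in> sets borel" by simp
    have "emeasure ?m1 U = emeasure (mu s) (?R \<inter> U)"
      by (simp add: emeasure_density indicator_inter_arith[symmetric] Int_commute)
    also have "\<dots> \<le> (\<integral>\<^sup>+w. ennreal (C * W w) * indicator (?R \<inter> U) w \<partial>lborel)" using U Ro by (intro openU) auto
    also have "\<dots> \<le> (\<integral>\<^sup>+w. ennreal (C * W w) * indicator U w \<partial>lborel)"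
      by (intro nn_integral_mono mult_left_mono) (auto simp: indicator_def)
    also have "\<dots> = emeasure ?m2 U" by (simp add: emeasure_density)
    finally show "emeasure ?m1 U \<le> emeasure ?m2 U" .
  qed auto
  show ?thesis
  proof (rule that[of C])
    show "0 \<le> C" using C by simp
    fix g :: "'a \<Rightarrow> ennreal" assume g[measurable]: "g \<in> borel_measurable borel"
    have "(\<integral>\<^sup>+z. indicator ?R z * g z \<partial>mu s) = (\<integral>\<^sup>+z. g z \<partial>?m1)" by (subst nn_integral_density) auto
    also have "\<dots> \<le> (\<integral>\<^sup>+z. g z \<partial>?m2)" by (rule m12)
    also have "\<dots> = (\<integral>\<^sup>+z. ennreal (C * W z) * g z \<partial>lborel)" by (subst nn_integral_density) auto
    also have "\<dots> = (\<integral>\<^sup>+z. ennreal C * (g z * ennreal (W z)) \<partial>lborel)"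
      using C W_pos by (intro nn_integral_cong) (simp add: ennreal_mult less_imp_le ac_simps)
    also have "\<dots> = ennreal C * (\<integral>\<^sup>+z. g z * ennreal (W z) \<partial>lborel)" by (rule nn_integral_cmult) measurable
    finally show "(\<integral>\<^sup>+z. indicator ?R z * g z \<partial>mu s) \<le> ennreal C * (\<integral>\<^sup>+z. g z * ennreal (W z) \<partial>lborel)" .
  qed
qed

definition overshoot :: "real \<Rightarrow> real" where
  "overshoot s = measure (mu s) {z. 2 * s < norm z}"

text \<open>A bump of radius s centred beyond 4 * s sees only exit positions beyond 2 * s. Its
  expectation is bounded below by \<open>bm_far_lower\<close>, with the shift by 2 * s paid by one
  doubling factor a, and \<open>mean_exit_ge\<close> replaces the mean exit time by the reciprocal
  of 17 * H s.\<close>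

lemma overshoot_ge:
  assumes s: "0 < s" "s \<le> 1/2"
  shows "tail_mass (4 * s) / (17 * a * H s) \<le> overshoot s"
proof -
  interpret mu: prob_space "mu s" by (rule mu_prob)
  define K where "K = (LBINT y. bump s (y::'a))"
  have K: "0 < K" unfolding K_def by (rule bump_integral_pos[OF s(1)])
  have e: "0 < mean_exit s" by (rule mean_exit_pos[OF s(1)])
  let ?A = "{w::'a. 4 * s < norm w}"
  have [measurable]: "?A \<in> sets borel" "{z::'a. 2 * s < norm z} \<in> sets borel" by measurable
  have "ennreal (mean_exit s * K / a * tail_mass (4 * s)) = ennreal (LBINT w. mean_exit s * K / a * (indicator ?A w * N w))"
    by (simp add: tail_mass_def)
  also have "\<dots> = (\<integral>\<^sup>+w. ennreal (mean_exit s * K / a * (indicator ?A w * N w)) \<partial>lborel)"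
    using e K a_ge_1 N_nonneg s tail_mass_integrable[of "4 * s"]
    by (intro nn_integral_eq_integral[symmetric] integrable_mult_right) auto
  also have "\<dots> \<le> (\<integral>\<^sup>+w. ennreal (indicator ?A w * bm s s (- w)) \<partial>lborel)"
  proof (intro nn_integral_mono ennreal_leI)
    fix w :: 'a
    show "mean_exit s * K / a * (indicator ?A w * N w) \<le> indicator ?A w * bm s s (- w)"
    proof (cases "w \<in> ?A")
      case True
      then have w: "4 * s < norm w" "w \<noteq> 0" using s by auto
      have "N w \<le> a * \<nu> (norm w + s + s)" unfolding N_eq[OF w(2)] using w s by (intro nu_comp) linarith+
      then have "mean_exit s * K / a * N w \<le> mean_exit s * K / a * (a * \<nu> (norm w + s + s))"
        using e K a_ge_1 by (intro mult_left_mono) auto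
      also have "\<dots> = mean_exit s * K * \<nu> (norm w + s + s)" using a_ge_1 by simp
      also have "\<dots> \<le> bm s s (- w)" using bm_far_lower[OF s(1) s(1), of "- w"] w s by (simp add: K_def)
      finally show ?thesis using True by simp
    qed simp
  qed
  also have "\<dots> = (\<integral>\<^sup>+z. (\<integral>\<^sup>+w. ennreal (indicator ?A w * bump s (w - z)) \<partial>lborel) \<partial>mu s)"
    by (rule mu_mollify[OF s(1), symmetric]) simp
  also have "\<dots> \<le> (\<integral>\<^sup>+z. ennreal K * indicator {z. 2 * s < norm z} z \<partial>mu s)"
  proof (rule nn_integral_mono)
    fix z :: 'a
    show "(\<integral>\<^sup>+w. ennreal (indicator ?A w * bump s (w - z)) \<partial>lborel) \<le> ennreal K * indicator {z. 2 * s < norm z} z"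
    proof (cases "2 * s < norm z")
      case True
      have "(\<integral>\<^sup>+w. ennreal (indicator ?A w * bump s (w - z)) \<partial>lborel) \<le> (\<integral>\<^sup>+w. ennreal (bump s (w - z)) \<partial>lborel)"
        by (intro nn_integral_mono ennreal_leI) (auto simp: indicator_def bump_nonneg)
      then show ?thesis using True bump_shift_nn[OF s(1), of z] by (simp add: K_def)
    next
      case False
      have "indicator ?A w * bump s (w - z) = 0" for w
      proof (cases "w \<in> ?A")
        case True
        then have "s \<le> norm (w - z)" using False norm_triangle_ineq2[of w z] s by simp
        then show ?thesis using bump_out[OF s(1), of "w - z"] by simp
      qed simp
      then show ?thesis by (simp only:) simp
    qed
  qed
  also have "\<dots> = ennreal K * ennreal (overshoot s)"
    by (simp add: nn_integral_cmult_indicator overshoot_def mu.emeasure_eq_measure)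
  also have "\<dots> = ennreal (K * overshoot s)" using K by (simp add: ennreal_mult overshoot_def)
  finally have "mean_exit s * K / a * tail_mass (4 * s) \<le> K * overshoot s"
    using K by (simp add: overshoot_def)
  then have "K * (mean_exit s / a * tail_mass (4 * s)) \<le> K * overshoot s" by (simp add: ac_simps)
  then have 1: "mean_exit s / a * tail_mass (4 * s) \<le> overshoot s" using K by (simp only: mult_le_cancel_left_pos)
  have "1 / (17 * H s) \<le> mean_exit s" using mean_exit_ge[OF s(1)] H_pos[OF s(1)] by (simp add: field_simps)
  then have "1 / (17 * H s) / a * tail_mass (4 * s) \<le> mean_exit s / a * tail_mass (4 * s)"
    using a_ge_1 tail_mass_nonneg by (intro mult_right_mono divide_right_mono) auto
  also note 1
  finally show ?thesis by (simp add: ac_simps)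
qed

lemma overshoot_le_1: "overshoot s \<le> 1" "0 \<le> overshoot s"
proof -
  interpret mu: prob_space "mu s" by (rule mu_prob)
  show "overshoot s \<le> 1" "0 \<le> overshoot s" by (auto simp: overshoot_def)
qed

end

section \<open>Decay of the oscillation\<close>

context levy_setting begin

text \<open>The modulus of continuity over the ball has a limit at most \<kappa> as the increment
  tends to 0. Thanks to the additional \<epsilon>, the case \<kappa> = 0 is uniform
  continuity.\<close>

definition osc_le :: "('a \<Rightarrow> real) \<Rightarrow> 'a \<Rightarrow> real \<Rightarrow> real \<Rightarrow> bool" where
  "osc_le f x0 \<rho> \<kappa> \<longleftrightarrow> (\<forall>\<epsilon>>0. \<exists>e>0. \<forall>x h. norm (x - x0) < \<rho> \<longrightarrow> norm h < e \<longrightarrow> \<bar>f (x + h) - f x\<bar> \<le> \<kappa> + \<epsilon>)"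

lemma osc_le_antimono: "osc_le f x0 \<rho> \<kappa> \<Longrightarrow> \<rho>' \<le> \<rho> \<Longrightarrow> osc_le f x0 \<rho>' \<kappa>"
  unfolding osc_le_def by (meson less_le_trans)

text \<open>On leaving a ball of radius \<open>s\<close> the process jumps further than \<open>2 * s\<close> with probability
  \<^term>\<open>overshoot s\<close>; there the exit law has a density, so translation is continuous in mean and
  this part of the mean value does not contribute to the oscillation.\<close>

lemma osc_step:
  assumes f[measurable]: "f \<in> borel_measurable borel" and iW: "integrable lborel (\<lambda>y. f y * W (y - x0))"
    and s: "0 < s" "s \<le> 1/2" and \<rho>: "\<rho> \<le> 1" and \<kappa>: "0 \<le> \<kappa>"
    and mv: "\<And>x. norm (x - x0) < \<rho> + s \<Longrightarrow> mean_value f s x" and osc: "osc_le f x0 (\<rho> + 2 * s) \<kappa>"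
  shows "osc_le f x0 \<rho> ((1 - overshoot s) * \<kappa>)"
  unfolding osc_le_def
proof (intro allI impI)
  fix \<epsilon> :: real assume \<epsilon>: "0 < \<epsilon>"
  interpret mu: prob_space "mu s" by (rule mu_prob)
  let ?R = "{z::'a. 2 * s < norm z}"
  have [measurable]: "?R \<in> sets borel" "{z::'a. norm z \<le> 2 * s} \<in> sets borel" by measurable
  obtain C where C: "0 \<le> C"
    "\<And>g. g \<in> borel_measurable borel \<Longrightarrow> (\<integral>\<^sup>+z. indicator ?R z * g z \<partial>mu s) \<le> ennreal C * (\<integral>\<^sup>+z. g z * ennreal (W z) \<partial>lborel)"
    using mu_le_W[OF s] by blast
  obtain e1 where e1: "0 < e1" "\<And>x h. norm (x - x0) < \<rho> + 2 * s \<Longrightarrow> norm h < e1 \<Longrightarrow> \<bar>f (x + h) - f x\<bar> \<le> \<kappa> + \<epsilon> / 2"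
    using osc \<epsilon> unfolding osc_le_def by (meson half_gt_zero)
  \<comment> \<open>C is the density constant and a the cost of moving the weight from x to x0; C +
    1 avoids a division by 0.\<close>
  define \<epsilon>' where "\<epsilon>' = \<epsilon> / (2 * ((C + 1) * a))"
  have Ca: "0 < (C + 1) * a" using C a_ge_1 by (intro mult_pos_pos) auto
  have \<epsilon>': "0 < \<epsilon>'" using \<epsilon> Ca by (simp add: \<epsilon>'_def)
  obtain e2 where e2: "0 < e2" "\<And>h. norm h < e2 \<Longrightarrow> integrable lborel (\<lambda>y. \<bar>f (y + h) - f y\<bar> * W (y - x0))"
    "\<And>h. norm h < e2 \<Longrightarrow> (LBINT y. \<bar>f (y + h) - f y\<bar> * W (y - x0)) \<le> \<epsilon>'"
    using weighted_translation[OF f iW \<epsilon>'] by blast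
  have "\<bar>f (x + h) - f x\<bar> \<le> (1 - overshoot s) * \<kappa> + \<epsilon>" if x: "norm (x - x0) < \<rho>" and h: "norm h < min (min e1 e2) s" for x h
  proof -
    define g where "g z = \<bar>f (x + h + z) - f (x + z)\<bar>" for z
    have [measurable]: "g \<in> borel_measurable borel" unfolding g_def[abs_def] by measurable
    have g0: "0 \<le> g z" for z by (simp add: g_def)
    have xh: "norm (x + h - x0) < \<rho> + s" using norm_triangle_ineq[of "x - x0" h] x h by (simp add: algebra_simps)
    have m1: "mean_value f s x" "mean_value f s (x + h)" using mv[OF xh] x s by (auto intro!: mv)
    have ig: "integrable (mu s) g" unfolding g_def[abs_def] using m1 by (auto simp: mean_value_def)
    have "f (x + h) - f x = (\<integral>z. f (x + h + z) - f (x + z) \<partial>mu s)" using m1 by (simp add: mean_value_def)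
    then have "\<bar>f (x + h) - f x\<bar> \<le> (\<integral>z. g z \<partial>mu s)" unfolding g_def by (simp only: integral_abs_bound)
    then have "ennreal \<bar>f (x + h) - f x\<bar> \<le> ennreal (\<integral>z. g z \<partial>mu s)" by (rule ennreal_leI)
    also have "\<dots> = (\<integral>\<^sup>+z. ennreal (g z) \<partial>mu s)" by (rule nn_integral_eq_integral[OF ig, symmetric]) (simp add: g0)
    also have "\<dots> \<le> (\<integral>\<^sup>+z. ennreal (\<kappa> + \<epsilon> / 2) * indicator (- ?R) z + indicator ?R z * ennreal (g z) \<partial>mu s)"
    proof (rule nn_integral_mono)
      fix z
      show "ennreal (g z) \<le> ennreal (\<kappa> + \<epsilon> / 2) * indicator (- ?R) z + indicator ?R z * ennreal (g z)"
      proof (cases "z \<in> ?R")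
        case False
        then have z: "norm z \<le> 2 * s" by simp
        have "norm (x + z - x0) < \<rho> + 2 * s" using norm_triangle_ineq[of "x - x0" z] x z by (simp add: algebra_simps)
        then have "g z \<le> \<kappa> + \<epsilon> / 2" using e1(2)[of "x + z" h] h by (simp add: g_def ac_simps)
        then show ?thesis using False by (simp add: ennreal_leI)
      qed simp
    qed
    also have "\<dots> = ennreal (\<kappa> + \<epsilon> / 2) * emeasure (mu s) (- ?R) + (\<integral>\<^sup>+z. indicator ?R z * ennreal (g z) \<partial>mu s)"
      by (subst nn_integral_add) (auto simp: nn_integral_cmult_indicator)
    also have "\<dots> \<le> ennreal ((\<kappa> + \<epsilon> / 2) * (1 - overshoot s)) + ennreal (C * (a * \<epsilon>'))"
    proof (rule add_mono)
      have "emeasure (mu s) (- ?R) = ennreal (1 - overshoot s)"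
        using mu.prob_compl[of ?R] by (simp add: mu.emeasure_eq_measure overshoot_def Compl_eq_Diff_UNIV)
      then show "ennreal (\<kappa> + \<epsilon> / 2) * emeasure (mu s) (- ?R) \<le> ennreal ((\<kappa> + \<epsilon> / 2) * (1 - overshoot s))"
        using \<kappa> \<epsilon> overshoot_le_1[of s] by (simp add: ennreal_mult)
      have "(\<integral>\<^sup>+z. ennreal (g z) * ennreal (W z) \<partial>lborel) \<le> ennreal (a * \<epsilon>')"
      proof -
        have e: "g z = \<bar>f (z + x + h) - f (z + x)\<bar>" "W z = W (z + x - x)" for z by (simp_all add: g_def ac_simps)
        have "(\<integral>\<^sup>+z. ennreal (g z) * ennreal (W z) \<partial>lborel) = (\<integral>\<^sup>+z. ennreal (\<bar>f (z + x + h) - f (z + x)\<bar> * W (z + x - x)) \<partial>lborel)"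
          by (intro nn_integral_cong) (simp add: e(1) ennreal_mult W_pos less_imp_le)
        also have "\<dots> = (\<integral>\<^sup>+y. ennreal (\<bar>f (y + h) - f y\<bar> * W (y - x)) \<partial>lborel)"
          by (rule lborel_invariant_nn[OF _ distr_lborel_plus[of x], of "\<lambda>y. ennreal (\<bar>f (y + h) - f y\<bar> * W (y - x))"]) measurable
        also have "\<dots> \<le> (\<integral>\<^sup>+y. ennreal (a * (\<bar>f (y + h) - f y\<bar> * W (y - x0))) \<partial>lborel)"
        proof (intro nn_integral_mono ennreal_leI)
          fix y
          have "W (y - x) \<le> a * W (y - x0)" using x \<rho> by (intro W_comp) (simp add: norm_minus_commute)
          from mult_left_mono[OF this, of "\<bar>f (y + h) - f y\<bar>"]
          show "\<bar>f (y + h) - f y\<bar> * W (y - x) \<le> a * (\<bar>f (y + h) - f y\<bar> * W (y - x0))" by (simp add: ac_simps)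
        qed
        also have "\<dots> = ennreal (LBINT y. a * (\<bar>f (y + h) - f y\<bar> * W (y - x0)))"
          using e2(2)[of h] h a_ge_1 W_pos by (intro nn_integral_eq_integral integrable_mult_right) (auto simp: less_imp_le)
        also have "\<dots> \<le> ennreal (a * \<epsilon>')" using e2(3)[of h] h a_ge_1 by (intro ennreal_leI) simp
        finally show ?thesis .
      qed
      then have "ennreal C * (\<integral>\<^sup>+z. ennreal (g z) * ennreal (W z) \<partial>lborel) \<le> ennreal C * ennreal (a * \<epsilon>')" by (rule mult_left_mono) simp
      also have "\<dots> = ennreal (C * (a * \<epsilon>'))" using C a_ge_1 \<epsilon>' by (simp add: ennreal_mult)
      finally show "(\<integral>\<^sup>+z. indicator ?R z * ennreal (g z) \<partial>mu s) \<le> ennreal (C * (a * \<epsilon>'))"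
        using C(2)[of "\<lambda>z. ennreal (g z)"] by (auto intro: order_trans)
    qed
    also have "\<dots> = ennreal ((\<kappa> + \<epsilon> / 2) * (1 - overshoot s) + C * (a * \<epsilon>'))"
      using \<kappa> \<epsilon> overshoot_le_1[of s] C a_ge_1 \<epsilon>' by (simp add: ennreal_plus)
    finally have "\<bar>f (x + h) - f x\<bar> \<le> (\<kappa> + \<epsilon> / 2) * (1 - overshoot s) + C * (a * \<epsilon>')"
    proof -
      have "0 \<le> (\<kappa> + \<epsilon> / 2) * (1 - overshoot s) + C * (a * \<epsilon>')"
        using \<kappa> \<epsilon> overshoot_le_1[of s] C(1) a_ge_1 \<epsilon>' by (intro add_nonneg_nonneg mult_nonneg_nonneg) auto
      then show "\<bar>f (x + h) - f x\<bar> \<le> (\<kappa> + \<epsilon> / 2) * (1 - overshoot s) + C * (a * \<epsilon>')"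
        if "ennreal \<bar>f (x + h) - f x\<bar> \<le> ennreal ((\<kappa> + \<epsilon> / 2) * (1 - overshoot s) + C * (a * \<epsilon>'))"
        using that by (simp only: ennreal_le_iff)
    qed
    also have "C * (a * \<epsilon>') \<le> ((C + 1) * a) * \<epsilon>'" using a_ge_1 \<epsilon>' by (simp add: algebra_simps)
    also have "\<dots> = \<epsilon> / 2" using Ca unfolding \<epsilon>'_def by (metis less_numeral_extra(3) nonzero_mult_div_cancel_left times_divide_eq_right mult.commute[of 2] divide_divide_eq_left)
    also have "(\<kappa> + \<epsilon> / 2) * (1 - overshoot s) \<le> (1 - overshoot s) * \<kappa> + \<epsilon> / 2"
    proof -
      have "\<epsilon> / 2 * (1 - overshoot s) \<le> \<epsilon> / 2 * 1" using overshoot_le_1[of s] \<epsilon> by (intro mult_left_mono) auto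
      then show ?thesis by (simp add: algebra_simps)
    qed
    finally show ?thesis by simp
  qed
  moreover have "0 < min (min e1 e2) s" using e1 e2 s by simp
  ultimately show "\<exists>e>0. \<forall>x h. norm (x - x0) < \<rho> \<longrightarrow> norm h < e \<longrightarrow> \<bar>f (x + h) - f x\<bar> \<le> (1 - overshoot s) * \<kappa> + \<epsilon>"
    by blast
qed

text \<open>Each application of \<open>osc_step\<close> multiplies the oscillation by 1 - overshoot,
  and the radius \<open>\<rho> / 2 + (1/2)^n\<close> never falls below \<rho> / 2. The factors may
  tend to 1, but their product tends to 0 because the overshoots have a divergent sum.\<close>

lemma mean_value_osc:
  assumes f: "f \<in> borel_measurable borel" and iW: "integrable lborel (\<lambda>y. f y * W (y - x0))"
    and \<rho>: "0 < \<rho>" "\<rho> \<le> 1" and G: "\<And>x. norm (x - x0) < \<rho> \<Longrightarrow> 0 \<le> f x \<and> f x \<le> G"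
    and mv: "\<And>x s. good_radius s \<Longrightarrow> norm (x - x0) + s < \<rho> \<Longrightarrow> mean_value f s x"
  shows "osc_le f x0 (\<rho> / 2) 0"
proof -
  have G0: "0 \<le> G" using G[of x0] \<rho> by auto
  \<comment> \<open>Below 2^-i / 8, so that four times the radius is at most 2^-(i+1), as comparing
    the tail masses requires; above 2^-i / 16, so that \<open>H\<close> at the radius is comparable
    with \<open>H\<close> at 2^-i. The interval in between contains a good radius.\<close>
  have "\<exists>s. (1/2)^(i + 4) < s \<and> s < (1/2)^(i + 3) \<and> good_radius s" for i
  proof -
    have 1: "(1/2)^(i + 4) < ((1/2)^(i + 3) :: real)" by (intro power_strict_decreasing) auto
    have 0: "0 \<le> (1/2 :: real)^(i + 4)" by (rule zero_le_power) simp
    show ?thesis using good_radius_exists[OF 0 1] by blast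
  qed
  then have "\<forall>i. \<exists>s. (1/2)^(i + 4) < s \<and> s < (1/2)^(i + 3) \<and> good_radius s" by blast
  from choice[OF this] obtain S where S: "\<And>i. (1/2)^(i + 4) < S i" "\<And>i. S i < (1/2)^(i + 3)" "\<And>i. good_radius (S i)" by blast
  have S0: "0 < S i" for i by (rule less_trans[OF _ S(1)]) simp
  have S8: "8 * S i < (1/2)^i" for i using S(2)[of i] by (simp add: power_add power3_eq_cube)
  have S16: "(1/2)^i < 16 * S i" for i using S(1)[of i] by (simp add: power_add power4_eq_xxxx)
  have Sh: "S i \<le> 1/2" for i using S8[of i] power_le_one[of "1/2::real" i] by simp
  obtain m :: nat where m: "(1/2)^m < \<rho> / 2" using real_arch_pow_inv[of "\<rho> / 2" "1/2"] \<rho> by auto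
  have main: "osc_le f x0 (\<rho> / 2 + (1/2)^n) (G * (\<Prod>i=m..<n. 1 - overshoot (S i)))" if "m \<le> n" for n
    using that
  proof (induction n rule: dec_induct)
    case base
    show ?case unfolding osc_le_def
    proof (intro allI impI exI[of _ "\<rho> / 2 - (1/2)^m"] conjI)
      fix \<epsilon> :: real and x h :: 'a assume *: "0 < \<epsilon>" "norm (x - x0) < \<rho> / 2 + (1/2)^m" "norm h < \<rho> / 2 - (1/2)^m"
      have "norm (x + h - x0) < \<rho>" using norm_triangle_ineq[of "x - x0" h] * by (simp add: algebra_simps)
      then show "\<bar>f (x + h) - f x\<bar> \<le> G * (\<Prod>i=m..<m. 1 - overshoot (S i)) + \<epsilon>"
        using G[of "x + h"] G[of x] * m by auto
    qed (use m in simp)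
  next
    case (step n)
    have nm: "(1/2)^n \<le> ((1/2)^m :: real)" using step.hyps by (intro power_decreasing) auto
    have "osc_le f x0 (\<rho> / 2 + (1/2)^Suc n) ((1 - overshoot (S n)) * (G * (\<Prod>i=m..<n. 1 - overshoot (S i))))"
    proof (rule osc_step[OF f iW S0 Sh])
      have pS: "(1/2)^Suc n = (1/2)^n / (2::real)" by simp
      have p0: "0 < (1/2::real)^n" by simp
      show "\<rho> / 2 + (1/2)^Suc n \<le> 1" using nm m \<rho> p0 unfolding pS by linarith
      show "0 \<le> G * (\<Prod>i=m..<n. 1 - overshoot (S i))" using G0 overshoot_le_1 by (intro mult_nonneg_nonneg prod_nonneg) auto
      show "mean_value f (S n) x" if "norm (x - x0) < \<rho> / 2 + (1/2)^Suc n + S n" for x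
        by (rule mv[OF S(3)]) (use that nm m S8[of n] S0[of n] p0 in \<open>unfold pS, linarith\<close>)
      show "osc_le f x0 (\<rho> / 2 + (1/2)^Suc n + 2 * S n) (G * (\<Prod>i=m..<n. 1 - overshoot (S i)))"
        by (rule osc_le_antimono[OF step.IH]) (use S8[of n] S0[of n] in simp)
    qed
    then show ?case using step.hyps by (simp add: ac_simps)
  qed
  \<comment> \<open>256 is 16^2 from \<open>H_scale\<close>, and 17 * a comes from
    \<open>overshoot_ge\<close>.\<close>
  define c where "c = 1 / (17 * a * 256)"
  have c: "0 < c" using a_ge_1 by (simp add: c_def)
  define t where "t i = tail_mass ((1/2)^Suc i) / H ((1/2)^i)" for i
  have t: "c * t i \<le> overshoot (S i)" for i
  proof -
    have l: "1 \<le> (1/2)^i / S i" "(1/2)^i / S i \<le> 16" using S8[of i] S16[of i] S0[of i] by (simp_all add: field_simps)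
    have "H (S i) \<le> ((1/2)^i / S i)\<^sup>2 * H ((1/2)^i / S i * S i)" by (rule H_scale[OF S0 l(1)])
    also have "\<dots> \<le> 256 * H ((1/2)^i)"
    proof -
      have "((1/2)^i / S i)\<^sup>2 \<le> 16\<^sup>2" using l by (intro power_mono) auto
      moreover have "(1/2)^i / S i * S i = (1/2)^i" using S0[of i] by simp
      ultimately show ?thesis using H_pos[of "(1/2)^i"] by simp
    qed
    finally have H: "H (S i) \<le> 256 * H ((1/2)^i)" .
    have "tail_mass ((1/2)^Suc i) \<le> tail_mass (4 * S i)" using S0[of i] S8[of i] by (intro tail_mass_mono) auto
    then have "tail_mass ((1/2)^Suc i) / (17 * a * (256 * H ((1/2)^i))) \<le> tail_mass (4 * S i) / (17 * a * H (S i))"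
      using H H_pos[OF S0[of i]] a_ge_1 tail_mass_nonneg by (intro frac_le mult_left_mono) auto
    also have "\<dots> \<le> overshoot (S i)" by (rule overshoot_ge[OF S0 Sh])
    finally show ?thesis by (simp add: c_def t_def ac_simps)
  qed
  show ?thesis unfolding osc_le_def
  proof (intro allI impI)
    fix \<epsilon> :: real assume \<epsilon>: "0 < \<epsilon>"
    \<comment> \<open>With this sum the product is at most exp (- 2 G / \<epsilon>), hence at most 1
      / (1 + 2 G / \<epsilon>), which times G is at most \<epsilon> / 2.\<close>
    obtain n where n: "m \<le> n" "2 * G / \<epsilon> / c \<le> (\<Sum>i=m..<n. t i)" using tail_sum_unbounded unfolding t_def by blast
    have "(\<Prod>i=m..<n. 1 - overshoot (S i)) \<le> (\<Prod>i=m..<n. exp (- (c * t i)))"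
    proof (rule prod_mono)
      fix i
      have "1 - overshoot (S i) \<le> 1 + (- (c * t i))" using t[of i] by simp
      also have "\<dots> \<le> exp (- (c * t i))" by (rule exp_ge_add_one_self)
      finally show "0 \<le> 1 - overshoot (S i) \<and> 1 - overshoot (S i) \<le> exp (- (c * t i))" using overshoot_le_1[of "S i"] by simp
    qed
    also have "\<dots> = exp (- (c * (\<Sum>i=m..<n. t i)))" by (simp add: exp_sum[symmetric] sum_negf sum_distrib_left)
    also have "\<dots> \<le> exp (- (2 * G / \<epsilon>))"
    proof -
      have "2 * G / \<epsilon> \<le> (\<Sum>i=m..<n. t i) * c" using n(2) unfolding pos_divide_le_eq[OF c] .
      then show ?thesis by (simp only: exp_le_cancel_iff neg_le_iff_le mult.commute)
    qed
    also have "\<dots> \<le> 1 / (1 + 2 * G / \<epsilon>)"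
    proof -
      have "0 \<le> 2 * G / \<epsilon>" using G0 \<epsilon> by simp
      then show ?thesis using exp_ge_add_one_self[of "2 * G / \<epsilon>"] by (simp add: exp_minus inverse_eq_divide frac_le)
    qed
    finally have "G * (\<Prod>i=m..<n. 1 - overshoot (S i)) \<le> G * (1 / (1 + 2 * G / \<epsilon>))" using G0 by (rule mult_left_mono)
    also have "\<dots> \<le> \<epsilon> / 2"
    proof -
      have "0 < 1 + 2 * G / \<epsilon>" using G0 \<epsilon> by (intro add_pos_nonneg) auto
      moreover have "G \<le> \<epsilon> / 2 * (1 + 2 * G / \<epsilon>)" using \<epsilon> by (simp add: field_simps)
      ultimately show ?thesis by (simp add: pos_divide_le_eq)
    qed
    finally have small: "G * (\<Prod>i=m..<n. 1 - overshoot (S i)) \<le> \<epsilon> / 2" .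
    obtain e where e: "0 < e" "\<And>x h. norm (x - x0) < \<rho> / 2 + (1/2)^n \<Longrightarrow> norm h < e \<Longrightarrow>
        \<bar>f (x + h) - f x\<bar> \<le> G * (\<Prod>i=m..<n. 1 - overshoot (S i)) + \<epsilon> / 2"
      using main[OF n(1)] \<epsilon> unfolding osc_le_def by (meson half_gt_zero)
    have "\<bar>f (x + h) - f x\<bar> \<le> 0 + \<epsilon>" if "norm (x - x0) < \<rho> / 2" "norm h < e" for x h
    proof -
      have "norm (x - x0) < \<rho> / 2 + (1/2)^n" by (rule less_trans[OF that(1)]) simp
      then show ?thesis using e(2)[of x h] that(2) small by simp
    qed
    then show "\<exists>e>0. \<forall>x h. norm (x - x0) < \<rho> / 2 \<longrightarrow> norm h < e \<longrightarrow> \<bar>f (x + h) - f x\<bar> \<le> 0 + \<epsilon>" using e(1) by blast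
  qed
qed

end

section \<open>Mollified harmonic functions solve the nonlocal equation\<close>

text \<open>Here the averaging kernel has compact support, so that near x0 the average uses only
  points at which the mean value property holds.\<close>

definition moll :: "real \<Rightarrow> ('a::euclidean_space \<Rightarrow> real) \<Rightarrow> 'a \<Rightarrow> real" where
  "moll d u x = (LBINT y. bump d (x - y) * u y) / (LBINT y. bump d (y::'a))"

context levy_kernel begin

lemma W_minus: "W (x - y) = W (y - x)"
  by (simp add: W_def norm_minus_commute)

lemma bump_le_W:
  assumes d: "0 < d" and B: "norm (x - x0) \<le> B"
  shows "bump d (x - y) \<le> W (y - x0) / \<nu> (B + d + 1)"
proof (cases "norm (x - y) < d")
  case True
  have B0: "0 \<le> B" using B norm_ge_zero order_trans by blast
  have "norm (y - x0) \<le> B + d" using norm_triangle_ineq[of "y - x" "x - x0"] B True by (simp add: norm_minus_commute)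
  then have "\<nu> (B + d + 1) \<le> W (y - x0)" unfolding W_def by (intro nu_mono) (auto simp: add_nonneg_pos)
  moreover have "0 < \<nu> (B + d + 1)" using B0 d by (intro nu_pos) simp
  ultimately have "1 \<le> W (y - x0) / \<nu> (B + d + 1)" by simp
  then show ?thesis using bump_le_1[of d "x - y"] by linarith
next
  case False
  have "0 < \<nu> (B + d + 1)" using B norm_ge_zero[of "x - x0"] d by (intro nu_pos) linarith
  then show ?thesis using False bump_out[OF d, of "x - y"] W_pos[of "y - x0"] by simp
qed

lemma bump_mult_le_W:
  assumes d: "0 < d" and B: "norm (x - x0) \<le> B"
  shows "\<bar>bump d (x - y) * q\<bar> \<le> \<bar>q * W (y - x0)\<bar> / \<nu> (B + d + 1)"
  using mult_right_mono[OF bump_le_W[OF d B, of y], of "\<bar>q\<bar>"] bump_nonneg[of d "x - y"] W_pos[of "y - x0"]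
  by (simp add: abs_mult ac_simps)

lemma bump_mult_integrable:
  assumes d: "0 < d" and u[measurable]: "u \<in> borel_measurable borel" and iW: "integrable lborel (\<lambda>y. u y * W (y - x0))"
  shows "integrable lborel (\<lambda>y. bump d (x - y) * u y)"
proof (rule Bochner_Integration.integrable_bound)
  show "integrable lborel (\<lambda>y. \<bar>u y * W (y - x0)\<bar> / \<nu> (norm (x - x0) + d + 1))" using iW by (intro integrable_divide_zero integrable_abs)
  show "AE y in lborel. norm (bump d (x - y) * u y) \<le> norm (\<bar>u y * W (y - x0)\<bar> / \<nu> (norm (x - x0) + d + 1))"
    using bump_mult_le_W[OF d order_refl, where x = x and ?x0.0 = x0] by (intro AE_I2) (simp only: real_norm_def order_trans[OF _ abs_ge_self])
qed measurable

lemma moll_continuous: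
  assumes d: "0 < d" and u[measurable]: "u \<in> borel_measurable borel" and iW: "integrable lborel (\<lambda>y. u y * W (y - x0))"
  shows "continuous_on S (moll d u)"
proof (rule continuous_on_subset)
  show "continuous_on UNIV (moll d u)" unfolding continuous_on_sequentially
  proof (intro allI ballI impI)
    fix w and x :: 'a assume "(\<forall>n. w n \<in> UNIV) \<and> w \<longlonglongrightarrow> x"
    then have w: "w \<longlonglongrightarrow> x" by simp
    have "(\<lambda>n. w n - x0) \<longlonglongrightarrow> x - x0" by (intro tendsto_intros w)
    then have "Bseq (\<lambda>n. w n - x0)" by (meson convergentI convergent_imp_Bseq)
    then obtain B where B: "\<And>n. norm (w n - x0) \<le> B" by (auto simp: Bseq_def)
    have "(\<lambda>n. \<integral>y. bump d (w n - y) * u y \<partial>lborel) \<longlonglongrightarrow> (LBINT y. bump d (x - y) * u y)"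
    proof (rule integral_dominated_convergence)
      show "integrable lborel (\<lambda>y. \<bar>u y * W (y - x0)\<bar> / \<nu> (B + d + 1))" using iW by (intro integrable_divide_zero integrable_abs)
      show "AE y in lborel. norm (bump d (w n - y) * u y) \<le> \<bar>u y * W (y - x0)\<bar> / \<nu> (B + d + 1)" for n
        using bump_mult_le_W[OF d B] by (intro AE_I2) auto
      show "AE y in lborel. (\<lambda>n. bump d (w n - y) * u y) \<longlonglongrightarrow> bump d (x - y) * u y"
        by (intro AE_I2 tendsto_intros isCont_tendsto_compose[OF bump_isCont] w)
    qed measurable
    then show "(moll d u \<circ> w) \<longlonglongrightarrow> moll d u x" unfolding moll_def comp_def
      using bump_integral_pos[OF d, where 'a = 'a] by (intro tendsto_intros) auto
  qed
qed simp

text \<open>The operator falls on the bump, so no regularity of u is involved. Fubini applies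
  because \<open>sdiff_bump_W\<close> bounds the inner integral by the weight against which u is
  integrable.\<close>

lemma moll_L:
  assumes d: "0 < d" "d \<le> 1" and u[measurable]: "u \<in> borel_measurable borel"
    and iW: "integrable lborel (\<lambda>y. u y * W (y - x0))" and x: "norm (x - x0) \<le> 1"
  shows "integrable lborel (\<lambda>z. sdiff (moll d u) x z * N z)"
    and "L (moll d u) x = (LBINT y. u y * L (bump d) (x - y)) / (LBINT y. bump d (y::'a))"
proof -
  let ?K = "\<integral>y. bump d (y::'a) \<partial>lborel"
  obtain C where C: "0 \<le> C" "\<And>w. (LBINT z. \<bar>sdiff (bump d) w z\<bar> * N z) \<le> C * W w" using sdiff_bump_W[OF d] by blast
  define F where "F y z = u y * (sdiff (bump d) (x - y) z * N z)" for y z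
  have mF: "(\<lambda>(y, z). F y z) \<in> borel_measurable (lborel \<Otimes>\<^sub>M lborel)" unfolding F_def sdiff_def by measurable
  have iz: "integrable lborel (F y)" for y unfolding F_def[abs_def] by (intro integrable_mult_right L_bump_integrable d)
  have absF: "(LBINT z. norm (F y z)) \<le> C * a * \<bar>u y * W (y - x0)\<bar>" for y
  proof -
    have "(LBINT z. norm (F y z)) = (LBINT z. \<bar>u y\<bar> * (\<bar>sdiff (bump d) (x - y) z\<bar> * N z))"
      by (intro Bochner_Integration.integral_cong) (simp_all add: F_def abs_mult N_nonneg)
    also have "\<dots> = \<bar>u y\<bar> * (LBINT z. \<bar>sdiff (bump d) (x - y) z\<bar> * N z)" by simp
    also have "\<dots> \<le> \<bar>u y\<bar> * (C * (a * W (y - x0)))"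
    proof -
      have "W (x - y) \<le> a * W (y - x0)" unfolding W_minus[of x y] using x by (intro W_comp) (simp add: norm_minus_commute)
      then have "C * W (x - y) \<le> C * (a * W (y - x0))" using C(1) by (rule mult_left_mono)
      then show ?thesis using C(2)[of "x - y"] by (intro mult_left_mono) auto
    qed
    finally show ?thesis using W_pos[of "y - x0"] by (simp add: abs_mult ac_simps)
  qed
  have iF: "integrable (lborel \<Otimes>\<^sub>M lborel) (\<lambda>(y, z). F y z)"
  proof (rule lborel_pair.Fubini_integrable[OF mF])
    show "AE y in lborel. integrable lborel (\<lambda>z. (case (y, z) of (y, z) \<Rightarrow> F y z))" using iz by simp
    show "integrable lborel (\<lambda>y. \<integral>z. norm (case (y, z) of (y, z) \<Rightarrow> F y z) \<partial>lborel)"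
    proof (rule Bochner_Integration.integrable_bound)
      show "integrable lborel (\<lambda>y. C * a * \<bar>u y * W (y - x0)\<bar>)" by (intro integrable_mult_right integrable_abs iW)
      have "(\<lambda>y. \<integral>z. norm (F y z) \<partial>lborel) \<in> borel_measurable lborel"
      proof -
        have "(\<lambda>(y, z). norm (F y z)) \<in> borel_measurable (lborel \<Otimes>\<^sub>M lborel)"
          using measurable_compose[OF mF borel_measurable_norm] by (simp add: case_prod_beta')
        from lborel.borel_measurable_lebesgue_integral[OF this] show ?thesis .
      qed
      then show "(\<lambda>y. \<integral>z. norm (case (y, z) of (y, z) \<Rightarrow> F y z) \<partial>lborel) \<in> borel_measurable lborel" by simp
      show "AE y in lborel. norm (LBINT z. norm (case (y, z) of (y, z) \<Rightarrow> F y z)) \<le> norm (C * a * \<bar>u y * W (y - x0)\<bar>)"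
        using absF by (intro AE_I2) (auto intro!: order_trans[OF _ abs_ge_self])
    qed
  qed
  have sd: "sdiff (moll d u) x z * N z = (LBINT y. F y z) / ?K" for z
  proof -
    have i: "integrable lborel (\<lambda>y. bump d (v - y) * u y)" for v by (rule bump_mult_integrable[OF d(1) u iW])
    have "(LBINT y. F y z) = (LBINT y. (bump d (x + z - y) * u y + bump d (x - z - y) * u y - 2 * (bump d (x - y) * u y)) * N z)"
      by (intro Bochner_Integration.integral_cong) (simp_all add: F_def sdiff_def algebra_simps)
    also have "\<dots> = (LBINT y. (bump d (x + z - y) * u y + bump d (x - z - y) * u y - 2 * (bump d (x - y) * u y))) * N z" by simp
    also have "\<dots> = ((LBINT y. bump d (x + z - y) * u y) + (LBINT y. bump d (x - z - y) * u y) - 2 * (LBINT y. bump d (x - y) * u y)) * N z"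
      using i[of "x + z"] i[of "x - z"] i[of x] by simp
    finally have *: "(LBINT y. F y z) = ((LBINT y. bump d (x + z - y) * u y) + (LBINT y. bump d (x - z - y) * u y) - 2 * (LBINT y. bump d (x - y) * u y)) * N z" .
    have "(A / K + B / K - 2 * (C / K)) * n = ((A + B - 2 * C) * n) / K" for A B C K n :: real
      by (simp add: add_divide_distrib diff_divide_distrib algebra_simps)
    then show ?thesis unfolding sdiff_def moll_def * by blast
  qed
  show "integrable lborel (\<lambda>z. sdiff (moll d u) x z * N z)" unfolding sd
    using lborel_pair.integrable_snd[OF iF] by (intro integrable_divide_zero) simp
  have "L (moll d u) x = (LBINT z. (LBINT y. F y z)) / ?K" unfolding L_def sd by simp
  also have "(LBINT z. (LBINT y. F y z)) = (LBINT y. (LBINT z. F y z))" using lborel_pair.Fubini_integral[OF iF] by simp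
  also have "(\<lambda>y. \<integral>z. F y z \<partial>lborel) = (\<lambda>y. u y * L (bump d) (x - y))" by (simp add: F_def L_def)
  finally show "L (moll d u) x = (LBINT y. u y * L (bump d) (x - y)) / ?K" .
qed

end

context levy_setting begin

text \<open>Dynkin's characteristic operator: the generator at w is recovered from exits of
  shrinking balls, by continuity of \<open>L (bump d)\<close>.\<close>

lemma bm_generator_limit:
  assumes d: "0 < d" and s: "\<And>n. 0 < s n" "s \<longlonglongrightarrow> 0"
  shows "(\<lambda>n. (bm d (s n) w - bump d w) / mean_exit (s n)) \<longlonglongrightarrow> L (bump d) w / 2"
proof (rule LIMSEQ_I)
  fix r :: real assume r: "0 < r"
  have "isCont (L (bump d)) w" using L_bump_continuous[OF d] by (simp add: continuous_on_eq_continuous_at)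
  then obtain e where e: "0 < e" "\<And>v. dist v w < e \<Longrightarrow> \<bar>L (bump d) v - L (bump d) w\<bar> < r"
    using r unfolding continuous_at_eps_delta dist_real_def by meson
  obtain n0 where n0: "\<And>n. n0 \<le> n \<Longrightarrow> s n < e" using order_tendstoD(2)[OF s(2) e(1)] by (auto simp: eventually_sequentially)
  have "norm ((bm d (s n) w - bump d w) / mean_exit (s n) - L (bump d) w / 2) < r" if n: "n0 \<le> n" for n
  proof -
    have p: "0 < mean_exit (s n)" by (rule mean_exit_pos[OF s(1)])
    have v: "\<bar>L (bump d) (w + y) - L (bump d) w\<bar> < r" if "norm y \<le> s n" for y
      using e(2)[of "w + y"] n0[OF n] that by (simp add: dist_norm)
    have "bm d (s n) w - bump d w \<le> (L (bump d) w + r) / 2 * mean_exit (s n)"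
      by (rule bm_dynkin(1)[OF d s(1)]) (use v in force)
    moreover have "(L (bump d) w - r) / 2 * mean_exit (s n) \<le> bm d (s n) w - bump d w"
      by (rule bm_dynkin(2)[OF d s(1)]) (use v in force)
    moreover have "\<bar>q / p - l / 2\<bar> < r" if "q \<le> (l + r) / 2 * p" "(l - r) / 2 * p \<le> q" "0 < p" for q p l :: real
    proof -
      have "q / p \<le> (l + r) / 2" "(l - r) / 2 \<le> q / p" using pos_divide_le_eq[OF that(3), of q "(l + r) / 2"] pos_le_divide_eq[OF that(3), of "(l - r) / 2" q] that by blast+
      moreover have "\<bar>x - l / 2\<bar> < r" if "x \<le> (l + r) / 2" "(l - r) / 2 \<le> x" for x using that r by argo
      ultimately show ?thesis by blast
    qed
    ultimately show ?thesis using p unfolding real_norm_def by blast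
  qed
  then show "\<exists>no. \<forall>n\<ge>no. norm ((bm d (s n) w - bump d w) / mean_exit (s n) - L (bump d) w / 2) < r" by blast
qed

text \<open>The weak form of the nonlocal equation. By \<open>mean_value_mollify\<close> f
  annihilates the difference of the bump and its exit average; divided by the mean exit time this
  difference tends to half of \<open>L (bump d)\<close>, dominated by a multiple of \<open>W\<close>
  through \<open>bm_W\<close>.\<close>

lemma mean_value_L_bump:
  assumes f[measurable]: "f \<in> borel_measurable borel" and f0: "\<And>x. 0 \<le> f x"
    and iW: "integrable lborel (\<lambda>y. f y * W (y - x0))"
    and mv: "\<And>x s. good_radius s \<Longrightarrow> norm (x - x0) + s < \<rho> \<Longrightarrow> mean_value f s x"
    and d: "0 < d" and x: "norm (x - x0) + d < \<rho>" and \<rho>: "\<rho> \<le> 1"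
  shows "(LBINT y. f y * L (bump d) (x - y)) = 0"
proof -
  define \<eta> where "\<eta> = \<rho> - (norm (x - x0) + d)"
  have \<eta>: "0 < \<eta>" "\<eta> \<le> 1" "d \<le> 1" "norm (x - x0) \<le> 1" using x \<rho> d norm_ge_zero[of "x - x0"] unfolding \<eta>_def by linarith+
  have "\<exists>s. 0 < s \<and> s < \<eta> / real (Suc n) \<and> good_radius s" for n
    using good_radius_exists[of 0 "\<eta> / real (Suc n)"] \<eta> by (metis divide_pos_pos of_nat_0_less_iff order_refl zero_less_Suc)
  then obtain s where s: "\<And>n. 0 < s n" "\<And>n. s n < \<eta> / real (Suc n)" "\<And>n. good_radius (s n)" by metis
  have s\<eta>: "s n < \<eta>" for n
  proof -
    have "\<eta> / real (Suc n) \<le> \<eta>" using \<eta> by (simp add: divide_le_eq)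
    then show ?thesis using s(2)[of n] by linarith
  qed
  have sl: "s \<longlonglongrightarrow> 0"
  proof (rule tendsto_sandwich[OF _ _ tendsto_const])
    show "(\<lambda>n. \<eta> / real (Suc n)) \<longlonglongrightarrow> 0" by real_asymp
  qed (use s in \<open>auto intro!: always_eventually less_imp_le\<close>)
  define D where "D n y = (bm d (s n) (x - y) - bump d (x - y)) / mean_exit (s n)" for n y
  obtain C where C: "0 \<le> C" "\<And>s w. 0 < s \<Longrightarrow> s \<le> 1 \<Longrightarrow> \<bar>bm d s w - bump d w\<bar> \<le> C * mean_exit s * W w"
    using bm_W[OF d \<eta>(3)] by blast
  have Dz: "(LBINT y. f y * D n y) = 0" for n
  proof -
    have ib: "integrable lborel (\<lambda>y. bump d (x - y) * f y)" by (rule bump_mult_integrable[OF d f iW])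
    have eq: "(\<integral>\<^sup>+y. ennreal (bump d (x - y) * f y) \<partial>lborel) = (\<integral>\<^sup>+y. ennreal (f y * bm d (s n) (x - y)) \<partial>lborel)"
    proof (rule mean_value_mollify[OF f f0 d])
      fix v assume "v \<in> ball x d"
      then have "norm (v - x) < d" by (simp add: dist_norm norm_minus_commute)
      then have "norm (v - x0) + s n < \<rho>" using norm_triangle_ineq[of "v - x" "x - x0"] s\<eta>[of n] by (simp add: \<eta>_def)
      then show "mean_value f (s n) v" by (rule mv[OF s(3)])
    qed
    have fin: "(\<integral>\<^sup>+y. ennreal (f y * bm d (s n) (x - y)) \<partial>lborel) = ennreal (LBINT y. bump d (x - y) * f y)"
      unfolding eq[symmetric] by (rule nn_integral_eq_integral[OF ib]) (simp add: f0 bump_nonneg)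
    have im: "integrable lborel (\<lambda>y. f y * bm d (s n) (x - y))"
      using fin by (intro integrableI_nonneg) (auto simp: f0 bm_nonneg)
    have "(LBINT y. f y * bm d (s n) (x - y)) = (LBINT y. bump d (x - y) * f y)"
      using fin by (subst integral_eq_nn_integral) (auto simp: f0 bm_nonneg bump_nonneg intro!: integral_nonneg_AE)
    then have "(LBINT y. f y * bm d (s n) (x - y) - bump d (x - y) * f y) = 0"
      using im ib by simp
    moreover have "f y * D n y = (f y * bm d (s n) (x - y) - bump d (x - y) * f y) / mean_exit (s n)" for y
      by (simp add: D_def algebra_simps diff_divide_distrib)
    ultimately show ?thesis by simp
  qed
  have "(\<lambda>n. \<integral>y. f y * D n y \<partial>lborel) \<longlonglongrightarrow> (LBINT y. f y * (L (bump d) (x - y) / 2))"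
  proof (rule integral_dominated_convergence)
    show "integrable lborel (\<lambda>y. C * a * \<bar>f y * W (y - x0)\<bar>)" by (intro integrable_mult_right integrable_abs iW)
    show "AE y in lborel. (\<lambda>n. f y * D n y) \<longlonglongrightarrow> f y * (L (bump d) (x - y) / 2)"
      unfolding D_def by (intro AE_I2 tendsto_mult tendsto_const bm_generator_limit d s sl)
    show "AE y in lborel. norm (f y * D n y) \<le> C * a * \<bar>f y * W (y - x0)\<bar>" for n
    proof (intro AE_I2)
      fix y
      have p: "0 < mean_exit (s n)" by (rule mean_exit_pos[OF s(1)])
      have "\<bar>bm d (s n) (x - y) - bump d (x - y)\<bar> \<le> C * mean_exit (s n) * W (x - y)"
        using s\<eta>[of n] \<eta>(2) by (intro C(2) s(1)) simp
      then have "\<bar>D n y\<bar> \<le> C * W (x - y)" using p by (simp add: D_def abs_divide divide_le_eq ac_simps)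
      also have "\<dots> \<le> C * (a * W (y - x0))"
        unfolding W_minus[of x y] using \<eta>(4) C(1) by (intro mult_left_mono W_comp) (simp_all add: norm_minus_commute)
      finally have "\<bar>f y\<bar> * \<bar>D n y\<bar> \<le> \<bar>f y\<bar> * (C * (a * W (y - x0)))" by (intro mult_left_mono) auto
      then show "norm (f y * D n y) \<le> C * a * \<bar>f y * W (y - x0)\<bar>" using W_pos[of "y - x0"] by (simp add: abs_mult ac_simps)
    qed
    show "(\<lambda>y. f y * D n y) \<in> borel_measurable lborel" for n unfolding D_def by measurable
  qed measurable
  then have "(LBINT y. f y * (L (bump d) (x - y) / 2)) = 0" unfolding Dz by (simp add: LIMSEQ_const_iff)
  then show ?thesis by simp
qed

lemma moll_harmonic:
  assumes f: "f \<in> borel_measurable borel" and f0: "\<And>x. 0 \<le> f x"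
    and iW: "integrable lborel (\<lambda>y. f y * W (y - x0))"
    and mv: "\<And>x s. good_radius s \<Longrightarrow> norm (x - x0) + s < \<rho> \<Longrightarrow> mean_value f s x"
    and d: "0 < d" and x: "norm (x - x0) + d < \<rho>" and \<rho>: "\<rho> \<le> 1"
  shows "integrable lborel (\<lambda>z. sdiff (moll d f) x z * N z)" and "L (moll d f) x = 0"
proof -
  have *: "d \<le> 1" "norm (x - x0) \<le> 1" using x \<rho> d norm_ge_zero[of "x - x0"] by linarith+
  show "integrable lborel (\<lambda>z. sdiff (moll d f) x z * N z)" by (rule moll_L(1)[OF d *(1) f iW *(2)])
  have "(LBINT y. f y * L (bump d) (x - y)) = 0" by (rule mean_value_L_bump[OF f f0 iW mv d x \<rho>])
  then show "L (moll d f) x = 0" unfolding moll_L(2)[OF d *(1) f iW *(2)] by simp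
qed

end

section \<open>Difference estimates\<close>

context levy_setting begin

lemma moll_approx:
  assumes d: "0 < d" and u[measurable]: "u \<in> borel_measurable borel" and iW: "integrable lborel (\<lambda>y. u y * W (y - x0))"
    and near: "\<And>y. norm (y - x) < d \<Longrightarrow> \<bar>u y - c\<bar> \<le> \<epsilon>"
  shows "\<bar>moll d u x - c\<bar> \<le> \<epsilon>"
proof -
  define K where "K = (LBINT y. bump d (y::'a))"
  have K: "0 < K" unfolding K_def by (rule bump_integral_pos[OF d])
  have ib: "integrable lborel (\<lambda>y. bump d (x - y))" "(LBINT y. bump d (x - y)) = K"
    using lborel_invariant[OF _ distr_lborel_diff[of x], of "bump d :: 'a \<Rightarrow> real"] bump_integrable[OF d, where 'a = 'a] by (auto simp: K_def)
  have iu: "integrable lborel (\<lambda>y. bump d (x - y) * u y)" by (rule bump_mult_integrable[OF d u iW])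
  have id: "integrable lborel (\<lambda>y. bump d (x - y) * u y - bump d (x - y) * c)" using iu ib(1) by simp
  have "\<bar>(LBINT y. bump d (x - y) * u y - bump d (x - y) * c)\<bar> \<le> (LBINT y. \<bar>bump d (x - y) * u y - bump d (x - y) * c\<bar>)"
    by (rule integral_abs_bound)
  also have "\<dots> \<le> (LBINT y. bump d (x - y) * \<epsilon>)"
  proof (rule integral_mono)
    fix y
    show "\<bar>bump d (x - y) * u y - bump d (x - y) * c\<bar> \<le> bump d (x - y) * \<epsilon>"
    proof (cases "norm (y - x) < d")
      case True
      from mult_left_mono[OF near[OF True] bump_nonneg[of d "x - y"]] show ?thesis
        using bump_nonneg[of d "x - y"] by (simp add: right_diff_distrib[symmetric] abs_mult)
    next
      case False
      then show ?thesis using bump_out[OF d, of "x - y"] by (simp add: norm_minus_commute)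
    qed
  qed (use id ib in auto)
  also have "\<dots> = K * \<epsilon>" using ib by simp
  finally have "\<bar>(LBINT y. bump d (x - y) * u y) - K * c\<bar> \<le> K * \<epsilon>" using iu ib by simp
  moreover have "moll d u x - c = ((LBINT y. bump d (x - y) * u y) - K * c) / K"
    using K by (simp add: moll_def K_def diff_divide_distrib)
  ultimately show ?thesis using K by (simp add: abs_divide pos_divide_le_eq mult.commute)
qed

text \<open>Averaging displaces mass by at most r / 4, over which \<open>N\<close> changes by at
  most a factor a; so the tail of the average beyond r is controlled by the tail of u beyond 3 r /
  4.\<close>

lemma moll_tail:
  assumes r: "0 < r" "r \<le> 1" and d: "0 < d" "d \<le> r / 4" and u[measurable]: "u \<in> borel_measurable borel"
    and iW: "integrable lborel (\<lambda>y. u y * W (y - x0))"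
    and T: "(\<integral>\<^sup>+w. ennreal (indicator {w. 3 * r / 4 \<le> norm (w - x0)} w * \<bar>u w\<bar> * N (w - x0)) \<partial>lborel) \<le> ennreal T"
  shows "(\<integral>\<^sup>+y. ennreal (\<bar>indicator {y. r \<le> norm y} y * moll d u (x0 + y) * N y\<bar>) \<partial>lborel) \<le> ennreal (a * T)"
proof -
  define K where "K = (LBINT y. bump d (y::'a))"
  have K: "0 < K" unfolding K_def by (rule bump_integral_pos[OF d(1)])
  let ?t = "\<lambda>w. indicator {w. 3 * r / 4 \<le> norm (w - x0)} w * \<bar>u w\<bar> * N (w - x0)"
  have t0: "0 \<le> ?t w" for w by (simp add: N_nonneg)
  have 1: "ennreal (\<bar>indicator {y. r \<le> norm y} y * moll d u (x0 + y) * N y\<bar>) \<le>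
      (\<integral>\<^sup>+w. ennreal (bump d (x0 + y - w)) * ennreal (a / K * ?t w) \<partial>lborel)" for y
  proof (cases "r \<le> norm y")
    case True
    have y0: "y \<noteq> 0" using True r by auto
    have iu: "integrable lborel (\<lambda>w. bump d (x0 + y - w) * u w)" by (rule bump_mult_integrable[OF d(1) u iW])
    have iu': "integrable lborel (\<lambda>w. \<bar>bump d (x0 + y - w) * u w\<bar> * (N y / K))" using iu by simp
    have "\<bar>indicator {y. r \<le> norm y} y * moll d u (x0 + y) * N y\<bar> = \<bar>\<integral>w. bump d (x0 + y - w) * u w \<partial>lborel\<bar> * (N y / K)"
      using True K N_nonneg[of y] by (simp add: moll_def K_def abs_mult abs_divide)
    also have "\<dots> \<le> (LBINT w. \<bar>bump d (x0 + y - w) * u w\<bar>) * (N y / K)"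
      using K N_nonneg[of y] by (intro mult_right_mono integral_abs_bound) auto
    also have "\<dots> = (LBINT w. \<bar>bump d (x0 + y - w) * u w\<bar> * (N y / K))" by simp
    finally have "ennreal (\<bar>indicator {y. r \<le> norm y} y * moll d u (x0 + y) * N y\<bar>) \<le> ennreal (LBINT w. \<bar>bump d (x0 + y - w) * u w\<bar> * (N y / K))"
      by (rule ennreal_leI)
    also have "\<dots> = (\<integral>\<^sup>+w. ennreal (\<bar>bump d (x0 + y - w) * u w\<bar> * (N y / K)) \<partial>lborel)"
      using K N_nonneg[of y] by (intro nn_integral_eq_integral[symmetric] iu') auto
    also have "\<dots> \<le> (\<integral>\<^sup>+w. ennreal (bump d (x0 + y - w)) * ennreal (a / K * ?t w) \<partial>lborel)"
    proof (rule nn_integral_mono)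
      fix w
      show "ennreal (\<bar>bump d (x0 + y - w) * u w\<bar> * (N y / K)) \<le> ennreal (bump d (x0 + y - w)) * ennreal (a / K * ?t w)"
      proof (cases "norm (x0 + y - w) < d")
        case near: True
        have e: "w - x0 = y - (x0 + y - w)" by simp
        have q: "norm y - d \<le> norm (w - x0)" "norm (w - x0) \<le> norm y + d"
          unfolding e using norm_triangle_ineq2[of y "x0 + y - w"] norm_triangle_ineq4[of y "x0 + y - w"] near by auto
        have wn: "3 * r / 4 \<le> norm (w - x0)" using q True d by linarith
        then have w0: "w - x0 \<noteq> 0" using r by auto
        have "N y \<le> a * N (w - x0)" unfolding N_eq[OF y0] N_eq[OF w0]
          using q wn True d r by (intro nu_comp) linarith+
        then have "\<bar>bump d (x0 + y - w) * u w\<bar> * (N y / K) \<le> \<bar>bump d (x0 + y - w) * u w\<bar> * (a * N (w - x0) / K)"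
          using K by (intro mult_left_mono divide_right_mono) auto
        also have "\<dots> = bump d (x0 + y - w) * (a / K * ?t w)" using wn bump_nonneg[of d "x0 + y - w"] by (simp add: abs_mult)
        finally have "ennreal (\<bar>bump d (x0 + y - w) * u w\<bar> * (N y / K)) \<le> ennreal (bump d (x0 + y - w) * (a / K * ?t w))" by (rule ennreal_leI)
        then show ?thesis by (simp only: ennreal_mult'[OF bump_nonneg])
      next
        case False then show ?thesis using bump_out[OF d(1), of "x0 + y - w"] by simp
      qed
    qed
    finally show ?thesis .
  qed simp
  have "(\<integral>\<^sup>+y. ennreal (\<bar>indicator {y. r \<le> norm y} y * moll d u (x0 + y) * N y\<bar>) \<partial>lborel) \<le>
      (\<integral>\<^sup>+y. (\<integral>\<^sup>+w. ennreal (bump d (x0 + y - w)) * ennreal (a / K * ?t w) \<partial>lborel) \<partial>lborel)" by (intro nn_integral_mono 1)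
  also have "\<dots> = (\<integral>\<^sup>+w. (\<integral>\<^sup>+y. ennreal (bump d (x0 + y - w)) * ennreal (a / K * ?t w) \<partial>lborel) \<partial>lborel)"
    by (rule lborel_pair.Fubini') measurable
  also have "\<dots> = (\<integral>\<^sup>+w. ennreal a * ennreal (?t w) \<partial>lborel)"
  proof (rule nn_integral_cong)
    fix w
    have "(\<integral>\<^sup>+y. ennreal (bump d (x0 + y - w)) * ennreal (a / K * ?t w) \<partial>lborel) = (\<integral>\<^sup>+y. ennreal (bump d (x0 + y - w)) \<partial>lborel) * ennreal (a / K * ?t w)"
      by (rule nn_integral_multc) measurable
    also have "(\<integral>\<^sup>+y. ennreal (bump d (x0 + y - w)) \<partial>lborel) = ennreal K"
      using bump_shift_nn[OF d(1), of "w - x0"] by (simp add: K_def algebra_simps)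
    also have "ennreal K * ennreal (a / K * ?t w) = ennreal (K * (a / K * ?t w))" by (rule ennreal_mult'[symmetric]) (use K in simp)
    also have "K * (a / K * ?t w) = a * ?t w" using K by simp
    also have "ennreal (a * ?t w) = ennreal a * ennreal (?t w)" using a_ge_1 by (simp add: ennreal_mult')
    finally show "(\<integral>\<^sup>+y. ennreal (bump d (x0 + y - w)) * ennreal (a / K * ?t w) \<partial>lborel) = ennreal a * ennreal (?t w)" .
  qed
  also have "\<dots> = ennreal a * (\<integral>\<^sup>+w. ennreal (?t w) \<partial>lborel)" by (rule nn_integral_cmult) measurable
  also have "\<dots> \<le> ennreal a * ennreal T" by (intro mult_left_mono T) simp
  also have "\<dots> = ennreal (a * T)" using a_ge_1 by (simp add: ennreal_mult')
  finally show ?thesis .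
qed

text \<open>The bound for the mollifications depends on u only through its supremum near x0 and its
  tail, both uniform in d, so d may tend to 0 by continuity of u at the two points. Dividing by a in
  the tail hypothesis offsets the loss in \<open>moll_tail\<close>. There is no sign condition on u,
  so that differences of translates qualify.\<close>

lemma difference_estimate:
  assumes b: "b \<in> Basis" and r: "0 < r" "r \<le> 1" and B: "0 < B" and u[measurable]: "u \<in> borel_measurable borel"
    and iW: "integrable lborel (\<lambda>y. u y * W (y - x0))"
    and cont: "continuous_on (ball x0 (2 * r)) u" and bd: "\<And>y. norm (y - x0) < 2 * r \<Longrightarrow> \<bar>u y\<bar> \<le> B"
    and tail: "(\<integral>\<^sup>+w. ennreal (indicator {w. 3 * r / 4 \<le> norm (w - x0)} w * \<bar>u w\<bar> * N (w - x0)) \<partial>lborel) \<le> ennreal (B * H r / a)"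
    and harm: "\<And>d x. 0 < d \<Longrightarrow> d \<le> r / 4 \<Longrightarrow> norm (x - x0) < r / 2 \<Longrightarrow>
        integrable lborel (\<lambda>z. sdiff (moll d u) x z * N z) \<and> L (moll d u) x = 0"
    and s: "0 < s" "s < r / 4"
  shows "\<bar>u (x0 + s *\<^sub>R b) - u (x0 - s *\<^sub>R b)\<bar> \<le> grad_const * B * s / r"
proof -
  have md: "\<bar>moll d u (x0 + s *\<^sub>R b) - moll d u (x0 - s *\<^sub>R b)\<bar> \<le> grad_const * B * s / r" if d: "0 < d" "d \<le> r / 4" for d
  proof -
    define v where "v y = moll d u (x0 + y)" for y
    have mc: "continuous_on UNIV (moll d u)" by (rule moll_continuous[OF d(1) u iW])
    then have [measurable]: "moll d u \<in> borel_measurable borel" by (rule borel_measurable_continuous_onI)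
    have vm[measurable]: "v \<in> borel_measurable borel" unfolding v_def[abs_def] by measurable
    have sv: "sdiff v x z = sdiff (moll d u) (x0 + x) z" for x z by (simp add: sdiff_def v_def algebra_simps)
    have tl: "(\<integral>\<^sup>+y. ennreal (\<bar>indicator {y. r \<le> norm y} y * v y * N y\<bar>) \<partial>lborel) \<le> ennreal (B * H r)"
      using moll_tail[OF r d u iW tail] a_ge_1 by (simp add: v_def)
    have ti: "integrable lborel (\<lambda>y. indicator {y. r \<le> norm y} y * v y * N y)"
      using le_less_trans[OF tl ennreal_less_top] by (intro integrableI_bounded) auto
    have "(LBINT y. \<bar>indicator {y. r \<le> norm y} y * v y * N y\<bar>) \<le> B * H r"
    proof -
      have "ennreal (LBINT y. \<bar>indicator {y. r \<le> norm y} y * v y * N y\<bar>) = (\<integral>\<^sup>+y. ennreal (\<bar>indicator {y. r \<le> norm y} y * v y * N y\<bar>) \<partial>lborel)"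
        by (rule nn_integral_eq_integral[symmetric, OF integrable_abs[OF ti]]) simp
      then have "ennreal (LBINT y. \<bar>indicator {y. r \<le> norm y} y * v y * N y\<bar>) \<le> ennreal (B * H r)" using tl by simp
      then show ?thesis using B H_pos[OF r(1)] by (simp add: ennreal_le_iff mult_nonneg_nonneg less_imp_le)
    qed
    note tail' = this
    have "\<bar>v (s *\<^sub>R b) - v (- (s *\<^sub>R b))\<bar> \<le> grad_const * B * s / r"
    proof (rule refl_difference_bound[OF b r B vm _ _ _ _ ti tail' s])
      show "continuous_on (ball 0 r) v" unfolding v_def[abs_def]
        by (rule continuous_on_compose2[OF mc]) (auto intro!: continuous_intros)
      show "\<bar>v x\<bar> \<le> B" if x: "x \<in> ball 0 r" for x
      proof -
        have "\<bar>moll d u (x0 + x) - 0\<bar> \<le> B"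
        proof (rule moll_approx[OF d(1) u iW])
          fix y assume "norm (y - (x0 + x)) < d"
          then have "norm (y - x0) < 2 * r" using norm_triangle_ineq[of "y - (x0 + x)" x] x d by simp
          then show "\<bar>u y - 0\<bar> \<le> B" using bd by simp
        qed
        then show ?thesis by (simp add: v_def)
      qed
      show "integrable lborel (\<lambda>z. sdiff v x z * N z)" if "x \<in> ball 0 (r/2)" for x
        unfolding sv using harm[OF d, of "x0 + x"] that by simp
      show "L v x = 0" if "x \<in> ball 0 (r/2)" for x
        unfolding L_def sv using harm[OF d, of "x0 + x"] that by (simp add: L_def)
    qed
    then show ?thesis by (simp add: v_def)
  qed
  show ?thesis
  proof (rule field_le_epsilon)
    fix \<epsilon> :: real assume \<epsilon>: "0 < \<epsilon>"
    have nb: "norm (s *\<^sub>R b) < 2 * r" using b s r by simp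
    have near: "\<exists>d>0. \<forall>y. norm (y - p) < d \<longrightarrow> \<bar>u y - u p\<bar> \<le> \<epsilon> / 2" if "norm (p - x0) < 2 * r" for p
    proof -
      have "isCont u p" using cont that by (simp add: continuous_on_eq_continuous_at dist_norm norm_minus_commute)
      then obtain d where "0 < d" "\<And>y. dist y p < d \<Longrightarrow> dist (u y) (u p) < \<epsilon> / 2"
        unfolding continuous_at_eps_delta using \<epsilon> by (meson half_gt_zero)
      then show ?thesis by (intro exI[of _ d]) (auto simp: dist_norm less_imp_le)
    qed
    obtain d1 where d1: "0 < d1" "\<And>y. norm (y - (x0 + s *\<^sub>R b)) < d1 \<Longrightarrow> \<bar>u y - u (x0 + s *\<^sub>R b)\<bar> \<le> \<epsilon> / 2"
      using near[of "x0 + s *\<^sub>R b"] nb by auto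
    obtain d2 where d2: "0 < d2" "\<And>y. norm (y - (x0 - s *\<^sub>R b)) < d2 \<Longrightarrow> \<bar>u y - u (x0 - s *\<^sub>R b)\<bar> \<le> \<epsilon> / 2"
      using near[of "x0 - s *\<^sub>R b"] nb by auto
    define d where "d = min (min d1 d2) (r / 4)"
    have d: "0 < d" "d \<le> d1" "d \<le> d2" "d \<le> r / 4" using d1(1) d2(1) r by (auto simp: d_def)
    have 1: "\<bar>moll d u (x0 + s *\<^sub>R b) - u (x0 + s *\<^sub>R b)\<bar> \<le> \<epsilon> / 2" by (rule moll_approx[OF d(1) u iW]) (use d1(2) d in simp)
    have 2: "\<bar>moll d u (x0 - s *\<^sub>R b) - u (x0 - s *\<^sub>R b)\<bar> \<le> \<epsilon> / 2" by (rule moll_approx[OF d(1) u iW]) (use d2(2) d in simp)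
    have "\<bar>p' - q'\<bar> \<le> m + \<epsilon>" if "\<bar>p - p'\<bar> \<le> \<epsilon> / 2" "\<bar>q - q'\<bar> \<le> \<epsilon> / 2" "\<bar>p - q\<bar> \<le> m" for p q p' q' m :: real
      using that by linarith
    from this[OF 1 2 md[OF d(1) d(4)]]
    show "\<bar>u (x0 + s *\<^sub>R b) - u (x0 - s *\<^sub>R b)\<bar> \<le> grad_const * B * s / r + \<epsilon>" .
  qed
qed

end

text \<open>Increments of equal length hardly depend on the base point, so the increment over
  \<sigma> is nearly floor (\<sigma> / \<tau>) copies of the one over \<tau>; the quotients at both
  scales agree up to \<epsilon> + 2 C \<tau> / \<sigma>. A limit along some null sequence is
  therefore the limit, and a left quotient is a right quotient at a shifted base point.\<close>

lemma has_derivative_from_differences: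
  fixes \<phi> :: "real \<Rightarrow> real"
  assumes e0: "0 < e0" and lip: "\<And>t \<sigma>. \<bar>t\<bar> < e0 \<Longrightarrow> 0 < \<sigma> \<Longrightarrow> \<sigma> < e0 \<Longrightarrow> \<bar>\<phi> (t + \<sigma>) - \<phi> t\<bar> \<le> C * \<sigma>"
    and eq: "\<And>\<epsilon>. 0 < \<epsilon> \<Longrightarrow> \<exists>\<eta>>0. \<forall>\<sigma> t t'. 0 < \<sigma> \<longrightarrow> \<sigma> < \<eta> \<longrightarrow> \<bar>t\<bar> < \<eta> \<longrightarrow> \<bar>t'\<bar> < \<eta> \<longrightarrow>
        \<bar>(\<phi> (t + \<sigma>) - \<phi> t) - (\<phi> (t' + \<sigma>) - \<phi> t')\<bar> \<le> \<epsilon> * \<sigma>"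
  shows "\<exists>l. (\<phi> has_real_derivative l) (at 0)"
proof -
  define q where "q \<sigma> = (\<phi> \<sigma> - \<phi> 0) / \<sigma>" for \<sigma>
  have "0 \<le> C * (e0 / 2)" by (rule order_trans[OF abs_ge_zero lip[of 0 "e0 / 2"]]) (use e0 in auto)
  then have C0: "0 \<le> C" using e0 by (simp add: zero_le_mult_iff)
  have qC: "\<bar>q \<sigma>\<bar> \<le> C" if "0 < \<sigma>" "\<sigma> < e0" for \<sigma>
    using lip[of 0 \<sigma>] that e0 by (simp add: q_def abs_divide pos_divide_le_eq)
  have comp: "\<bar>q \<sigma> - q \<tau>\<bar> \<le> \<epsilon> + 2 * C * \<tau> / \<sigma>"
    if \<epsilon>: "0 < \<epsilon>" and \<eta>: "\<forall>\<sigma> t t'. 0 < \<sigma> \<longrightarrow> \<sigma> < \<eta> \<longrightarrow> \<bar>t\<bar> < \<eta> \<longrightarrow> \<bar>t'\<bar> < \<eta> \<longrightarrow> \<bar>(\<phi> (t + \<sigma>) - \<phi> t) - (\<phi> (t' + \<sigma>) - \<phi> t')\<bar> \<le> \<epsilon> * \<sigma>"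
      and st: "0 < \<tau>" "\<tau> < \<sigma>" "\<sigma> < \<eta>" "\<sigma> < e0" for \<epsilon> \<eta> \<sigma> \<tau>
  proof -
    define D where "D = \<phi> \<tau> - \<phi> 0"
    have step: "\<bar>\<phi> (real n * \<tau>) - \<phi> 0 - real n * D\<bar> \<le> real n * (\<epsilon> * \<tau>)" if "real n * \<tau> \<le> \<sigma>" for n
      using that
    proof (induction n)
      case (Suc n)
      have n: "real n * \<tau> \<le> \<sigma>" "real (Suc n) * \<tau> = real n * \<tau> + \<tau>" "0 \<le> real n * \<tau>" using Suc.prems st by (auto simp: algebra_simps)
      have "\<bar>(\<phi> (real n * \<tau> + \<tau>) - \<phi> (real n * \<tau>)) - (\<phi> (0 + \<tau>) - \<phi> 0)\<bar> \<le> \<epsilon> * \<tau>"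
      proof (rule \<eta>[rule_format])
        show "\<bar>real n * \<tau>\<bar> < \<eta>" unfolding abs_of_nonneg[OF n(3)] using n(1) st by linarith
      qed (use st in auto)
      moreover have "\<bar>\<phi> (real n * \<tau>) - \<phi> 0 - real n * D\<bar> \<le> real n * (\<epsilon> * \<tau>)" by (rule Suc.IH[OF n(1)])
      moreover have "real (Suc n) * D = real n * D + D" "real (Suc n) * (\<epsilon> * \<tau>) = real n * (\<epsilon> * \<tau>) + \<epsilon> * \<tau>" by (simp_all add: algebra_simps)
      ultimately show ?case unfolding n(2) D_def[symmetric] by (simp add: D_def)
    qed (simp add: D_def)
    define n where "n = nat \<lfloor>\<sigma> / \<tau>\<rfloor>"
    have sp: "0 \<le> \<sigma> / \<tau>" using st by simp
    have "real n \<le> \<sigma> / \<tau>" "\<sigma> / \<tau> < real n + 1" using sp unfolding n_def by linarith+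
    then have n: "real n * \<tau> \<le> \<sigma>" "\<sigma> < real n * \<tau> + \<tau>" using st by (simp_all add: field_simps)
    have n0: "0 \<le> real n * \<tau>" using st by simp
    have rest: "\<bar>\<phi> \<sigma> - \<phi> (real n * \<tau>)\<bar> \<le> C * \<tau>"
    proof (cases "real n * \<tau> = \<sigma>")
      case True then show ?thesis using C0 st by simp
    next
      case False
      have "\<bar>\<phi> (real n * \<tau> + (\<sigma> - real n * \<tau>)) - \<phi> (real n * \<tau>)\<bar> \<le> C * (\<sigma> - real n * \<tau>)"
        using False n n0 st by (intro lip) auto
      also have "\<dots> \<le> C * \<tau>" using n C0 by (intro mult_left_mono) auto
      finally show ?thesis by simp
    qed
    have D: "\<bar>D\<bar> \<le> C * \<tau>" using lip[of 0 \<tau>] st e0 by (simp add: D_def)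
    have q\<tau>: "q \<tau> * \<tau> = D" "q \<sigma> * \<sigma> = \<phi> \<sigma> - \<phi> 0" using st by (simp_all add: q_def D_def)
    have "\<bar>(\<sigma> - real n * \<tau>) * q \<tau>\<bar> \<le> \<tau> * C"
      unfolding abs_mult using n st qC[of \<tau>] by (intro mult_mono) auto
    moreover have "(q \<sigma> - q \<tau>) * \<sigma> = (\<phi> \<sigma> - \<phi> (real n * \<tau>)) + (\<phi> (real n * \<tau>) - \<phi> 0 - real n * D) - (\<sigma> - real n * \<tau>) * q \<tau>"
    proof -
      have "real n * D = real n * \<tau> * q \<tau>" unfolding q\<tau>(1)[symmetric] by simp
      then show ?thesis using q\<tau>(2) unfolding left_diff_distrib by (simp only: mult.commute[of \<sigma> "q \<tau>"])
    qed
    moreover have "real n * (\<epsilon> * \<tau>) \<le> \<epsilon> * \<sigma>" using mult_left_mono[OF n(1), of \<epsilon>] \<epsilon> by (simp add: ac_simps)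
    moreover have "2 * C * \<tau> = C * \<tau> + \<tau> * C" by simp
    ultimately have "\<bar>(q \<sigma> - q \<tau>) * \<sigma>\<bar> \<le> \<epsilon> * \<sigma> + 2 * C * \<tau>" using rest step[OF n(1)] by linarith
    also have "\<dots> = (\<epsilon> + 2 * C * \<tau> / \<sigma>) * \<sigma>" using st by (simp add: field_simps)
    finally show ?thesis using st by (simp add: abs_mult)
  qed
  define T where "T k = e0 / (real k + 2)" for k :: nat
  have T: "0 < T k" "T k < e0" for k using e0 by (auto simp: T_def divide_simps)
  have Tl: "T \<longlonglongrightarrow> 0" unfolding T_def[abs_def] by real_asymp
  have "bounded (range (\<lambda>k. q (T k)))" unfolding bounded_iff using qC T by (intro exI[of _ C]) auto
  then obtain l r where r: "strict_mono r" "((\<lambda>k. q (T k)) \<circ> r) \<longlonglongrightarrow> l"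
    using bounded_imp_convergent_subsequence by blast
  have lim: "\<exists>\<eta>>0. (\<forall>\<sigma>. 0 < \<sigma> \<longrightarrow> \<sigma> < \<eta> \<longrightarrow> \<bar>q \<sigma> - l\<bar> \<le> \<epsilon> \<and> \<bar>(\<phi> 0 - \<phi> (- \<sigma>)) / \<sigma> - l\<bar> \<le> 2 * \<epsilon>)" if \<epsilon>: "0 < \<epsilon>" for \<epsilon>
  proof -
    obtain \<eta> where \<eta>: "0 < \<eta>" "\<forall>\<sigma> t t'. 0 < \<sigma> \<longrightarrow> \<sigma> < \<eta> \<longrightarrow> \<bar>t\<bar> < \<eta> \<longrightarrow> \<bar>t'\<bar> < \<eta> \<longrightarrow> \<bar>(\<phi> (t + \<sigma>) - \<phi> t) - (\<phi> (t' + \<sigma>) - \<phi> t')\<bar> \<le> \<epsilon> * \<sigma>"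
      using eq[OF \<epsilon>] by blast
    have ql: "\<bar>q \<sigma> - l\<bar> \<le> \<epsilon>" if \<sigma>: "0 < \<sigma>" "\<sigma> < \<eta>" "\<sigma> < e0" for \<sigma>
    proof -
      have Tr: "(\<lambda>k. T (r k)) \<longlonglongrightarrow> 0" using LIMSEQ_subseq_LIMSEQ[OF Tl r(1)] by (simp add: comp_def)
      have "(\<lambda>k. \<bar>q \<sigma> - q (T (r k))\<bar>) \<longlonglongrightarrow> \<bar>q \<sigma> - l\<bar>" using r(2) unfolding comp_def by (intro tendsto_intros)
      moreover have "(\<lambda>k. \<epsilon> + 2 * C * T (r k) / \<sigma>) \<longlonglongrightarrow> \<epsilon> + 2 * C * 0 / \<sigma>" using \<sigma> by (intro tendsto_intros Tr) auto
      moreover have "eventually (\<lambda>k. \<bar>q \<sigma> - q (T (r k))\<bar> \<le> \<epsilon> + 2 * C * T (r k) / \<sigma>) sequentially"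
        using order_tendstoD(2)[OF Tr \<sigma>(1)] by eventually_elim (rule comp[OF \<epsilon> \<eta>(2) T(1) _ \<sigma>(2,3)])
      ultimately have "\<bar>q \<sigma> - l\<bar> \<le> \<epsilon> + 2 * C * 0 / \<sigma>" by (intro tendsto_le[OF sequentially_bot])
      then show ?thesis by simp
    qed
    moreover have "\<bar>(\<phi> 0 - \<phi> (- \<sigma>)) / \<sigma> - l\<bar> \<le> 2 * \<epsilon>" if \<sigma>: "0 < \<sigma>" "\<sigma> < \<eta>" "\<sigma> < e0" for \<sigma>
    proof -
      have "\<bar>(\<phi> (- \<sigma> + \<sigma>) - \<phi> (- \<sigma>)) - (\<phi> (0 + \<sigma>) - \<phi> 0)\<bar> \<le> \<epsilon> * \<sigma>" by (rule \<eta>(2)[rule_format]) (use \<sigma> \<eta>(1) in auto)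
      then have "\<bar>((\<phi> 0 - \<phi> (- \<sigma>)) - (\<phi> \<sigma> - \<phi> 0)) / \<sigma>\<bar> \<le> \<epsilon>" using \<sigma> by (simp add: abs_divide pos_divide_le_eq)
      then have "\<bar>(\<phi> 0 - \<phi> (- \<sigma>)) / \<sigma> - q \<sigma>\<bar> \<le> \<epsilon>" unfolding q_def diff_divide_distrib[symmetric] .
      then show ?thesis using ql[OF \<sigma>] by linarith
    qed
    ultimately show ?thesis using \<eta>(1) e0 by (intro exI[of _ "min \<eta> e0"]) auto
  qed
  have "(\<phi> has_real_derivative l) (at 0)" unfolding DERIV_def LIM_def
  proof (intro allI impI)
    fix \<epsilon> :: real assume \<epsilon>: "0 < \<epsilon>"
    obtain \<eta> where \<eta>: "0 < \<eta>" "\<And>\<sigma>. 0 < \<sigma> \<Longrightarrow> \<sigma> < \<eta> \<Longrightarrow> \<bar>q \<sigma> - l\<bar> \<le> \<epsilon> / 3 \<and> \<bar>(\<phi> 0 - \<phi> (- \<sigma>)) / \<sigma> - l\<bar> \<le> 2 * (\<epsilon> / 3)"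
      using lim[of "\<epsilon> / 3"] \<epsilon> by auto
    have "dist ((\<phi> (0 + h) - \<phi> 0) / h) l < \<epsilon>" if h: "h \<noteq> 0" "dist h 0 < \<eta>" for h
    proof (cases "0 < h")
      case True then show ?thesis using \<eta>(2)[of h] h \<epsilon> by (simp add: q_def dist_real_def)
    next
      case False
      then have "(\<phi> (0 + h) - \<phi> 0) / h = (\<phi> 0 - \<phi> (- (- h))) / (- h)" by (simp add: minus_divide_right[symmetric] diff_divide_distrib)
      then show ?thesis using \<eta>(2)[of "- h"] h \<epsilon> False by (simp add: dist_real_def)
    qed
    then show "\<exists>s>0. \<forall>h. h \<noteq> 0 \<and> dist h 0 < s \<longrightarrow> dist ((\<phi> (0 + h) - \<phi> 0) / h) l < \<epsilon>" using \<eta>(1) by blast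
  qed
  then show ?thesis by blast
qed

section \<open>From difference estimates to the derivative\<close>

context levy_setting begin

text \<open>What is kept of harmonicity from here on. The bound G is the entry point for the Harnack
  inequality.\<close>

definition mv_ball :: "('a \<Rightarrow> real) \<Rightarrow> 'a \<Rightarrow> real \<Rightarrow> real \<Rightarrow> bool" where
  "mv_ball f x0 \<rho> G \<longleftrightarrow> f \<in> borel_measurable borel \<and> (\<forall>x. 0 \<le> f x) \<and> (\<forall>x. norm (x - x0) < \<rho> \<longrightarrow> f x \<le> G) \<and>
     (\<forall>x s. good_radius s \<longrightarrow> norm (x - x0) + s < \<rho> \<longrightarrow> mean_value f s x)"

lemma mv_ballD:
  assumes "mv_ball f x0 \<rho> G"
  shows "f \<in> borel_measurable borel" and "0 \<le> f x" and "norm (x - x0) < \<rho> \<Longrightarrow> f x \<le> G"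
    and "good_radius s \<Longrightarrow> norm (x - x0) + s < \<rho> \<Longrightarrow> mean_value f s x"
  using assms by (auto simp: mv_ball_def)

text \<open>Near x0 the function is at most G and \<open>W\<close> is integrable. Farther out
  \<open>tail_bound\<close> applies, and since both radii together stay below 1, \<open>W\<close> is
  smaller than the weight there.\<close>

lemma mv_ball_integrable_W:
  assumes f: "mv_ball f x0 \<rho> G" and \<rho>: "0 < \<rho>" "\<rho> \<le> 1"
  shows "integrable lborel (\<lambda>y. f y * W (y - x0))"
proof -
  note [measurable] = mv_ballD(1)[OF f]
  note f0 = mv_ballD(2)[OF f]
  have G0: "0 \<le> G" using f0[of x0] mv_ballD(3)[OF f, of x0] \<rho> by auto
  obtain s where s: "\<rho> / 8 < s" "s < \<rho> / 4" "good_radius s" using good_radius_exists[of "\<rho> / 8" "\<rho> / 4"] \<rho> by auto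
  let ?d = "\<rho> / 4"
  have tb: "(\<integral>\<^sup>+y. ennreal (indicator {y. ?d + s < norm (x0 - y)} y * f y * \<nu> (norm (x0 - y) + s + ?d)) \<partial>lborel) \<le> ennreal (17 * H s * G)"
  proof (rule tail_bound)
    fix x assume "x \<in> ball x0 ?d"
    then have x: "norm (x - x0) < ?d" by (simp add: dist_norm norm_minus_commute)
    show "mean_value f s x" using x s \<rho> by (intro mv_ballD(4)[OF f]) auto
    show "f x \<le> G" using x \<rho> by (intro mv_ballD(3)[OF f]) auto
  qed (use \<rho> s f0 G0 in auto)
  have Wi: "integrable lborel (\<lambda>y. G * W (y - x0))"
    using lborel_invariant(2)[OF _ distr_lborel_plus[of "- x0"], of W] W_integrable by (intro integrable_mult_right) simp
  have "(\<integral>\<^sup>+y. ennreal (f y * W (y - x0)) \<partial>lborel) \<le> (\<integral>\<^sup>+y. ennreal (G * W (y - x0)) + ennreal (f y * W (y - x0) * indicator {y. ?d + s < norm (x0 - y)} y) \<partial>lborel)"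
  proof (rule nn_integral_mono)
    fix y
    show "ennreal (f y * W (y - x0)) \<le> ennreal (G * W (y - x0)) + ennreal (f y * W (y - x0) * indicator {y. ?d + s < norm (x0 - y)} y)"
    proof (cases "?d + s < norm (x0 - y)")
      case False
      then have "f y \<le> G" using s \<rho> by (intro mv_ballD(3)[OF f]) (simp add: norm_minus_commute)
      then show ?thesis using False W_pos[of "y - x0"] by (simp add: ennreal_leI mult_right_mono)
    qed simp
  qed
  also have "\<dots> = (\<integral>\<^sup>+y. ennreal (G * W (y - x0)) \<partial>lborel) + (\<integral>\<^sup>+y. ennreal (f y * W (y - x0) * indicator {y. ?d + s < norm (x0 - y)} y) \<partial>lborel)"
    by (rule nn_integral_add) measurable
  also have "\<dots> \<le> ennreal (LBINT y. G * W (y - x0)) + ennreal (17 * H s * G)"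
  proof (rule add_mono)
    show "(\<integral>\<^sup>+y. ennreal (G * W (y - x0)) \<partial>lborel) \<le> ennreal (LBINT y. G * W (y - x0))"
      using G0 W_pos by (subst nn_integral_eq_integral[OF Wi]) (auto simp: less_imp_le)
    have "(\<integral>\<^sup>+y. ennreal (f y * W (y - x0) * indicator {y. ?d + s < norm (x0 - y)} y) \<partial>lborel) \<le>
        (\<integral>\<^sup>+y. ennreal (indicator {y. ?d + s < norm (x0 - y)} y * f y * \<nu> (norm (x0 - y) + s + ?d)) \<partial>lborel)"
    proof (intro nn_integral_mono ennreal_leI)
      fix y
      have "W (y - x0) \<le> \<nu> (norm (x0 - y) + s + ?d)" unfolding W_def norm_minus_commute[of y x0] using s \<rho>
        by (intro nu_mono) (auto intro!: add_nonneg_pos)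
      from mult_left_mono[OF this f0[of y]]
      show "f y * W (y - x0) * indicator {y. ?d + s < norm (x0 - y)} y \<le> indicator {y. ?d + s < norm (x0 - y)} y * f y * \<nu> (norm (x0 - y) + s + ?d)"
        by (auto simp: indicator_def)
    qed
    then show "(\<integral>\<^sup>+y. ennreal (f y * W (y - x0) * indicator {y. ?d + s < norm (x0 - y)} y) \<partial>lborel) \<le> ennreal (17 * H s * G)"
      using tb by (rule order_trans)
  qed
  also have "\<dots> < \<infinity>" by simp
  finally show ?thesis using f0 W_pos by (intro integrableI_nonneg) (auto simp: less_imp_le)
qed

lemma mv_ball_continuous:
  assumes f: "mv_ball f x0 \<rho> G" and \<rho>: "0 < \<rho>" "\<rho> \<le> 1"
  shows "osc_le f x0 (\<rho> / 2) 0" and "norm (x - x0) < \<rho> / 2 \<Longrightarrow> isCont f x"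
proof -
  show o: "osc_le f x0 (\<rho> / 2) 0"
    using mv_ballD[OF f] by (intro mean_value_osc[OF mv_ballD(1)[OF f] mv_ball_integrable_W[OF f \<rho>] \<rho>, of G]) auto
  show "isCont f x" if x: "norm (x - x0) < \<rho> / 2"
    unfolding continuous_at_eps_delta
  proof (intro allI impI)
    fix \<epsilon> :: real assume "0 < \<epsilon>"
    then obtain e where e: "0 < e" "\<And>x h. norm (x - x0) < \<rho> / 2 \<Longrightarrow> norm h < e \<Longrightarrow> \<bar>f (x + h) - f x\<bar> \<le> 0 + \<epsilon> / 2"
      using o unfolding osc_le_def by (meson half_gt_zero)
    have "dist (f y) (f x) < \<epsilon>" if "dist y x < e" for y
      using e(2)[OF x, of "y - x"] that \<open>0 < \<epsilon>\<close> by (simp add: dist_norm)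
    then show "\<exists>d>0. \<forall>y. dist y x < d \<longrightarrow> dist (f y) (f x) < \<epsilon>" using e(1) by blast
  qed
qed

text \<open>272 = 17 * 16, with 17 from \<open>tail_bound\<close> and 16 from comparing
  \<open>H\<close> at radii whose ratio is at most 4. One a compares \<open>N\<close> with the
  weight in \<open>tail_bound\<close>, the other makes up for the division by a in
  \<open>difference_estimate\<close>.\<close>

definition diff_const :: real where "diff_const = grad_const * (272 * a\<^sup>2)"

lemma diff_const_pos: "0 < diff_const"
  unfolding diff_const_def using grad_const_pos a_ge_1 by (intro mult_pos_pos) auto

lemma mv_ball_difference:
  assumes f: "mv_ball f x0 \<rho> G" and \<rho>: "0 < \<rho>" "\<rho> \<le> 1" and b: "b \<in> Basis" and r: "r = \<rho> / 8" and s: "0 < s" "s < r / 4"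
  shows "\<bar>f (x0 + s *\<^sub>R b) - f (x0 - s *\<^sub>R b)\<bar> \<le> diff_const * G * s / r"
proof (rule field_le_epsilon)
  fix \<epsilon> :: real assume \<epsilon>: "0 < \<epsilon>"
  note [measurable] = mv_ballD(1)[OF f]
  note f0 = mv_ballD(2)[OF f]
  have r0: "0 < r" "r \<le> 1" using r \<rho> by auto
  have dc: "0 < diff_const * s / r" using diff_const_pos s r0 by simp
  have G0: "0 \<le> G" using f0[of x0] mv_ballD(3)[OF f, of x0] \<rho> by auto
  \<comment> \<open>\<open>difference_estimate\<close> asks for a positive bound, whereas G may be
    0; the surplus contributes exactly \<epsilon> to the final estimate.\<close>
  define G' where "G' = G + \<epsilon> / (diff_const * s / r)"
  have G': "0 < G'" "G \<le> G'" using G0 divide_pos_pos[OF \<epsilon> dc] unfolding G'_def by linarith+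
  define B where "B = 272 * a\<^sup>2 * G'"
  have a2: "1 \<le> 272 * a\<^sup>2" using one_le_power[OF a_ge_1, of 2] by simp
  have B: "0 < B" "G' \<le> B" using mult_right_mono[OF a2, of G'] G' unfolding B_def by linarith+
  have "\<bar>f (x0 + s *\<^sub>R b) - f (x0 - s *\<^sub>R b)\<bar> \<le> grad_const * B * s / r"
  proof (rule difference_estimate[OF b r0 B(1) mv_ballD(1)[OF f] mv_ball_integrable_W[OF f \<rho>] _ _ _ _ s])
    show "continuous_on (ball x0 (2 * r)) f"
      by (intro continuous_at_imp_continuous_on ballI mv_ball_continuous(2)[OF f \<rho>]) (use r \<rho> in \<open>simp add: dist_norm norm_minus_commute\<close>)
    show "\<bar>f y\<bar> \<le> B" if "norm (y - x0) < 2 * r" for y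
      using mv_ballD(3)[OF f, of y] that r \<rho> f0[of y] G' B by simp
    show "integrable lborel (\<lambda>z. sdiff (moll d f) x z * N z) \<and> L (moll d f) x = 0"
      if "0 < d" "d \<le> r / 4" "norm (x - x0) < r / 2" for d x
      using moll_harmonic[OF mv_ballD(1)[OF f] f0 mv_ball_integrable_W[OF f \<rho>] mv_ballD(4)[OF f] that(1) _ \<rho>(2), of x] that r \<rho> by simp
    obtain t where t: "r / 4 < t" "t < r / 2" "good_radius t" using good_radius_exists[of "r / 4" "r / 2"] r0 by auto
    let ?d = "r / 4"
    have "(\<integral>\<^sup>+w. ennreal (indicator {w. 3 * r / 4 \<le> norm (w - x0)} w * \<bar>f w\<bar> * N (w - x0)) \<partial>lborel)
      \<le> (\<integral>\<^sup>+y. ennreal a * ennreal (indicator {y. ?d + t < norm (x0 - y)} y * f y * \<nu> (norm (x0 - y) + t + ?d)) \<partial>lborel)"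
    proof (rule nn_integral_mono)
      fix w
      show "ennreal (indicator {w. 3 * r / 4 \<le> norm (w - x0)} w * \<bar>f w\<bar> * N (w - x0)) \<le>
        ennreal a * ennreal (indicator {y. ?d + t < norm (x0 - y)} w * f w * \<nu> (norm (x0 - w) + t + ?d))"
      proof (cases "3 * r / 4 \<le> norm (w - x0)")
        case True
        then have w: "?d + t < norm (x0 - w)" "w - x0 \<noteq> 0" using t r0 by (auto simp: norm_minus_commute)
        have "N (w - x0) \<le> a * \<nu> (norm (x0 - w) + t + ?d)" unfolding N_eq[OF w(2)] norm_minus_commute[of w x0]
          using w t r0 by (intro nu_comp) linarith+
        from mult_left_mono[OF this f0[of w]] have "f w * N (w - x0) \<le> a * (f w * \<nu> (norm (x0 - w) + t + ?d))" by (simp add: ac_simps)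
        then have "ennreal (f w * N (w - x0)) \<le> ennreal (a * (f w * \<nu> (norm (x0 - w) + t + ?d)))" by (rule ennreal_leI)
        then show ?thesis using True w a_ge_1 f0[of w] by (simp add: ennreal_mult')
      qed simp
    qed
    also have "\<dots> = ennreal a * (\<integral>\<^sup>+y. ennreal (indicator {y. ?d + t < norm (x0 - y)} y * f y * \<nu> (norm (x0 - y) + t + ?d)) \<partial>lborel)"
    proof (rule nn_integral_cmult)
      have e: "\<nu> (norm (x0 - y) + t + ?d) = N ((norm (x0 - y) + t + ?d) *\<^sub>R b)" for y
      proof -
        have p: "0 < norm (x0 - y) + t + ?d" using t r0 norm_ge_zero[of "x0 - y"] by linarith
        then have "(norm (x0 - y) + t + ?d) *\<^sub>R b \<noteq> 0" using b nonzero_Basis by auto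
        from N_eq[OF this] p b show ?thesis by simp
      qed
      show "(\<lambda>y. ennreal (indicator {y. ?d + t < norm (x0 - y)} y * f y * \<nu> (norm (x0 - y) + t + ?d))) \<in> borel_measurable lborel"
        unfolding e by measurable
    qed
    also have "\<dots> \<le> ennreal a * ennreal (17 * H t * G)"
    proof (intro mult_left_mono tail_bound)
      fix x assume "x \<in> ball x0 ?d"
      then have x: "norm (x - x0) < ?d" by (simp add: dist_norm norm_minus_commute)
      show "mean_value f t x" using x t r \<rho> by (intro mv_ballD(4)[OF f]) auto
      show "f x \<le> G" using x r \<rho> by (intro mv_ballD(3)[OF f]) auto
    qed (use r0 t f0 G0 in auto)
    also have "\<dots> = ennreal (a * (17 * H t * G))" using a_ge_1 by (simp add: ennreal_mult')
    also have "\<dots> \<le> ennreal (B * H r / a)"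
    proof (rule ennreal_leI)
      have l: "1 \<le> r / t" "r / t \<le> 4" using t r0 by (auto simp: field_simps)
      have "H t \<le> (r / t)\<^sup>2 * H (r / t * t)" using l t r0 by (intro H_scale) auto
      also have "\<dots> \<le> 4\<^sup>2 * H r"
      proof -
        have "(r / t)\<^sup>2 \<le> 4\<^sup>2" using l by (intro power_mono) auto
        moreover have "r / t * t = r" using t r0 by simp
        ultimately show ?thesis using H_pos[OF r0(1)] by (simp add: mult_right_mono)
      qed
      finally have H: "H t \<le> 16 * H r" by simp
      have "17 * H t * G \<le> 17 * (16 * H r) * G'" using H G' G0 H_pos[OF r0(1)] H_pos[of t] t r0 by (intro mult_mono) auto
      then have "a * (17 * H t * G) \<le> a * (17 * (16 * H r) * G')" using a_ge_1 by (intro mult_left_mono) auto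
      also have "\<dots> = B * H r / a" using a_ge_1 by (simp add: B_def power2_eq_square)
      finally show "a * (17 * H t * G) \<le> B * H r / a" .
    qed
    finally show "(\<integral>\<^sup>+w. ennreal (indicator {w. 3 * r / 4 \<le> norm (w - x0)} w * \<bar>f w\<bar> * N (w - x0)) \<partial>lborel) \<le> ennreal (B * H r / a)" .
  qed
  also have "grad_const * B * s / r = G' * (diff_const * s / r)" by (simp add: B_def diff_const_def ac_simps)
  also have "\<dots> = diff_const * G * s / r + \<epsilon>"
  proof -
    have "(G + \<epsilon> / p) * p = p * G + \<epsilon>" if "0 < p" for p :: real using that by (simp add: algebra_simps)
    from this[OF dc] show ?thesis unfolding G'_def by (simp add: ac_simps)
  qed
  finally show "\<bar>f (x0 + s *\<^sub>R b) - f (x0 - s *\<^sub>R b)\<bar> \<le> diff_const * G * s / r + \<epsilon>" .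
qed

end

section \<open>Differences of translates\<close>

context levy_setting begin

lemma moll_translate:
  assumes [measurable]: "f \<in> borel_measurable borel"
  shows "moll d (\<lambda>y. f (y + e)) x = moll d f (x + e)"
    and "integrable lborel (\<lambda>y. bump d (x - y) * f (y + e)) \<longleftrightarrow> integrable lborel (\<lambda>y. bump d (x + e - y) * f y)"
  using lborel_invariant[OF _ distr_lborel_plus[of e], of "\<lambda>y. bump d (x + e - y) * f y"] by (simp_all add: moll_def)

lemma N_le_W: assumes r: "0 < r" obtains C where "0 < C" "\<And>z. 3 * r / 4 \<le> norm z \<Longrightarrow> N z \<le> C * W z"
proof -
  have n2: "0 < \<nu> 2" "0 < \<nu> (3 * r / 4)" using r by (auto intro!: nu_pos)
  define C where "C = a + \<nu> (3 * r / 4) / \<nu> 2"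
  have q: "0 < \<nu> (3 * r / 4) / \<nu> 2" using n2 by simp
  show ?thesis
  proof (rule that[of C])
    show "0 < C" using q a_ge_1 by (simp add: C_def)
    fix z :: 'a assume z: "3 * r / 4 \<le> norm z"
    then have z0: "z \<noteq> 0" using r by auto
    have 0: "0 \<le> a * W z" "0 \<le> \<nu> (3 * r / 4) / \<nu> 2 * W z" using a_ge_1 W_pos[of z] mult_pos_pos[OF q W_pos[of z]] by (simp, linarith)
    have "N z \<le> a * W z \<or> N z \<le> \<nu> (3 * r / 4) / \<nu> 2 * W z"
    proof (cases "1 \<le> norm z")
      case True
      then have "N z \<le> a * W z" unfolding N_eq[OF z0] W_def by (intro nu_comp) linarith+
      then show ?thesis ..
    next
      case False
      have "N z \<le> \<nu> (3 * r / 4)" unfolding N_eq[OF z0] using z r by (intro nu_mono) auto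
      also have "\<dots> = \<nu> (3 * r / 4) / \<nu> 2 * \<nu> 2" using n2 by simp
      also have "\<dots> \<le> \<nu> (3 * r / 4) / \<nu> 2 * W z" unfolding W_def using q False
        by (intro mult_left_mono nu_mono) (auto simp: add_nonneg_pos)
      finally show ?thesis ..
    qed
    then show "N z \<le> C * W z" using 0 unfolding C_def distrib_right by linarith
  qed
qed

lemma mv_ball_second_difference:
  assumes f: "mv_ball f x0 \<rho> G" and \<rho>: "0 < \<rho>" "\<rho> \<le> 1" and b: "b \<in> Basis" and r: "r = \<rho> / 8" and \<epsilon>: "0 < \<epsilon>"
  shows "\<exists>\<eta>>0. \<forall>e e' s. norm e < \<eta> \<longrightarrow> norm e' < \<eta> \<longrightarrow> 0 < s \<longrightarrow> s < r / 4 \<longrightarrow>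
     \<bar>(f (x0 + e' + s *\<^sub>R b) - f (x0 + e' - s *\<^sub>R b)) - (f (x0 + e + s *\<^sub>R b) - f (x0 + e - s *\<^sub>R b))\<bar> \<le> \<epsilon> * s"
proof -
  note [measurable] = mv_ballD(1)[OF f]
  note iW = mv_ball_integrable_W[OF f \<rho>]
  have r0: "0 < r" "r \<le> 1" using r \<rho> by auto
  obtain C where C: "0 < C" "\<And>z. 3 * r / 4 \<le> norm z \<Longrightarrow> N z \<le> C * W z" using N_le_W[OF r0(1)] by blast
  \<comment> \<open>Read off backwards: B is the supremum that turns the estimate into slope
    \<epsilon>, and \<theta> below is the weighted norm that yields the tail bound belonging to B,
    with C for passing from \<open>N\<close> to \<open>W\<close> and 2 for the two
    translates.\<close>
  define B where "B = \<epsilon> * r / grad_const"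
  have B: "0 < B" using \<epsilon> r0 grad_const_pos by (simp add: B_def)
  define \<theta> where "\<theta> = B * H r / a / C / 2"
  have \<theta>: "0 < \<theta>" using B H_pos[OF r0(1)] a_ge_1 C by (simp add: \<theta>_def)
  obtain e1 where e1: "0 < e1" "\<And>x h. norm (x - x0) < \<rho> / 2 \<Longrightarrow> norm h < e1 \<Longrightarrow> \<bar>f (x + h) - f x\<bar> \<le> 0 + B"
    using mv_ball_continuous(1)[OF f \<rho>] B unfolding osc_le_def by blast
  obtain e2 where e2: "0 < e2" "\<And>h. norm h < e2 \<Longrightarrow> integrable lborel (\<lambda>y. \<bar>f (y + h) - f y\<bar> * W (y - x0))"
    "\<And>h. norm h < e2 \<Longrightarrow> (LBINT y. \<bar>f (y + h) - f y\<bar> * W (y - x0)) \<le> \<theta>"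
    using weighted_translation[OF mv_ballD(1)[OF f] iW \<theta>] by blast
  define \<eta> where "\<eta> = min (min (e1 / 2) e2) (r / 4)"
  have \<eta>: "0 < \<eta>" "2 * \<eta> \<le> e1" "\<eta> \<le> e2" "\<eta> \<le> r / 4" using e1(1) e2(1) r0 by (auto simp: \<eta>_def)
  have "\<bar>(f (x0 + e' + s *\<^sub>R b) - f (x0 + e' - s *\<^sub>R b)) - (f (x0 + e + s *\<^sub>R b) - f (x0 + e - s *\<^sub>R b))\<bar> \<le> \<epsilon> * s"
    if e: "norm e < \<eta>" "norm e' < \<eta>" and s: "0 < s" "s < r / 4" for e e' s
  proof -
    define u where "u y = f (y + e') - f (y + e)" for y
    have um[measurable]: "u \<in> borel_measurable borel" unfolding u_def[abs_def] by measurable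
    have ie: "integrable lborel (\<lambda>y. \<bar>f (y + e) - f y\<bar> * W (y - x0))" "integrable lborel (\<lambda>y. \<bar>f (y + e') - f y\<bar> * W (y - x0))"
      using e \<eta> by (auto intro!: e2(2))
    have pt: "\<bar>u y\<bar> * W (y - x0) \<le> \<bar>f (y + e') - f y\<bar> * W (y - x0) + \<bar>f (y + e) - f y\<bar> * W (y - x0)" for y
      unfolding distrib_right[symmetric] using W_pos[of "y - x0"] by (intro mult_right_mono) (auto simp: u_def)
    have iu: "integrable lborel (\<lambda>y. u y * W (y - x0))"
    proof (rule Bochner_Integration.integrable_bound[OF Bochner_Integration.integrable_add[OF ie(2,1)]])
      show "AE y in lborel. norm (u y * W (y - x0)) \<le> norm (\<bar>f (y + e') - f y\<bar> * W (y - x0) + \<bar>f (y + e) - f y\<bar> * W (y - x0))"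
      proof (intro AE_I2)
        fix y
        have "norm (u y * W (y - x0)) = \<bar>u y\<bar> * W (y - x0)" using W_pos[of "y - x0"] by (simp add: abs_mult)
        also note pt[of y]
        finally show "norm (u y * W (y - x0)) \<le> norm (\<bar>f (y + e') - f y\<bar> * W (y - x0) + \<bar>f (y + e) - f y\<bar> * W (y - x0))"
          by (rule order_trans) (simp only: real_norm_def abs_ge_self)
      qed
    qed measurable
    have Iu: "(LBINT y. \<bar>u y\<bar> * W (y - x0)) \<le> 2 * \<theta>"
    proof -
      have "(LBINT y. \<bar>u y\<bar> * W (y - x0)) \<le> (LBINT y. \<bar>f (y + e') - f y\<bar> * W (y - x0) + \<bar>f (y + e) - f y\<bar> * W (y - x0))"
      proof (rule integral_mono[OF _ Bochner_Integration.integrable_add[OF ie(2,1)] pt])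
        have "(\<lambda>y. \<bar>u y\<bar> * W (y - x0)) = (\<lambda>y. \<bar>u y * W (y - x0)\<bar>)" using W_pos by (auto simp: abs_mult abs_of_pos)
        then show "integrable lborel (\<lambda>y. \<bar>u y\<bar> * W (y - x0))" using integrable_abs[OF iu] by simp
      qed
      also have "\<dots> = (LBINT y. \<bar>f (y + e') - f y\<bar> * W (y - x0)) + (LBINT y. \<bar>f (y + e) - f y\<bar> * W (y - x0))"
        by (rule Bochner_Integration.integral_add[OF ie(2,1)])
      also have "\<dots> \<le> \<theta> + \<theta>" using e \<eta> by (intro add_mono e2(3)) auto
      finally show ?thesis by simp
    qed
    have "\<bar>u (x0 + s *\<^sub>R b) - u (x0 - s *\<^sub>R b)\<bar> \<le> grad_const * B * s / r"
    proof (rule difference_estimate[OF b r0 B um iu _ _ _ _ s])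
      have c: "isCont f (y + h)" if "y \<in> ball x0 (2 * r)" "norm h < \<eta>" for y h
      proof (rule mv_ball_continuous(2)[OF f \<rho>])
        have "norm (y - x0) < 2 * r" using that by (simp add: dist_norm norm_minus_commute)
        moreover have "norm (y + h - x0) \<le> norm (y - x0) + norm h" using norm_triangle_ineq[of "y - x0" h] by (simp add: algebra_simps)
        ultimately show "norm (y + h - x0) < \<rho> / 2" using that(2) \<eta>(4) r \<rho> by linarith
      qed
      have c': "isCont (\<lambda>y. f (y + h)) y" if "y \<in> ball x0 (2 * r)" "norm h < \<eta>" for y h
        by (rule isCont_o2[where g = f and f = "\<lambda>y. y + h", OF _ c[OF that]]) simp
      show "continuous_on (ball x0 (2 * r)) u" unfolding u_def[abs_def]
        by (intro continuous_at_imp_continuous_on ballI continuous_diff c' e)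
      show "\<bar>u y\<bar> \<le> B" if "norm (y - x0) < 2 * r" for y
      proof -
        have "norm (y + e - x0) < \<rho> / 2"
        proof -
          have "norm (y + e - x0) \<le> norm (y - x0) + norm e" using norm_triangle_ineq[of "y - x0" e] by (simp add: algebra_simps)
          then show ?thesis using that e(1) \<eta>(4) r \<rho> by linarith
        qed
        moreover have "norm (e' - e) < e1" using norm_triangle_ineq4[of e' e] e \<eta> by simp
        ultimately have "\<bar>f (y + e + (e' - e)) - f (y + e)\<bar> \<le> 0 + B" by (rule e1(2))
        then show ?thesis by (simp add: u_def)
      qed
      have "(\<integral>\<^sup>+w. ennreal (indicator {w. 3 * r / 4 \<le> norm (w - x0)} w * \<bar>u w\<bar> * N (w - x0)) \<partial>lborel) \<le> (\<integral>\<^sup>+w. ennreal (C * (\<bar>u w * W (w - x0)\<bar>)) \<partial>lborel)"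
      proof (intro nn_integral_mono ennreal_leI)
        fix w
        show "indicator {w. 3 * r / 4 \<le> norm (w - x0)} w * \<bar>u w\<bar> * N (w - x0) \<le> C * (\<bar>u w * W (w - x0)\<bar>)"
        proof (cases "3 * r / 4 \<le> norm (w - x0)")
          case True
          from mult_left_mono[OF C(2)[OF True], of "\<bar>u w\<bar>"] show ?thesis
            using True W_pos[of "w - x0"] by (simp add: abs_mult ac_simps)
        qed (use C in simp)
      qed
      also have "\<dots> = ennreal (LBINT w. C * (\<bar>u w * W (w - x0)\<bar>))"
        using C iu by (intro nn_integral_eq_integral integrable_mult_right integrable_abs) auto
      also have "\<dots> \<le> ennreal (B * H r / a)"
      proof (rule ennreal_leI)
        have e: "\<bar>u y * W (y - x0)\<bar> = \<bar>u y\<bar> * W (y - x0)" for y using W_pos[of "y - x0"] by (simp add: abs_mult)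
        have "(LBINT w. C * (\<bar>u w * W (w - x0)\<bar>)) = C * (LBINT y. \<bar>u y\<bar> * W (y - x0))" unfolding e by (rule integral_mult_right_zero)
        also have "\<dots> \<le> C * (2 * \<theta>)" using C(1) Iu by (intro mult_left_mono) auto
        also have "\<dots> = B * H r / a" using C(1) by (simp add: \<theta>_def)
        finally show "(LBINT w. C * (\<bar>u w * W (w - x0)\<bar>)) \<le> B * H r / a" .
      qed
      finally show "(\<integral>\<^sup>+w. ennreal (indicator {w. 3 * r / 4 \<le> norm (w - x0)} w * \<bar>u w\<bar> * N (w - x0)) \<partial>lborel) \<le> ennreal (B * H r / a)" .
      fix d x assume d: "0 < d" "d \<le> r / 4" and x: "norm (x - x0) < r / 2"
      have m: "moll d u v = moll d f (v + e') - moll d f (v + e)" for v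
      proof -
        have i: "integrable lborel (\<lambda>y. bump d (v - y) * f (y + h))" for h
          unfolding moll_translate(2)[OF mv_ballD(1)[OF f]] by (rule bump_mult_integrable[OF d(1) mv_ballD(1)[OF f] iW])
        have "(LBINT y. bump d (v - y) * u y) = (LBINT y. bump d (v - y) * f (y + e')) - (LBINT y. bump d (v - y) * f (y + e))"
          unfolding u_def right_diff_distrib by (rule Bochner_Integration.integral_diff[OF i i])
        then show ?thesis unfolding moll_translate(1)[OF mv_ballD(1)[OF f], symmetric] by (simp add: moll_def diff_divide_distrib)
      qed
      have sm: "sdiff (moll d u) x z * N z = sdiff (moll d f) (x + e') z * N z - sdiff (moll d f) (x + e) z * N z" for z
        unfolding sdiff_def m by (simp add: algebra_simps)
      have h: "integrable lborel (\<lambda>z. sdiff (moll d f) (x + h) z * N z)" "L (moll d f) (x + h) = 0" if "norm h < \<eta>" for h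
      proof -
        have "norm (x + h - x0) \<le> norm (x - x0) + norm h" using norm_triangle_ineq[of "x - x0" h] by (simp add: algebra_simps)
        then have "norm (x + h - x0) + d < \<rho>" using x d \<eta>(4) that r \<rho> by linarith
        then show "integrable lborel (\<lambda>z. sdiff (moll d f) (x + h) z * N z)" "L (moll d f) (x + h) = 0"
          using moll_harmonic[OF mv_ballD(1)[OF f] mv_ballD(2)[OF f] iW mv_ballD(4)[OF f] d(1) _ \<rho>(2)] by auto
      qed
      show "integrable lborel (\<lambda>z. sdiff (moll d u) x z * N z) \<and> L (moll d u) x = 0"
        unfolding L_def sm using h[OF e(1)] h[OF e(2)] by (simp add: L_def)
    qed
    also have "grad_const * B * s / r = \<epsilon> * s" using r0 grad_const_pos by (simp add: B_def)
    finally show ?thesis by (simp add: u_def algebra_simps)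
  qed
  then show ?thesis using \<eta>(1) by blast
qed

text \<open>The linear estimate concerns differences symmetric about x0. \<open>second\<close>
  transfers it to one-sided increments at nearby base points, which costs an additional 1 in the
  Lipschitz constant. The bound on l comes from the symmetric quotient, whose limit is 2 l, and so
  avoids this loss.\<close>

lemma mv_ball_derivative:
  assumes f: "mv_ball f x0 \<rho> G" and \<rho>: "0 < \<rho>" "\<rho> \<le> 1" and b: "b \<in> Basis"
  shows "\<exists>l. ((\<lambda>t. f (x0 + t *\<^sub>R b)) has_real_derivative l) (at 0) \<and> \<bar>l\<bar> \<le> 4 * diff_const * G / \<rho>"
proof -
  define r where "r = \<rho> / 8"
  have r0: "0 < r" using \<rho> by (simp add: r_def)
  define \<phi> where "\<phi> t = f (x0 + t *\<^sub>R b)" for t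
  define C where "C = diff_const * G / r"
  have sym: "\<bar>\<phi> s - \<phi> (- s)\<bar> \<le> C * s" if "0 < s" "s < r / 4" for s
    using mv_ball_difference[OF f \<rho> b r_def that] by (simp add: \<phi>_def C_def)
  have second: "\<exists>\<eta>>0. \<forall>\<sigma> t t'. 0 < \<sigma> \<longrightarrow> \<sigma> < \<eta> \<longrightarrow> \<bar>t\<bar> < \<eta> \<longrightarrow> \<bar>t'\<bar> < \<eta> \<longrightarrow>
        \<bar>(\<phi> (t + \<sigma>) - \<phi> t) - (\<phi> (t' + \<sigma>) - \<phi> t')\<bar> \<le> \<epsilon> * \<sigma>" if \<epsilon>: "0 < \<epsilon>" for \<epsilon>
  proof -
    obtain \<eta> where \<eta>: "0 < \<eta>" "\<And>e e' s. norm e < \<eta> \<Longrightarrow> norm e' < \<eta> \<Longrightarrow> 0 < s \<Longrightarrow> s < r / 4 \<Longrightarrow>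
      \<bar>(f (x0 + e' + s *\<^sub>R b) - f (x0 + e' - s *\<^sub>R b)) - (f (x0 + e + s *\<^sub>R b) - f (x0 + e - s *\<^sub>R b))\<bar> \<le> \<epsilon> * s"
      using mv_ball_second_difference[OF f \<rho> b r_def \<epsilon>] by blast
    define \<delta> where "\<delta> = min (\<eta> / 2) (r / 4)"
    have \<delta>: "0 < \<delta>" "2 * \<delta> \<le> \<eta>" "\<delta> \<le> r / 4" using \<eta>(1) r0 by (auto simp: \<delta>_def)
    have "\<bar>(\<phi> (t + \<sigma>) - \<phi> t) - (\<phi> (t' + \<sigma>) - \<phi> t')\<bar> \<le> \<epsilon> * \<sigma>" if \<sigma>: "0 < \<sigma>" "\<sigma> < \<delta>" and t: "\<bar>t\<bar> < \<delta>" "\<bar>t'\<bar> < \<delta>" for \<sigma> t t'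
    proof -
      \<comment> \<open>The increment from q to q + \<sigma> is a symmetric difference with centre q
        + \<sigma> / 2 and half length \<sigma> / 2.\<close>
      have n: "norm ((q + \<sigma> / 2) *\<^sub>R b) < \<eta>" if "\<bar>q\<bar> < \<delta>" for q
      proof -
        have "\<bar>q + \<sigma> / 2\<bar> < \<eta>" using that \<sigma> \<delta> by linarith
        then show ?thesis using b by simp
      qed
      have p: "f (x0 + (q + \<sigma> / 2) *\<^sub>R b + (\<sigma> / 2) *\<^sub>R b) = \<phi> (q + \<sigma>)" "f (x0 + (q + \<sigma> / 2) *\<^sub>R b - (\<sigma> / 2) *\<^sub>R b) = \<phi> q" for q
        by (simp_all add: \<phi>_def scaleR_left_distrib[symmetric] scaleR_left_diff_distrib[symmetric] add.assoc add_diff_eq[symmetric] del: scaleR_left_distrib)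
      have "\<bar>(\<phi> (t + \<sigma>) - \<phi> t) - (\<phi> (t' + \<sigma>) - \<phi> t')\<bar> \<le> \<epsilon> * (\<sigma> / 2)"
        using \<eta>(2)[OF n[OF t(2)] n[OF t(1)], of "\<sigma> / 2"] \<sigma> \<delta> unfolding p by simp
      also have "\<dots> \<le> \<epsilon> * \<sigma>" using \<epsilon> \<sigma> by (intro mult_left_mono) auto
      finally show ?thesis .
    qed
    then show ?thesis using \<delta>(1) by blast
  qed
  obtain \<eta> where \<eta>: "0 < \<eta>" "\<And>\<sigma> t t'. 0 < \<sigma> \<Longrightarrow> \<sigma> < \<eta> \<Longrightarrow> \<bar>t\<bar> < \<eta> \<Longrightarrow> \<bar>t'\<bar> < \<eta> \<Longrightarrow>
      \<bar>(\<phi> (t + \<sigma>) - \<phi> t) - (\<phi> (t' + \<sigma>) - \<phi> t')\<bar> \<le> 1 * \<sigma>" using second[of 1] by auto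
  have "\<exists>l. (\<phi> has_real_derivative l) (at 0)"
  proof (rule has_derivative_from_differences[OF _ _ second])
    show "0 < min \<eta> (r / 4)" using \<eta> r0 by simp
    fix t \<sigma> :: real assume t: "\<bar>t\<bar> < min \<eta> (r / 4)" and \<sigma>: "0 < \<sigma>" "\<sigma> < min \<eta> (r / 4)"
    have "\<bar>(\<phi> (t + \<sigma>) - \<phi> t) - (\<phi> (- (\<sigma> / 2) + \<sigma>) - \<phi> (- (\<sigma> / 2)))\<bar> \<le> 1 * \<sigma>" using t \<sigma> by (intro \<eta>(2)) auto
    moreover have "\<bar>\<phi> (\<sigma> / 2) - \<phi> (- (\<sigma> / 2))\<bar> \<le> C * (\<sigma> / 2)" using \<sigma> by (intro sym) auto
    moreover have half: "- (\<sigma> / 2) + \<sigma> = \<sigma> / 2" by simp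
    moreover have "(C / 2 + 1) * \<sigma> = C * (\<sigma> / 2) + 1 * \<sigma>" by (simp add: algebra_simps)
    ultimately show "\<bar>\<phi> (t + \<sigma>) - \<phi> t\<bar> \<le> (C / 2 + 1) * \<sigma>" unfolding half by linarith
  qed
  then obtain l where l: "(\<phi> has_real_derivative l) (at 0)" by blast
  have "\<bar>l\<bar> \<le> C / 2"
  proof -
    have "((\<lambda>s. \<phi> s - \<phi> (- s)) has_real_derivative l - l * (- 1)) (at 0)"
      using l by (auto intro!: derivative_eq_intros DERIV_chain2[of \<phi> l "\<lambda>s. - s"])
    then have "((\<lambda>s. (\<phi> s - \<phi> (- s)) / s) \<longlongrightarrow> 2 * l) (at 0)" by (simp add: has_field_derivative_iff)
    then have lim: "((\<lambda>s. (\<phi> s - \<phi> (- s)) / s) \<longlongrightarrow> 2 * l) (at_right 0)" by (simp add: filterlim_at_split)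
    have "eventually (\<lambda>s. \<bar>(\<phi> s - \<phi> (- s)) / s\<bar> \<le> C) (at_right 0)"
    proof -
      have "eventually (\<lambda>s. s \<in> {0<..<r / 4}) (at_right 0)" using r0 by (intro eventually_at_right_real) simp
      then show ?thesis
      proof eventually_elim
        case (elim s) then show ?case using sym[of s] by (simp add: abs_divide pos_divide_le_eq)
      qed
    qed
    then have "\<bar>2 * l\<bar> \<le> C" by (rule tendsto_upperbound[OF tendsto_rabs[OF lim]]) simp
    then show ?thesis by simp
  qed
  also have "C / 2 = 4 * diff_const * G / \<rho>" by (simp add: C_def r_def)
  finally show ?thesis using l unfolding \<phi>_def by blast
qed

end

section \<open>The gradient estimate\<close>

lemma has_bochner_integral_id_interval:
  fixes p q :: real
  assumes "p \<le> q"
  shows "has_bochner_integral lborel (\<lambda>\<rho>. indicator {p<..q} \<rho> *\<^sub>R \<rho>) ((q\<^sup>2 - p\<^sup>2) / 2)"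
proof -
  have 1: "has_bochner_integral lborel (\<lambda>\<rho>. \<rho> * indicator {p..q} \<rho>) (q\<^sup>2 / 2 - p\<^sup>2 / 2)"
    by (rule has_bochner_integral_FTC_Icc_real[OF assms]) (auto intro!: derivative_eq_intros)
  have "AE \<rho> in lborel. \<rho> * indicator {p..q} \<rho> = indicator {p<..q} \<rho> *\<^sub>R \<rho>"
    using AE_lborel_singleton[of p] by eventually_elim (auto simp: indicator_def)
  then have "has_bochner_integral lborel (\<lambda>\<rho>. indicator {p<..q} \<rho> *\<^sub>R \<rho>) (q\<^sup>2 / 2 - p\<^sup>2 / 2)"
    using 1 by (subst has_bochner_integral_cong_AE[symmetric]) auto
  then show ?thesis by (simp add: diff_divide_distrib)
qed

text \<open>If \<open>m \<rho> = - \<nu>' \<rho> / \<rho>\<close> is nonincreasing, both sides compare with \<open>m q\<close>.\<close>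

lemma quadratic_convexity:
  fixes \<nu> \<nu>' :: "real \<Rightarrow> real"
  assumes ac: "\<forall>r>0. set_integrable lborel {r<..} \<nu>' \<and> \<nu> r = - (\<integral>\<rho>\<in>{r<..}. \<nu>' \<rho> \<partial>lborel)"
    and mono: "\<forall>r s. 0 < r \<and> r \<le> s \<longrightarrow> - \<nu>' s / s \<le> - \<nu>' r / r"
    and pqt: "0 < p" "p < q" "q < t"
  shows "(\<nu> q - \<nu> t) * (q\<^sup>2 - p\<^sup>2) \<le> (\<nu> p - \<nu> q) * (t\<^sup>2 - q\<^sup>2)"
proof -
  define m where "m = - \<nu>' q / q"
  have i0: "set_integrable lborel {x<..} \<nu>'" and v0: "\<nu> x = - (\<integral>\<rho>\<in>{x<..}. \<nu>' \<rho> \<partial>lborel)" if "0 < x" for x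
    using ac that by blast+
  have si: "set_integrable lborel {x<..y} \<nu>'" if "0 < x" "x < y" for x y
    by (rule set_integrable_subset[OF i0[OF that(1)]]) auto
  have d: "\<nu> x - \<nu> y = (LBINT \<rho>. indicator {x<..y} \<rho> *\<^sub>R (- \<nu>' \<rho>))" if "0 < x" "x < y" for x y
  proof -
    have u: "{x<..} = {x<..y} \<union> {y<..}" using that by auto
    have "(\<integral>\<rho>\<in>{x<..}. \<nu>' \<rho> \<partial>lborel) = (\<integral>\<rho>\<in>{x<..y}. \<nu>' \<rho> \<partial>lborel) + (\<integral>\<rho>\<in>{y<..}. \<nu>' \<rho> \<partial>lborel)"
      unfolding u using that by (intro set_integral_Un si i0) auto
    then show ?thesis using v0[of x] v0[of y] that by (simp add: set_lebesgue_integral_def)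
  qed
  have in': "integrable lborel (\<lambda>\<rho>. indicator {x<..y} \<rho> *\<^sub>R (- \<nu>' \<rho>))" if "0 < x" "x < y" for x y
    using si[OF that] by (simp add: set_integrable_def)
  have m1: "integrable lborel (\<lambda>\<rho>. m * (indicator {x<..y} \<rho> *\<^sub>R \<rho>))" "(LBINT \<rho>. m * (indicator {x<..y} \<rho> *\<^sub>R \<rho>)) = m * ((y\<^sup>2 - x\<^sup>2) / 2)"
    if "x < y" for x y
    using has_bochner_integral_id_interval[of x y] that by (auto simp: has_bochner_integral_iff)
  have "\<nu> q - \<nu> t \<le> (LBINT \<rho>. m * (indicator {q<..t} \<rho> *\<^sub>R \<rho>))"
    unfolding d[of q t, OF less_trans[OF pqt(1,2)] pqt(3)]
  proof (rule integral_mono)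
    fix \<rho>
    show "indicator {q<..t} \<rho> *\<^sub>R (- \<nu>' \<rho>) \<le> m * (indicator {q<..t} \<rho> *\<^sub>R \<rho>)"
    proof (cases "\<rho> \<in> {q<..t}")
      case True
      then have "- \<nu>' \<rho> / \<rho> \<le> m" using mono[rule_format, of q \<rho>] pqt by (simp add: m_def)
      then have "- \<nu>' \<rho> \<le> m * \<rho>" using True pqt pos_divide_le_eq[of \<rho> "- \<nu>' \<rho>" m] by auto
      then show ?thesis using True by simp
    qed simp
  qed (use in'[of q t] m1(1)[of q t] pqt in auto)
  also have "\<dots> = m * ((t\<^sup>2 - q\<^sup>2) / 2)" using m1(2) pqt by simp
  finally have 1: "\<nu> q - \<nu> t \<le> m * ((t\<^sup>2 - q\<^sup>2) / 2)" .
  have "(LBINT \<rho>. m * (indicator {p<..q} \<rho> *\<^sub>R \<rho>)) \<le> \<nu> p - \<nu> q"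
    unfolding d[OF pqt(1,2)]
  proof (rule integral_mono)
    fix \<rho>
    show "m * (indicator {p<..q} \<rho> *\<^sub>R \<rho>) \<le> indicator {p<..q} \<rho> *\<^sub>R (- \<nu>' \<rho>)"
    proof (cases "\<rho> \<in> {p<..q}")
      case True
      then have "m \<le> - \<nu>' \<rho> / \<rho>" using mono[rule_format, of \<rho> q] pqt by (simp add: m_def)
      then have "m * \<rho> \<le> - \<nu>' \<rho>" using True pqt pos_le_divide_eq[of \<rho> m "- \<nu>' \<rho>"] by auto
      then show ?thesis using True by simp
    qed simp
  qed (use in'[of p q] m1(1)[of p q] pqt in auto)
  then have 2: "m * ((q\<^sup>2 - p\<^sup>2) / 2) \<le> \<nu> p - \<nu> q" by (simp only: m1(2)[OF pqt(2)])
  have sq: "0 \<le> q\<^sup>2 - p\<^sup>2" "0 \<le> t\<^sup>2 - q\<^sup>2" using pqt by (auto intro!: power_mono)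
  have "(\<nu> q - \<nu> t) * (q\<^sup>2 - p\<^sup>2) \<le> m * ((t\<^sup>2 - q\<^sup>2) / 2) * (q\<^sup>2 - p\<^sup>2)" by (rule mult_right_mono[OF 1 sq(1)])
  also have "\<dots> = m * ((q\<^sup>2 - p\<^sup>2) / 2) * (t\<^sup>2 - q\<^sup>2)" by simp
  also have "\<dots> \<le> (\<nu> p - \<nu> q) * (t\<^sup>2 - q\<^sup>2)" by (rule mult_right_mono[OF 2 sq(2)])
  finally show ?thesis .
qed

text \<open>A ball is connected, so if it met both D and its complement it would contain a frontier
  point, closer to x than the distance allows.\<close>

lemma delta_min1_ball:
  assumes D: "open D" and x: "x \<in> D"
  shows "0 < delta_min1 D x" and "delta_min1 D x \<le> 1" and "ball x (delta_min1 D x) \<subseteq> D"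
proof -
  have nx: "x \<notin> frontier D" using D x by (simp add: frontier_def interior_open)
  show "0 < delta_min1 D x"
  proof (cases "frontier D = {}")
    case False
    then have "infdist x (frontier D) \<noteq> 0" using nx in_closed_iff_infdist_zero[OF frontier_closed False] by blast
    then show ?thesis using infdist_nonneg[of x "frontier D"] False by (simp add: delta_min1_def)
  qed (simp add: delta_min1_def)
  show "delta_min1 D x \<le> 1" by (simp add: delta_min1_def)
  show "ball x (delta_min1 D x) \<subseteq> D"
  proof (rule ccontr)
    assume n: "\<not> ball x (delta_min1 D x) \<subseteq> D"
    have "ball x (delta_min1 D x) \<inter> frontier D \<noteq> {}"
    proof (rule connected_Int_frontier[OF connected_ball])
      show "ball x (delta_min1 D x) \<inter> D \<noteq> {}" using \<open>0 < delta_min1 D x\<close> x centre_in_ball by blast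
      show "ball x (delta_min1 D x) - D \<noteq> {}" using n by blast
    qed
    then obtain y where y: "y \<in> frontier D" "dist x y < delta_min1 D x" by auto
    have "infdist x (frontier D) \<le> dist x y" by (rule infdist_le[OF y(1)])
    then show False using y by (auto simp: delta_min1_def split: if_splits)
  qed
qed

text \<open>Harnack on the half ball supplies the bound G = \<open>max 1 a2 * f x\<close>, where the
  maximum makes the factor positive. The 8 is 4 / \<rho> at \<rho> = \<delta> / 2, and the dimension
  comes from bounding the norm by the sum of the coordinates.\<close>

lemma (in levy_setting) harmonic_gradient:
  assumes H2: "\<forall>x0 r h. 0 < r \<and> r \<le> 1 \<and> (\<forall>z. h z \<ge> 0) \<and> harmonic_wrt M Y h (ball x0 r) \<longrightarrow>
        (\<forall>x\<in>ball x0 (r/2). \<forall>y\<in>ball x0 (r/2). h x \<le> a2 * h y)"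
    and D: "open D" and f0: "\<And>z. 0 \<le> f z" and f: "harmonic_wrt M Y f D" and x: "x \<in> D"
  shows "\<exists>g. has_gradient_at f g x \<and> norm g \<le> real DIM('a) * (8 * diff_const * max 1 a2) * f x / delta_min1 D x"
proof -
  define \<delta> where "\<delta> = delta_min1 D x"
  note \<delta> = delta_min1_ball[OF D x, folded \<delta>_def]
  have "harmonic_wrt M Y f (ball x \<delta>)" using f \<delta>(3) unfolding harmonic_wrt_def by blast
  then have "\<forall>y\<in>ball x (\<delta>/2). \<forall>z\<in>ball x (\<delta>/2). f y \<le> a2 * f z" using \<delta>(1,2) f0 H2[rule_format, of \<delta> f x] by blast
  then have har: "f y \<le> a2 * f x" if "norm (y - x) < \<delta> / 2" for y
    using that \<delta>(1) by (simp add: dist_norm norm_minus_commute)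
  have mvb: "mv_ball f x (\<delta> / 2) (max 1 a2 * f x)" unfolding mv_ball_def
  proof (intro conjI allI impI)
    show "f \<in> borel_measurable borel" using f by (simp add: harmonic_wrt_def)
    show "0 \<le> f y" for y by (rule f0)
    show "f y \<le> max 1 a2 * f x" if "norm (y - x) < \<delta> / 2" for y
      by (rule order_trans[OF har[OF that] mult_right_mono[OF max.cobounded2 f0]])
    show "mean_value f s y" if "good_radius s" "norm (y - x) + s < \<delta> / 2" for y s
    proof (rule harmonic_mean_value[OF f that(1)])
      have "norm (z - x) < \<delta>" if "norm (z - y) \<le> s" for z
        using norm_triangle_ineq[of "z - y" "y - x"] that \<open>norm (y - x) + s < \<delta> / 2\<close> \<delta>(1) by simp
      then have "cball y s \<subseteq> ball x \<delta>" by (auto simp: dist_norm norm_minus_commute)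
      then show "cball y s \<subseteq> D" using \<delta>(3) by blast
    qed
  qed
  let ?c = "8 * diff_const * max 1 a2 * f x / \<delta>"
  have "\<exists>l. ((\<lambda>t. f (x + t *\<^sub>R b)) has_real_derivative l) (at 0) \<and> \<bar>l\<bar> \<le> ?c" if "b \<in> Basis" for b
    using mv_ball_derivative[OF mvb _ _ that] \<delta> by (simp add: ac_simps)
  then have "\<forall>b\<in>Basis. \<exists>l. ((\<lambda>t. f (x + t *\<^sub>R b)) has_real_derivative l) (at 0) \<and> \<bar>l\<bar> \<le> ?c" by blast
  from bchoice[OF this] obtain l where l: "\<And>b. b \<in> Basis \<Longrightarrow> ((\<lambda>t. f (x + t *\<^sub>R b)) has_real_derivative l b) (at 0)" "\<And>b. b \<in> Basis \<Longrightarrow> \<bar>l b\<bar> \<le> ?c"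
    by blast
  define g where "g = (\<Sum>b\<in>Basis. l b *\<^sub>R b)"
  have gb: "g \<bullet> b = l b" if "b \<in> Basis" for b unfolding g_def using that by simp
  have "norm g \<le> (\<Sum>b\<in>Basis. \<bar>g \<bullet> b\<bar>)" by (rule norm_le_l1)
  also have "\<dots> \<le> (\<Sum>b\<in>(Basis::'a set). ?c)" using gb l(2) by (intro sum_mono) auto
  also have "\<dots> = real DIM('a) * (8 * diff_const * max 1 a2) * f x / \<delta>" by simp
  finally show ?thesis using l(1) gb unfolding has_gradient_at_def \<delta>_def by (intro exI[of _ g]) auto
qed

theorem theorem1p1:
  fixes M :: "'w measure" and Y :: "'w \<Rightarrow> real \<Rightarrow> 'a::euclidean_space"
    and \<nu> :: "real \<Rightarrow> real"
  assumes levy: "levy_process M Y"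
    and nu_nonneg: "\<forall>r>0. \<nu> r \<ge> 0"
    and nu_levy: "integrable lborel (\<lambda>y::'a. min 1 ((norm y)\<^sup>2) * \<nu> (norm y))"
    and nu_infinite: "(\<integral>\<^sup>+ y. ennreal (\<nu> (norm (y::'a))) \<partial>lborel) = \<infinity>"
    and char_exp: "\<forall>t\<ge>0. \<forall>\<xi>::'a.
        (\<integral>\<omega>. cis (\<xi> \<bullet> Y \<omega> t) \<partial>M) =
        complex_of_real (exp (- t * (\<integral>y. (1 - cos (\<xi> \<bullet> y)) * \<nu> (norm y) \<partial>lborel)))"
    and H1_mono: "\<forall>r s. 0 < r \<and> r \<le> s \<longrightarrow> \<nu> s \<le> \<nu> r"
    and H1_ac: "\<exists>\<nu>'::real \<Rightarrow> real.
        (\<forall>r>0. set_integrable lborel {r<..} \<nu>' \<and> \<nu> r = - (\<integral>\<rho>\<in>{r<..}. \<nu>' \<rho> \<partial>lborel)) \<and>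
        (\<forall>r s. 0 < r \<and> r \<le> s \<longrightarrow> - \<nu>' s / s \<le> - \<nu>' r / r)"
    and H1_doubling: "\<exists>a1. (\<forall>r\<ge>1. \<nu> r \<le> a1 * \<nu> (r + 1)) \<and> (\<forall>r. 0 < r \<and> r \<le> 1 \<longrightarrow> \<nu> r \<le> a1 * \<nu> (2 * r))"
    and H2: "\<exists>a2. \<forall>x0 r h. 0 < r \<and> r \<le> 1 \<and> (\<forall>z. h z \<ge> 0) \<and> harmonic_wrt M Y h (ball x0 r) \<longrightarrow>
        (\<forall>x\<in>ball x0 (r/2). \<forall>y\<in>ball x0 (r/2). h x \<le> a2 * h y)"
  shows "\<exists>c. \<forall>D f. open D \<and> D \<noteq> {} \<and> (\<forall>z. f z \<ge> 0) \<and> harmonic_wrt M Y f D \<longrightarrow>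
     (\<forall>x\<in>D. \<exists>g. has_gradient_at f g x \<and> norm g \<le> c * f x / delta_min1 D x)"
proof -
  obtain a1 where a1: "\<And>r. 1 \<le> r \<Longrightarrow> \<nu> r \<le> a1 * \<nu> (r + 1)" "\<And>r. 0 < r \<Longrightarrow> r \<le> 1 \<Longrightarrow> \<nu> r \<le> a1 * \<nu> (2 * r)"
    using H1_doubling by blast
  obtain \<nu>' where \<nu>': "\<forall>r>0. set_integrable lborel {r<..} \<nu>' \<and> \<nu> r = - (\<integral>\<rho>\<in>{r<..}. \<nu>' \<rho> \<partial>lborel)"
    "\<forall>r s. 0 < r \<and> r \<le> s \<longrightarrow> - \<nu>' s / s \<le> - \<nu>' r / r" using H1_ac by blast
  from H2 obtain a2 where a2: "\<forall>x0 r h. 0 < r \<and> r \<le> 1 \<and> (\<forall>z. h z \<ge> 0) \<and> harmonic_wrt M Y h (ball x0 r) \<longrightarrow>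
        (\<forall>x\<in>ball x0 (r/2). \<forall>y\<in>ball x0 (r/2). h x \<le> a2 * h y)" ..
  \<comment> \<open>In the integrability and exponent conditions the cofactor vanishes at 0, so the
    integrands agree everywhere; in the infinite mass condition they agree off a null set.\<close>
  define N :: "'a \<Rightarrow> real" where "N z = (if z = 0 then 0 else \<nu> (norm z))" for z
  have N1: "min 1 ((norm z)\<^sup>2) * \<nu> (norm z) = min 1 ((norm z)\<^sup>2) * N z" for z :: 'a by (simp add: N_def)
  have N2: "(1 - cos (\<xi> \<bullet> y)) * \<nu> (norm y) = (1 - cos (\<xi> \<bullet> y)) * N y" for \<xi> y :: 'a by (simp add: N_def)
  interpret levy_kernel \<nu> N a1
  proof
    show "integrable lborel (\<lambda>z. min 1 ((norm z)\<^sup>2) * N z)" using nu_levy unfolding N1 .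
    have "AE y in lborel. ennreal (N y) = ennreal (\<nu> (norm (y::'a)))"
      using AE_lborel_singleton[of 0] by eventually_elim (simp add: N_def)
    then show "(\<integral>\<^sup>+ z. ennreal (N z) \<partial>lborel) = \<infinity>" using nu_infinite by (subst nn_integral_cong_AE) auto
    show "(\<nu> q - \<nu> t) * (q\<^sup>2 - p\<^sup>2) \<le> (\<nu> p - \<nu> q) * (t\<^sup>2 - q\<^sup>2)" if "0 < p" "p < q" "q < t" for p q t
      by (rule quadratic_convexity[OF \<nu>' that])
  qed (use nu_nonneg H1_mono a1 in \<open>auto simp: N_def\<close>)
  interpret levy_setting \<nu> N a1 M Y
    by unfold_locales (use levy char_exp in \<open>simp_all only: Psi_def N2[symmetric]\<close>)
  show ?thesis
    using harmonic_gradient[OF a2] by (intro exI[of _ "real DIM('a) * (8 * diff_const * max 1 a2)"]) blast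
qed

end
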